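(* Let $n\ge3$, $r_0>0$, $M^n=\mathbb{S}^{n-1}\times(r_0,\infty)$ and $g=u^2(\theta,r)\,dr^2+r^2g_{\mathbb{S}^{n-1}}$ with $u\in C^\infty(M)$, $u>0$. Suppose there is a bounded function $V\in C^\infty(M)$ (not assumed positive and with no assumed asymptotics) satisfying $\mathrm{Hess}_gV=V\,\mathrm{Ric}_g$ and $\Delta_gV=0$. Then there is a constant $m\in\mathbb{R}$ with $r_0\ge r_m$ such that $u=(1-2mr^{2-n})^{-1/2}$, i.e. $g=g_m$ is the Schwarzschild metric, and $V$ is a constant multiple of the Schwarzschild potential $V_m$; in particular (after normalizing $V\to1$) $(M,g,V)$ is the Schwarzschild space $(\mathbb{S}^{n-1}\times(r_0,\infty),g_m,V_m)$.
   Context: For $m\in\mathbb{R}$, the Schwarzschild space of mass $m$ is $\mathbb{S}^{n-1}\times(r_m,\infty)$ with $g_m=(1-2mr^{2-n})^{-1}dr^2+r^2g_{\mathbb{S}^{n-1}}$ and potential $V_m=\sqrt{1-2mr^{2-n}}$, where $r_m^{n-2}=\max\{2m,0\}$ and $g_{\mathbb{S}^{n-1}}$ is the round unit-sphere metric.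
   Formalization: The formal theorem additionally assumes that V is not identically zero; without this the claim fails, since V = 0 satisfies both equations for every u (for example u = 2, which is not a Schwarzschild coefficient). *)

theory Defs
  imports "HOL-Analysis.Analysis"
begin

text \<open>Coordinates: M = S^(n-1) x (r0,oo) is identified with the exterior region
  {x in R^n. |x| > r0} via (theta, r) <-> r*theta.  Functions on M are functions on R^n
  restricted to this open set.\<close>

definition ext_region :: "real \<Rightarrow> (real^'n) set" where
  "ext_region r0 = {x. norm x > r0}"

definition pd :: "'n::finite \<Rightarrow> (real^'n \<Rightarrow> real) \<Rightarrow> real^'n \<Rightarrow> real" where
  "pd i f x = frechet_derivative f (at x) (axis i 1)"

fun Ck_on :: "nat \<Rightarrow> (real^'n::finite \<Rightarrow> real) \<Rightarrow> (real^'n) set \<Rightarrow> bool" where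
  "Ck_on 0 f U = continuous_on U f"
| "Ck_on (Suc k) f U = (continuous_on U f \<and> f differentiable_on U \<and> (\<forall>i. Ck_on k (pd i f) U))"

definition smooth_on :: "(real^'n::finite \<Rightarrow> real) \<Rightarrow> (real^'n) set \<Rightarrow> bool" where
  "smooth_on f U = (\<forall>k. Ck_on k f U)"

text \<open>The metric g = u^2 dr^2 + r^2 g_{S^{n-1}} in Cartesian coordinates:
  since dr^2 + r^2 g_S is the Euclidean metric, g = delta + (u^2 - 1) dr (x) dr,
  with dr = x/|x|.\<close>
definition warped_metric :: "(real^'n::finite \<Rightarrow> real) \<Rightarrow> real^'n \<Rightarrow> real^'n^'n" where
  "warped_metric u x = (\<chi> i j. (if i = j then 1 else 0) + ((u x)\<^sup>2 - 1) * (x$i) * (x$j) / (norm x)\<^sup>2)"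

definition ginv :: "(real^'n::finite \<Rightarrow> real^'n^'n) \<Rightarrow> real^'n \<Rightarrow> real^'n^'n" where
  "ginv G x = matrix_inv (G x)"

definition christoffel :: "(real^'n::finite \<Rightarrow> real^'n^'n) \<Rightarrow> 'n \<Rightarrow> 'n \<Rightarrow> 'n \<Rightarrow> real^'n \<Rightarrow> real" where
  "christoffel G k i j x = (1/2) * (\<Sum>l\<in>UNIV. ginv G x $ k $ l *
      (pd i (\<lambda>y. G y $ j $ l) x + pd j (\<lambda>y. G y $ i $ l) x - pd l (\<lambda>y. G y $ i $ j) x))"

definition hessian :: "(real^'n::finite \<Rightarrow> real^'n^'n) \<Rightarrow> (real^'n \<Rightarrow> real) \<Rightarrow> 'n \<Rightarrow> 'n \<Rightarrow> real^'n \<Rightarrow> real" where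
  "hessian G f i j x = pd i (pd j f) x - (\<Sum>k\<in>UNIV. christoffel G k i j x * pd k f x)"

definition ricci :: "(real^'n::finite \<Rightarrow> real^'n^'n) \<Rightarrow> 'n \<Rightarrow> 'n \<Rightarrow> real^'n \<Rightarrow> real" where
  "ricci G i j x = (\<Sum>k\<in>UNIV.
      pd k (christoffel G k i j) x - pd j (christoffel G k i k) x
      + (\<Sum>l\<in>UNIV. christoffel G k k l x * christoffel G l i j x
                   - christoffel G k j l x * christoffel G l i k x))"

definition laplacian :: "(real^'n::finite \<Rightarrow> real^'n^'n) \<Rightarrow> (real^'n \<Rightarrow> real) \<Rightarrow> real^'n \<Rightarrow> real" where
  "laplacian G f x = (\<Sum>i\<in>UNIV. \<Sum>j\<in>UNIV. ginv G x $ i $ j * hessian G f i j x)"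

definition schw_rm :: "nat \<Rightarrow> real \<Rightarrow> real" where
  "schw_rm n m = root (n - 2) (max (2*m) 0)"

definition schw_V :: "nat \<Rightarrow> real \<Rightarrow> real \<Rightarrow> real" where
  "schw_V n m r = sqrt (1 - 2*m * r powr (2 - real n))"

end

theory Submission
  imports Defs
begin

text \<open>
  Let \<open>E = r d/dr\<close>, \<open>\<omega> = u^(-2)\<close> and let \<open>L\<close> run over the infinitesimal rotations. The static
  equations split into a mixed equation \<open>L(EV) = LV + (Lu/u)(EV + (n-2)V)\<close>, a tangential equation
  saying that \<open>u V_XY + V u_XY\<close> is pure trace on spheres, and, since \<open>V\<close> vanishes on no open set,
  the scalar equation \<open>\<Delta>u/u - (n-1)\<omega>Eu/u = (n-1)(n-2)(1-\<omega>)/2\<close>, with \<open>\<Delta>\<close> the spherical Laplacian.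
  The commutators of rotations applied to the mixed equation make the tangential gradients of \<open>u\<close>
  and \<open>V\<close> parallel. Hence, near a point where \<open>u\<close> is not radial, the whole system lives on a plane
  through the origin, where it is an overdetermined system of first order for \<open>E\<close> and one rotation \<open>S\<close>;
  its integrability conditions are three polynomial relations. At a maximum of \<open>|d log u|\<close> these
  have no solution if \<open>Z = Su/u\<close> is small and dominates \<open>Y = SV/V\<close>.

  The scalar equation is parabolic with \<open>log r\<close> as time. The maximum principle, applied to
  \<open>(1-\<omega>) r^(n-2)\<close> and, in Bernstein's manner, to the gradient of \<open>u\<close>, gives decay of \<open>1-\<omega>\<close> and
  of the tangential gradient; the boundedness of \<open>V\<close> and the mixed equation then give \<open>EV \<rightarrow> 0\<close>, a
  positive lower bound for \<open>|V|\<close>, and \<open>|Y| < Z\<close> at a maximum of a weighted \<open>|d log u|\<close> over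
  \<open>|x| \<ge> R\<close>. So \<open>u\<close> is radial near infinity. On the inner boundary sphere of the maximal radial
  region the mixed equation gives \<open>Y/Z \<rightarrow> 0\<close>, and the same contradiction shows that the region is
  everything. For radial \<open>u\<close> the scalar equation integrates to \<open>(1-\<omega>) r^(n-2) = 2m\<close>, and \<open>uV\<close> is
  constant.
\<close>

section \<open>Directional derivatives and smooth functions\<close>

declare linear_id [simp]

definition dderiv :: "'a::real_normed_vector \<Rightarrow> ('a \<Rightarrow> real) \<Rightarrow> 'a \<Rightarrow> real" where
  "dderiv v f x = frechet_derivative f (at x) v"

definition lderiv :: "('a \<Rightarrow> 'a) \<Rightarrow> ('a::real_normed_vector \<Rightarrow> real) \<Rightarrow> 'a \<Rightarrow> real" where
  "lderiv A f x = dderiv (A x) f x"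

lemma pd_eq_dderiv: "pd i f x = dderiv (axis i 1) f x"
  by (simp add: pd_def dderiv_def)

lemma pd_eq_dderiv_axis: "pd i f = dderiv (axis i 1) f"
  by (simp add: pd_eq_dderiv fun_eq_iff)

lemma dderiv_eq: "(f has_derivative f') (at x) \<Longrightarrow> dderiv v f x = f' v"
  unfolding dderiv_def by (metis frechet_derivative_at)

lemma has_derivative_dderiv: "f differentiable (at x) \<Longrightarrow> (f has_derivative (\<lambda>v. dderiv v f x)) (at x)"
  unfolding dderiv_def by (metis frechet_derivative_works)

lemma linear_dderiv: "f differentiable (at x) \<Longrightarrow> linear (\<lambda>v. dderiv v f x)"
  unfolding dderiv_def by (metis linear_frechet_derivative)

lemma dderiv_linear:
  assumes "f differentiable (at x)"
  shows "dderiv (v + w) f x = dderiv v f x + dderiv w f x" "dderiv (v - w) f x = dderiv v f x - dderiv w f x"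
    "dderiv (c *\<^sub>R v) f x = c * dderiv v f x" "dderiv (- v) f x = - dderiv v f x" "dderiv 0 f x = 0"
    "dderiv (\<Sum>i\<in>I. g i) f x = (\<Sum>i\<in>I. dderiv (g i) f x)"
  using linear_add[OF linear_dderiv[OF assms], of v w] linear_diff[OF linear_dderiv[OF assms], of v w]
    linear_scale[OF linear_dderiv[OF assms], of c v] linear_neg[OF linear_dderiv[OF assms], of v]
    linear_0[OF linear_dderiv[OF assms]] linear_sum[OF linear_dderiv[OF assms], of g I]
  by simp_all

lemma dderiv_eq_sum_pd:
  assumes "f differentiable (at x)"
  shows "dderiv v f x = (\<Sum>i\<in>UNIV. v $ i * pd i f x)"
proof -
  have "v = (\<Sum>i\<in>UNIV. v $ i *\<^sub>R axis i 1)"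
    by (simp add: basis_expansion flip: scalar_mult_eq_scaleR)
  then have "dderiv v f x = dderiv (\<Sum>i\<in>UNIV. v $ i *\<^sub>R axis i 1) f x" by simp
  also have "\<dots> = (\<Sum>i\<in>UNIV. v $ i * pd i f x)"
    by (simp add: dderiv_linear[OF assms] pd_eq_dderiv)
  finally show ?thesis .
qed

lemma has_derivative_cong_open:
  assumes "open U" "x \<in> U" "\<And>y. y \<in> U \<Longrightarrow> f y = g y"
  shows "(f has_derivative D) (at x) \<longleftrightarrow> (g has_derivative D) (at x)"
  using has_derivative_transform_within_open[OF _ assms(1,2)] assms(3) by metis

lemma dderiv_cong_open:
  assumes "open U" "x \<in> U" "\<And>y. y \<in> U \<Longrightarrow> f y = g y"
  shows "dderiv v f x = dderiv v g x"
  using has_derivative_cong_open[OF assms] by (simp add: dderiv_def frechet_derivative_def)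

lemma lderiv_cong_open:
  assumes "open U" "x \<in> U" "\<And>y. y \<in> U \<Longrightarrow> f y = g y"
  shows "lderiv A f x = lderiv A g x"
  unfolding lderiv_def by (rule dderiv_cong_open[OF assms])

lemma pd_cong_open:
  assumes "open U" "x \<in> U" "\<And>y. y \<in> U \<Longrightarrow> f y = g y"
  shows "pd i f x = pd i g x"
  unfolding pd_eq_dderiv by (rule dderiv_cong_open[OF assms])

lemma dderiv_arith:
  assumes "f differentiable (at x)" "g differentiable (at x)"
  shows "dderiv v (\<lambda>y. f y + g y) x = dderiv v f x + dderiv v g x"
    "dderiv v (\<lambda>y. f y - g y) x = dderiv v f x - dderiv v g x"
    "dderiv v (\<lambda>y. f y * g y) x = f x * dderiv v g x + dderiv v f x * g x"
  using has_derivative_dderiv[OF assms(1)] has_derivative_dderiv[OF assms(2)]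
  by (auto intro!: dderiv_eq derivative_eq_intros)

lemma lderiv_arith:
  assumes "f differentiable (at x)" "g differentiable (at x)"
  shows "lderiv A (\<lambda>y. f y + g y) x = lderiv A f x + lderiv A g x"
    "lderiv A (\<lambda>y. f y - g y) x = lderiv A f x - lderiv A g x"
    "lderiv A (\<lambda>y. f y * g y) x = f x * lderiv A g x + lderiv A f x * g x"
  using dderiv_arith[OF assms] by (simp_all add: lderiv_def)

lemma dderiv_const [simp]: "dderiv v (\<lambda>y. c) x = 0"
  by (rule dderiv_eq[where f'="\<lambda>v. 0"]) simp

lemma lderiv_const [simp]: "lderiv A (\<lambda>_. c) x = 0"
  by (simp add: lderiv_def)

lemma dderiv_minus: "f differentiable (at x) \<Longrightarrow> dderiv v (\<lambda>y. - f y) x = - dderiv v f x"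
  using has_derivative_dderiv by (auto intro!: dderiv_eq derivative_eq_intros)

lemma dderiv_inverse:
  assumes "f differentiable (at x)" "f x \<noteq> 0"
  shows "dderiv v (\<lambda>y. inverse (f y)) x = - (dderiv v f x * (inverse (f x) * inverse (f x)))"
  using has_derivative_dderiv[OF assms(1)] assms(2) by (auto intro!: dderiv_eq derivative_eq_intros)

lemma dderiv_divide:
  assumes "f differentiable (at x)" "g differentiable (at x)" "g x \<noteq> 0"
  shows "dderiv v (\<lambda>y. f y / g y) x = dderiv v f x / g x - f x * dderiv v g x / (g x)\<^sup>2"
proof -
  have "((\<lambda>y. f y / g y) has_derivative (\<lambda>v. dderiv v f x / g x - f x * dderiv v g x / (g x)\<^sup>2)) (at x)"
    using has_derivative_dderiv[OF assms(1)] has_derivative_dderiv[OF assms(2)] assms(3)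
    by (auto intro!: derivative_eq_intros simp: field_simps power2_eq_square)
  then show ?thesis by (rule dderiv_eq)
qed

lemma dderiv_sum:
  assumes "\<And>i. i \<in> I \<Longrightarrow> f i differentiable (at x)"
  shows "dderiv v (\<lambda>y. \<Sum>i\<in>I. f i y) x = (\<Sum>i\<in>I. dderiv v (f i) x)"
  by (rule dderiv_eq) (auto intro!: derivative_eq_intros has_derivative_dderiv assms)

lemma dderiv_inner [simp]: "dderiv v (\<lambda>y. y \<bullet> a) x = v \<bullet> a"
  by (rule dderiv_eq) (auto intro!: derivative_eq_intros)

lemma dderiv_inner_self [simp]: "dderiv v (\<lambda>y. y \<bullet> y) x = 2 * (x \<bullet> v)"
  by (rule dderiv_eq[where f'="\<lambda>v. 2 * (x \<bullet> v)"]) (auto intro!: derivative_eq_intros simp: inner_commute)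

lemma dderiv_nth [simp]: "dderiv v (\<lambda>y. y $ i) x = v $ i"
  using dderiv_inner[of v "axis i 1" x] by (simp add: inner_axis)

lemma differentiable_nth [simp]: "(\<lambda>y::real^'n. y $ i) differentiable (at x)"
  by (rule bounded_linear_imp_differentiable) (rule bounded_linear_vec_nth)

lemma Ck_on_continuous: "Ck_on k f U \<Longrightarrow> continuous_on U f"
  by (cases k) auto

lemma Ck_on_Suc_imp: "Ck_on (Suc k) f U \<Longrightarrow> Ck_on k f U"
  by (induction k arbitrary: f) auto

lemma Ck_on_cong:
  assumes "open U" "\<And>x. x \<in> U \<Longrightarrow> f x = g x"
  shows "Ck_on k f U \<longleftrightarrow> Ck_on k g U"
  using assms(2)
proof (induction k arbitrary: f g)
  case 0
  then show ?case by (simp cong: continuous_on_cong)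
next
  case (Suc k)
  have "Ck_on k (pd i f) U \<longleftrightarrow> Ck_on k (pd i g) U" for i
    using pd_cong_open[OF assms(1)] Suc by blast
  moreover have "f differentiable_on U \<longleftrightarrow> g differentiable_on U"
    unfolding differentiable_on_eq_differentiable_at[OF assms(1)] differentiable_def
    using has_derivative_cong_open[OF assms(1), of _ f g] Suc.prems by meson
  moreover have "continuous_on U f \<longleftrightarrow> continuous_on U g"
    using Suc.prems by (simp cong: continuous_on_cong)
  ultimately show ?case by simp
qed

lemma Ck_on_SucI:
  assumes "open U" "\<And>x. x \<in> U \<Longrightarrow> f differentiable (at x)"
    and "\<And>i x. x \<in> U \<Longrightarrow> pd i f x = f' i x" "\<And>i. Ck_on k (f' i) U"
  shows "Ck_on (Suc k) f U"
proof -
  have "f differentiable_on U"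
    using assms(2) by (simp add: differentiable_on_eq_differentiable_at[OF assms(1)])
  moreover have "Ck_on k (pd i f) U" for i
    using Ck_on_cong[OF assms(1), of "pd i f" "f' i" k] assms(3,4) by simp
  ultimately show ?thesis
    by (simp add: differentiable_imp_continuous_on)
qed

lemma Ck_on_Suc_differentiable:
  assumes "open U" "Ck_on (Suc k) f U" "x \<in> U"
  shows "f differentiable (at x)"
  using assms differentiable_on_eq_differentiable_at[OF assms(1), of f] by simp

lemma Ck_on_const:
  assumes "open U"
  shows "Ck_on k (\<lambda>x. c) U"
proof (induction k arbitrary: c)
  case (Suc k)
  then show ?case by (intro Ck_on_SucI[OF assms, where f'="\<lambda>_ _. 0"]) (simp_all add: pd_eq_dderiv)
qed simp

lemma Ck_on_nth:
  assumes "open U"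
  shows "Ck_on k (\<lambda>x. x $ j) U"
proof (cases k)
  case (Suc m)
  then show ?thesis
    using Ck_on_SucI[OF assms, of "\<lambda>x. x $ j" "\<lambda>i x. axis i 1 $ j" m]
    by (simp add: pd_eq_dderiv Ck_on_const[OF assms])
qed (simp add: continuous_intros)

lemma Ck_on_add:
  assumes "open U"
  shows "Ck_on k f U \<Longrightarrow> Ck_on k g U \<Longrightarrow> Ck_on k (\<lambda>x. f x + g x) U"
proof (induction k arbitrary: f g)
  case (Suc k)
  note differentiable = Ck_on_Suc_differentiable[OF assms Suc.prems(1)]
    Ck_on_Suc_differentiable[OF assms Suc.prems(2)]
  have "Ck_on k (\<lambda>x. pd i f x + pd i g x) U" for i
    using Suc.IH[of "pd i f" "pd i g"] Suc.prems by simp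
  then show ?case
    by (rule Ck_on_SucI[OF assms, rotated 2]) (simp_all add: differentiable pd_eq_dderiv dderiv_arith)
qed (simp add: continuous_intros)

lemma Ck_on_mult:
  assumes "open U"
  shows "Ck_on k f U \<Longrightarrow> Ck_on k g U \<Longrightarrow> Ck_on k (\<lambda>x. f x * g x) U"
proof (induction k arbitrary: f g)
  case (Suc k)
  note differentiable = Ck_on_Suc_differentiable[OF assms Suc.prems(1)]
    Ck_on_Suc_differentiable[OF assms Suc.prems(2)]
  have "Ck_on k f U" "Ck_on k g U" using Suc.prems Ck_on_Suc_imp by blast+
  then have "Ck_on k (\<lambda>x. f x * pd i g x + pd i f x * g x) U" for i
    using Suc.IH[of f "pd i g"] Suc.IH[of "pd i f" g] Suc.prems by (intro Ck_on_add[OF assms]) auto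
  then show ?case
    by (rule Ck_on_SucI[OF assms, rotated 2]) (simp_all add: differentiable pd_eq_dderiv dderiv_arith)
qed (simp add: continuous_intros)

lemma Ck_on_inverse:
  assumes "open U" "\<And>x. x \<in> U \<Longrightarrow> f x \<noteq> 0"
  shows "Ck_on k f U \<Longrightarrow> Ck_on k (\<lambda>x. inverse (f x)) U"
proof (induction k)
  case 0
  then show ?case using assms by (simp add: continuous_intros)
next
  case (Suc k)
  note differentiable = Ck_on_Suc_differentiable[OF assms(1) Suc.prems]
  have "Ck_on k (\<lambda>x. inverse (f x)) U" using Suc Ck_on_Suc_imp by blast
  then have "Ck_on k (\<lambda>x. (-1) * (pd i f x * (inverse (f x) * inverse (f x)))) U" for i
    using Suc.prems by (intro Ck_on_mult[OF assms(1)] Ck_on_const[OF assms(1)]) auto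
  then show ?case
    by (rule Ck_on_SucI[OF assms(1), rotated 2])
      (simp_all add: differentiable pd_eq_dderiv dderiv_inverse assms(2))
qed

named_theorems smooth_intros "closure properties of smooth functions"

lemma smooth_const [smooth_intros]: "open U \<Longrightarrow> smooth_on (\<lambda>x. c) U"
  by (simp add: smooth_on_def Ck_on_const)

lemma smooth_nth [smooth_intros]: "open U \<Longrightarrow> smooth_on (\<lambda>x. x $ i) U"
  by (simp add: smooth_on_def Ck_on_nth)

lemma smooth_add [smooth_intros]:
  "open U \<Longrightarrow> smooth_on f U \<Longrightarrow> smooth_on g U \<Longrightarrow> smooth_on (\<lambda>x. f x + g x) U"
  by (simp add: smooth_on_def Ck_on_add)

lemma smooth_mult [smooth_intros]:
  "open U \<Longrightarrow> smooth_on f U \<Longrightarrow> smooth_on g U \<Longrightarrow> smooth_on (\<lambda>x. f x * g x) U"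
  by (simp add: smooth_on_def Ck_on_mult)

lemma smooth_minus [smooth_intros]: "open U \<Longrightarrow> smooth_on f U \<Longrightarrow> smooth_on (\<lambda>x. - f x) U"
  using smooth_mult[of U "\<lambda>_. -1" f] smooth_const[of U "-1"] by simp

lemma smooth_diff [smooth_intros]:
  "open U \<Longrightarrow> smooth_on f U \<Longrightarrow> smooth_on g U \<Longrightarrow> smooth_on (\<lambda>x. f x - g x) U"
  using smooth_add[of U f "\<lambda>x. - g x"] smooth_minus[of U g] by simp

lemma smooth_inverse [smooth_intros]:
  "open U \<Longrightarrow> (\<And>x. x \<in> U \<Longrightarrow> f x \<noteq> 0) \<Longrightarrow> smooth_on f U \<Longrightarrow> smooth_on (\<lambda>x. inverse (f x)) U"
  by (simp add: smooth_on_def Ck_on_inverse)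

lemma smooth_divide [smooth_intros]:
  "open U \<Longrightarrow> (\<And>x. x \<in> U \<Longrightarrow> g x \<noteq> 0) \<Longrightarrow> smooth_on f U \<Longrightarrow> smooth_on g U \<Longrightarrow> smooth_on (\<lambda>x. f x / g x) U"
  unfolding divide_inverse by (rule smooth_mult[OF _ _ smooth_inverse])

lemma smooth_power [smooth_intros]: "open U \<Longrightarrow> smooth_on f U \<Longrightarrow> smooth_on (\<lambda>x. f x ^ k) U"
  by (induction k) (simp_all add: smooth_const smooth_mult)

lemma smooth_sum [smooth_intros]:
  "open U \<Longrightarrow> (\<And>i. i \<in> I \<Longrightarrow> smooth_on (f i) U) \<Longrightarrow> smooth_on (\<lambda>x. \<Sum>i\<in>I. f i x) U"
  by (induction I rule: infinite_finite_induct) (simp_all add: smooth_const smooth_add)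

lemma smooth_inner [smooth_intros]: "open U \<Longrightarrow> smooth_on (\<lambda>x. x \<bullet> a) U"
  unfolding inner_vec_def inner_real_def by (intro smooth_sum smooth_mult smooth_const smooth_nth)

lemma smooth_inner_self [smooth_intros]: "open U \<Longrightarrow> smooth_on (\<lambda>x. x \<bullet> x) U"
  unfolding inner_vec_def inner_real_def by (intro smooth_sum smooth_mult smooth_nth)

lemma smooth_on_cong: "open U \<Longrightarrow> (\<And>x. x \<in> U \<Longrightarrow> f x = g x) \<Longrightarrow> smooth_on f U \<longleftrightarrow> smooth_on g U"
  using Ck_on_cong[of U f g] unfolding smooth_on_def by simp

lemma smooth_continuous: "smooth_on f U \<Longrightarrow> continuous_on U f"
  unfolding smooth_on_def using Ck_on_continuous by blast

lemma smooth_pd [smooth_intros]: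
  assumes "smooth_on f U"
  shows "smooth_on (pd i f) U"
proof -
  have "Ck_on (Suc k) f U" for k using assms unfolding smooth_on_def by blast
  then show ?thesis unfolding smooth_on_def by simp
qed

lemma smooth_differentiable:
  assumes "open U" "smooth_on f U" "x \<in> U"
  shows "f differentiable (at x)"
  using Ck_on_Suc_differentiable[OF assms(1) _ assms(3)] assms(2) unfolding smooth_on_def by blast

lemma smooth_on_subset:
  assumes "smooth_on f U" "T \<subseteq> U"
  shows "smooth_on f T"
proof -
  have "Ck_on k f U \<Longrightarrow> Ck_on k f T" for k
    using assms(2) by (induction k arbitrary: f) (auto intro: continuous_on_subset differentiable_on_subset)
  then show ?thesis using assms(1) unfolding smooth_on_def by blast
qed

lemma smooth_dderiv_along:
  assumes "open U" "smooth_on f U" "\<And>i. smooth_on (\<lambda>x. A x $ i) U"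
  shows "smooth_on (\<lambda>x. dderiv (A x) f x) U"
proof -
  have "smooth_on (\<lambda>x. \<Sum>i\<in>UNIV. A x $ i * pd i f x) U"
    by (intro smooth_sum smooth_mult smooth_pd assms)
  then show ?thesis
    using smooth_on_cong[OF assms(1), of "\<lambda>x. dderiv (A x) f x" "\<lambda>x. \<Sum>i\<in>UNIV. A x $ i * pd i f x"]
      dderiv_eq_sum_pd[OF smooth_differentiable[OF assms(1,2)]] by simp
qed

lemma smooth_dderiv [smooth_intros]: "open U \<Longrightarrow> smooth_on f U \<Longrightarrow> smooth_on (dderiv v f) U"
  using smooth_dderiv_along[of U f "\<lambda>x. v"] smooth_const[of U] by simp

lemma smooth_linear_nth:
  fixes A :: "real^'n \<Rightarrow> real^'m"
  assumes "open U" "linear A"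
  shows "smooth_on (\<lambda>x. A x $ i) U"
proof -
  have coordinates: "A x $ i = (\<Sum>j\<in>UNIV. x $ j * A (axis j 1) $ i)" for x
  proof -
    have "A x = A (\<Sum>j\<in>UNIV. x $ j *\<^sub>R axis j 1)"
      by (simp add: basis_expansion flip: scalar_mult_eq_scaleR)
    then show ?thesis using assms(2) by (simp add: linear_sum linear_scale)
  qed
  show ?thesis
    by (subst coordinates) (intro smooth_sum smooth_mult smooth_nth smooth_const assms(1))
qed

lemma smooth_lderiv [smooth_intros]: "open U \<Longrightarrow> linear A \<Longrightarrow> smooth_on f U \<Longrightarrow> smooth_on (lderiv A f) U"
  unfolding lderiv_def by (rule smooth_dderiv_along) (simp_all add: smooth_linear_nth)

lemma DERIV_along_curve:
  assumes "f differentiable (at (\<gamma> t))" "(\<gamma> has_vector_derivative v) (at t)"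
  shows "((\<lambda>t. f (\<gamma> t)) has_real_derivative dderiv v f (\<gamma> t)) (at t)"
proof -
  have "((f \<circ> \<gamma>) has_derivative (\<lambda>w. dderiv w f (\<gamma> t)) \<circ> (\<lambda>h. h *\<^sub>R v)) (at t)"
    using assms(2) has_derivative_dderiv[OF assms(1)] unfolding has_vector_derivative_def
    by (rule diff_chain_at)
  then show ?thesis
    by (simp add: o_def dderiv_linear[OF assms(1)] has_field_derivative_def mult_commute_abs)
qed

lemma DERIV_along_line:
  assumes "f differentiable (at (x + t *\<^sub>R v))"
  shows "((\<lambda>t. f (x + t *\<^sub>R v)) has_real_derivative dderiv v f (x + t *\<^sub>R v)) (at t)"
proof -
  have "((\<lambda>t. x + t *\<^sub>R v) has_vector_derivative v) (at t)"
    by (auto intro!: derivative_eq_intros)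
  then show ?thesis
    using DERIV_along_curve[where f=f and \<gamma>="\<lambda>t. x + t *\<^sub>R v" and t=t and v=v] assms by simp
qed

lemma DERIV_along_ray:
  assumes "f differentiable (at (t *\<^sub>R x))" "t \<noteq> 0"
  shows "((\<lambda>t. f (t *\<^sub>R x)) has_real_derivative lderiv id f (t *\<^sub>R x) / t) (at t)"
proof -
  have "((\<lambda>t. f (0 + t *\<^sub>R x)) has_real_derivative dderiv x f (0 + t *\<^sub>R x)) (at t)"
    by (rule DERIV_along_line) (use assms in simp)
  moreover have "dderiv x f (t *\<^sub>R x) = lderiv id f (t *\<^sub>R x) / t"
    using assms by (simp add: lderiv_def dderiv_linear)
  ultimately show ?thesis by simp
qed

lemma dderiv_eq_line_derivative:
  assumes "f differentiable (at x)" "((\<lambda>t. f (x + t *\<^sub>R v)) has_real_derivative D) (at 0)"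
  shows "dderiv v f x = D"
  using DERIV_along_line[of f x 0 v] assms DERIV_unique by fastforce

lemma second_difference_mvt:
  assumes "open U" "smooth_on f U" "h > 0"
    and parallelogram: "\<And>s t. 0 \<le> s \<Longrightarrow> s \<le> h \<Longrightarrow> 0 \<le> t \<Longrightarrow> t \<le> h \<Longrightarrow> x + s *\<^sub>R v + t *\<^sub>R w \<in> U"
  obtains s t where "0 < s" "s < h" "0 < t" "t < h"
    "f (x + h *\<^sub>R v + h *\<^sub>R w) - f (x + h *\<^sub>R v) - f (x + h *\<^sub>R w) + f x
       = h * h * dderiv w (dderiv v f) (x + s *\<^sub>R v + t *\<^sub>R w)"
proof -
  define increment where "increment = (\<lambda>s. f (x + s *\<^sub>R v + h *\<^sub>R w) - f (x + s *\<^sub>R v))"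
  define slope where "slope t s = dderiv v f (x + s *\<^sub>R v + t *\<^sub>R w)" for s t
  have "(increment has_real_derivative slope h s - slope 0 s) (at s)" if "0 \<le> s" "s \<le> h" for s
  proof -
    have "x + h *\<^sub>R w + s *\<^sub>R v \<in> U" "x + s *\<^sub>R v \<in> U"
      using parallelogram[of s h] parallelogram[of s 0] that assms(3) by (simp_all add: algebra_simps)
    from this[THEN smooth_differentiable[OF assms(1,2)]] show ?thesis
      using DERIV_diff[OF DERIV_along_line DERIV_along_line, of f "x + h *\<^sub>R w" s v f x v]
      by (simp add: increment_def slope_def algebra_simps)
  qed
  then obtain s where s: "0 < s" "s < h" "increment h - increment 0 = h * (slope h s - slope 0 s)"
    using MVT2[OF assms(3), of increment "\<lambda>s. slope h s - slope 0 s"] by auto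
  have "((\<lambda>t. slope t s) has_real_derivative dderiv w (dderiv v f) (x + s *\<^sub>R v + t *\<^sub>R w)) (at t)"
    if "0 \<le> t" "t \<le> h" for t
    unfolding slope_def
    by (intro DERIV_along_line smooth_differentiable[OF assms(1) smooth_dderiv[OF assms(1,2)]] parallelogram)
      (use that s in auto)
  then obtain t where "0 < t" "t < h"
    "slope h s - slope 0 s = h * dderiv w (dderiv v f) (x + s *\<^sub>R v + t *\<^sub>R w)"
    using MVT2[OF assms(3), of "\<lambda>t. slope t s" "\<lambda>t. dderiv w (dderiv v f) (x + s *\<^sub>R v + t *\<^sub>R w)"] by auto
  then show ?thesis using s by (intro that[of s t]) (simp_all add: increment_def)
qed

lemma norm_parallelogram_le:
  assumes "0 \<le> s" "s \<le> h" "0 \<le> t" "t \<le> h"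
  shows "norm (s *\<^sub>R v + t *\<^sub>R w) \<le> h * (norm v + norm w)"
proof -
  have "norm (s *\<^sub>R v + t *\<^sub>R w) \<le> s * norm v + t * norm w"
    using norm_triangle_ineq[of "s *\<^sub>R v" "t *\<^sub>R w"] assms by simp
  also have "\<dots> \<le> h * norm v + h * norm w" using assms by (intro add_mono mult_right_mono) auto
  finally show ?thesis by (simp add: distrib_left)
qed

lemma second_difference_approx:
  assumes "open U" "smooth_on f U" "x \<in> U" "e > 0"
  shows "\<forall>\<^sub>F h in at_right 0.
    \<bar>f (x + h *\<^sub>R v + h *\<^sub>R w) - f (x + h *\<^sub>R v) - f (x + h *\<^sub>R w) + f x
    - h * h * dderiv w (dderiv v f) x\<bar> < h * h * e"
proof -
  let ?D = "dderiv w (dderiv v f)"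
  have "continuous (at x) ?D"
    using smooth_differentiable[OF assms(1) smooth_dderiv[OF assms(1) smooth_dderiv[OF assms(1,2)]] assms(3)]
    by (rule differentiable_imp_continuous_within)
  then obtain d where d: "d > 0" "\<And>y. dist y x < d \<Longrightarrow> dist (?D y) (?D x) < e"
    using assms(4) unfolding continuous_at_eps_delta by blast
  obtain r where r: "r > 0" "ball x r \<subseteq> U" using assms(1,3) open_contains_ball by blast
  define h0 where "h0 = min d r / (norm v + norm w + 1)"
  have pos: "norm v + norm w + 1 > 0" by (smt (verit) norm_ge_zero)
  have near: "dist (x + s *\<^sub>R v + t *\<^sub>R w) x < min d r"
    if "0 \<le> s" "s \<le> h" "0 \<le> t" "t \<le> h" "0 < h" "h < h0" for s t h
  proof -
    have "dist (x + s *\<^sub>R v + t *\<^sub>R w) x \<le> h * (norm v + norm w)"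
      using norm_parallelogram_le[OF that(1-4), of v w] by (simp add: dist_norm add.assoc)
    also have "\<dots> < h * (norm v + norm w + 1)" using that by (simp add: algebra_simps)
    also have "\<dots> < h0 * (norm v + norm w + 1)" using that pos by simp
    finally show ?thesis using pos by (simp add: h0_def)
  qed
  show ?thesis
  proof (rule eventually_at_rightI)
    show "0 < h0" using d(1) r(1) pos by (simp add: h0_def)
    fix h assume "h \<in> {0<..<h0}"
    then have h: "0 < h" "h < h0" by auto
    have "x + s *\<^sub>R v + t *\<^sub>R w \<in> U" if "0 \<le> s" "s \<le> h" "0 \<le> t" "t \<le> h" for s t
      using near[OF that h] r(2) by (auto simp: dist_commute)
    then obtain s t where st: "0 < s" "s < h" "0 < t" "t < h"
      "f (x + h *\<^sub>R v + h *\<^sub>R w) - f (x + h *\<^sub>R v) - f (x + h *\<^sub>R w) + f x = h * h * ?D (x + s *\<^sub>R v + t *\<^sub>R w)"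
      using second_difference_mvt[OF assms(1,2) h(1)] by blast
    have "\<bar>?D (x + s *\<^sub>R v + t *\<^sub>R w) - ?D x\<bar> < e"
      using d(2)[of "x + s *\<^sub>R v + t *\<^sub>R w"] near[of s h t] st h by (simp add: dist_real_def)
    then have "h * h * \<bar>?D (x + s *\<^sub>R v + t *\<^sub>R w) - ?D x\<bar> < h * h * e" using h by simp
    moreover have "\<bar>h * h * ?D (x + s *\<^sub>R v + t *\<^sub>R w) - h * h * ?D x\<bar>
        = h * h * \<bar>?D (x + s *\<^sub>R v + t *\<^sub>R w) - ?D x\<bar>"
      by (simp add: abs_mult flip: right_diff_distrib)
    ultimately show "\<bar>f (x + h *\<^sub>R v + h *\<^sub>R w) - f (x + h *\<^sub>R v) - f (x + h *\<^sub>R w) + f x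
        - h * h * ?D x\<bar> < h * h * e"
      unfolding st(5) by simp
  qed
qed

lemma dderiv_commute:
  assumes "open U" "smooth_on f U" "x \<in> U"
  shows "dderiv v (dderiv w f) x = dderiv w (dderiv v f) x"
proof (rule ccontr)
  let ?D1 = "dderiv v (dderiv w f) x" and ?D2 = "dderiv w (dderiv v f) x"
  assume "?D1 \<noteq> ?D2"
  then have gap: "\<bar>?D1 - ?D2\<bar> / 2 > 0" by simp
  have "\<forall>\<^sub>F h in at_right (0::real). False"
    using second_difference_approx[OF assms gap, of v w] second_difference_approx[OF assms gap, of w v]
      eventually_at_right_less[of "0::real"]
  proof eventually_elim
    case (elim h)
    let ?\<Delta> = "f (x + h *\<^sub>R v + h *\<^sub>R w) - f (x + h *\<^sub>R v) - f (x + h *\<^sub>R w) + f x"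
    have "x + h *\<^sub>R w + h *\<^sub>R v = x + h *\<^sub>R v + h *\<^sub>R w" by (simp add: algebra_simps)
    then have "\<bar>?\<Delta> - h * h * ?D2\<bar> < h * h * (\<bar>?D1 - ?D2\<bar> / 2)"
      "\<bar>?\<Delta> - h * h * ?D1\<bar> < h * h * (\<bar>?D1 - ?D2\<bar> / 2)"
      using elim(1,2) by (simp_all add: algebra_simps)
    then have "\<bar>h * h * ?D1 - h * h * ?D2\<bar> < h * h * \<bar>?D1 - ?D2\<bar>" by linarith
    moreover have "\<bar>h * h * ?D1 - h * h * ?D2\<bar> = h * h * \<bar>?D1 - ?D2\<bar>"
      by (simp add: abs_mult flip: right_diff_distrib)
    ultimately show False by simp
  qed
  then show False by simp
qed

lemma dderiv_lderiv:
  assumes "open U" "smooth_on f U" "x \<in> U" "linear A"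
  shows "dderiv v (lderiv A f) x = dderiv v (dderiv (A x) f) x + dderiv (A v) f x"
proof -
  note differentiable = smooth_differentiable[OF assms(1)]
  have field_derivative: "dderiv v (\<lambda>y. B y $ i * pd i f y) x
      = B x $ i * dderiv v (pd i f) x + dderiv v (\<lambda>y. B y $ i) x * pd i f x"
    if "(\<lambda>y. B y $ i) differentiable (at x)" for B :: "real^'a \<Rightarrow> real^'a" and i
    by (rule dderiv_arith(3)[OF that differentiable[OF smooth_pd[OF assms(2)] assms(3)]])
  have sum_derivative: "dderiv v (\<lambda>y. dderiv (B y) f y) x = (\<Sum>i\<in>UNIV. dderiv v (\<lambda>y. B y $ i * pd i f y) x)"
    if "\<And>i. smooth_on (\<lambda>y. B y $ i) U" for B :: "real^'a \<Rightarrow> real^'a"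
  proof -
    have "dderiv v (\<lambda>y. dderiv (B y) f y) x = dderiv v (\<lambda>y. \<Sum>i\<in>UNIV. B y $ i * pd i f y) x"
      by (intro dderiv_cong_open[OF assms(1,3)] dderiv_eq_sum_pd differentiable[OF assms(2)])
    then show ?thesis
      by (simp add: dderiv_sum
        differentiable[OF smooth_mult[OF assms(1) that smooth_pd[OF assms(2)]] assms(3)])
  qed
  have linear_derivative: "dderiv v (\<lambda>y. A y $ i) x = A v $ i" "(\<lambda>y. A y $ i) differentiable (at x)" for i
  proof -
    have "((\<lambda>y. A y $ i) has_derivative (\<lambda>y. A y $ i)) (at x)"
      using bounded_linear_compose[OF bounded_linear_vec_nth] assms(4)
      by (intro bounded_linear_imp_has_derivative) (simp add: linear_conv_bounded_linear)
    then show "dderiv v (\<lambda>y. A y $ i) x = A v $ i" "(\<lambda>y. A y $ i) differentiable (at x)"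
      by (auto simp: dderiv_eq differentiable_def)
  qed
  have "dderiv v (lderiv A f) x = (\<Sum>i\<in>UNIV. A x $ i * dderiv v (pd i f) x + A v $ i * pd i f x)"
    using sum_derivative[of A] smooth_linear_nth[OF assms(1,4)] field_derivative[OF linear_derivative(2)]
    by (simp add: lderiv_def[abs_def] linear_derivative(1))
  moreover have "dderiv v (dderiv (A x) f) x = (\<Sum>i\<in>UNIV. A x $ i * dderiv v (pd i f) x)"
    using sum_derivative[of "\<lambda>_. A x"] field_derivative[of "\<lambda>_. A x"] by (simp add: smooth_const[OF assms(1)])
  ultimately show ?thesis
    by (simp add: sum.distrib dderiv_eq_sum_pd[OF differentiable[OF assms(2,3)], of "A v"])
qed

lemma dderiv_lderiv_commute:
  assumes "open U" "smooth_on f U" "x \<in> U" "linear A"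
  shows "dderiv v (lderiv A f) x = lderiv A (dderiv v f) x + dderiv (A v) f x"
  using dderiv_lderiv[OF assms, of v] dderiv_commute[OF assms(1-3), of v "A x"] by (simp add: lderiv_def)

lemma lderiv_lderiv:
  assumes "open U" "smooth_on f U" "x \<in> U" "linear A"
  shows "lderiv A (lderiv A f) x = dderiv (A x) (dderiv (A x) f) x + dderiv (A (A x)) f x"
  using dderiv_lderiv[OF assms, of "A x"] by (simp add: lderiv_def[of A "lderiv A f"])

lemma lderiv_id_lderiv_id:
  assumes "open U" "smooth_on f U" "x \<in> U"
  shows "lderiv id (lderiv id f) x = dderiv x (dderiv x f) x + lderiv id f x"
  using lderiv_lderiv[OF assms linear_id] by (simp add: lderiv_def)

lemma lderiv_commutator:
  assumes "open U" "smooth_on f U" "x \<in> U" "linear A" "linear B"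
  shows "lderiv A (lderiv B f) x - lderiv B (lderiv A f) x = dderiv (B (A x) - A (B x)) f x"
  unfolding lderiv_def[of A "lderiv B f"] lderiv_def[of B "lderiv A f"]
  by (simp add: dderiv_lderiv[OF assms(1-3)] assms dderiv_commute[OF assms(1-3), of "A x" "B x"]
      dderiv_linear[OF smooth_differentiable[OF assms(1-3)]])

lemma lderiv_id_commute:
  assumes "open U" "smooth_on f U" "x \<in> U" "linear A"
  shows "lderiv id (lderiv A f) x = lderiv A (lderiv id f) x"
  using lderiv_commutator[OF assms(1-3) linear_id assms(4)]
    dderiv_linear(5)[OF smooth_differentiable[OF assms(1-3)]]
  by simp

lemma dderiv_dderiv_eq_sum_pd:
  assumes "open U" "smooth_on f U" "x \<in> U"
  shows "(\<Sum>i\<in>UNIV. \<Sum>j\<in>UNIV. v $ i * w $ j * pd i (pd j f) x) = dderiv v (dderiv w f) x"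
proof -
  note differentiable = smooth_differentiable[OF assms(1)]
  have "dderiv v (dderiv w f) x = (\<Sum>i\<in>UNIV. v $ i * pd i (dderiv w f) x)"
    by (rule dderiv_eq_sum_pd[OF differentiable[OF smooth_dderiv[OF assms(1,2)] assms(3)]])
  also have "\<dots> = (\<Sum>i\<in>UNIV. v $ i * dderiv w (pd i f) x)"
    by (simp add: pd_eq_dderiv_axis dderiv_commute[OF assms])
  also have "\<dots> = (\<Sum>i\<in>UNIV. v $ i * (\<Sum>j\<in>UNIV. w $ j * pd i (pd j f) x))"
  proof -
    have "pd j (pd i f) x = pd i (pd j f) x" for i j
      unfolding pd_eq_dderiv_axis by (rule dderiv_commute[OF assms])
    then show ?thesis
      by (simp add: dderiv_eq_sum_pd[OF differentiable[OF smooth_pd[OF assms(2)] assms(3)], of w])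
  qed
  finally show ?thesis by (simp add: sum_distrib_left mult.assoc)
qed

lemma lderiv_id_of_norm:
  fixes x :: "'a::real_inner"
  assumes "x \<noteq> 0" "(\<phi> has_real_derivative D) (at (norm x))"
  shows "(\<lambda>y. \<phi> (norm y)) differentiable (at x)" "lderiv id (\<lambda>y. \<phi> (norm y)) x = norm x * D"
proof -
  have derivative: "((\<lambda>y. \<phi> (norm y)) has_derivative (\<lambda>v. (v \<bullet> sgn x) * D)) (at x)"
    by (rule DERIV_compose_FDERIV[OF assms(2) has_derivative_norm[OF assms(1)]])
  then show "(\<lambda>y. \<phi> (norm y)) differentiable (at x)" by (auto simp: differentiable_def)
  show "lderiv id (\<lambda>y. \<phi> (norm y)) x = norm x * D"
    unfolding lderiv_def using assms(1) dderiv_eq[OF derivative, of x]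
    by (simp add: sgn_div_norm dot_square_norm power2_eq_square)
qed

lemma lderiv_id_norm_powr:
  fixes x :: "'a::real_inner"
  assumes "x \<noteq> 0"
  shows "(\<lambda>y. norm y powr k) differentiable (at x)" "lderiv id (\<lambda>y. norm y powr k) x = k * norm x powr k"
proof -
  have "((\<lambda>z. z powr k) has_real_derivative k * norm x powr (k - 1)) (at (norm x))"
    by (rule has_real_derivative_powr) (use assms in simp)
  note power_derivative = lderiv_id_of_norm[OF assms this]
  show "(\<lambda>y. norm y powr k) differentiable (at x)" by (rule power_derivative(1))
  show "lderiv id (\<lambda>y. norm y powr k) x = k * norm x powr k"
    using power_derivative(2) assms by (simp add: powr_diff)
qed

lemma gronwall_zero:
  fixes g :: "real \<Rightarrow> real"
  assumes "\<And>t. 0 \<le> t \<Longrightarrow> t \<le> 1 \<Longrightarrow> (g has_real_derivative g' t) (at t)"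
    and "\<And>t. 0 \<le> t \<Longrightarrow> t \<le> 1 \<Longrightarrow> g' t \<le> K * g t" and "g 0 \<le> 0"
  shows "g 1 \<le> 0"
proof -
  have "g 1 * exp (- K * 1) \<le> g 0 * exp (- K * 0)"
  proof (rule DERIV_nonpos_imp_nonincreasing[of 0 1 "\<lambda>t. g t * exp (- K * t)"])
    fix t :: real assume t: "0 \<le> t" "t \<le> 1"
    have "((\<lambda>t. g t * exp (- K * t)) has_real_derivative (g' t - K * g t) * exp (- K * t)) (at t)"
      using assms(1)[OF t] by (auto intro!: derivative_eq_intros simp: algebra_simps)
    then show "\<exists>y. DERIV (\<lambda>t. g t * exp (- K * t)) t :> y \<and> y \<le> 0"
      using assms(2)[OF t] by (intro exI conjI) (auto simp: mult_le_0_iff)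
  qed simp
  then show ?thesis
    using assms(3) by (simp add: mult_le_0_iff) (meson exp_gt_zero linorder_not_less mult_pos_pos order_trans)
qed

lemma linear_ode_zero:
  fixes \<phi> :: "real \<Rightarrow> real"
  assumes "\<phi> 0 = 0" "\<And>t. 0 \<le> t \<Longrightarrow> t \<le> 1 \<Longrightarrow> (\<phi> has_real_derivative k t * \<phi> t) (at t)"
    and "\<And>t. 0 \<le> t \<Longrightarrow> t \<le> 1 \<Longrightarrow> k t \<le> K"
  shows "\<phi> 1 = 0"
proof -
  have "(\<phi> 1)\<^sup>2 \<le> 0"
  proof (rule gronwall_zero[where g="\<lambda>t. (\<phi> t)\<^sup>2" and K="2 * K"])
    fix t :: real assume t: "0 \<le> t" "t \<le> 1"
    show "((\<lambda>t. (\<phi> t)\<^sup>2) has_real_derivative 2 * k t * (\<phi> t)\<^sup>2) (at t)"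
      using assms(2)[OF t] by (auto intro!: derivative_eq_intros simp: power2_eq_square)
    show "2 * k t * (\<phi> t)\<^sup>2 \<le> 2 * K * (\<phi> t)\<^sup>2" using assms(3)[OF t] by (simp add: mult_right_mono)
  qed (simp add: assms(1))
  then show ?thesis by simp
qed

lemma abs_diff_le_powr:
  fixes g :: "real \<Rightarrow> real"
  assumes "0 < s" "s \<le> t" "j > 0" "\<And>z. s \<le> z \<Longrightarrow> z \<le> t \<Longrightarrow> (g has_real_derivative g' z) (at z)"
    and "\<And>z. s \<le> z \<Longrightarrow> z \<le> t \<Longrightarrow> \<bar>g' z\<bar> \<le> A * z powr (- j - 1)"
  shows "\<bar>g t - g s\<bar> \<le> A / j * s powr (- j)"
proof -
  define primitive where "primitive z = A / j * z powr (- j)" for z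
  have primitive_deriv: "(primitive has_real_derivative - (A * z powr (- j - 1))) (at z)" if "s \<le> z" for z
    unfolding primitive_def using that assms(1,3) by (auto intro!: derivative_eq_intros simp: field_simps)
  have "g t + primitive t \<le> g s + primitive s"
  proof (rule DERIV_nonpos_imp_nonincreasing[of s t "\<lambda>z. g z + primitive z", OF assms(2)])
    fix z assume z: "s \<le> z" "z \<le> t"
    show "\<exists>y. ((\<lambda>z. g z + primitive z) has_real_derivative y) (at z) \<and> y \<le> 0"
      using DERIV_add[OF assms(4)[OF z] primitive_deriv[OF z(1)]] assms(5)[OF z] by (intro exI conjI) auto
  qed
  moreover have "g s - primitive s \<le> g t - primitive t"
  proof (rule DERIV_nonneg_imp_nondecreasing[of s t "\<lambda>z. g z - primitive z", OF assms(2)])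
    fix z assume z: "s \<le> z" "z \<le> t"
    show "\<exists>y. ((\<lambda>z. g z - primitive z) has_real_derivative y) (at z) \<and> 0 \<le> y"
      using DERIV_diff[OF assms(4)[OF z] primitive_deriv[OF z(1)]] assms(5)[OF z] by (intro exI conjI) auto
  qed
  moreover have "0 \<le> A"
    using assms(5)[of s] assms(1,2)
    by (simp add: zero_le_mult_iff) (smt (verit) powr_gt_zero zero_le_mult_iff)
  then have "primitive t \<ge> 0" using assms(3) by (simp add: primitive_def)
  ultimately show ?thesis unfolding primitive_def by linarith
qed

section \<open>Rotations and the spherical Laplacian\<close>

definition kdelta :: "'n \<Rightarrow> 'n \<Rightarrow> real" where
  "kdelta i j = (if i = j then 1 else 0)"

lemma sum_kdelta [simp]:
  fixes f :: "'n::finite \<Rightarrow> real"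
  shows "(\<Sum>l\<in>UNIV. kdelta i l * f l) = f i" "(\<Sum>l\<in>UNIV. kdelta l i * f l) = f i"
    "(\<Sum>l\<in>UNIV. f l * kdelta i l) = f i" "(\<Sum>l\<in>UNIV. f l * kdelta l i) = f i"
    "(\<Sum>l\<in>UNIV. kdelta i l) = 1" "(\<Sum>l\<in>UNIV. kdelta l i) = 1"
  by (simp_all add: kdelta_def if_distrib[of "\<lambda>c. c * _"] if_distrib[of "\<lambda>c. _ * c"] cong: if_cong)

lemma axis_nth: "axis i 1 $ j = kdelta i j"
  by (simp add: kdelta_def axis_def)

lemma kdelta_refl [simp]: "kdelta i i = 1"
  by (simp add: kdelta_def)

lemma kdelta_commute: "kdelta i j = kdelta j i"
  by (simp add: kdelta_def)

lemma inner_eq_sum: "x \<bullet> y = (\<Sum>i\<in>UNIV. x $ i * y $ i)" for x y :: "real^'n"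
  by (simp add: inner_vec_def)

lemma sum_UNIV_pairs: "(\<Sum>i\<in>UNIV. \<Sum>j\<in>UNIV. f i j) = (\<Sum>p\<in>UNIV. f (fst p) (snd p))"
  for f :: "'n::finite \<Rightarrow> 'm::finite \<Rightarrow> real"
  by (simp add: sum.cartesian_product case_prod_beta)

lemma exists_unit_orthogonal:
  fixes S :: "'a::euclidean_space set"
  assumes "finite S" "card S < DIM('a)"
  obtains e where "e \<bullet> e = 1" "\<And>y. y \<in> S \<Longrightarrow> e \<bullet> y = 0"
proof -
  have "dim S < DIM('a)" using dim_le_card'[OF assms(1)] assms(2) by simp
  then obtain e where e: "e \<noteq> 0" "\<And>y. y \<in> span S \<Longrightarrow> orthogonal e y"
    using orthogonal_to_subspace_exists by blast
  show ?thesis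
  proof (rule that[of "sgn e"])
    show "sgn e \<bullet> sgn e = 1" using e(1) by (simp add: dot_square_norm norm_sgn)
    show "sgn e \<bullet> y = 0" if "y \<in> S" for y
      using e(2)[OF span_base[OF that]] by (simp add: sgn_div_norm orthogonal_def)
  qed
qed

definition grad :: "(real^'n::finite \<Rightarrow> real) \<Rightarrow> real^'n \<Rightarrow> real^'n" where
  "grad f x = (\<chi> i. pd i f x)"

lemma inner_grad: "f differentiable (at x) \<Longrightarrow> v \<bullet> grad f x = dderiv v f x"
  by (simp add: inner_eq_sum grad_def dderiv_eq_sum_pd)

definition laplace :: "(real^'n::finite \<Rightarrow> real) \<Rightarrow> real^'n \<Rightarrow> real" where
  "laplace f x = (\<Sum>i\<in>UNIV. pd i (pd i f) x)"

lemma laplace_eq_sum_dderiv: "laplace f x = (\<Sum>i\<in>UNIV. dderiv (axis i 1) (dderiv (axis i 1) f) x)"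
  by (simp add: laplace_def pd_eq_dderiv_axis)

lemma smooth_laplace [smooth_intros]: "open U \<Longrightarrow> smooth_on f U \<Longrightarrow> smooth_on (laplace f) U"
  unfolding laplace_def by (intro smooth_sum smooth_pd)

(* In polar coordinates the Euclidean Laplacian is (E^2 + (n-2) E + sphere_laplace) / r^2 with E = r d/dr. *)
definition sphere_laplace :: "(real^'n::finite \<Rightarrow> real) \<Rightarrow> real^'n \<Rightarrow> real" where
  "sphere_laplace f x = (x \<bullet> x) * laplace f x - lderiv id (lderiv id f) x
    - (real CARD('n) - 2) * lderiv id f x"

lemma smooth_sphere_laplace [smooth_intros]: "open U \<Longrightarrow> smooth_on f U \<Longrightarrow> smooth_on (sphere_laplace f) U"
  unfolding sphere_laplace_def
  by (intro smooth_diff smooth_mult smooth_inner_self smooth_const smooth_lderiv linear_id smooth_laplace)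

definition rot :: "'a::real_inner \<Rightarrow> 'a \<Rightarrow> 'a \<Rightarrow> 'a" where
  "rot a b x = (x \<bullet> a) *\<^sub>R b - (x \<bullet> b) *\<^sub>R a"

lemma linear_rot [simp]: "linear (rot a b)"
  by (rule linearI) (simp_all add: rot_def inner_add_left algebra_simps scaleR_add_left)

lemma inner_rot_self: "x \<bullet> rot a b x = 0"
  by (simp add: rot_def inner_diff_right inner_commute mult.commute)

lemma skew_inner:
  assumes "linear A" "\<And>y. y \<bullet> A y = 0"
  shows "y \<bullet> A z = - (A y \<bullet> z)"
proof -
  have "(y + z) \<bullet> A (y + z) = 0" using assms(2) by blast
  then show ?thesis using assms(2)[of y] assms(2)[of z]
    by (simp add: linear_add[OF assms(1)] inner_add_left inner_add_right inner_commute)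
qed

lemma lderiv_rot_at_center:
  assumes "f differentiable (at x)" "x \<bullet> v = 0"
  shows "lderiv (rot x v) f x = (x \<bullet> x) * dderiv v f x"
  using assms by (simp add: lderiv_def rot_def dderiv_linear)

definition orthonormal_pair :: "'a::real_inner \<Rightarrow> 'a \<Rightarrow> bool" where
  "orthonormal_pair a b \<longleftrightarrow> a \<bullet> a = 1 \<and> b \<bullet> b = 1 \<and> a \<bullet> b = 0"

lemma orthonormal_pairD:
  assumes "orthonormal_pair a b"
  shows "a \<bullet> a = 1" "b \<bullet> b = 1" "a \<bullet> b = 0" "b \<bullet> a = 0"
  using assms by (auto simp: orthonormal_pair_def inner_commute)

lemma orthonormal_pair_axis: "i \<noteq> j \<Longrightarrow> orthonormal_pair (axis i 1) (axis j 1 :: real^'n::finite)"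
  by (simp add: orthonormal_pair_def inner_axis_axis)

lemma orthonormal_decomposition:
  fixes a y :: "'a::euclidean_space"
  assumes "DIM('a) \<ge> 2" "a \<bullet> a = 1"
  obtains b s where "orthonormal_pair a b" "s \<ge> 0" "y = (y \<bullet> a) *\<^sub>R a + s *\<^sub>R b" "(y \<bullet> a)\<^sup>2 + s\<^sup>2 = y \<bullet> y"
proof -
  define z where "z = y - (y \<bullet> a) *\<^sub>R a"
  have z: "z \<bullet> a = 0" "y = (y \<bullet> a) *\<^sub>R a + z" using assms(2) by (simp_all add: z_def inner_diff_left)
  obtain b where b: "orthonormal_pair a b" "z = norm z *\<^sub>R b"
  proof (cases "z = 0")
    case True
    obtain b where "b \<bullet> b = 1" "b \<bullet> a = 0" using exists_unit_orthogonal[of "{a}"] assms(1) by auto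
    then show ?thesis using True assms(2) that by (simp add: orthonormal_pair_def inner_commute)
  next
    case False
    have "orthonormal_pair a (sgn z)"
      using False z(1) assms(2)
      by (simp add: orthonormal_pair_def dot_square_norm norm_sgn) (simp add: sgn_div_norm inner_commute)
    then show ?thesis using False that by (simp add: sgn_div_norm)
  qed
  have "y \<bullet> y = ((y \<bullet> a) *\<^sub>R a + z) \<bullet> ((y \<bullet> a) *\<^sub>R a + z)" using z(2) by simp
  also have "\<dots> = (y \<bullet> a)\<^sup>2 + (norm z)\<^sup>2"
    using z(1) assms(2)
    by (simp add: inner_add_left inner_add_right inner_commute[of a z] power2_eq_square dot_square_norm[of z])
  finally show ?thesis using that[of b "norm z"] b z(2) by simp
qed

definition rot_flow :: "'a::real_inner \<Rightarrow> 'a \<Rightarrow> 'a \<Rightarrow> real \<Rightarrow> 'a" where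
  "rot_flow a b x t = x + (cos t - 1) *\<^sub>R ((x \<bullet> a) *\<^sub>R a + (x \<bullet> b) *\<^sub>R b) + sin t *\<^sub>R rot a b x"

lemma rot_flow_0 [simp]: "rot_flow a b x 0 = x"
  by (simp add: rot_flow_def)

lemma rot_flow_scaleR: "rot_flow a b (s *\<^sub>R x) t = s *\<^sub>R rot_flow a b x t"
  by (simp add: rot_flow_def rot_def scaleR_add_right scaleR_diff_right algebra_simps)

lemma has_vector_derivative_rot_flow:
  assumes "orthonormal_pair a b"
  shows "(rot_flow a b x has_vector_derivative rot a b (rot_flow a b x t)) (at t)"
proof -
  have "((\<lambda>t. x + (cos t - 1) *\<^sub>R ((x \<bullet> a) *\<^sub>R a + (x \<bullet> b) *\<^sub>R b) + sin t *\<^sub>R rot a b x) has_vector_derivative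
     (- sin t) *\<^sub>R ((x \<bullet> a) *\<^sub>R a + (x \<bullet> b) *\<^sub>R b) + cos t *\<^sub>R rot a b x) (at t)"
    by (auto intro!: derivative_eq_intros simp: has_vector_derivative_def scaleR_add_left algebra_simps)
  moreover have "rot a b (rot_flow a b x t) = (- sin t) *\<^sub>R ((x \<bullet> a) *\<^sub>R a + (x \<bullet> b) *\<^sub>R b) + cos t *\<^sub>R rot a b x"
  proof -
    have coordinates: "rot_flow a b x t \<bullet> a = cos t * (x \<bullet> a) - sin t * (x \<bullet> b)"
      "rot_flow a b x t \<bullet> b = cos t * (x \<bullet> b) + sin t * (x \<bullet> a)"
      using orthonormal_pairD[OF assms]
      by (simp_all add: rot_flow_def rot_def inner_add_left inner_diff_left algebra_simps)
    show ?thesis unfolding rot_def[of a b "rot_flow a b x t"] coordinates by (simp add: rot_def algebra_simps)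
  qed
  ultimately show ?thesis by (simp add: rot_flow_def[abs_def])
qed

lemma norm_rot_flow:
  assumes "orthonormal_pair a b"
  shows "norm (rot_flow a b x t) = norm x"
proof -
  have "((\<lambda>t. rot_flow a b x t \<bullet> rot_flow a b x t) has_real_derivative 0) (at t)" for t
    using has_vector_derivative_rot_flow[OF assms, of x t] inner_rot_self[of "rot_flow a b x t" a b]
    unfolding has_vector_derivative_def has_field_derivative_def
    by (auto intro!: derivative_eq_intros simp: inner_commute)
  then have "rot_flow a b x t \<bullet> rot_flow a b x t = rot_flow a b x 0 \<bullet> rot_flow a b x 0"
    using DERIV_isconst_all by blast
  then show ?thesis by (simp add: norm_eq_sqrt_inner)
qed

lemma DERIV_rot_flow:
  assumes "orthonormal_pair a b" "f differentiable (at (rot_flow a b x t))"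
  shows "((\<lambda>t. f (rot_flow a b x t)) has_real_derivative lderiv (rot a b) f (rot_flow a b x t)) (at t)"
  using DERIV_along_curve[OF assms(2) has_vector_derivative_rot_flow[OF assms(1)]] by (simp add: lderiv_def)

lemma rot_flow_transitive_on_sphere:
  fixes x y :: "'a::euclidean_space"
  assumes "DIM('a) \<ge> 2" "norm y = norm x" "x \<noteq> 0"
  obtains a b t where "orthonormal_pair a b" "0 \<le> t" "t \<le> pi" "rot_flow a b x t = y"
proof -
  define r where "r = norm x"
  have r: "r > 0" using assms(3) by (simp add: r_def)
  define a where "a = sgn x"
  have a: "a \<bullet> a = 1" "x = r *\<^sub>R a"
    using assms(3) by (simp_all add: a_def r_def dot_square_norm norm_sgn sgn_div_norm)
  obtain b s where b: "orthonormal_pair a b" "s \<ge> 0" "y = (y \<bullet> a) *\<^sub>R a + s *\<^sub>R b" "(y \<bullet> a)\<^sup>2 + s\<^sup>2 = y \<bullet> y"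
    using orthonormal_decomposition[OF assms(1) a(1), of y] .
  have "((y \<bullet> a) / r)\<^sup>2 + (s / r)\<^sup>2 = 1"
    using b(4) r assms(2) by (simp add: power_divide r_def dot_square_norm flip: add_divide_distrib)
  then obtain t where t: "0 \<le> t" "t \<le> pi" "(y \<bullet> a) / r = cos t" "s / r = sin t"
    using sincos_total_pi[of "s / r" "(y \<bullet> a) / r"] b(2) r by auto
  have "rot_flow a b x t = (r * cos t) *\<^sub>R a + (r * sin t) *\<^sub>R b"
    using orthonormal_pairD[OF b(1)] by (simp add: rot_flow_def rot_def a(2) algebra_simps)
  also have "\<dots> = y" using b(3) r by (simp flip: t(3,4))
  finally show ?thesis using that b(1) t(1,2) by blast
qed

lemma sphere_oscillation_bound:
  fixes f :: "'a::euclidean_space \<Rightarrow> real"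
  assumes "DIM('a) \<ge> 2" "norm y = norm x" "x \<noteq> 0" "\<And>z. norm z = norm x \<Longrightarrow> f differentiable (at z)"
    and B: "\<And>a b z. orthonormal_pair a b \<Longrightarrow> norm z = norm x \<Longrightarrow> \<bar>lderiv (rot a b) f z\<bar> \<le> B"
  shows "\<bar>f y - f x\<bar> \<le> pi * B"
proof -
  obtain a b t where ab: "orthonormal_pair a b" and t: "0 \<le> t" "t \<le> pi" "rot_flow a b x t = y"
    using rot_flow_transitive_on_sphere[OF assms(1-3)] .
  have "norm (f (rot_flow a b x t) - f (rot_flow a b x 0)) \<le> B * norm (t - 0)"
  proof (rule field_differentiable_bound[of UNIV])
    show "((\<lambda>t. f (rot_flow a b x t)) has_field_derivative lderiv (rot a b) f (rot_flow a b x s)) (at s within UNIV)" for s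
      by (rule DERIV_rot_flow[OF ab assms(4)[OF norm_rot_flow[OF ab]]])
    show "norm (lderiv (rot a b) f (rot_flow a b x s)) \<le> B" for s using B[OF ab norm_rot_flow[OF ab]] by simp
  qed auto
  also have "\<dots> \<le> B * pi" using t B[OF ab, of x] by (intro mult_left_mono) auto
  finally show ?thesis using t(3) by (simp add: mult.commute)
qed

abbreviation rot_deriv :: "'n \<times> 'n \<Rightarrow> (real^'n::finite \<Rightarrow> real) \<Rightarrow> real^'n \<Rightarrow> real" where
  "rot_deriv p \<equiv> lderiv (rot (axis (fst p) 1) (axis (snd p) 1))"

lemma rot_deriv_diagonal: "f differentiable (at x) \<Longrightarrow> fst p = snd p \<Longrightarrow> rot_deriv p f x = 0"
  by (simp add: lderiv_def rot_def dderiv_linear)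

lemma dderiv_dderiv_linear:
  assumes "open U" "smooth_on f U" "x \<in> U"
  shows "dderiv w (dderiv (v + v') f) x = dderiv w (dderiv v f) x + dderiv w (dderiv v' f) x"
    "dderiv w (dderiv (v - v') f) x = dderiv w (dderiv v f) x - dderiv w (dderiv v' f) x"
    "dderiv w (dderiv (c *\<^sub>R v) f) x = c * dderiv w (dderiv v f) x"
  unfolding dderiv_commute[OF assms, of w]
  by (rule dderiv_linear, rule smooth_differentiable[OF assms(1) smooth_dderiv[OF assms(1,2)] assms(3)])+

lemma sum_dderiv_dderiv_rot_axis:
  fixes f :: "real^'n::finite \<Rightarrow> real"
  assumes "open U" "smooth_on f U" "x \<in> U"
  shows "(\<Sum>i\<in>UNIV. \<Sum>j\<in>UNIV. dderiv (rot (axis i 1) (axis j 1) x) (dderiv (rot (axis i 1) (axis j 1) x) f) x)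
    = 2 * ((x \<bullet> x) * laplace f x) - 2 * dderiv x (dderiv x f) x"
proof -
  define H where "H i j = pd i (pd j f) x" for i j
  have H_commute: "H i j = H j i" for i j
    unfolding H_def pd_eq_dderiv_axis by (rule dderiv_commute[OF assms])
  have diff: "dderiv w f differentiable (at x)" for w
    by (rule smooth_differentiable[OF assms(1) smooth_dderiv[OF assms(1,2)] assms(3)])
  have "dderiv (rot (axis i 1) (axis j 1) x) (dderiv (rot (axis i 1) (axis j 1) x) f) x
     = (x $ i * x $ i) * H j j - 2 * (x $ i * x $ j * H i j) + (x $ j * x $ j) * H i i" for i j
  proof -
    have rot_axis: "rot (axis i 1) (axis j 1) x = x $ i *\<^sub>R axis j 1 - x $ j *\<^sub>R axis i 1"
      by (simp add: rot_def inner_axis)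
    show ?thesis
      unfolding rot_axis using H_commute[of j i]
      by (simp add: dderiv_linear[OF diff] dderiv_dderiv_linear[OF assms] H_def pd_eq_dderiv_axis
        algebra_simps)
  qed
  moreover have "(\<Sum>i\<in>UNIV. \<Sum>j\<in>UNIV. (x $ i * x $ i) * H j j) = (x \<bullet> x) * laplace f x"
    by (simp add: inner_eq_sum laplace_def H_def sum_product)
  moreover from this have "(\<Sum>i\<in>UNIV. \<Sum>j\<in>UNIV. (x $ j * x $ j) * H i i) = (x \<bullet> x) * laplace f x"
    by (subst sum.swap)
  moreover have "(\<Sum>i\<in>UNIV. \<Sum>j\<in>UNIV. x $ i * x $ j * H i j) = dderiv x (dderiv x f) x"
    unfolding H_def by (rule dderiv_dderiv_eq_sum_pd[OF assms])
  ultimately show ?thesis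
    by (simp add: sum.distrib sum_subtractf flip: sum_distrib_left)
qed

lemma sum_dderiv_rot_rot_axis:
  fixes f :: "real^'n::finite \<Rightarrow> real"
  assumes "f differentiable (at x)"
  shows "(\<Sum>i\<in>UNIV. \<Sum>j\<in>UNIV. dderiv (rot (axis i 1) (axis j 1) (rot (axis i 1) (axis j 1) x)) f x)
    = - 2 * (real CARD('n) - 1) * lderiv id f x"
proof -
  have euler: "lderiv id f x = (\<Sum>i\<in>UNIV. x $ i * pd i f x)"
    using dderiv_eq_sum_pd[OF assms, of x] by (simp add: lderiv_def)
  have "dderiv (rot (axis i 1) (axis j 1) (rot (axis i 1) (axis j 1) x)) f x = x $ i * (kdelta i j * pd j f x)
      - x $ j * pd j f x - x $ i * pd i f x + kdelta i j * (x $ j * pd i f x)" for i j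
    by (simp add: rot_def dderiv_linear[OF assms] inner_diff_left inner_axis axis_nth pd_eq_dderiv
        kdelta_commute[of j i] algebra_simps)
  moreover have "(\<Sum>i\<in>UNIV. \<Sum>j\<in>UNIV. x $ i * (kdelta i j * pd j f x)) = lderiv id f x"
    unfolding euler by (simp flip: sum_distrib_left)
  moreover have "(\<Sum>i\<in>UNIV. \<Sum>j\<in>UNIV. kdelta i j * (x $ j * pd i f x)) = lderiv id f x"
    unfolding euler by simp
  moreover have "(\<Sum>i\<in>(UNIV::'n set). \<Sum>j\<in>UNIV. x $ j * pd j f x) = real CARD('n) * lderiv id f x"
    unfolding euler by simp
  moreover have "(\<Sum>i\<in>UNIV. \<Sum>j\<in>(UNIV::'n set). x $ i * pd i f x) = real CARD('n) * lderiv id f x"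
    unfolding euler sum_distrib_left by simp
  ultimately show ?thesis
    by (simp only: sum.distrib sum_subtractf) (simp add: algebra_simps)
qed

lemma sphere_laplace_eq_rot_derivs:
  assumes "open U" "smooth_on f U" "x \<in> U"
  shows "sphere_laplace f x = (1/2) * (\<Sum>p\<in>UNIV. rot_deriv p (rot_deriv p f) x)"
  using sum_dderiv_dderiv_rot_axis[OF assms] sum_dderiv_rot_rot_axis[OF smooth_differentiable[OF assms]]
  unfolding lderiv_lderiv[OF assms linear_rot] sphere_laplace_def lderiv_id_lderiv_id[OF assms] sum.distrib
    sum_UNIV_pairs
  by (simp add: algebra_simps)

lemma laplace_rot_commute:
  assumes "open U" "smooth_on f U" "x \<in> U"
  shows "laplace (lderiv (rot a b) f) x = lderiv (rot a b) (laplace f) x"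
proof -
  let ?A = "rot a b"
  have smooth: "smooth_on (dderiv e f) U" for e by (rule smooth_dderiv[OF assms(1,2)])
  note diff = smooth_differentiable[OF assms(1) smooth assms(3)]
  have second_deriv: "dderiv e (dderiv e (lderiv ?A f)) x
      = lderiv ?A (dderiv e (dderiv e f)) x + 2 * dderiv (?A e) (dderiv e f) x" for e
  proof -
    have "dderiv e (dderiv e (lderiv ?A f)) x = dderiv e (\<lambda>y. lderiv ?A (dderiv e f) y + dderiv (?A e) f y) x"
      by (rule dderiv_cong_open[OF assms(1,3)]) (rule dderiv_lderiv_commute[OF assms(1,2) _ linear_rot])
    also have "\<dots> = dderiv e (lderiv ?A (dderiv e f)) x + dderiv e (dderiv (?A e) f) x"
      by (rule dderiv_arith)
        (intro smooth_differentiable[OF assms(1) _ assms(3)] smooth_lderiv assms(1) linear_rot smooth)+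
    finally show ?thesis
      using dderiv_lderiv_commute[OF assms(1) smooth assms(3) linear_rot, of e a b e]
        dderiv_commute[OF assms, of e "?A e"]
      by simp
  qed
  have "dderiv (?A (axis i 1)) (dderiv (axis i 1) f) x
      = a $ i * pd i (dderiv b f) x - b $ i * pd i (dderiv a f) x" for i
    using dderiv_commute[OF assms, of "axis i 1"]
    by (simp add: rot_def dderiv_linear[OF diff] inner_axis' pd_eq_dderiv)
  then have "(\<Sum>i\<in>UNIV. dderiv (?A (axis i 1)) (dderiv (axis i 1) f) x)
      = dderiv a (dderiv b f) x - dderiv b (dderiv a f) x"
    by (simp add: sum_subtractf dderiv_eq_sum_pd[OF diff])
  then have cross_terms: "(\<Sum>i\<in>UNIV. dderiv (?A (axis i 1)) (dderiv (axis i 1) f) x) = 0"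
    using dderiv_commute[OF assms, of a b] by simp
  have "lderiv ?A (laplace f) x = (\<Sum>i\<in>UNIV. lderiv ?A (dderiv (axis i 1) (dderiv (axis i 1) f)) x)"
    unfolding lderiv_def laplace_eq_sum_dderiv[abs_def]
    by (intro dderiv_sum smooth_differentiable[OF assms(1) _ assms(3)] smooth_dderiv assms(1) smooth)
  then show ?thesis
    unfolding laplace_eq_sum_dderiv[of "lderiv ?A f"] second_deriv
    by (simp add: sum.distrib cross_terms flip: sum_distrib_left)
qed

lemma sphere_laplace_rot_commute:
  fixes f :: "real^'n::finite \<Rightarrow> real"
  assumes "open U" "smooth_on f U" "x \<in> U"
  shows "sphere_laplace (lderiv (rot a b) f) x = lderiv (rot a b) (sphere_laplace f) x"
proof -
  let ?A = "rot a b"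
  have smooth: "smooth_on (lderiv id f) U" "smooth_on (lderiv id (lderiv id f)) U"
    by (intro smooth_lderiv assms linear_id)+
  note diff = smooth_differentiable[OF assms(1) _ assms(3)]
  have norm_invariant: "lderiv ?A (\<lambda>x. x \<bullet> x) x = 0"
    by (simp add: lderiv_def inner_rot_self)
  have "lderiv ?A (sphere_laplace f) x
      = lderiv ?A (\<lambda>x. (x \<bullet> x) * laplace f x - lderiv id (lderiv id f) x
      - (real CARD('n) - 2) * lderiv id f x) x"
    by (simp add: sphere_laplace_def[abs_def])
  also have "\<dots> = (x \<bullet> x) * lderiv ?A (laplace f) x - lderiv ?A (lderiv id (lderiv id f)) x
      - (real CARD('n) - 2) * lderiv ?A (lderiv id f) x"
    by (subst lderiv_arith |
      (intro diff smooth_diff smooth_mult smooth_const smooth_inner_self smooth_laplace assms smooth))+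
      (simp add: norm_invariant)
  also have "\<dots> = sphere_laplace (lderiv ?A f) x"
  proof -
    have "lderiv id (lderiv id (lderiv ?A f)) x = lderiv id (lderiv ?A (lderiv id f)) x"
      by (rule lderiv_cong_open[OF assms(1,3)]) (rule lderiv_id_commute[OF assms(1,2) _ linear_rot])
    then show ?thesis
      unfolding sphere_laplace_def laplace_rot_commute[OF assms] lderiv_id_commute[OF assms linear_rot]
        lderiv_id_commute[OF assms(1) smooth(1) assms(3) linear_rot] by simp
  qed
  finally show ?thesis by simp
qed

lemma sphere_laplace_add:
  assumes "open U" "smooth_on f U" "smooth_on g U" "x \<in> U"
  shows "sphere_laplace (\<lambda>y. f y + g y) x = sphere_laplace f x + sphere_laplace g x"
proof -
  note diff = smooth_differentiable[OF assms(1)] and smooth = smooth_lderiv[OF assms(1) linear_rot]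
  have "rot_deriv p (rot_deriv p (\<lambda>y. f y + g y)) x
      = rot_deriv p (rot_deriv p f) x + rot_deriv p (rot_deriv p g) x" for p
  proof -
    have "rot_deriv p (rot_deriv p (\<lambda>y. f y + g y)) x = rot_deriv p (\<lambda>y. rot_deriv p f y + rot_deriv p g y) x"
      by (rule lderiv_cong_open[OF assms(1,4)]) (intro lderiv_arith diff assms)
    then show ?thesis by (simp add: lderiv_arith diff smooth assms)
  qed
  then show ?thesis
    by (simp add: sphere_laplace_eq_rot_derivs[OF assms(1) _ assms(4)] smooth_add assms sum.distrib)
qed

lemma sphere_laplace_mult:
  assumes "open U" "smooth_on f U" "smooth_on g U" "x \<in> U"
  shows "sphere_laplace (\<lambda>y. f y * g y) x
      = f x * sphere_laplace g x + g x * sphere_laplace f x + (\<Sum>p\<in>UNIV. rot_deriv p f x * rot_deriv p g x)"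
proof -
  note diff = smooth_differentiable[OF assms(1)] and smooth = smooth_lderiv[OF assms(1) linear_rot]
  have "rot_deriv p (rot_deriv p (\<lambda>y. f y * g y)) x
    = f x * rot_deriv p (rot_deriv p g) x + g x * rot_deriv p (rot_deriv p f) x
    + 2 * (rot_deriv p f x * rot_deriv p g x)" for p
  proof -
    have "rot_deriv p (rot_deriv p (\<lambda>y. f y * g y)) x
        = rot_deriv p (\<lambda>y. f y * rot_deriv p g y + rot_deriv p f y * g y) x"
      by (rule lderiv_cong_open[OF assms(1,4)]) (intro lderiv_arith diff assms)
    also have "\<dots> = rot_deriv p (\<lambda>y. f y * rot_deriv p g y) x + rot_deriv p (\<lambda>y. rot_deriv p f y * g y) x"
      by (intro lderiv_arith diff assms smooth_mult smooth)
    finally show ?thesis by (simp add: lderiv_arith diff smooth assms)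
  qed
  then show ?thesis
    by (simp add: sphere_laplace_eq_rot_derivs[OF assms(1) _ assms(4)] smooth_mult assms sum.distrib
      sum_distrib_left algebra_simps)
qed

lemma sphere_laplace_const:
  fixes x :: "real^'n::finite"
  assumes "open U" "x \<in> U"
  shows "sphere_laplace (\<lambda>_. c) x = 0"
proof -
  have "lderiv A (\<lambda>_. c) = (\<lambda>_. 0)" for A :: "real^'n \<Rightarrow> real^'n" by (simp add: fun_eq_iff)
  then show ?thesis
    by (simp add: sphere_laplace_eq_rot_derivs[OF assms(1) smooth_const[OF assms(1)] assms(2)])
qed

lemma sphere_laplace_cmult:
  "open U \<Longrightarrow> smooth_on f U \<Longrightarrow> x \<in> U \<Longrightarrow> sphere_laplace (\<lambda>y. c * f y) x = c * sphere_laplace f x"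
  using sphere_laplace_mult[of U "\<lambda>_. c" f x] by (simp add: smooth_const sphere_laplace_const)

lemma sphere_laplace_sum:
  assumes "open U" "finite I" "\<And>i. i \<in> I \<Longrightarrow> smooth_on (f i) U" "x \<in> U"
  shows "sphere_laplace (\<lambda>y. \<Sum>i\<in>I. f i y) x = (\<Sum>i\<in>I. sphere_laplace (f i) x)"
  using assms(2,3)
  by (induction I rule: finite_induct)
    (simp_all add: sphere_laplace_add[OF assms(1)] smooth_sum assms(1,4) sphere_laplace_const[OF assms(1,4)])

section \<open>The tangential gradient\<close>

definition tangrad_sq :: "(real^'n::finite \<Rightarrow> real) \<Rightarrow> real^'n \<Rightarrow> real" where
  "tangrad_sq f x = (1/2) * (\<Sum>p\<in>UNIV. (rot_deriv p f x)\<^sup>2)"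

definition tangrad :: "(real^'n::finite \<Rightarrow> real) \<Rightarrow> real^'n \<Rightarrow> real^'n" where
  "tangrad f x = grad f x - ((x \<bullet> grad f x) / (x \<bullet> x)) *\<^sub>R x"

lemma tangrad_sq_nonneg: "tangrad_sq f x \<ge> 0"
  by (simp add: tangrad_sq_def sum_nonneg)

lemma smooth_tangrad_sq [smooth_intros]: "open U \<Longrightarrow> smooth_on f U \<Longrightarrow> smooth_on (tangrad_sq f) U"
  unfolding tangrad_sq_def
  by (intro smooth_mult smooth_const smooth_sum smooth_power smooth_lderiv linear_rot)

lemma inner_tangrad_self: "tangrad f x \<bullet> x = 0"
  by (simp add: tangrad_def inner_diff_left inner_commute[of "grad f x"])

lemma dderiv_eq_inner_tangrad:
  assumes "f differentiable (at x)" "x \<bullet> v = 0"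
  shows "dderiv v f x = v \<bullet> tangrad f x"
  using assms(2) by (simp add: tangrad_def inner_diff_right inner_grad[OF assms(1)] inner_commute[of v x])

lemma tangrad_sq_eq:
  assumes "f differentiable (at x)"
  shows "tangrad_sq f x = (x \<bullet> x) * (tangrad f x \<bullet> tangrad f x)"
proof -
  define h where "h = tangrad f x"
  have rot_deriv: "rot_deriv p f x = x $ fst p * h $ snd p - x $ snd p * h $ fst p" for p
    using dderiv_eq_inner_tangrad[OF assms inner_rot_self, of "axis (fst p) 1" "axis (snd p) 1"]
    by (simp add: lderiv_def h_def rot_def inner_diff_left inner_axis inner_axis')
  have "2 * tangrad_sq f x = (\<Sum>i\<in>UNIV. \<Sum>j\<in>UNIV.
      (x $ i * x $ i) * (h $ j * h $ j) - 2 * ((x $ i * h $ i) * (x $ j * h $ j))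
      + (h $ i * h $ i) * (x $ j * x $ j))"
    unfolding tangrad_sq_def sum_UNIV_pairs rot_deriv by (simp add: power2_eq_square algebra_simps)
  also have "\<dots> = (x \<bullet> x) * (h \<bullet> h) - 2 * ((x \<bullet> h) * (x \<bullet> h)) + (h \<bullet> h) * (x \<bullet> x)"
    unfolding inner_eq_sum sum_product by (simp add: sum.distrib sum_subtractf sum_distrib_left)
  finally show ?thesis
    using inner_tangrad_self[of f x] by (simp add: h_def inner_commute)
qed

lemma dderiv_sq_le_tangrad_sq:
  assumes "f differentiable (at x)" "x \<bullet> v = 0"
  shows "(dderiv v f x)\<^sup>2 * (x \<bullet> x) \<le> (v \<bullet> v) * tangrad_sq f x"
proof -
  have "(dderiv v f x)\<^sup>2 \<le> (v \<bullet> v) * (tangrad f x \<bullet> tangrad f x)"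
    using Cauchy_Schwarz_ineq[of v "tangrad f x"] by (simp add: dderiv_eq_inner_tangrad[OF assms])
  then have "(dderiv v f x)\<^sup>2 * (x \<bullet> x) \<le> (v \<bullet> v) * (tangrad f x \<bullet> tangrad f x) * (x \<bullet> x)"
    by (rule mult_right_mono) simp
  then show ?thesis by (simp add: tangrad_sq_eq[OF assms(1)] mult_ac)
qed

lemma inner_rot_rot_le:
  assumes "orthonormal_pair a b"
  shows "rot a b x \<bullet> rot a b x \<le> x \<bullet> x"
proof -
  note ab = orthonormal_pairD[OF assms]
  have "0 \<le> (x - (x \<bullet> a) *\<^sub>R a - (x \<bullet> b) *\<^sub>R b) \<bullet> (x - (x \<bullet> a) *\<^sub>R a - (x \<bullet> b) *\<^sub>R b)" by simp
  also have "\<dots> = x \<bullet> x - rot a b x \<bullet> rot a b x"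
    by (simp add: rot_def inner_diff_left inner_diff_right ab inner_commute[of a x] inner_commute[of b x])
  finally show ?thesis by simp
qed

lemma lderiv_rot_sq_le_tangrad_sq:
  assumes "f differentiable (at x)" "orthonormal_pair a b" "x \<noteq> 0"
  shows "(lderiv (rot a b) f x)\<^sup>2 \<le> tangrad_sq f x"
proof -
  have "(rot a b x \<bullet> rot a b x) * tangrad_sq f x \<le> (x \<bullet> x) * tangrad_sq f x"
    by (rule mult_right_mono[OF inner_rot_rot_le[OF assms(2)] tangrad_sq_nonneg])
  then have "(lderiv (rot a b) f x)\<^sup>2 * (x \<bullet> x) \<le> tangrad_sq f x * (x \<bullet> x)"
    using dderiv_sq_le_tangrad_sq[OF assms(1) inner_rot_self, of a b] by (simp add: lderiv_def mult.commute)
  then show ?thesis using assms(3) by simp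
qed

lemma tangrad_sq_frame:
  assumes "f differentiable (at x)" "tangrad_sq f x > 0" "x \<noteq> 0"
  obtains a b where "orthonormal_pair a b" "x = norm x *\<^sub>R a" "\<And>e. e \<bullet> a = 0 \<Longrightarrow> e \<bullet> b = 0 \<Longrightarrow> dderiv e f x = 0"
    "lderiv (rot a b) f x = sqrt (tangrad_sq f x)"
proof -
  define h where "h = tangrad f x"
  have norm_h: "sqrt (tangrad_sq f x) = norm x * norm h"
    by (simp add: tangrad_sq_eq[OF assms(1)] h_def norm_eq_sqrt_inner real_sqrt_mult)
  have h: "h \<noteq> 0" "h \<bullet> x = 0"
    using assms(2) by (auto simp: tangrad_sq_eq[OF assms(1)] h_def inner_tangrad_self)
  show ?thesis
  proof (rule that[of "sgn x" "sgn h"])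
    show "orthonormal_pair (sgn x) (sgn h)" using h assms(3)
      by (simp add: orthonormal_pair_def dot_square_norm norm_sgn) (simp add: sgn_div_norm inner_commute)
    show "x = norm x *\<^sub>R sgn x" using assms(3) by (simp add: sgn_div_norm)
    show "dderiv e f x = 0" if "e \<bullet> sgn x = 0" "e \<bullet> sgn h = 0" for e
    proof -
      have "x \<bullet> e = 0" "e \<bullet> h = 0" using that assms(3) h(1) by (simp_all add: sgn_div_norm inner_commute)
      then show ?thesis by (simp add: dderiv_eq_inner_tangrad[OF assms(1)] h_def)
    qed
    have "rot (sgn x) (sgn h) x = norm x *\<^sub>R sgn h"
      using h assms(3)
      by (simp add: rot_def sgn_div_norm inner_commute[of x h] dot_square_norm power2_eq_square)
    moreover have "x \<bullet> sgn h = 0" using h by (simp add: sgn_div_norm inner_commute)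
    ultimately have "lderiv (rot (sgn x) (sgn h)) f x = norm x * (sgn h \<bullet> h)"
      by (simp add: lderiv_def dderiv_linear[OF assms(1)] dderiv_eq_inner_tangrad[OF assms(1)] h_def)
    then show "lderiv (rot (sgn x) (sgn h)) f x = sqrt (tangrad_sq f x)"
      using h(1) by (simp add: norm_h sgn_div_norm dot_square_norm power2_eq_square)
  qed
qed

lemma sphere_laplace_tangrad_sq:
  assumes "open U" "smooth_on f U" "x \<in> U"
  shows "sphere_laplace (tangrad_sq f) x
    = (\<Sum>p\<in>UNIV. rot_deriv p f x * sphere_laplace (rot_deriv p f) x)
    + (1/2) * (\<Sum>p\<in>UNIV. \<Sum>q\<in>UNIV. (rot_deriv q (rot_deriv p f) x)\<^sup>2)"
proof -
  note smooth = smooth_lderiv[OF assms(1) linear_rot assms(2)]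
  have "sphere_laplace (tangrad_sq f) x
      = sphere_laplace (\<lambda>x. (1/2) * (\<Sum>p\<in>UNIV. rot_deriv p f x * rot_deriv p f x)) x"
    by (simp add: tangrad_sq_def[abs_def] power2_eq_square)
  also have "\<dots> = (1/2) * (\<Sum>p\<in>UNIV. sphere_laplace (\<lambda>x. rot_deriv p f x * rot_deriv p f x) x)"
    by (subst sphere_laplace_cmult[OF assms(1)] sphere_laplace_sum[OF assms(1)]
        | (intro smooth_sum smooth_mult smooth assms finite))+ simp
  also have "\<dots> = (1/2) * (\<Sum>p\<in>UNIV. 2 * (rot_deriv p f x * sphere_laplace (rot_deriv p f) x)
      + (\<Sum>q\<in>UNIV. (rot_deriv q (rot_deriv p f) x)\<^sup>2))"
    unfolding sphere_laplace_mult[OF assms(1) smooth smooth assms(3)] by (simp add: power2_eq_square)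
  finally show ?thesis by (simp add: sum.distrib sum_distrib_left[symmetric])
qed

lemma lderiv_tangrad_sq:
  assumes "open U" "smooth_on f U" "x \<in> U"
  shows "lderiv A (tangrad_sq f) x = (\<Sum>p\<in>UNIV. rot_deriv p f x * lderiv A (rot_deriv p f) x)"
proof -
  note smooth = smooth_lderiv[OF assms(1) linear_rot assms(2)]
  note diff = smooth_differentiable[OF assms(1) _ assms(3)]
  have "lderiv A (tangrad_sq f) x = dderiv (A x) (\<lambda>x. (1/2) * (\<Sum>p\<in>UNIV. rot_deriv p f x * rot_deriv p f x)) x"
    by (simp add: lderiv_def[of A] tangrad_sq_def[abs_def] power2_eq_square)
  also have "\<dots> = (1/2) * (\<Sum>p\<in>UNIV. dderiv (A x) (\<lambda>x. rot_deriv p f x * rot_deriv p f x) x)"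
    by (subst dderiv_arith(3) dderiv_sum |
      (intro diff smooth_const smooth_sum smooth_mult assms(1) smooth))+ simp
  also have "\<dots> = (\<Sum>p\<in>UNIV. rot_deriv p f x * lderiv A (rot_deriv p f) x)"
    by (simp add: dderiv_arith diff smooth sum_distrib_left algebra_simps lderiv_def[of A])
  finally show ?thesis .
qed

lemma sphere_laplace_sq_le:
  fixes f :: "real^'n::finite \<Rightarrow> real"
  assumes "open U" "smooth_on f U" "x \<in> U"
  shows "(sphere_laplace f x)\<^sup>2 \<le> (real CARD('n))\<^sup>2 / 4 * (\<Sum>p\<in>UNIV. \<Sum>q\<in>UNIV. (rot_deriv q (rot_deriv p f) x)\<^sup>2)"
proof -
  have "(\<Sum>p\<in>UNIV. rot_deriv p (rot_deriv p f) x)\<^sup>2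
      \<le> real (card (UNIV :: ('n \<times> 'n) set)) * (\<Sum>p\<in>UNIV. (rot_deriv p (rot_deriv p f) x)\<^sup>2)"
    using sum_squared_le_sum_of_squares[of "\<lambda>p. rot_deriv p (rot_deriv p f) x" UNIV]
    by (simp add: mult.commute)
  also have "\<dots> \<le> real (card (UNIV :: ('n \<times> 'n) set)) * (\<Sum>p\<in>UNIV. \<Sum>q\<in>UNIV. (rot_deriv q (rot_deriv p f) x)\<^sup>2)"
    by (intro mult_left_mono sum_mono member_le_sum) auto
  finally show ?thesis
    unfolding sphere_laplace_eq_rot_derivs[OF assms] by (simp add: power2_eq_square field_simps)
qed

section \<open>Maximum principles on spheres and annuli\<close>

lemma sphere_attains_sup:
  fixes f :: "'a::euclidean_space \<Rightarrow> real" and x :: 'a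
  assumes "continuous_on (sphere 0 (norm x)) f"
  obtains z where "norm z = norm x" "\<And>y. norm y = norm x \<Longrightarrow> f y \<le> f z"
proof -
  have "sphere (0::'a) (norm x) \<noteq> {}" by simp
  then have "\<exists>z\<in>sphere 0 (norm x). \<forall>y\<in>sphere 0 (norm x). f y \<le> f z"
    by (intro continuous_attains_sup compact_sphere assms)
  then show ?thesis using that by auto
qed

lemma bounded_on_sphere:
  fixes f :: "'a::euclidean_space \<Rightarrow> real"
  assumes "continuous_on (sphere 0 r) f"
  obtains K where "\<And>x. norm x = r \<Longrightarrow> \<bar>f x\<bar> \<le> K"
proof -
  have "bounded (f ` sphere 0 r)"
    by (intro compact_imp_bounded compact_continuous_image assms compact_sphere)
  then obtain K where "\<forall>x\<in>sphere 0 r. \<bar>f x\<bar> \<le> K" unfolding bounded_iff by auto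
  then show ?thesis using that[of K] by simp
qed

lemma compact_annulus: "compact {x::'a::euclidean_space. r1 \<le> norm x \<and> norm x \<le> r2}"
proof -
  have "{x::'a. r1 \<le> norm x \<and> norm x \<le> r2} = cball 0 r2 - ball 0 r1" by auto
  then show ?thesis by (simp add: compact_diff)
qed

lemma annulus_attains_sup:
  fixes f :: "'a::euclidean_space \<Rightarrow> real" and y :: 'a
  assumes "continuous_on {x. r1 \<le> norm x \<and> norm x \<le> r2} f" "r1 \<le> norm y" "norm y \<le> r2"
  obtains z where "r1 \<le> norm z" "norm z \<le> r2" "\<And>x. r1 \<le> norm x \<Longrightarrow> norm x \<le> r2 \<Longrightarrow> f x \<le> f z"
proof -
  have "{x::'a. r1 \<le> norm x \<and> norm x \<le> r2} \<noteq> {}" using assms(2,3) by auto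
  then have "\<exists>z\<in>{x. r1 \<le> norm x \<and> norm x \<le> r2}. \<forall>x\<in>{x. r1 \<le> norm x \<and> norm x \<le> r2}. f x \<le> f z"
    by (intro continuous_attains_sup compact_annulus assms(1))
  then show ?thesis using that by auto
qed

lemma exterior_attains_sup:
  fixes f :: "'a::euclidean_space \<Rightarrow> real"
  assumes "continuous_on {x. R \<le> norm x} f" "(f \<longlongrightarrow> 0) at_infinity" "R \<le> norm x0" "f x0 > 0"
  obtains p where "R \<le> norm p" "\<And>x. R \<le> norm x \<Longrightarrow> f x \<le> f p"
proof -
  obtain R2 where far: "\<And>x. R2 \<le> norm x \<Longrightarrow> f x < f x0"
    using order_tendstoD(2)[OF assms(2,4)] unfolding eventually_at_infinity by blast
  have "norm x0 \<le> R2" using far[of x0] by force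
  moreover have "continuous_on {x. R \<le> norm x \<and> norm x \<le> R2} f"
    by (rule continuous_on_subset[OF assms(1)]) auto
  ultimately obtain p where p: "R \<le> norm p" "norm p \<le> R2" "\<And>x. R \<le> norm x \<Longrightarrow> norm x \<le> R2 \<Longrightarrow> f x \<le> f p"
    using annulus_attains_sup[of R R2 f x0] assms(3) by blast
  have "f x \<le> f p" if "R \<le> norm x" for x
    using p(3)[of x] p(3)[of x0] far[of x] that assms(3) \<open>norm x0 \<le> R2\<close> by (cases "norm x \<le> R2") auto
  then show ?thesis using that p(1) by blast
qed

lemma eventually_annulus_less:
  fixes f :: "'a::euclidean_space \<Rightarrow> real"
  assumes "continuous_on {x. r0 < norm x} f" "r0 < r" "\<And>x. norm x = r \<Longrightarrow> f x < c"
  shows "\<forall>\<^sub>F s in at_left r. \<forall>x. s \<le> norm x \<and> norm x \<le> r \<longrightarrow> f x < c"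
proof -
  obtain q where q: "r0 < q" "q < r" using dense[OF assms(2)] by blast
  define A where "A = {x::'a. q \<le> norm x \<and> norm x \<le> r}"
  define K where "K = A \<inter> f -` {c..}"
  have cont: "continuous_on A f"
    by (rule continuous_on_subset[OF assms(1)]) (use q in \<open>auto simp: A_def\<close>)
  have "compact A" unfolding A_def by (rule compact_annulus)
  moreover have "closed K" unfolding K_def
    by (rule continuous_closed_preimage[OF cont compact_imp_closed[OF \<open>compact A\<close>] closed_atLeast])
  ultimately have "compact (A \<inter> K)" by (rule compact_Int_closed)
  then have "compact K" by (simp add: K_def)
  obtain s where s: "q \<le> s" "s < r" "\<And>x. x \<in> K \<Longrightarrow> norm x \<le> s"
  proof (cases "K = {}")
    case True
    then show ?thesis using that[of q] q(2) by simp
  next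
    case False
    then obtain z where z: "z \<in> K" "\<And>x. x \<in> K \<Longrightarrow> norm x \<le> norm z"
      using continuous_attains_sup[OF \<open>compact K\<close> _ continuous_on_norm_id] by blast
    then have "norm z < r" using assms(3)[of z] by (cases "norm z = r") (auto simp: K_def A_def)
    then show ?thesis using that[of "norm z"] z by (simp add: K_def A_def)
  qed
  show ?thesis
    by (rule eventually_at_leftI[OF _ s(2)]) (use s(1,3) in \<open>force simp: K_def A_def not_less\<close>)
qed

lemma DERIV_max_second:
  fixes g :: "real \<Rightarrow> real"
  assumes "\<And>t. (g has_real_derivative g' t) (at t)" "(g' has_real_derivative D) (at 0)" "\<And>t. g t \<le> g 0"
  shows "g' 0 = 0" "D \<le> 0"
proof -
  show critical: "g' 0 = 0" using DERIV_local_max[OF assms(1)[of 0], of 1] assms(3) by simp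
  show "D \<le> 0"
  proof (rule ccontr)
    assume "\<not> D \<le> 0"
    then obtain d where d: "d > 0" "\<And>h. h > 0 \<Longrightarrow> h < d \<Longrightarrow> g' 0 < g' (0 + h)"
      using DERIV_pos_inc_right[OF assms(2)] by auto
    have "\<exists>z>0. z < d/2 \<and> g (d/2) - g 0 = (d/2 - 0) * g' z" by (rule MVT2) (use d assms(1) in auto)
    then obtain z where z: "0 < z" "z < d/2" "g (d/2) - g 0 = d/2 * g' z" by auto
    have "g' z > 0" using d(2)[of z] z critical by simp
    then have "g (d/2) - g 0 > 0" unfolding z(3) using d by simp
    then show False using assms(3)[of "d/2"] by simp
  qed
qed

lemma sphere_max_lderiv_rot:
  assumes "open U" "smooth_on f U" "\<And>y. norm y = norm x \<Longrightarrow> y \<in> U" "\<And>y. norm y = norm x \<Longrightarrow> f y \<le> f x"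
    and "orthonormal_pair a b"
  shows "lderiv (rot a b) f x = 0" "lderiv (rot a b) (lderiv (rot a b) f) x \<le> 0"
proof -
  have in_U: "rot_flow a b x t \<in> U" for t using assms(3) norm_rot_flow[OF assms(5)] by blast
  have first: "((\<lambda>t. f (rot_flow a b x t)) has_real_derivative lderiv (rot a b) f (rot_flow a b x t)) (at t)"
    for t
    by (rule DERIV_rot_flow[OF assms(5) smooth_differentiable[OF assms(1,2) in_U]])
  have second: "((\<lambda>t. lderiv (rot a b) f (rot_flow a b x t)) has_real_derivative
      lderiv (rot a b) (lderiv (rot a b) f) (rot_flow a b x 0)) (at 0)"
    by (rule DERIV_rot_flow[OF assms(5)
      smooth_differentiable[OF assms(1) smooth_lderiv[OF assms(1) linear_rot assms(2)] in_U]])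
  have "f (rot_flow a b x t) \<le> f (rot_flow a b x 0)" for t using assms(4) norm_rot_flow[OF assms(5)] by simp
  from DERIV_max_second[OF first second this]
  show "lderiv (rot a b) f x = 0" "lderiv (rot a b) (lderiv (rot a b) f) x \<le> 0" by simp_all
qed

lemma sphere_max_sphere_laplace:
  assumes "open U" "smooth_on f U" "\<And>y. norm y = norm x \<Longrightarrow> y \<in> U" "\<And>y. norm y = norm x \<Longrightarrow> f y \<le> f x"
  shows "sphere_laplace f x \<le> 0" "rot_deriv p f x = 0"
proof -
  have x: "x \<in> U" by (rule assms(3)) simp
  have diff: "f differentiable (at x)" "rot_deriv p f differentiable (at x)" for p
    by (intro smooth_differentiable[OF assms(1) _ x] smooth_lderiv assms linear_rot)+
  show "rot_deriv p f x = 0" for p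
    using rot_deriv_diagonal[OF diff(1), of p] sphere_max_lderiv_rot(1)[OF assms orthonormal_pair_axis]
    by (cases "fst p = snd p") auto
  have "rot_deriv p (rot_deriv p f) x \<le> 0" for p
    using rot_deriv_diagonal[OF diff(2), of p p] sphere_max_lderiv_rot(2)[OF assms orthonormal_pair_axis]
    by (cases "fst p = snd p") auto
  then show "sphere_laplace f x \<le> 0"
    unfolding sphere_laplace_eq_rot_derivs[OF assms(1,2) x] by (auto intro!: sum_nonpos)
qed

lemma sphere_min_sphere_laplace:
  assumes "open U" "smooth_on f U" "\<And>y. norm y = norm x \<Longrightarrow> y \<in> U" "\<And>y. norm y = norm x \<Longrightarrow> f x \<le> f y"
  shows "sphere_laplace f x \<ge> 0"
proof -
  have "sphere_laplace (\<lambda>y. -1 * f y) x \<le> 0"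
    by (rule sphere_max_sphere_laplace(1)[OF assms(1) _ assms(3)])
      (use assms(4) in \<open>auto intro!: smooth_minus assms(1,2)\<close>)
  then show ?thesis using sphere_laplace_cmult[OF assms(1,2), of x "-1"] assms(3) by simp
qed

lemma constant_on_sphere:
  fixes f :: "real^'n::finite \<Rightarrow> real"
  assumes "CARD('n) \<ge> 2" "open U" "smooth_on f U" "x \<noteq> 0" "\<And>y. norm y = norm x \<Longrightarrow> y \<in> U"
    and "\<And>a b z. orthonormal_pair a b \<Longrightarrow> norm z = norm x \<Longrightarrow> lderiv (rot a b) f z = 0"
  shows "norm y = norm x \<Longrightarrow> f y = f x" "sphere_laplace f x = 0"
proof -
  have const: "f y = f x" if "norm y = norm x" for y
  proof -
    have "\<bar>f y - f x\<bar> \<le> pi * 0"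
    proof (rule sphere_oscillation_bound[OF _ that assms(4)])
      show "f differentiable (at z)" if "norm z = norm x" for z
        by (rule smooth_differentiable[OF assms(2,3) assms(5)[OF that]])
    qed (use assms(1,6) in auto)
    then show ?thesis by simp
  qed
  then show "norm y = norm x \<Longrightarrow> f y = f x" .
  have "sphere_laplace f x \<le> 0"
    by (rule sphere_max_sphere_laplace(1)[OF assms(2,3)]) (erule assms(5), erule eq_refl[OF const])
  moreover have "sphere_laplace f x \<ge> 0"
    by (rule sphere_min_sphere_laplace[OF assms(2,3)]) (erule assms(5), erule eq_refl[OF const[symmetric]])
  ultimately show "sphere_laplace f x = 0" by simp
qed

lemma constant_on_ray:
  assumes "s \<ge> 1" "\<And>y. norm x \<le> norm y \<Longrightarrow> norm y \<le> s * norm x \<Longrightarrow> f differentiable (at y)"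
    and "\<And>y. norm x \<le> norm y \<Longrightarrow> norm y \<le> s * norm x \<Longrightarrow> lderiv id f y = 0"
  shows "f (s *\<^sub>R x) = f x"
proof -
  have "\<bar>f (s *\<^sub>R x) - f (1 *\<^sub>R x)\<bar> \<le> 0 / 1 * 1 powr (- 1)"
  proof (rule abs_diff_le_powr[OF _ assms(1)])
    fix z :: real assume z: "1 \<le> z" "z \<le> s"
    have range: "norm x \<le> norm (z *\<^sub>R x)" "norm (z *\<^sub>R x) \<le> s * norm x"
      using z mult_right_mono[of 1 z "norm x"] mult_right_mono[of z s "norm x"] by auto
    show "((\<lambda>z. f (z *\<^sub>R x)) has_real_derivative lderiv id f (z *\<^sub>R x) / z) (at z)"
      by (rule DERIV_along_ray[OF assms(2)[OF range]]) (use z in auto)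
    show "\<bar>lderiv id f (z *\<^sub>R x) / z\<bar> \<le> 0 * z powr (- 1 - 1)" using assms(3)[OF range] by simp
  qed simp_all
  then show ?thesis by simp
qed

lemma radial_constant:
  fixes f :: "'a::real_normed_vector \<Rightarrow> real"
  assumes "0 \<le> r0" "\<And>x. r0 < norm x \<Longrightarrow> f differentiable (at x)" "\<And>x. r0 < norm x \<Longrightarrow> lderiv id f x = 0"
    and "\<And>x y. r0 < norm x \<Longrightarrow> norm y = norm x \<Longrightarrow> f y = f x" "r0 < norm x" "r0 < norm y"
  shows "f y = f x"
proof -
  have outward: "f y = f x" if xy: "r0 < norm x" "norm x \<le> norm y" for x y
  proof -
    define s where "s = norm y / norm x"
    have pos: "norm x > 0" using xy assms(1) by linarith
    have s: "s \<ge> 1" "norm y = norm (s *\<^sub>R x)" using xy pos by (auto simp: s_def le_divide_eq)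
    have "f (s *\<^sub>R x) = f x" by (rule constant_on_ray[OF s(1)]) (use assms(2,3) xy in auto)
    moreover have "f y = f (s *\<^sub>R x)" by (rule assms(4)[OF _ s(2)]) (use s(2) xy in linarith)
    ultimately show ?thesis by simp
  qed
  show ?thesis using outward[of x y] outward[of y x] assms(5,6) by (cases "norm x \<le> norm y") auto
qed

lemma annulus_max_lderiv_id:
  fixes f :: "'a::real_normed_vector \<Rightarrow> real"
  assumes "f differentiable (at z)" "z \<noteq> 0" "r1 \<le> norm z" "norm z \<le> r2"
    and max: "\<And>x. r1 \<le> norm x \<Longrightarrow> norm x \<le> r2 \<Longrightarrow> f x \<le> f z"
  shows "r1 < norm z \<Longrightarrow> lderiv id f z \<ge> 0" "norm z < r2 \<Longrightarrow> lderiv id f z \<le> 0"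
proof -
  have ray: "((\<lambda>t. f (t *\<^sub>R z)) has_real_derivative lderiv id f z) (at 1)"
    using DERIV_along_ray[of f 1 z] assms(1) by simp
  have pos: "norm z > 0" using assms(2) by simp
  show "lderiv id f z \<ge> 0" if inner: "r1 < norm z"
  proof (rule ccontr)
    assume "\<not> lderiv id f z \<ge> 0"
    then obtain d where d: "d > 0" "\<And>h. 0 < h \<Longrightarrow> h < d \<Longrightarrow> f z < f ((1 - h) *\<^sub>R z)"
      using DERIV_neg_dec_left[OF ray] by auto
    define h where "h = min (d / 2) (min 1 (1 - r1 / norm z))"
    have h: "0 < h" "h < d" "h \<le> 1" "h \<le> 1 - r1 / norm z" using d(1) inner pos by (auto simp: h_def)
    have "norm ((1 - h) *\<^sub>R z) = norm z - h * norm z" using h by (simp add: left_diff_distrib)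
    moreover have "h * norm z \<le> norm z - r1" "0 \<le> h * norm z" using h pos by (simp_all add: field_simps)
    ultimately have "r1 \<le> norm ((1 - h) *\<^sub>R z)" "norm ((1 - h) *\<^sub>R z) \<le> r2" using assms(4) by linarith+
    then show False using max d(2)[OF h(1,2)] by (meson not_less)
  qed
  show "lderiv id f z \<le> 0" if outer: "norm z < r2"
  proof (rule ccontr)
    assume "\<not> lderiv id f z \<le> 0"
    then obtain d where d: "d > 0" "\<And>h. 0 < h \<Longrightarrow> h < d \<Longrightarrow> f z < f ((1 + h) *\<^sub>R z)"
      using DERIV_pos_inc_right[OF ray] by auto
    define h where "h = min (d / 2) (r2 / norm z - 1)"
    have h: "0 < h" "h < d" "h \<le> r2 / norm z - 1" using d(1) outer pos by (auto simp: h_def)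
    have "norm ((1 + h) *\<^sub>R z) = norm z + h * norm z" using h by (simp add: distrib_right)
    moreover have "h * norm z \<le> r2 - norm z" "0 \<le> h * norm z" using h pos by (simp_all add: field_simps)
    ultimately have "r1 \<le> norm ((1 + h) *\<^sub>R z)" "norm ((1 + h) *\<^sub>R z) \<le> r2" using assms(3) by linarith+
    then show False using max d(2)[OF h(1,2)] by (meson not_less)
  qed
qed

text \<open>Both principles perturb \<open>H\<close> by a small multiple of \<open>ln |x|\<close> to make the inequality for its radial derivative
  strict.\<close>

lemma differentiable_log_perturbation:
  fixes H :: "'a::real_inner \<Rightarrow> real"
  assumes "H differentiable (at x)" "x \<noteq> 0"
  shows "(\<lambda>y. H y + c * (ln (norm y) - k)) differentiable (at x)"
    "lderiv id (\<lambda>y. H y + c * (ln (norm y) - k)) x = lderiv id H x + c"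
proof -
  have "((\<lambda>r. c * (ln r - k)) has_real_derivative c * (1 / norm x)) (at (norm x))"
    using assms(2) by (auto intro!: derivative_eq_intros simp: field_simps)
  note log = lderiv_id_of_norm[OF assms(2) this]
  show "(\<lambda>y. H y + c * (ln (norm y) - k)) differentiable (at x)"
    by (rule differentiable_add[OF assms(1) log(1)])
  show "lderiv id (\<lambda>y. H y + c * (ln (norm y) - k)) x = lderiv id H x + c"
    using lderiv_arith(1)[OF assms(1) log(1), of id] log(2) assms(2) by simp
qed

lemma exterior_max_principle:
  fixes H :: "'a::euclidean_space \<Rightarrow> real"
  assumes "r1 > 0" "\<And>x. norm x = r1 \<Longrightarrow> H x \<le> K" "\<And>x. norm x \<ge> r1 \<Longrightarrow> H differentiable (at x)"
    and nonincreasing: "\<And>x. norm x > r1 \<Longrightarrow> (\<And>y. norm y = norm x \<Longrightarrow> H y \<le> H x) \<Longrightarrow> lderiv id H x \<le> 0"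
    and "norm y \<ge> r1"
  shows "H y \<le> K"
proof (rule ccontr)
  assume "\<not> H y \<le> K"
  then have y: "norm y > r1" "H y > K" using assms(2)[of y] assms(5) by (cases "norm y = r1", auto)
  define L where "L = ln (norm y) - ln r1"
  have L: "L > 0" using y assms(1) ln_less_cancel_iff[of r1 "norm y"] unfolding L_def by linarith
  define \<epsilon> where "\<epsilon> = (H y - K) / (2 * L)"
  have \<epsilon>: "\<epsilon> > 0" "H y - \<epsilon> * L > K" using y(2) L by (simp_all add: \<epsilon>_def field_simps)
  define F where "F x = H x + (- \<epsilon>) * (ln (norm x) - ln r1)" for x
  have F: "F differentiable (at x)" "lderiv id F x = lderiv id H x - \<epsilon>" if "norm x \<ge> r1" for x
  proof -
    have "x \<noteq> 0" using that assms(1) by auto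
    from differentiable_log_perturbation[OF assms(3)[OF that] this, of "- \<epsilon>" "ln r1"]
    show "F differentiable (at x)" "lderiv id F x = lderiv id H x - \<epsilon>" by (simp_all add: F_def[abs_def])
  qed
  have "continuous_on {x. r1 \<le> norm x \<and> norm x \<le> norm y} F"
    using F(1) by (intro differentiable_imp_continuous_on)
      (auto simp: differentiable_on_def intro: differentiable_at_withinI)
  then obtain z where z: "r1 \<le> norm z" "norm z \<le> norm y" "\<And>x. r1 \<le> norm x \<Longrightarrow> norm x \<le> norm y \<Longrightarrow> F x \<le> F z"
    using annulus_attains_sup[of r1 "norm y" F y] assms(5) by auto
  have "F z > K" using z(3)[of y] assms(5) \<epsilon>(2) by (simp add: F_def L_def)
  then have "norm z > r1" using z(1) assms(2)[of z] by (cases "norm z = r1") (auto simp: F_def)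
  moreover have "H x \<le> H z" if "norm x = norm z" for x using z(3)[of x] z(1,2) that by (simp add: F_def)
  ultimately have "lderiv id H z \<le> 0" by (rule nonincreasing)
  moreover have "lderiv id F z \<ge> 0"
    by (rule annulus_max_lderiv_id(1)[OF F(1)[OF z(1)] _ z]) (use z(1) \<open>norm z > r1\<close> assms(1) in auto)
  ultimately show False using F(2)[OF z(1)] \<epsilon>(1) by simp
qed

lemma inner_sphere_max_le:
  fixes H :: "'a::euclidean_space \<Rightarrow> real"
  assumes "0 < r1" "r1 < r2" "\<And>x. norm x \<ge> r1 \<Longrightarrow> H differentiable (at x)"
    and nondecreasing: "\<And>x. norm x \<ge> r1 \<Longrightarrow> (\<And>y. norm y = norm x \<Longrightarrow> H y \<le> H x) \<Longrightarrow> lderiv id H x \<ge> 0"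
    and "norm y = r1" "\<And>x. norm x = r2 \<Longrightarrow> H x \<le> K"
  shows "H y \<le> K"
proof (rule ccontr)
  assume "\<not> H y \<le> K"
  then have y: "H y > K" by simp
  define L where "L = ln r1 - ln r2"
  have L: "L < 0" using assms(1,2) by (simp add: L_def)
  define \<epsilon> where "\<epsilon> = (K - H y) / (2 * L)"
  have \<epsilon>: "\<epsilon> > 0" "H y + \<epsilon> * L > K" using y L by (simp add: \<epsilon>_def divide_neg_neg, simp add: \<epsilon>_def field_simps)
  define F where "F x = H x + \<epsilon> * (ln (norm x) - ln r2)" for x
  have F: "F differentiable (at x)" "lderiv id F x = lderiv id H x + \<epsilon>" if "norm x \<ge> r1" for x
  proof -
    have "x \<noteq> 0" using that assms(1) by auto
    from differentiable_log_perturbation[OF assms(3)[OF that] this, of \<epsilon> "ln r2"]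
    show "F differentiable (at x)" "lderiv id F x = lderiv id H x + \<epsilon>" by (simp_all add: F_def[abs_def])
  qed
  have "continuous_on {x. r1 \<le> norm x \<and> norm x \<le> r2} F"
    using F(1) by (intro differentiable_imp_continuous_on)
      (auto simp: differentiable_on_def intro: differentiable_at_withinI)
  then obtain z where z: "r1 \<le> norm z" "norm z \<le> r2" "\<And>x. r1 \<le> norm x \<Longrightarrow> norm x \<le> r2 \<Longrightarrow> F x \<le> F z"
    using annulus_attains_sup[of r1 r2 F y] assms(2,5) by auto
  have "F z > K" using z(3)[of y] assms(2,5) \<epsilon>(2) by (simp add: F_def L_def)
  then have "norm z < r2" using z(2) assms(6)[of z] by (cases "norm z = r2") (auto simp: F_def)
  then have "lderiv id F z \<le> 0"
    by (intro annulus_max_lderiv_id(2)[OF F(1)[OF z(1)] _ z]) (use z(1) assms(1) in auto)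
  moreover have "H x \<le> H z" if "norm x = norm z" for x using z(3)[of x] z(1,2) that by (simp add: F_def)
  then have "lderiv id H z \<ge> 0" by (rule nondecreasing[OF z(1)])
  ultimately show False using F(2)[OF z(1)] \<epsilon>(1) by simp
qed

section \<open>Curvature of the metric in Cartesian coordinates\<close>

lemma matrix_inv_eqI:
  fixes A B :: "real^'n^'n"
  assumes "A ** B = mat 1" shows "matrix_inv A = B"
proof -
  have BA: "B ** A = mat 1" using assms matrix_left_right_inverse by blast
  have "\<exists>A'. A ** A' = mat 1 \<and> A' ** A = mat 1" using assms BA by blast
  then have "A ** matrix_inv A = mat 1 \<and> matrix_inv A ** A = mat 1"
    unfolding matrix_inv_def by (rule someI_ex)
  then show ?thesis using BA assms by (metis matrix_mul_assoc matrix_mul_lid matrix_mul_rid)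
qed

lemma sum_nth_pd: "f differentiable (at x) \<Longrightarrow> (\<Sum>l\<in>UNIV. x $ l * pd l f x) = lderiv id f x"
  by (simp add: lderiv_def dderiv_eq_sum_pd)

locale quasi_spherical =
  fixes U :: "(real^'n::finite) set" and u :: "real^'n \<Rightarrow> real"
  assumes open_U: "open U" and zero_notin_U: "0 \<notin> U" and smooth_u: "smooth_on u U"
    and u_pos: "\<And>x. x \<in> U \<Longrightarrow> u x > 0"
begin

abbreviation \<Gamma> where "\<Gamma> \<equiv> christoffel (warped_metric u)"
abbreviation Ric where "Ric \<equiv> ricci (warped_metric u)"

definition psi where "psi x = ((u x)\<^sup>2 - 1) / (x \<bullet> x)"
definition omega where "omega x = 1 / (u x)\<^sup>2"
definition chi where "chi x = (1 - omega x) / (x \<bullet> x)"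

definition chr_coeff where
  "chr_coeff i j x = omega x * (pd i psi x * x $ j + pd j psi x * x $ i) / 2 + chi x * kdelta i j
    + chi x * lderiv id psi x * x $ i * x $ j / 2"

definition chr_form where
  "chr_form X Y x = omega x * (dderiv X psi x * (x \<bullet> Y) + dderiv Y psi x * (x \<bullet> X)) / 2 + chi x * (X \<bullet> Y)
    + chi x * lderiv id psi x * (x \<bullet> X) * (x \<bullet> Y) / 2"

lemma inner_self_nonzero: "x \<in> U \<Longrightarrow> x \<bullet> x \<noteq> 0" using zero_notin_U by auto
lemma u_nonzero: "x \<in> U \<Longrightarrow> u x \<noteq> 0" using u_pos by fastforce

lemma omega_pos: "x \<in> U \<Longrightarrow> omega x > 0"
  using u_nonzero by (simp add: omega_def)

lemma smooth_coefficients [smooth_intros]: "smooth_on psi U" "smooth_on omega U" "smooth_on chi U"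
proof -
  show "smooth_on psi U" unfolding psi_def
    by (intro smooth_divide smooth_diff smooth_power smooth_const smooth_inner_self open_U smooth_u
      inner_self_nonzero)
  show "smooth_on omega U" unfolding omega_def
    by (intro smooth_divide smooth_power smooth_const open_U smooth_u) (use u_nonzero in auto)
  then show "smooth_on chi U" unfolding chi_def
    by (intro smooth_divide smooth_diff smooth_const smooth_inner_self open_U inner_self_nonzero)
qed

lemma smooth_chr [smooth_intros]: "smooth_on (chr_coeff i j) U" "smooth_on (chr_form X Y) U"
  unfolding chr_coeff_def chr_form_def divide_inverse
  by (intro smooth_add smooth_mult smooth_const smooth_pd smooth_coefficients smooth_nth open_U smooth_lderiv
    linear_id smooth_dderiv smooth_inner)+

lemmas differentiable_U = smooth_differentiable[OF open_U]

lemma coefficient_identities: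
  assumes "x \<in> U"
  shows "(x \<bullet> x) * psi x = (u x)\<^sup>2 - 1" "omega x * (u x)\<^sup>2 = 1" "omega x + chi x * (x \<bullet> x) = 1"
    "chi x = psi x * omega x"
  using inner_self_nonzero[OF assms] u_nonzero[OF assms] by (auto simp: psi_def omega_def chi_def field_simps)

lemma dderiv_psi:
  assumes "x \<in> U"
  shows "2 * u x * dderiv v u x = 2 * (x \<bullet> v) * psi x + (x \<bullet> x) * dderiv v psi x"
proof -
  have "dderiv v (\<lambda>y. u y * u y) x = dderiv v (\<lambda>y. (y \<bullet> y) * psi y + 1) x"
    by (rule dderiv_cong_open[OF open_U assms]) (simp add: coefficient_identities(1) power2_eq_square)
  then show ?thesis
    by (simp add: dderiv_arith differentiable_U[OF smooth_u assms]
      differentiable_U[OF smooth_coefficients(1) assms] differentiable_U[OF smooth_inner_self assms] open_U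
        differentiable_U[OF smooth_mult[OF open_U smooth_inner_self[OF open_U] smooth_coefficients(1)] assms]
        algebra_simps)
qed

lemma dderiv_dderiv_psi:
  assumes "x \<in> U"
  shows "2 * dderiv v u x * dderiv w u x + 2 * u x * dderiv v (dderiv w u) x
    = 2 * (v \<bullet> w) * psi x + 2 * (x \<bullet> w) * dderiv v psi x + 2 * (x \<bullet> v) * dderiv w psi x
    + (x \<bullet> x) * dderiv v (dderiv w psi) x"
proof -
  have "dderiv v (\<lambda>y. 2 * (u y * dderiv w u y)) x
      = dderiv v (\<lambda>y. 2 * ((y \<bullet> w) * psi y) + (y \<bullet> y) * dderiv w psi y) x"
    by (rule dderiv_cong_open[OF open_U assms]) (use dderiv_psi[of _ w] in \<open>simp add: algebra_simps\<close>)
  moreover have "dderiv v (\<lambda>y. 2 * (u y * dderiv w u y)) x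
      = 2 * dderiv v u x * dderiv w u x + 2 * u x * dderiv v (dderiv w u) x"
    by (subst dderiv_arith dderiv_const |
      (intro differentiable_U[OF _ assms] smooth_mult smooth_const smooth_u smooth_dderiv open_U))+
      (simp add: algebra_simps)
  moreover have "dderiv v (\<lambda>y. 2 * ((y \<bullet> w) * psi y) + (y \<bullet> y) * dderiv w psi y) x
     = 2 * (v \<bullet> w) * psi x + 2 * (x \<bullet> w) * dderiv v psi x + 2 * (x \<bullet> v) * dderiv w psi x
     + (x \<bullet> x) * dderiv v (dderiv w psi) x"
    by (subst dderiv_arith dderiv_const dderiv_inner dderiv_inner_self |
      (intro differentiable_U[OF _ assms] smooth_mult smooth_const smooth_coefficients smooth_dderiv open_U
      smooth_inner smooth_inner_self))+
      (simp add: algebra_simps)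
  ultimately show ?thesis by simp
qed

lemma warped_metric_eq: "x \<in> U \<Longrightarrow> warped_metric u x $ i $ j = kdelta i j + psi x * (x $ i * x $ j)"
  by (simp add: warped_metric_def kdelta_def psi_def power2_norm_eq_inner)

lemma pd_warped_metric:
  assumes "x \<in> U"
  shows "pd k (\<lambda>y. warped_metric u y $ i $ j) x
      = pd k psi x * (x $ i * x $ j) + psi x * (kdelta k i * x $ j + x $ i * kdelta k j)"
proof -
  have "pd k (\<lambda>y. warped_metric u y $ i $ j) x = pd k (\<lambda>y. kdelta i j + psi y * (y $ i * y $ j)) x"
    by (rule pd_cong_open[OF open_U assms]) (rule warped_metric_eq)
  also have "\<dots> = pd k psi x * (x $ i * x $ j) + psi x * (kdelta k i * x $ j + x $ i * kdelta k j)"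
    unfolding pd_eq_dderiv
    by (subst dderiv_arith dderiv_const dderiv_nth |
      (intro differentiable_U[OF _ assms] smooth_mult smooth_const smooth_coefficients smooth_nth open_U))+
      (simp add: axis_nth algebra_simps)
  finally show ?thesis .
qed

lemma ginv_eq:
  assumes "x \<in> U"
  shows "ginv (warped_metric u) x $ k $ l = kdelta k l - chi x * (x $ k * x $ l)"
proof -
  define B where "B = (\<chi> k l. kdelta k l - chi x * (x $ k * x $ l))"
  have "warped_metric u x ** B = mat 1"
  proof -
    have "(\<Sum>l\<in>UNIV. (kdelta i l + psi x * (x $ i * x $ l)) * (kdelta l j - chi x * (x $ l * x $ j)))
        = kdelta i j" for i j
    proof -
      have "(\<Sum>l\<in>UNIV. (kdelta i l + psi x * (x $ i * x $ l)) * (kdelta l j - chi x * (x $ l * x $ j)))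
         = (\<Sum>l\<in>UNIV. kdelta i l * kdelta l j) - (\<Sum>l\<in>UNIV. kdelta i l * (chi x * (x $ l * x $ j)))
           + (\<Sum>l\<in>UNIV. (psi x * (x $ i * x $ l)) * kdelta l j)
           - psi x * chi x * (x $ i * x $ j) * (\<Sum>l\<in>UNIV. x $ l * x $ l)"
        by (simp only: sum_distrib_left flip: sum.distrib sum_subtractf)
          (rule sum.cong, simp_all add: algebra_simps)
      also have "\<dots> = kdelta i j + (x $ i * x $ j) * (psi x - chi x - psi x * chi x * (x \<bullet> x))"
        by (simp only: sum_kdelta inner_eq_sum) (simp add: algebra_simps)
      also have "psi x - chi x - psi x * chi x * (x \<bullet> x) = 0"
      proof -
        have "psi x - chi x - psi x * chi x * (x \<bullet> x) = psi x * (1 - (omega x + chi x * (x \<bullet> x)))"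
          using coefficient_identities(4)[OF assms] by (simp add: algebra_simps)
        then show ?thesis using coefficient_identities(3)[OF assms] by simp
      qed
      finally show ?thesis by simp
    qed
    then show ?thesis
      by (simp add: vec_eq_iff matrix_matrix_mult_def warped_metric_eq[OF assms] B_def mat_def kdelta_def)
  qed
  then have "matrix_inv (warped_metric u x) = B" by (rule matrix_inv_eqI)
  then show ?thesis by (simp add: ginv_def B_def)
qed

lemma christoffel_eq:
  assumes "x \<in> U"
  shows "\<Gamma> k i j x = x $ k * chr_coeff i j x - pd k psi x * (x $ i * x $ j) / 2"
proof -
  define T where "T l = (pd i psi x * (x $ j * x $ l) + pd j psi x * (x $ i * x $ l)
      - pd l psi x * (x $ i * x $ j)) / 2
      + psi x * kdelta i j * x $ l" for l
  have lowered: "(1/2) * (pd i (\<lambda>y. warped_metric u y $ j $ l) x + pd j (\<lambda>y. warped_metric u y $ i $ l) x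
       - pd l (\<lambda>y. warped_metric u y $ i $ j) x) = T l" for l
    by (simp add: pd_warped_metric[OF assms] T_def kdelta_commute[of j i] kdelta_commute[of l i]
      kdelta_commute[of l j] field_simps)
  have "\<Gamma> k i j x = (\<Sum>l\<in>UNIV. (kdelta k l - chi x * (x $ k * x $ l)) * T l)"
    unfolding christoffel_def sum_distrib_left ginv_eq[OF assms]
    by (rule sum.cong, simp, subst lowered[symmetric], simp only: mult_ac)
  also have "\<dots> = (\<Sum>l\<in>UNIV. kdelta k l * T l) - chi x * x $ k * (\<Sum>l\<in>UNIV. x $ l * T l)"
    by (simp only: left_diff_distrib sum_subtractf sum_distrib_left mult.assoc)
  also have "(\<Sum>l\<in>UNIV. x $ l * T l) = (pd i psi x * x $ j + pd j psi x * x $ i) / 2 * (\<Sum>l\<in>UNIV. x $ l * x $ l)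
      - x $ i * x $ j / 2 * (\<Sum>l\<in>UNIV. x $ l * pd l psi x) + psi x * kdelta i j * (\<Sum>l\<in>UNIV. x $ l * x $ l)"
    by (simp only: sum_distrib_left flip: sum.distrib sum_subtractf)
      (rule sum.cong, simp_all add: T_def field_simps)
  also have "\<dots> = (pd i psi x * x $ j + pd j psi x * x $ i) / 2 * (x \<bullet> x)
      - x $ i * x $ j / 2 * lderiv id psi x + psi x * kdelta i j * (x \<bullet> x)"
    by (simp add: sum_nth_pd differentiable_U[OF smooth_coefficients(1) assms] inner_eq_sum)
  finally have expanded: "\<Gamma> k i j x
      = T k - chi x * x $ k * ((pd i psi x * x $ j + pd j psi x * x $ i) / 2 * (x \<bullet> x)
      - x $ i * x $ j / 2 * lderiv id psi x + psi x * kdelta i j * (x \<bullet> x))" by simp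
  have omega_eq: "omega x = 1 - chi x * (x \<bullet> x)" using coefficient_identities(3)[OF assms] by simp
  have chi_eq: "chi x = psi x * (1 - chi x * (x \<bullet> x))"
    using coefficient_identities(4)[OF assms] omega_eq by simp
  have chi_kdelta: "chi x * kdelta i j = psi x * (1 - chi x * (x \<bullet> x)) * kdelta i j" using chi_eq by simp
  have chr_coeff_eq: "chr_coeff i j x
      = (1 - chi x * (x \<bullet> x)) * (pd i psi x * x $ j + pd j psi x * x $ i) / 2
      + psi x * (1 - chi x * (x \<bullet> x)) * kdelta i j
    + chi x * lderiv id psi x * x $ i * x $ j / 2"
    unfolding chr_coeff_def omega_eq chi_kdelta ..
  show ?thesis unfolding expanded T_def chr_coeff_eq by (simp add: field_simps)
qed

lemma trace_christoffel:
  assumes "x \<in> U"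
  shows "(\<Sum>k\<in>UNIV. \<Gamma> k i k x) = pd i u x / u x"
    "(\<Sum>k\<in>UNIV. \<Gamma> k k i x) = pd i u x / u x"
proof -
  have contraction: "(\<Sum>k\<in>UNIV. x $ k * chr_coeff i k x)
      = omega x * (pd i psi x * (x \<bullet> x) + lderiv id psi x * x $ i) / 2 + chi x * x $ i
      + chi x * lderiv id psi x * (x \<bullet> x) * x $ i / 2"
  proof -
    have "(\<Sum>k\<in>UNIV. x $ k * chr_coeff i k x) = omega x * pd i psi x / 2 * (\<Sum>k\<in>UNIV. x $ k * x $ k)
       + omega x * x $ i / 2 * (\<Sum>k\<in>UNIV. x $ k * pd k psi x) + chi x * (\<Sum>k\<in>UNIV. x $ k * kdelta i k)
       + chi x * lderiv id psi x * x $ i / 2 * (\<Sum>k\<in>UNIV. x $ k * x $ k)"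
      by (simp only: sum_distrib_left flip: sum.distrib)
        (rule sum.cong, simp_all add: chr_coeff_def field_simps)
    then show ?thesis
      by (simp add: sum_nth_pd differentiable_U[OF smooth_coefficients(1) assms] inner_eq_sum algebra_simps)
  qed
  have "(\<Sum>k\<in>UNIV. \<Gamma> k i k x) = (\<Sum>k\<in>UNIV. x $ k * chr_coeff i k x) - x $ i / 2 * (\<Sum>k\<in>UNIV. x $ k * pd k psi x)"
    by (simp only: sum_distrib_left christoffel_eq[OF assms] flip: sum_subtractf)
      (rule sum.cong, simp_all add: field_simps)
  also have "\<dots> = chi x * x $ i + omega x * pd i psi x * (x \<bullet> x) / 2
      + x $ i * lderiv id psi x / 2 * (omega x + chi x * (x \<bullet> x) - 1)"
    by (simp add: contraction sum_nth_pd differentiable_U[OF smooth_coefficients(1) assms] field_simps)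
  also have "\<dots> = omega x * (2 * (x $ i) * psi x + (x \<bullet> x) * pd i psi x) / 2"
    by (simp add: coefficient_identities(3)[OF assms])
      (simp add: coefficient_identities(4)[OF assms] field_simps)
  also have "\<dots> = omega x * (u x * pd i u x)"
    using dderiv_psi[OF assms, of "axis i 1"] by (simp add: pd_eq_dderiv inner_axis)
  also have "\<dots> = pd i u x / u x"
    using u_nonzero[OF assms] by (simp add: omega_def field_simps power2_eq_square)
  finally show trace: "(\<Sum>k\<in>UNIV. \<Gamma> k i k x) = pd i u x / u x" .
  have "\<Gamma> k k i x = \<Gamma> k i k x" for k
    by (simp add: christoffel_eq[OF assms] chr_coeff_def kdelta_commute[of k i] algebra_simps)
  then show "(\<Sum>k\<in>UNIV. \<Gamma> k k i x) = pd i u x / u x" using trace by simp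
qed

lemma sum_chr_coeff:
  assumes "x \<in> U"
  shows "(\<Sum>i\<in>UNIV. \<Sum>j\<in>UNIV. X $ i * Y $ j * chr_coeff i j x) = chr_form X Y x"
    "(\<Sum>j\<in>UNIV. Y $ j * chr_coeff i j x) = chr_form (axis i 1) Y x"
proof -
  show axis_form: "(\<Sum>j\<in>UNIV. Y $ j * chr_coeff i j x) = chr_form (axis i 1) Y x" for i
  proof -
    have "(\<Sum>j\<in>UNIV. Y $ j * chr_coeff i j x) = omega x * pd i psi x / 2 * (\<Sum>k\<in>UNIV. x $ k * Y $ k)
       + omega x * x $ i / 2 * (\<Sum>k\<in>UNIV. Y $ k * pd k psi x) + chi x * (\<Sum>k\<in>UNIV. Y $ k * kdelta i k)
       + chi x * lderiv id psi x * x $ i / 2 * (\<Sum>k\<in>UNIV. x $ k * Y $ k)"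
      by (simp only: sum_distrib_left flip: sum.distrib)
        (rule sum.cong, simp_all add: chr_coeff_def field_simps)
    then show ?thesis
      unfolding chr_form_def dderiv_eq_sum_pd[OF differentiable_U[OF smooth_coefficients(1) assms], of Y]
      by (simp add: inner_eq_sum inner_axis axis_nth pd_eq_dderiv algebra_simps)
  qed
  have "(\<Sum>i\<in>UNIV. \<Sum>j\<in>UNIV. X $ i * Y $ j * chr_coeff i j x) = (\<Sum>i\<in>UNIV. X $ i * chr_form (axis i 1) Y x)"
    by (simp add: axis_form[symmetric] sum_distrib_left mult_ac)
  also have "\<dots> = omega x * (x \<bullet> Y) / 2 * (\<Sum>i\<in>UNIV. X $ i * pd i psi x)
      + omega x * dderiv Y psi x / 2 * (\<Sum>i\<in>UNIV. x $ i * X $ i)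
      + chi x * (\<Sum>i\<in>UNIV. X $ i * Y $ i) + chi x * lderiv id psi x * (x \<bullet> Y) / 2 * (\<Sum>i\<in>UNIV. x $ i * X $ i)"
    by (simp only: sum_distrib_left flip: sum.distrib)
      (rule sum.cong, simp_all add: chr_form_def inner_axis inner_axis' pd_eq_dderiv field_simps)
  also have "\<dots> = chr_form X Y x"
    unfolding chr_form_def dderiv_eq_sum_pd[OF differentiable_U[OF smooth_coefficients(1) assms], of X]
    by (simp add: inner_eq_sum field_simps)
  finally show "(\<Sum>i\<in>UNIV. \<Sum>j\<in>UNIV. X $ i * Y $ j * chr_coeff i j x) = chr_form X Y x" .
qed

lemma pd_christoffel:
  assumes "x \<in> U"
  shows "pd l (\<Gamma> k i j) x = kdelta l k * chr_coeff i j x + x $ k * pd l (chr_coeff i j) x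
     - (pd l (pd k psi) x * (x $ i * x $ j) + pd k psi x * (kdelta l i * x $ j + x $ i * kdelta l j)) / 2"
proof -
  have "pd l (\<Gamma> k i j) x = pd l (\<lambda>y. y $ k * chr_coeff i j y - (1/2) * (pd k psi y * (y $ i * y $ j))) x"
    by (rule pd_cong_open[OF open_U assms]) (simp add: christoffel_eq)
  also have "\<dots> = kdelta l k * chr_coeff i j x + x $ k * pd l (chr_coeff i j) x
     - (pd l (pd k psi) x * (x $ i * x $ j) + pd k psi x * (kdelta l i * x $ j + x $ i * kdelta l j)) / 2"
    unfolding pd_eq_dderiv[of l]
    by (subst dderiv_arith dderiv_const dderiv_nth |
      (intro differentiable_U[OF _ assms] smooth_mult smooth_const smooth_coefficients smooth_chr smooth_nth
      open_U smooth_pd))+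
      (simp add: axis_nth field_simps)
  finally show ?thesis .
qed

lemma smooth_christoffel: "smooth_on (\<Gamma> k i j) U"
  by (subst smooth_on_cong[OF open_U, where g="\<lambda>y. y $ k * chr_coeff i j y
      - (1/2) * (pd k psi y * (y $ i * y $ j))"])
    (simp add: christoffel_eq, intro smooth_diff smooth_mult smooth_const smooth_coefficients smooth_chr
    smooth_nth open_U smooth_pd)

lemma sum_pd_christoffel:
  assumes "x \<in> U"
  shows "(\<Sum>k\<in>UNIV. pd k (\<Gamma> k i j) x) = real CARD('n) * chr_coeff i j x + lderiv id (chr_coeff i j) x
    - laplace psi x * (x $ i * x $ j) / 2 - (pd i psi x * x $ j + pd j psi x * x $ i) / 2"
proof -
  have "(\<Sum>k\<in>UNIV. pd k (\<Gamma> k i j) x)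
      = (\<Sum>k\<in>(UNIV::'n set). chr_coeff i j x) + (\<Sum>k\<in>UNIV. x $ k * pd k (chr_coeff i j) x)
     - x $ i * x $ j / 2 * (\<Sum>k\<in>UNIV. pd k (pd k psi) x)
     - x $ j / 2 * (\<Sum>k\<in>UNIV. pd k psi x * kdelta k i) - x $ i / 2 * (\<Sum>k\<in>UNIV. pd k psi x * kdelta k j)"
    by (simp only: pd_christoffel[OF assms] sum_distrib_left flip: sum.distrib sum_subtractf)
      (rule sum.cong, simp_all add: field_simps)
  then show ?thesis
    by (simp only: sum_kdelta sum_nth_pd[OF differentiable_U[OF smooth_chr(1) assms]] laplace_def)
      (simp add: field_simps)
qed

lemma sum_pd_trace_christoffel:
  assumes "x \<in> U"
  shows "(\<Sum>k\<in>UNIV. pd j (\<Gamma> k i k) x) = pd j (\<lambda>y. pd i u y / u y) x"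
proof -
  have "pd j (\<lambda>y. pd i u y / u y) x = pd j (\<lambda>y. \<Sum>k\<in>UNIV. \<Gamma> k i k y) x"
    by (rule pd_cong_open[OF open_U assms]) (simp add: trace_christoffel)
  also have "\<dots> = (\<Sum>k\<in>UNIV. pd j (\<Gamma> k i k) x)"
    unfolding pd_eq_dderiv by (rule dderiv_sum) (rule differentiable_U[OF smooth_christoffel assms])
  finally show ?thesis by simp
qed

lemma sum_trace_christoffel_mult:
  assumes "x \<in> U"
  shows "(\<Sum>k\<in>UNIV. \<Sum>l\<in>UNIV. \<Gamma> k k l x * \<Gamma> l i j x)
     = (lderiv id u x / u x) * chr_coeff i j x - dderiv (grad u x) psi x / u x * (x $ i * x $ j) / 2"
proof -
  have "(\<Sum>k\<in>UNIV. \<Sum>l\<in>UNIV. \<Gamma> k k l x * \<Gamma> l i j x) = (\<Sum>l\<in>UNIV. (\<Sum>k\<in>UNIV. \<Gamma> k k l x) * \<Gamma> l i j x)"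
    by (subst sum.swap) (simp add: sum_distrib_right)
  also have "\<dots> = chr_coeff i j x / u x * (\<Sum>l\<in>UNIV. x $ l * pd l u x)
      - x $ i * x $ j / (2 * u x) * (\<Sum>l\<in>UNIV. pd l u x * pd l psi x)"
    unfolding trace_christoffel[OF assms]
    using u_nonzero[OF assms] by (simp only: christoffel_eq[OF assms] sum_distrib_left flip: sum_subtractf)
      (rule sum.cong, simp_all add: field_simps)
  also have "(\<Sum>l\<in>UNIV. pd l u x * pd l psi x) = dderiv (grad u x) psi x"
    by (simp add: dderiv_eq_sum_pd[OF differentiable_U[OF smooth_coefficients(1) assms]] grad_def)
  finally show ?thesis by (simp add: sum_nth_pd differentiable_U[OF smooth_u assms] field_simps)
qed

lemma sum_christoffel_mult:
  assumes "x \<in> U"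
  shows "(\<Sum>k\<in>UNIV. \<Sum>l\<in>UNIV. \<Gamma> k j l x * \<Gamma> l i k x)
     = chr_form (axis i 1) x x * chr_form (axis j 1) x x
     - (x \<bullet> x) * (x $ i * chr_form (axis j 1) (grad psi x) x + x $ j * chr_form (axis i 1) (grad psi x) x) / 2
     + (lderiv id psi x)\<^sup>2 * (x $ i * x $ j) / 4"
proof -
  have "(\<Sum>k\<in>UNIV. \<Sum>l\<in>UNIV. \<Gamma> k j l x * \<Gamma> l i k x)
   = (\<Sum>k\<in>UNIV. \<Sum>l\<in>UNIV. (x $ k * chr_coeff i k x) * (x $ l * chr_coeff j l x)
       - (x $ i / 2) * ((x $ k * x $ k) * (grad psi x $ l * chr_coeff j l x))
       - (x $ j / 2) * ((grad psi x $ k * chr_coeff i k x) * (x $ l * x $ l))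
       + (x $ i * x $ j / 4) * ((x $ k * pd k psi x) * (x $ l * pd l psi x)))"
    by (intro sum.cong refl) (simp add: christoffel_eq[OF assms] grad_def field_simps)
  also have "\<dots> = (\<Sum>k\<in>UNIV. x $ k * chr_coeff i k x) * (\<Sum>l\<in>UNIV. x $ l * chr_coeff j l x)
       - x $ i / 2 * ((\<Sum>k\<in>UNIV. x $ k * x $ k) * (\<Sum>l\<in>UNIV. grad psi x $ l * chr_coeff j l x))
       - x $ j / 2 * ((\<Sum>k\<in>UNIV. grad psi x $ k * chr_coeff i k x) * (\<Sum>l\<in>UNIV. x $ l * x $ l))
       + x $ i * x $ j / 4 * ((\<Sum>k\<in>UNIV. x $ k * pd k psi x) * (\<Sum>l\<in>UNIV. x $ l * pd l psi x))"
    by (simp only: sum.distrib sum_subtractf sum_product) (simp only: sum_distrib_left)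
  also have "\<dots> = chr_form (axis i 1) x x * chr_form (axis j 1) x x
      - x $ i / 2 * ((x \<bullet> x) * chr_form (axis j 1) (grad psi x) x)
       - x $ j / 2 * (chr_form (axis i 1) (grad psi x) x * (x \<bullet> x))
       + x $ i * x $ j / 4 * (lderiv id psi x * lderiv id psi x)"
    by (simp only: sum_chr_coeff(2)[OF assms] sum_nth_pd[OF differentiable_U[OF smooth_coefficients(1) assms]]
      inner_eq_sum)
  finally show ?thesis by (simp add: field_simps power2_eq_square)
qed

lemma ricci_eq:
  assumes "x \<in> U"
  shows "Ric i j x =
     real CARD('n) * chr_coeff i j x + lderiv id (chr_coeff i j) x - laplace psi x * (x $ i * x $ j) / 2
     - (pd i psi x * x $ j + pd j psi x * x $ i) / 2 - pd j (\<lambda>y. pd i u y / u y) x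
     + (lderiv id u x / u x) * chr_coeff i j x - dderiv (grad u x) psi x / u x * (x $ i * x $ j) / 2
     - chr_form (axis i 1) x x * chr_form (axis j 1) x x
     + (x \<bullet> x) * (x $ i * chr_form (axis j 1) (grad psi x) x + x $ j * chr_form (axis i 1) (grad psi x) x) / 2
     - (lderiv id psi x)\<^sup>2 * (x $ i * x $ j) / 4"
proof -
  have "Ric i j x = (\<Sum>k\<in>UNIV. pd k (\<Gamma> k i j) x) - (\<Sum>k\<in>UNIV. pd j (\<Gamma> k i k) x)
      + (\<Sum>k\<in>UNIV. \<Sum>l\<in>UNIV. \<Gamma> k k l x * \<Gamma> l i j x) - (\<Sum>k\<in>UNIV. \<Sum>l\<in>UNIV. \<Gamma> k j l x * \<Gamma> l i k x)"
    by (simp add: ricci_def sum.distrib sum_subtractf)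
  then show ?thesis
    unfolding sum_pd_christoffel[OF assms] sum_pd_trace_christoffel[OF assms]
      sum_trace_christoffel_mult[OF assms]
      sum_christoffel_mult[OF assms]
    by (simp add: algebra_simps)
qed

lemma sum_lderiv_id_chr_coeff:
  assumes "x \<in> U"
  shows "(\<Sum>i\<in>UNIV. \<Sum>j\<in>UNIV. X $ i * Y $ j * lderiv id (chr_coeff i j) x) = dderiv x (chr_form X Y) x"
proof -
  have "dderiv x (chr_form X Y) x = dderiv x (\<lambda>y. \<Sum>i\<in>UNIV. \<Sum>j\<in>UNIV. (X $ i * Y $ j) * chr_coeff i j y) x"
    by (rule dderiv_cong_open[OF open_U assms]) (simp add: sum_chr_coeff)
  also have "\<dots> = (\<Sum>i\<in>UNIV. \<Sum>j\<in>UNIV. dderiv x (\<lambda>y. (X $ i * Y $ j) * chr_coeff i j y) x)"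
    by (subst dderiv_sum |
      (intro differentiable_U[OF _ assms] smooth_sum smooth_mult smooth_const smooth_chr open_U))+ simp
  also have "\<dots> = (\<Sum>i\<in>UNIV. \<Sum>j\<in>UNIV. X $ i * Y $ j * lderiv id (chr_coeff i j) x)"
    by (intro sum.cong refl, subst dderiv_arith)
      (auto intro!: differentiable_U[OF _ assms] smooth_const smooth_chr open_U simp: lderiv_def)
  finally show ?thesis by simp
qed

lemma sum_pd_pd_log_u:
  assumes "x \<in> U"
  shows "(\<Sum>i\<in>UNIV. \<Sum>j\<in>UNIV. X $ i * Y $ j * pd j (\<lambda>y. pd i u y / u y) x)
      = dderiv Y (\<lambda>y. dderiv X u y / u y) x"
proof -
  have smooth: "smooth_on (\<lambda>y. pd i u y / u y) U" for i
    by (intro smooth_divide open_U smooth_pd smooth_u u_nonzero)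
  have "dderiv Y (\<lambda>y. dderiv X u y / u y) x = dderiv Y (\<lambda>y. \<Sum>i\<in>UNIV. X $ i * (pd i u y / u y)) x"
    by (rule dderiv_cong_open[OF open_U assms])
      (simp add: dderiv_eq_sum_pd differentiable_U[OF smooth_u] sum_divide_distrib)
  also have "\<dots> = (\<Sum>i\<in>UNIV. dderiv Y (\<lambda>y. X $ i * (pd i u y / u y)) x)"
    by (intro dderiv_sum differentiable_U[OF _ assms] smooth_mult smooth_const smooth open_U)
  also have "\<dots> = (\<Sum>i\<in>UNIV. X $ i * dderiv Y (\<lambda>y. pd i u y / u y) x)"
    by (intro sum.cong refl, subst dderiv_arith)
      (auto intro!: differentiable_U[OF _ assms] smooth_const smooth open_U)
  also have "\<dots> = (\<Sum>i\<in>UNIV. \<Sum>j\<in>UNIV. X $ i * Y $ j * pd j (\<lambda>y. pd i u y / u y) x)"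
    by (intro sum.cong refl, subst dderiv_eq_sum_pd[OF differentiable_U[OF smooth assms]])
      (simp add: sum_distrib_left mult_ac)
  finally show ?thesis by simp
qed

lemma sum_chr_form_axis:
  assumes "x \<in> U"
  shows "(\<Sum>i\<in>UNIV. X $ i * chr_form (axis i 1) Y x) = chr_form X Y x"
proof -
  have "(\<Sum>i\<in>UNIV. X $ i * chr_form (axis i 1) Y x) = (\<Sum>i\<in>UNIV. \<Sum>j\<in>UNIV. X $ i * Y $ j * chr_coeff i j x)"
    by (simp add: sum_chr_coeff(2)[OF assms, symmetric] sum_distrib_left mult_ac)
  then show ?thesis using sum_chr_coeff(1)[OF assms] by simp
qed

definition ricci_form where
  "ricci_form X Y x = (\<Sum>i\<in>UNIV. \<Sum>j\<in>UNIV. X $ i * Y $ j * Ric i j x)"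

lemma ricci_form_eq:
  assumes "x \<in> U"
  shows "ricci_form X Y x
      = real CARD('n) * chr_form X Y x + dderiv x (chr_form X Y) x - laplace psi x * ((x \<bullet> X) * (x \<bullet> Y)) / 2
     - (dderiv X psi x * (x \<bullet> Y) + dderiv Y psi x * (x \<bullet> X)) / 2 - dderiv Y (\<lambda>y. dderiv X u y / u y) x
     + (lderiv id u x / u x) * chr_form X Y x - dderiv (grad u x) psi x / u x * ((x \<bullet> X) * (x \<bullet> Y)) / 2
     - chr_form X x x * chr_form Y x x
     + (x \<bullet> x) * ((x \<bullet> X) * chr_form Y (grad psi x) x + (x \<bullet> Y) * chr_form X (grad psi x) x) / 2
     - (lderiv id psi x)\<^sup>2 * ((x \<bullet> X) * (x \<bullet> Y)) / 4"
proof -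
  have inner: "x \<bullet> X = (\<Sum>i\<in>UNIV. X $ i * x $ i)" for X by (simp add: inner_eq_sum mult.commute)
  have "ricci_form X Y x = real CARD('n) * (\<Sum>i\<in>UNIV. \<Sum>j\<in>UNIV. X $ i * Y $ j * chr_coeff i j x)
     + (\<Sum>i\<in>UNIV. \<Sum>j\<in>UNIV. X $ i * Y $ j * lderiv id (chr_coeff i j) x)
     - laplace psi x / 2 * ((\<Sum>i\<in>UNIV. X $ i * x $ i) * (\<Sum>j\<in>UNIV. Y $ j * x $ j))
     - 1 / 2 * ((\<Sum>i\<in>UNIV. X $ i * pd i psi x) * (\<Sum>j\<in>UNIV. Y $ j * x $ j))
     - 1 / 2 * ((\<Sum>i\<in>UNIV. X $ i * x $ i) * (\<Sum>j\<in>UNIV. Y $ j * pd j psi x))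
     - (\<Sum>i\<in>UNIV. \<Sum>j\<in>UNIV. X $ i * Y $ j * pd j (\<lambda>y. pd i u y / u y) x)
     + (lderiv id u x / u x) * (\<Sum>i\<in>UNIV. \<Sum>j\<in>UNIV. X $ i * Y $ j * chr_coeff i j x)
     - dderiv (grad u x) psi x / u x / 2 * ((\<Sum>i\<in>UNIV. X $ i * x $ i) * (\<Sum>j\<in>UNIV. Y $ j * x $ j))
     - (\<Sum>i\<in>UNIV. X $ i * chr_form (axis i 1) x x) * (\<Sum>j\<in>UNIV. Y $ j * chr_form (axis j 1) x x)
     + (x \<bullet> x) / 2 * ((\<Sum>i\<in>UNIV. X $ i * x $ i) * (\<Sum>j\<in>UNIV. Y $ j * chr_form (axis j 1) (grad psi x) x))
     + (x \<bullet> x) / 2 * ((\<Sum>i\<in>UNIV. X $ i * chr_form (axis i 1) (grad psi x) x) * (\<Sum>j\<in>UNIV. Y $ j * x $ j))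
     - (lderiv id psi x)\<^sup>2 / 4 * ((\<Sum>i\<in>UNIV. X $ i * x $ i) * (\<Sum>j\<in>UNIV. Y $ j * x $ j))"
    unfolding sum_product unfolding sum_distrib_left unfolding ricci_form_def ricci_eq[OF assms]
    unfolding sum.distrib[symmetric] sum_subtractf[symmetric]
    using u_nonzero[OF assms] by (intro sum.cong refl) (simp add: field_simps)
  then show ?thesis
    unfolding sum_lderiv_id_chr_coeff[OF assms] sum_pd_pd_log_u[OF assms] sum_chr_coeff(1)[OF assms]
      sum_chr_form_axis[OF assms] inner[symmetric]
    by (simp add: dderiv_eq_sum_pd[OF differentiable_U[OF smooth_coefficients(1) assms], symmetric]
      field_simps)
qed

lemma differentiable_inverse_u: "x \<in> U \<Longrightarrow> (\<lambda>y. inverse (u y)) differentiable (at x)"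
  by (rule differentiable_U[OF smooth_inverse[OF open_U u_nonzero smooth_u]])

lemma dderiv_omega: "x \<in> U \<Longrightarrow> dderiv v omega x = - 2 * omega x * dderiv v u x / u x"
proof -
  assume x: "x \<in> U"
  have "dderiv v omega x = dderiv v (\<lambda>y. inverse (u y) * inverse (u y)) x"
    by (rule dderiv_cong_open[OF open_U x]) (simp add: omega_def power2_eq_square field_simps)
  also have "\<dots> = - 2 * omega x * dderiv v u x / u x"
    unfolding dderiv_arith[OF differentiable_inverse_u[OF x] differentiable_inverse_u[OF x]]
      dderiv_inverse[OF differentiable_U[OF smooth_u x] u_nonzero[OF x]]
    using u_nonzero[OF x] by (simp add: omega_def field_simps power2_eq_square)
  finally show ?thesis .
qed

lemma dderiv_chi: "x \<in> U \<Longrightarrow> (x \<bullet> x) * dderiv v chi x = 2 * omega x * dderiv v u x / u x - 2 * (x \<bullet> v) * chi x"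
proof -
  assume x: "x \<in> U"
  have "dderiv v (\<lambda>y. (y \<bullet> y) * chi y + omega y) x = dderiv v (\<lambda>y. 1) x"
    by (rule dderiv_cong_open[OF open_U x]) (use coefficient_identities(3) in \<open>simp add: algebra_simps\<close>)
  moreover have "dderiv v (\<lambda>y. (y \<bullet> y) * chi y + omega y) x
      = (x \<bullet> x) * dderiv v chi x + 2 * (x \<bullet> v) * chi x + dderiv v omega x"
    by (subst dderiv_arith dderiv_inner_self |
      (intro differentiable_U[OF _ x] smooth_mult smooth_coefficients open_U smooth_inner_self))+ simp
  ultimately show ?thesis using dderiv_omega[OF x, of v] by simp
qed

lemma dderiv_chr_form:
  assumes "x \<in> U"
  shows "dderiv x (chr_form X Y) x = (dderiv x omega x * (dderiv X psi x * (x \<bullet> Y) + dderiv Y psi x * (x \<bullet> X))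
     + omega x * (dderiv x (dderiv X psi) x * (x \<bullet> Y) + dderiv X psi x * (x \<bullet> Y)
     + dderiv x (dderiv Y psi) x * (x \<bullet> X) + dderiv Y psi x * (x \<bullet> X))) / 2
     + dderiv x chi x * (X \<bullet> Y)
     + (dderiv x chi x * lderiv id psi x + chi x * (dderiv x (dderiv x psi) x + lderiv id psi x)
     + 2 * chi x * lderiv id psi x) * (x \<bullet> X) * (x \<bullet> Y) / 2"
proof -
  have "dderiv x (chr_form X Y) x
      = dderiv x (\<lambda>y. (1/2) * (omega y * (dderiv X psi y * (y \<bullet> Y) + dderiv Y psi y * (y \<bullet> X)))
      + chi y * (X \<bullet> Y)
    + (1/2) * (chi y * (lderiv id psi y * ((y \<bullet> X) * (y \<bullet> Y))))) x"
    by (rule dderiv_cong_open[OF open_U assms]) (simp add: chr_form_def)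
  also have "\<dots> = (dderiv x omega x * (dderiv X psi x * (x \<bullet> Y) + dderiv Y psi x * (x \<bullet> X))
     + omega x * (dderiv x (dderiv X psi) x * (x \<bullet> Y) + dderiv X psi x * (x \<bullet> Y)
     + dderiv x (dderiv Y psi) x * (x \<bullet> X) + dderiv Y psi x * (x \<bullet> X))) / 2
     + dderiv x chi x * (X \<bullet> Y)
     + (dderiv x chi x * lderiv id psi x + chi x * dderiv x (lderiv id psi) x + 2 * chi x * lderiv id psi x)
     * (x \<bullet> X) * (x \<bullet> Y) / 2"
    by (subst dderiv_arith dderiv_const dderiv_inner |
      (intro differentiable_U[OF _ assms] smooth_add smooth_mult smooth_const smooth_coefficients open_U
      smooth_inner smooth_dderiv smooth_lderiv linear_id))+
      (simp add: field_simps)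
  also have "dderiv x (lderiv id psi) x = dderiv x (dderiv x psi) x + lderiv id psi x"
    by (subst dderiv_lderiv[OF open_U smooth_coefficients(1) assms]) (simp_all add: lderiv_def)
  finally show ?thesis .
qed

lemma chr_form_tangential:
  assumes "x \<in> U" "x \<bullet> X = 0"
  shows "chr_form X x x = dderiv X u x / u x" "chr_form x X x = dderiv X u x / u x"
proof -
  have "2 * u x * dderiv X u x = (x \<bullet> x) * dderiv X psi x"
    using dderiv_psi[OF assms(1), of X] assms(2) by simp
  then have "omega x * ((x \<bullet> x) * dderiv X psi x) / 2 = dderiv X u x / u x"
    using u_nonzero[OF assms(1)] by (simp add: omega_def field_simps power2_eq_square)
  then show "chr_form X x x = dderiv X u x / u x" "chr_form x X x = dderiv X u x / u x"
    using assms(2) by (simp_all add: chr_form_def inner_commute algebra_simps)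
qed

lemma dderiv_log_quotient:
  assumes "x \<in> U"
  shows "dderiv Y (\<lambda>y. dderiv X u y / u y) x
      = dderiv Y (dderiv X u) x / u x - dderiv X u x * dderiv Y u x / (u x)\<^sup>2"
proof -
  have "dderiv Y (\<lambda>y. dderiv X u y / u y) x = dderiv Y (\<lambda>y. dderiv X u y * inverse (u y)) x"
    by (simp add: divide_inverse)
  also have "\<dots> = dderiv Y (dderiv X u) x / u x - dderiv X u x * dderiv Y u x / (u x)\<^sup>2"
    unfolding dderiv_arith[OF differentiable_U[OF smooth_dderiv[OF open_U smooth_u] assms]
      differentiable_inverse_u[OF assms]]
      dderiv_inverse[OF differentiable_U[OF smooth_u assms] u_nonzero[OF assms]]
    using u_nonzero[OF assms] by (simp add: field_simps power2_eq_square)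
  finally show ?thesis .
qed

lemma ricci_form_tangential:
  assumes "x \<in> U" "x \<bullet> X = 0" "x \<bullet> Y = 0"
  shows "ricci_form X Y x
      = (real CARD('n) * chi x + dderiv x chi x + chi x * (lderiv id u x / u x)) * (X \<bullet> Y)
      - dderiv Y (dderiv X u) x / u x"
  unfolding ricci_form_eq[OF assms(1)] dderiv_chr_form[OF assms(1)] dderiv_log_quotient[OF assms(1)]
    chr_form_tangential(1)[OF assms(1,2)] chr_form_tangential(1)[OF assms(1,3)]
  by (simp add: chr_form_def assms algebra_simps power2_eq_square)

lemma dderiv_psi_eq:
  assumes "x \<in> U"
  shows "dderiv v psi x = (2 * u x * dderiv v u x - 2 * (x \<bullet> v) * psi x) / (x \<bullet> x)"
    "dderiv v (dderiv w psi) x = (2 * dderiv v u x * dderiv w u x + 2 * u x * dderiv v (dderiv w u) x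
       - 2 * (v \<bullet> w) * psi x - 2 * (x \<bullet> w) * dderiv v psi x - 2 * (x \<bullet> v) * dderiv w psi x) / (x \<bullet> x)"
  using dderiv_psi[OF assms, of v] dderiv_dderiv_psi[OF assms, of v w] inner_self_nonzero[OF assms]
  by (auto simp: field_simps)

lemma ricci_form_mixed:
  assumes "x \<in> U" "x \<bullet> Y = 0"
  shows "ricci_form x Y x = (real CARD('n) - 2) * (dderiv Y u x / u x)"
proof -
  have u_nz: "u x \<noteq> 0" and R_nz: "x \<bullet> x \<noteq> 0" using u_nonzero inner_self_nonzero assms by auto
  have dpsi: "psi differentiable (at x)" using differentiable_U[OF smooth_coefficients(1) assms(1)] .
  have psi_Y: "dderiv Y psi x = 2 * u x * dderiv Y u x / (x \<bullet> x)"
    using dderiv_psi_eq(1)[OF assms(1), of Y] assms(2) by simp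
  have psi_x: "dderiv x psi x = (2 * u x * dderiv x u x - 2 * (x \<bullet> x) * psi x) / (x \<bullet> x)"
    using dderiv_psi_eq(1)[OF assms(1), of x] by simp
  have psi_xY: "dderiv x (dderiv Y psi) x
      = (2 * dderiv x u x * dderiv Y u x + 2 * u x * dderiv x (dderiv Y u) x
      - 2 * (x \<bullet> x) * dderiv Y psi x) / (x \<bullet> x)"
    using dderiv_psi_eq(2)[OF assms(1), of x Y] assms(2) by simp
  have commute: "dderiv Y (dderiv x u) x = dderiv x (dderiv Y u) x"
    by (rule dderiv_commute[OF open_U smooth_u assms(1)])
  have grad_term: "chr_form Y (grad psi x) x
      = omega x * (dderiv Y psi x * dderiv x psi x) / 2 + chi x * dderiv Y psi x"
    by (simp add: chr_form_def assms(2) inner_grad[OF dpsi])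
  have expanded: "ricci_form x Y x
      = real CARD('n) * (dderiv Y u x / u x)
      + (dderiv x omega x * (dderiv Y psi x * (x \<bullet> x))
      + omega x * (dderiv x (dderiv Y psi) x * (x \<bullet> x) + dderiv Y psi x * (x \<bullet> x))) / 2
      - dderiv Y psi x * (x \<bullet> x) / 2 - (dderiv x (dderiv Y u) x / u x - dderiv x u x * dderiv Y u x / (u x)\<^sup>2)
      + dderiv x u x / u x * (dderiv Y u x / u x)
      - chr_form x x x * (dderiv Y u x / u x) + (x \<bullet> x) * ((x \<bullet> x) * chr_form Y (grad psi x) x) / 2"
    unfolding ricci_form_eq[OF assms(1)] dderiv_chr_form[OF assms(1)] dderiv_log_quotient[OF assms(1)] commute
      chr_form_tangential[OF assms]
    by (simp add: assms(2) lderiv_def)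
  have radial_term: "chr_form x x x
      = omega x * dderiv x psi x * (x \<bullet> x) + chi x * (x \<bullet> x) + chi x * dderiv x psi x * (x \<bullet> x) * (x \<bullet> x) / 2"
    by (simp add: chr_form_def lderiv_def field_simps)
  show ?thesis
    unfolding expanded grad_term radial_term psi_xY psi_Y psi_x dderiv_omega[OF assms(1)]
    unfolding psi_def chi_def omega_def
    using u_nz R_nz by (simp add: field_simps power2_eq_square power3_eq_cube power4_eq_xxxx)
qed

lemma laplace_psi:
  assumes "x \<in> U"
  shows "(x \<bullet> x) * laplace psi x
      = 2 * (grad u x \<bullet> grad u x) + 2 * u x * laplace u x - 2 * real CARD('n) * psi x - 4 * dderiv x psi x"
proof -
  have summand: "(x \<bullet> x) * pd i (pd i psi) x
      = 2 * (grad u x $ i * grad u x $ i) + 2 * u x * pd i (pd i u) x - 2 * psi x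
      - 4 * (x $ i * pd i psi x)" for i
    using dderiv_dderiv_psi[OF assms, of "axis i 1" "axis i 1"]
    by (simp add: grad_def pd_eq_dderiv_axis inner_axis algebra_simps)
  have "(x \<bullet> x) * laplace psi x = (\<Sum>i\<in>UNIV. (x \<bullet> x) * pd i (pd i psi) x)"
    by (simp add: laplace_def sum_distrib_left)
  also have "\<dots> = 2 * (\<Sum>i\<in>UNIV. grad u x $ i * grad u x $ i) + 2 * u x * (\<Sum>i\<in>UNIV. pd i (pd i u) x)
      - (\<Sum>i\<in>(UNIV::'n set). 2 * psi x) - 4 * (\<Sum>i\<in>UNIV. x $ i * pd i psi x)"
    unfolding summand by (simp only: sum.distrib sum_subtractf sum_distrib_left)
  finally show ?thesis
    by (simp add: laplace_def inner_eq_sum sum_nth_pd differentiable_U[OF smooth_coefficients(1) assms]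
      lderiv_def)
qed

lemma grad_psi:
  assumes "x \<in> U"
  shows "grad psi x = (2 * u x / (x \<bullet> x)) *\<^sub>R grad u x - (2 * psi x / (x \<bullet> x)) *\<^sub>R x"
proof -
  have "pd i psi x = 2 * u x / (x \<bullet> x) * pd i u x - 2 * psi x / (x \<bullet> x) * x $ i" for i
    using dderiv_psi_eq(1)[OF assms, of "axis i 1"] by (simp add: pd_eq_dderiv inner_axis diff_divide_distrib)
  then show ?thesis by (simp add: vec_eq_iff grad_def)
qed

lemma dderiv_grad_psi:
  assumes "x \<in> U"
  shows "dderiv (grad u x) psi x = (2 * u x * (grad u x \<bullet> grad u x) - 2 * psi x * dderiv x u x) / (x \<bullet> x)"
    "dderiv (grad psi x) psi x
      = (4 * (u x)\<^sup>2 * (grad u x \<bullet> grad u x) - 8 * u x * psi x * dderiv x u x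
      + 4 * (psi x)\<^sup>2 * (x \<bullet> x)) / (x \<bullet> x)\<^sup>2"
proof -
  have diff: "u differentiable (at x)" "psi differentiable (at x)"
    by (intro differentiable_U[OF _ assms] smooth_u smooth_coefficients)+
  show grad_u: "dderiv (grad u x) psi x
      = (2 * u x * (grad u x \<bullet> grad u x) - 2 * psi x * dderiv x u x) / (x \<bullet> x)"
    using dderiv_psi_eq(1)[OF assms, of "grad u x"] by (simp add: inner_grad[OF diff(1)] mult_ac)
  have "dderiv (grad psi x) psi x
      = 2 * u x / (x \<bullet> x) * dderiv (grad u x) psi x - 2 * psi x / (x \<bullet> x) * dderiv x psi x"
    by (subst grad_psi[OF assms]) (simp add: dderiv_linear[OF diff(2)])
  also have "\<dots> = (4 * (u x)\<^sup>2 * (grad u x \<bullet> grad u x) - 8 * u x * psi x * dderiv x u x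
      + 4 * (psi x)\<^sup>2 * (x \<bullet> x)) / (x \<bullet> x)\<^sup>2"
    unfolding grad_u dderiv_psi_eq(1)[OF assms, of x] using inner_self_nonzero[OF assms]
    by (simp add: field_simps power2_eq_square)
  finally show "dderiv (grad psi x) psi x
      = (4 * (u x)\<^sup>2 * (grad u x \<bullet> grad u x) - 8 * u x * psi x * dderiv x u x
      + 4 * (psi x)\<^sup>2 * (x \<bullet> x)) / (x \<bullet> x)\<^sup>2" .
qed

lemma ricci_form_radial_expand:
  assumes "x \<in> U"
  defines "R \<equiv> x \<bullet> x" and "q \<equiv> dderiv x psi x"
  shows "ricci_form x x x = real CARD('n) * chr_form x x x + ((dderiv x omega x * (q * R + q * R)
     + omega x * (dderiv x (dderiv x psi) x * R + q * R + dderiv x (dderiv x psi) x * R + q * R)) / 2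
     + dderiv x chi x * R
     + (dderiv x chi x * q + chi x * (dderiv x (dderiv x psi) x + q) + 2 * chi x * q) * R * R / 2)
     - laplace psi x * (R * R) / 2 - (q * R + q * R) / 2
     - (dderiv x (dderiv x u) x / u x - dderiv x u x * dderiv x u x / (u x)\<^sup>2)
     + (dderiv x u x / u x) * chr_form x x x - dderiv (grad u x) psi x / u x * (R * R) / 2
     - chr_form x x x * chr_form x x x
     + R * (R * chr_form x (grad psi x) x + R * chr_form x (grad psi x) x) / 2 - q\<^sup>2 * (R * R) / 4"
    "chr_form x x x = omega x * q * R + chi x * R + chi x * q * R * R / 2"
    "chr_form x (grad psi x) x
      = omega x * (q * q + dderiv (grad psi x) psi x * R) / 2 + chi x * q + chi x * q * R * q / 2"
proof -
  show "chr_form x x x = omega x * q * R + chi x * R + chi x * q * R * R / 2"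
    by (simp add: chr_form_def lderiv_def R_def q_def)
  show "chr_form x (grad psi x) x
      = omega x * (q * q + dderiv (grad psi x) psi x * R) / 2 + chi x * q + chi x * q * R * q / 2"
    by (simp add: chr_form_def lderiv_def R_def q_def
      inner_grad[OF differentiable_U[OF smooth_coefficients(1) assms(1)]])
qed (unfold ricci_form_eq[OF assms(1)] dderiv_chr_form[OF assms(1)] dderiv_log_quotient[OF assms(1)],
    simp add: lderiv_def R_def q_def)

lemma ricci_form_radial:
  assumes "x \<in> U"
  shows "omega x * ricci_form x x x
      = (real CARD('n) - 1) * omega x * (dderiv x u x / u x) - sphere_laplace u x / u x"
proof -
  define R where "R = x \<bullet> x"
  define p where "p = dderiv x u x"
  define h where "h = dderiv x (dderiv x u) x"
  define g where "g = grad u x \<bullet> grad u x"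
  define P where "P = ((u x)\<^sup>2 - 1) / R"
  define q where "q = 2 * (u x * p - (u x)\<^sup>2 + 1) / R"
  have nonzero: "u x \<noteq> 0" "R \<noteq> 0" using u_nonzero inner_self_nonzero assms by (auto simp: R_def)
  have psi: "psi x = P" by (simp add: psi_def P_def R_def)
  have dpsi: "dderiv x psi x = q"
    unfolding dderiv_psi_eq(1)[OF assms] using nonzero by (simp add: psi P_def q_def p_def R_def field_simps)
  have ddpsi: "dderiv x (dderiv x psi) x = (2 * p * p + 2 * u x * h - 2 * R * P - 4 * R * q) / R"
    using dderiv_psi_eq(2)[OF assms, of x x] unfolding psi dpsi by (simp add: R_def p_def h_def algebra_simps)
  have laplace_psi: "laplace psi x = (2 * g + 2 * u x * laplace u x - 2 * real CARD('n) * P - 4 * q) / R"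
    using laplace_psi[OF assms] nonzero unfolding psi dpsi by (simp add: R_def g_def field_simps)
  have omega_chi: "omega x = 1 / (u x)\<^sup>2" "chi x = (1 - 1 / (u x)\<^sup>2) / R"
    by (simp_all add: omega_def chi_def R_def)
  have derivs: "dderiv x omega x = - 2 * omega x * p / u x"
    "dderiv x chi x = (2 * omega x * p / u x - 2 * R * chi x) / R"
    using dderiv_omega[OF assms, of x] dderiv_chi[OF assms, of x] nonzero
    by (simp_all add: p_def R_def field_simps)
  have sphere: "sphere_laplace u x = R * laplace u x - (h + p) - (real CARD('n) - 2) * p"
    by (simp add: sphere_laplace_def lderiv_id_lderiv_id[OF open_U smooth_u assms] lderiv_def[of id u] R_def
      p_def h_def)
  show ?thesis
    unfolding ricci_form_radial_expand[OF assms] dderiv_grad_psi[OF assms] sphere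
    unfolding dpsi ddpsi laplace_psi psi derivs omega_chi R_def[symmetric] p_def[symmetric] h_def[symmetric]
      g_def[symmetric]
    unfolding q_def P_def
    using nonzero by (simp add: field_simps power2_eq_square)
qed

end

section \<open>Unique continuation for closed second-order systems\<close>

definition jet_sq :: "(real^'n::finite \<Rightarrow> real) \<Rightarrow> real^'n \<Rightarrow> real" where
  "jet_sq f x = (f x)\<^sup>2 + (\<Sum>j\<in>UNIV. (pd j f x)\<^sup>2)"

lemma jet_sq_nonneg: "0 \<le> jet_sq f x"
  unfolding jet_sq_def by (intro add_nonneg_nonneg sum_nonneg) auto

lemma abs_le_sqrt_jet_sq: "\<bar>f x\<bar> \<le> sqrt (jet_sq f x)" "\<bar>pd j f x\<bar> \<le> sqrt (jet_sq f x)"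
proof -
  have "(f x)\<^sup>2 \<le> jet_sq f x" by (simp add: jet_sq_def sum_nonneg)
  then show "\<bar>f x\<bar> \<le> sqrt (jet_sq f x)" using real_sqrt_le_mono by fastforce
  have "(pd j f x)\<^sup>2 \<le> (\<Sum>j\<in>UNIV. (pd j f x)\<^sup>2)" by (rule member_le_sum) auto
  also have "\<dots> \<le> jet_sq f x" by (simp add: jet_sq_def)
  finally show "\<bar>pd j f x\<bar> \<le> sqrt (jet_sq f x)" using real_sqrt_le_mono by fastforce
qed

lemma jet_sq_eq_zero: "jet_sq f x = 0 \<longleftrightarrow> f x = 0 \<and> (\<forall>j. pd j f x = 0)"
proof
  assume "jet_sq f x = 0"
  then show "f x = 0 \<and> (\<forall>j. pd j f x = 0)"
    using abs_le_sqrt_jet_sq(1)[of f x] abs_le_sqrt_jet_sq(2)[of _ f x] by simp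
qed (simp add: jet_sq_def)

lemma abs_dderiv_le:
  fixes f :: "real^'n::finite \<Rightarrow> real"
  assumes "f differentiable (at x)" "\<And>i. \<bar>pd i f x\<bar> \<le> B"
  shows "\<bar>dderiv v f x\<bar> \<le> real CARD('n) * norm v * B"
proof -
  have "\<bar>dderiv v f x\<bar> \<le> (\<Sum>i\<in>UNIV. \<bar>v $ i * pd i f x\<bar>)"
    unfolding dderiv_eq_sum_pd[OF assms(1)] by (rule sum_abs)
  also have "\<dots> \<le> (\<Sum>i\<in>(UNIV::'n set). norm v * B)"
    unfolding abs_mult using assms(2) by (intro sum_mono mult_mono component_le_norm_cart) auto
  finally show ?thesis by simp
qed

locale closed_linear_system =
  fixes U :: "(real^'n::finite) set" and f :: "real^'n \<Rightarrow> real"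
    and a :: "'n \<Rightarrow> 'n \<Rightarrow> 'n \<Rightarrow> real^'n \<Rightarrow> real" and b :: "'n \<Rightarrow> 'n \<Rightarrow> real^'n \<Rightarrow> real"
  assumes open_domain: "open U" and smooth_f: "smooth_on f U"
    and continuous_coeffs: "\<And>k i j. continuous_on U (a k i j)" "\<And>i j. continuous_on U (b i j)"
    and system: "\<And>x i j. x \<in> U \<Longrightarrow> pd i (pd j f) x = (\<Sum>k\<in>UNIV. a k i j x * pd k f x) + f x * b i j x"
begin

lemma coeffs_bounded:
  assumes "compact K" "K \<subseteq> U"
  obtains B where "\<And>x k i j. x \<in> K \<Longrightarrow> \<bar>a k i j x\<bar> \<le> B" "\<And>x i j. x \<in> K \<Longrightarrow> \<bar>b i j x\<bar> \<le> B"
proof -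
  define total where
    "total x = (\<Sum>k\<in>UNIV. \<Sum>i\<in>UNIV. \<Sum>j\<in>UNIV. \<bar>a k i j x\<bar>) + (\<Sum>i\<in>UNIV. \<Sum>j\<in>UNIV. \<bar>b i j x\<bar>)" for x
  have "continuous_on K total"
    unfolding total_def by (intro continuous_intros continuous_on_subset[OF _ assms(2)] continuous_coeffs)
  then have "bounded (total ` K)" by (intro compact_imp_bounded compact_continuous_image assms(1))
  then obtain B where B: "\<And>x. x \<in> K \<Longrightarrow> total x \<le> B" unfolding bounded_iff by (auto simp: abs_le_iff)
  have member: "g i \<le> (\<Sum>i\<in>UNIV. g i)" if "\<And>i. 0 \<le> g i" for g :: "'n \<Rightarrow> real" and i
    using that by (intro member_le_sum) auto
  have le_total: "\<bar>a k i j x\<bar> \<le> total x" "\<bar>b i j x\<bar> \<le> total x" for k i j x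
  proof -
    have "\<bar>a k i j x\<bar> \<le> (\<Sum>j\<in>UNIV. \<bar>a k i j x\<bar>)" by (rule member) simp
    also have "\<dots> \<le> (\<Sum>i\<in>UNIV. \<Sum>j\<in>UNIV. \<bar>a k i j x\<bar>)" by (rule member) (simp add: sum_nonneg)
    also have "\<dots> \<le> (\<Sum>k\<in>UNIV. \<Sum>i\<in>UNIV. \<Sum>j\<in>UNIV. \<bar>a k i j x\<bar>)" by (rule member) (simp add: sum_nonneg)
    also have "\<dots> \<le> total x" by (simp add: total_def sum_nonneg)
    finally show "\<bar>a k i j x\<bar> \<le> total x" .
    have "\<bar>b i j x\<bar> \<le> (\<Sum>j\<in>UNIV. \<bar>b i j x\<bar>)" by (rule member) simp
    also have "\<dots> \<le> (\<Sum>i\<in>UNIV. \<Sum>j\<in>UNIV. \<bar>b i j x\<bar>)" by (rule member) (simp add: sum_nonneg)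
    also have "\<dots> \<le> total x" by (simp add: total_def sum_nonneg)
    finally show "\<bar>b i j x\<bar> \<le> total x" .
  qed
  show ?thesis
    by (rule that[of B]) (rule order_trans[OF le_total(1) B] order_trans[OF le_total(2) B], assumption)+
qed

lemma dderiv_jet_sq_le:
  assumes "x \<in> U" "\<And>k i j. \<bar>a k i j x\<bar> \<le> B" "\<And>i j. \<bar>b i j x\<bar> \<le> B"
  defines "N \<equiv> real CARD('n)"
  shows "dderiv v (jet_sq f) x \<le> 2 * (N * norm v) * (1 + N * ((N + 1) * B)) * jet_sq f x"
proof -
  define m where "m = sqrt (jet_sq f x)"
  have m: "m * m = jet_sq f x" "0 \<le> m" by (simp_all add: m_def jet_sq_nonneg)
  have jet: "\<bar>f x\<bar> \<le> m" "\<bar>pd j f x\<bar> \<le> m" for j by (simp_all add: m_def abs_le_sqrt_jet_sq)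
  note diff = smooth_differentiable[OF open_domain _ assms(1)]
  note smooth = smooth_pd[OF smooth_f] smooth_f
  have "\<bar>pd i (pd j f) x\<bar> \<le> (N + 1) * B * m" for i j
  proof -
    have "\<bar>pd i (pd j f) x\<bar> \<le> (\<Sum>k\<in>UNIV. \<bar>a k i j x * pd k f x\<bar>) + \<bar>f x * b i j x\<bar>"
      unfolding system[OF assms(1)] by (rule order_trans[OF abs_triangle_ineq add_right_mono[OF sum_abs]])
    also have "\<dots> \<le> (\<Sum>k\<in>(UNIV::'n set). B * m) + m * B"
      unfolding abs_mult using assms(2,3) jet m(2) order_trans[OF abs_ge_zero assms(3)]
      by (intro add_mono sum_mono mult_mono) auto
    finally show ?thesis by (simp add: N_def algebra_simps)
  qed
  then have second: "\<bar>dderiv v (pd j f) x\<bar> \<le> N * norm v * ((N + 1) * B * m)" for j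
    unfolding N_def by (intro abs_dderiv_le diff smooth)
  have first: "\<bar>dderiv v f x\<bar> \<le> N * norm v * m"
    unfolding N_def by (intro abs_dderiv_le diff smooth jet)
  have product: "2 * (c * d) \<le> 2 * (m * D)" if "\<bar>c\<bar> \<le> m" "\<bar>d\<bar> \<le> D" for c d D
    using mult_mono[OF that m(2) abs_ge_zero] by (simp add: abs_mult[symmetric] abs_le_iff)
  have square: "dderiv v (\<lambda>y. (g y)\<^sup>2) x = 2 * (g x * dderiv v g x)" if "g differentiable (at x)"
    for g :: "real^'n \<Rightarrow> real"
    by (simp add: power2_eq_square dderiv_arith[OF that that])
  have "dderiv v (jet_sq f) x = dderiv v (\<lambda>y. (f y)\<^sup>2) x + dderiv v (\<lambda>y. \<Sum>j\<in>UNIV. (pd j f y)\<^sup>2) x"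
    unfolding jet_sq_def[abs_def]
    by (intro dderiv_arith diff smooth_sum smooth_power smooth_pd smooth_f open_domain)
  also have "dderiv v (\<lambda>y. \<Sum>j\<in>UNIV. (pd j f y)\<^sup>2) x = (\<Sum>j\<in>UNIV. dderiv v (\<lambda>y. (pd j f y)\<^sup>2) x)"
    by (intro dderiv_sum diff smooth_power smooth_pd smooth_f open_domain)
  also have "dderiv v (\<lambda>y. (f y)\<^sup>2) x + (\<Sum>j\<in>UNIV. dderiv v (\<lambda>y. (pd j f y)\<^sup>2) x)
      = 2 * (f x * dderiv v f x) + (\<Sum>j\<in>UNIV. 2 * (pd j f x * dderiv v (pd j f) x))"
    by (simp add: square diff smooth_pd[OF smooth_f] smooth_f)
  also have "\<dots> \<le> 2 * (m * (N * norm v * m)) + (\<Sum>j\<in>(UNIV::'n set). 2 * (m * (N * norm v * ((N + 1) * B * m))))"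
    by (intro add_mono sum_mono product jet first second)
  also have "\<dots> = 2 * (N * norm v) * (1 + N * ((N + 1) * B)) * (m * m)" by (simp add: N_def algebra_simps)
  finally show ?thesis unfolding m(1) .
qed

lemma jet_sq_zero_on_cball:
  assumes "jet_sq f x = 0" "cball x r \<subseteq> U" "y \<in> cball x r"
  shows "jet_sq f y = 0"
proof -
  define v where "v = y - x"
  have segment: "x + t *\<^sub>R v \<in> cball x r" if "0 \<le> t" "t \<le> 1" for t
  proof -
    have "norm (t *\<^sub>R v) \<le> 1 * norm v" using that by (simp add: mult_left_le_one_le)
    also have "\<dots> \<le> r" using assms(3) by (simp add: v_def dist_norm norm_minus_commute)
    finally show ?thesis by (simp add: dist_norm)
  qed
  obtain B where B: "\<And>x' k i j. x' \<in> cball x r \<Longrightarrow> \<bar>a k i j x'\<bar> \<le> B" "\<And>x' i j. x' \<in> cball x r \<Longrightarrow> \<bar>b i j x'\<bar> \<le> B"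
    using coeffs_bounded[OF compact_cball assms(2)] by blast
  have "smooth_on (jet_sq f) U"
    unfolding jet_sq_def by (intro smooth_add smooth_sum smooth_power smooth_pd smooth_f open_domain)
  then have "((\<lambda>t. jet_sq f (x + t *\<^sub>R v)) has_real_derivative dderiv v (jet_sq f) (x + t *\<^sub>R v)) (at t)"
    if "0 \<le> t" "t \<le> 1" for t
    using segment[OF that] assms(2) by (intro DERIV_along_line smooth_differentiable[OF open_domain]) auto
  moreover have "dderiv v (jet_sq f) (x + t *\<^sub>R v)
      \<le> 2 * (real CARD('n) * norm v) * (1 + real CARD('n) * ((real CARD('n) + 1) * B))
      * jet_sq f (x + t *\<^sub>R v)"
    if "0 \<le> t" "t \<le> 1" for t
    using segment[OF that] assms(2) by (intro dderiv_jet_sq_le B) auto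
  ultimately have "jet_sq f (x + 1 *\<^sub>R v) \<le> 0"
    by (rule gronwall_zero[where g="\<lambda>t. jet_sq f (x + t *\<^sub>R v)"]) (use assms(1) in auto)
  then show ?thesis using jet_sq_nonneg[of f y] by (simp add: v_def)
qed

lemma unique_continuation:
  assumes "connected U" "open W" "W \<subseteq> U" "W \<noteq> {}" "\<And>x. x \<in> W \<Longrightarrow> f x = 0" "y \<in> U"
  shows "f y = 0"
proof -
  define Z where "Z = {x \<in> U. jet_sq f x = 0}"
  have "open Z" unfolding open_contains_cball
  proof
    fix x assume x: "x \<in> Z"
    then obtain r where r: "r > 0" "cball x r \<subseteq> U"
      using open_domain open_contains_cball unfolding Z_def by blast
    then show "\<exists>r>0. cball x r \<subseteq> Z" using jet_sq_zero_on_cball[of x r] x unfolding Z_def by blast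
  qed
  then have "openin (top_of_set U) Z" by (subst openin_open_eq[OF open_domain]) (auto simp: Z_def)
  moreover have "smooth_on (jet_sq f) U"
    unfolding jet_sq_def by (intro smooth_add smooth_sum smooth_power smooth_pd smooth_f open_domain)
  then have "closedin (top_of_set U) Z"
    unfolding Z_def by (intro continuous_closedin_preimage_constant smooth_continuous)
  moreover obtain x where x: "x \<in> W" using assms(4) by blast
  have "pd j f x = 0" for j
    using pd_cong_open[OF assms(2) x, of f "\<lambda>x. 0" j] assms(5) by (simp add: pd_eq_dderiv)
  then have "x \<in> Z" using x assms(3,5) by (auto simp: Z_def jet_sq_eq_zero)
  ultimately have "Z = U" using assms(1) connected_clopen by blast
  then show ?thesis using assms(6) by (auto simp: Z_def jet_sq_eq_zero)
qed

end

section \<open>The static vacuum equations\<close>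

locale static_quasi_spherical = quasi_spherical U u for U :: "(real^'n::finite) set" and u +
  fixes V :: "real^'n::finite \<Rightarrow> real" and n :: real
  assumes CARD_eq [simp]: "real CARD('n) = n" and smooth_V: "smooth_on V U"
    and static: "\<And>x i j. x \<in> U \<Longrightarrow> hessian (warped_metric u) V i j x = V x * Ric i j x"
    and harmonic: "\<And>x. x \<in> U \<Longrightarrow> laplacian (warped_metric u) V x = 0"
begin

abbreviation Hess where "Hess \<equiv> hessian (warped_metric u) V"
abbreviation EV where "EV \<equiv> lderiv id V"
abbreviation Eu where "Eu \<equiv> lderiv id u"

definition hessian_form where
  "hessian_form X Y x = (\<Sum>i\<in>UNIV. \<Sum>j\<in>UNIV. X $ i * Y $ j * Hess i j x)"

definition mixed_coeff where
  "mixed_coeff x = EV x + (n - 2) * V x"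

lemma hessian_eq:
  assumes "x \<in> U"
  shows "Hess i j x = pd i (pd j V) x - chr_coeff i j x * EV x
      + dderiv (grad psi x) V x * (x $ i * x $ j) / 2"
proof -
  have "(\<Sum>k\<in>UNIV. \<Gamma> k i j x * pd k V x)
     = chr_coeff i j x * (\<Sum>k\<in>UNIV. x $ k * pd k V x)
     - x $ i * x $ j / 2 * (\<Sum>k\<in>UNIV. grad psi x $ k * pd k V x)"
    by (simp only: christoffel_eq[OF assms] sum_distrib_left flip: sum_subtractf)
      (rule sum.cong, simp_all add: grad_def field_simps)
  then show ?thesis
    by (simp add: hessian_def sum_nth_pd differentiable_U[OF smooth_V assms]
      dderiv_eq_sum_pd[OF differentiable_U[OF smooth_V assms], of "grad psi x"] field_simps)
qed

lemma hessian_form_eq: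
  assumes "x \<in> U"
  shows "hessian_form X Y x
      = dderiv X (dderiv Y V) x - chr_form X Y x * EV x + dderiv (grad psi x) V x * ((x \<bullet> X) * (x \<bullet> Y)) / 2"
proof -
  have "hessian_form X Y x = (\<Sum>i\<in>UNIV. \<Sum>j\<in>UNIV. X $ i * Y $ j * pd i (pd j V) x)
     - EV x * (\<Sum>i\<in>UNIV. \<Sum>j\<in>UNIV. X $ i * Y $ j * chr_coeff i j x)
     + dderiv (grad psi x) V x / 2 * ((\<Sum>i\<in>UNIV. X $ i * x $ i) * (\<Sum>j\<in>UNIV. Y $ j * x $ j))"
    unfolding sum_product unfolding sum_distrib_left unfolding hessian_form_def hessian_eq[OF assms]
    unfolding sum.distrib[symmetric] sum_subtractf[symmetric]
    by (intro sum.cong refl) (simp add: field_simps)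
  moreover have "x \<bullet> X = (\<Sum>i\<in>UNIV. X $ i * x $ i)" for X by (simp add: inner_eq_sum mult.commute)
  ultimately show ?thesis
    unfolding dderiv_dderiv_eq_sum_pd[OF open_U smooth_V assms] sum_chr_coeff(1)[OF assms] by simp
qed

lemma hessian_form_eq_ricci_form: "x \<in> U \<Longrightarrow> hessian_form X Y x = V x * ricci_form X Y x"
  by (simp add: hessian_form_def ricci_form_def static sum_distrib_left mult_ac)

lemma static_mixed:
  assumes "x \<in> U" "x \<bullet> Y = 0"
  shows "dderiv Y EV x = dderiv Y V x + dderiv Y u x / u x * mixed_coeff x"
proof -
  have "dderiv x (dderiv Y V) x - dderiv Y u x / u x * EV x = V x * ((n - 2) * (dderiv Y u x / u x))"
    using hessian_form_eq[OF assms(1), of x Y] hessian_form_eq_ricci_form[OF assms(1), of x Y]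
      ricci_form_mixed[OF assms] chr_form_tangential(2)[OF assms] assms(2)
    by simp
  moreover have "dderiv Y EV x = dderiv x (dderiv Y V) x + dderiv Y V x"
    using dderiv_lderiv[OF open_U smooth_V assms(1) linear_id, of Y]
      dderiv_commute[OF open_U smooth_V assms(1), of Y x]
    by simp
  ultimately show ?thesis using u_nonzero[OF assms(1)] by (simp add: mixed_coeff_def field_simps)
qed

definition trace_factor
  where "trace_factor x = u x * (chi x * EV x + V x * (n * chi x + dderiv x chi x + chi x * (Eu x / u x)))"

lemma static_tangential:
  assumes "x \<in> U" "x \<bullet> X = 0" "x \<bullet> Y = 0"
  shows "u x * dderiv X (dderiv Y V) x + V x * dderiv X (dderiv Y u) x = trace_factor x * (X \<bullet> Y)"
proof -
  have "dderiv X (dderiv Y V) x - chi x * (X \<bullet> Y) * EV x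
     = V x * ((n * chi x + dderiv x chi x + chi x * (Eu x / u x)) * (X \<bullet> Y) - dderiv X (dderiv Y u) x / u x)"
    using hessian_form_eq[OF assms(1), of X Y] hessian_form_eq_ricci_form[OF assms(1), of X Y]
      ricci_form_tangential[OF assms] assms(2,3)
      dderiv_commute[OF open_U smooth_u assms(1), of X Y] by (simp add: chr_form_def)
  then have "dderiv X (dderiv Y V) x = chi x * (X \<bullet> Y) * EV x
     + V x * ((n * chi x + dderiv x chi x + chi x * (Eu x / u x)) * (X \<bullet> Y) - dderiv X (dderiv Y u) x / u x)"
    by simp
  then show ?thesis
    unfolding trace_factor_def using u_nonzero[OF assms(1)] by (simp only:) (simp add: field_simps)
qed

lemma trace_factor_eq:
  assumes "x \<in> U"
  shows "(x \<bullet> x) * trace_factor x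
      = u x * ((1 - omega x) * EV x + V x * ((n - 2) * (1 - omega x) + (1 + omega x) * (Eu x / u x)))"
proof -
  have chi_eq: "(x \<bullet> x) * chi x = 1 - omega x"
    using coefficient_identities(3)[OF assms] by (simp add: algebra_simps)
  have dchi_eq: "(x \<bullet> x) * dderiv x chi x = 2 * omega x * (Eu x / u x) - 2 * ((x \<bullet> x) * chi x)"
    using dderiv_chi[OF assms, of x] by (simp add: lderiv_def)
  have "(x \<bullet> x) * trace_factor x
      = u x * (((x \<bullet> x) * chi x) * EV x
      + V x * (n * ((x \<bullet> x) * chi x) + (x \<bullet> x) * dderiv x chi x + ((x \<bullet> x) * chi x) * (Eu x / u x)))"
    by (simp add: trace_factor_def algebra_simps)
  then have expanded: "(x \<bullet> x) * trace_factor x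
      = u x * ((1 - omega x) * EV x
      + V x * (n * (1 - omega x) + (2 * omega x * (Eu x / u x) - 2 * (1 - omega x))
      + (1 - omega x) * (Eu x / u x)))"
    unfolding dchi_eq chi_eq .
  define M where "M = Eu x / u x"
  show ?thesis unfolding expanded M_def[symmetric] by (simp add: algebra_simps)
qed

lemma sum_tangential_second_derivs:
  assumes "x \<in> U" "smooth_on f U"
  defines "e i \<equiv> axis i 1 - (x $ i / (x \<bullet> x)) *\<^sub>R x"
  shows "(\<Sum>i\<in>UNIV. (x \<bullet> x) * dderiv (e i) (dderiv (e i) f) x) = sphere_laplace f x + (n - 1) * lderiv id f x"
proof -
  have diff: "dderiv v f differentiable (at x)" for v
    by (rule differentiable_U[OF smooth_dderiv[OF open_U assms(2)] assms(1)])
  have expanded: "(x \<bullet> x) * dderiv (e i) (dderiv (e i) f) x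
     = (x \<bullet> x) * dderiv (axis i 1) (dderiv (axis i 1) f) x - 2 * (x $ i * pd i (dderiv x f) x)
       + (x $ i * x $ i) * (dderiv x (dderiv x f) x / (x \<bullet> x))" for i
  proof -
    have "dderiv x (dderiv (axis i 1) f) x = pd i (dderiv x f) x"
      using dderiv_commute[OF open_U assms(2,1)] by (simp add: pd_eq_dderiv)
    then show ?thesis
      using inner_self_nonzero[OF assms(1)]
      by (simp add: e_def dderiv_dderiv_linear[OF open_U assms(2,1)] dderiv_linear[OF diff] pd_eq_dderiv
        field_simps)
  qed
  have "(\<Sum>i\<in>UNIV. (x \<bullet> x) * dderiv (e i) (dderiv (e i) f) x)
     = (x \<bullet> x) * laplace f x - 2 * (\<Sum>i\<in>UNIV. x $ i * pd i (dderiv x f) x)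
     + (\<Sum>i\<in>UNIV. x $ i * x $ i) * (dderiv x (dderiv x f) x / (x \<bullet> x))"
    unfolding expanded laplace_eq_sum_dderiv
    by (simp only: sum.distrib sum_subtractf sum_distrib_left sum_distrib_right)
  also have "\<dots> = (x \<bullet> x) * laplace f x - 2 * dderiv x (dderiv x f) x + dderiv x (dderiv x f) x"
    using inner_self_nonzero[OF assms(1)]
    by (simp add: dderiv_eq_sum_pd[OF diff, symmetric] inner_eq_sum[symmetric])
  finally show ?thesis
    by (simp add: sphere_laplace_def lderiv_id_lderiv_id[OF open_U assms(2,1)] algebra_simps)
qed

lemma static_tangential_trace:
  assumes "x \<in> U"
  shows "u x * sphere_laplace V x + V x * sphere_laplace u x
      = (n - 1) * u x * (- omega x * EV x + V x * ((n - 2) * (1 - omega x) + omega x * (Eu x / u x)))"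
proof -
  let ?e = "\<lambda>i. axis i 1 - (x $ i / (x \<bullet> x)) *\<^sub>R x"
  have perp: "x \<bullet> ?e i = 0" for i
    using inner_self_nonzero[OF assms] by (simp add: inner_diff_right inner_axis)
  have inner_proj: "?e i \<bullet> ?e i = 1 - x $ i * x $ i / (x \<bullet> x)" for i
    using inner_self_nonzero[OF assms]
    by (simp add: inner_diff_right inner_diff_left inner_axis inner_axis' field_simps)
  have "u x * (sphere_laplace V x + (n - 1) * EV x) + V x * (sphere_laplace u x + (n - 1) * Eu x)
     = (\<Sum>i\<in>UNIV. (x \<bullet> x) * (u x * dderiv (?e i) (dderiv (?e i) V) x
     + V x * dderiv (?e i) (dderiv (?e i) u) x))"
    unfolding sum_tangential_second_derivs[OF assms smooth_V, symmetric]
      sum_tangential_second_derivs[OF assms smooth_u, symmetric]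
    by (simp only: sum.distrib[symmetric] sum_distrib_left) (rule sum.cong, simp_all add: algebra_simps)
  also have "\<dots> = (\<Sum>i\<in>UNIV. (x \<bullet> x) * (trace_factor x * (1 - x $ i * x $ i / (x \<bullet> x))))"
    by (simp only: static_tangential[OF assms perp perp] inner_proj)
  also have "\<dots> = (x \<bullet> x) * trace_factor x * (\<Sum>i\<in>(UNIV::'n set). 1)
      - trace_factor x * (\<Sum>i\<in>UNIV. x $ i * x $ i)"
    by (simp only: sum_distrib_left flip: sum_subtractf)
      (rule sum.cong, use inner_self_nonzero[OF assms] in \<open>simp_all add: field_simps\<close>)
  also have "\<dots> = (n - 1) * ((x \<bullet> x) * trace_factor x)" by (simp add: inner_eq_sum[symmetric] algebra_simps)
  finally show ?thesis
    unfolding trace_factor_eq[OF assms] using u_nonzero[OF assms] by (simp add: field_simps)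
qed

lemma laplacian_eq:
  assumes "x \<in> U"
  shows "laplacian (warped_metric u) V x = (\<Sum>i\<in>UNIV. Hess i i x) - chi x * hessian_form x x x"
proof -
  have "laplacian (warped_metric u) V x = (\<Sum>i\<in>UNIV. (\<Sum>j\<in>UNIV. kdelta i j * Hess i j x)
      - (\<Sum>j\<in>UNIV. chi x * (x $ i * x $ j * Hess i j x)))"
    unfolding laplacian_def ginv_eq[OF assms] by (simp only: left_diff_distrib sum_subtractf mult.assoc)
  then show ?thesis by (simp only: sum_kdelta sum_subtractf hessian_form_def sum_distrib_left)
qed

lemma sum_Hess_diagonal:
  assumes "x \<in> U"
  shows "(\<Sum>i\<in>UNIV. Hess i i x) = laplace V x
    - (omega x * lderiv id psi x + n * chi x + chi x * lderiv id psi x * (x \<bullet> x) / 2) * EV x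
    + dderiv (grad psi x) V x * (x \<bullet> x) / 2"
proof -
  have "(\<Sum>i\<in>UNIV. chr_coeff i i x) = omega x * (\<Sum>i\<in>UNIV. x $ i * pd i psi x) + (\<Sum>i\<in>(UNIV::'n set). chi x)
      + chi x * lderiv id psi x / 2 * (\<Sum>i\<in>UNIV. x $ i * x $ i)"
    by (simp only: sum_distrib_left flip: sum.distrib)
      (rule sum.cong, simp_all add: chr_coeff_def field_simps)
  then have trace: "(\<Sum>i\<in>UNIV. chr_coeff i i x)
      = omega x * lderiv id psi x + n * chi x + chi x * lderiv id psi x * (x \<bullet> x) / 2"
    by (simp add: sum_nth_pd[OF differentiable_U[OF smooth_coefficients(1) assms]] inner_eq_sum)
  have "(\<Sum>i\<in>UNIV. Hess i i x)
      = laplace V x - EV x * (\<Sum>i\<in>UNIV. chr_coeff i i x)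
      + dderiv (grad psi x) V x / 2 * (\<Sum>i\<in>UNIV. x $ i * x $ i)"
    unfolding hessian_eq[OF assms] laplace_def
    by (simp only: sum_distrib_left flip: sum.distrib sum_subtractf)
      (rule sum.cong, simp_all add: field_simps)
  then show ?thesis unfolding trace by (simp add: inner_eq_sum)
qed

lemma harmonic_radial:
  assumes "x \<in> U"
  shows "sphere_laplace V x + (n - 1) * omega x * EV x
      = - V x * ((n - 1) * omega x * (Eu x / u x) - sphere_laplace u x / u x)"
proof -
  have trace: "laplace V x
      - (omega x * lderiv id psi x + n * chi x + chi x * lderiv id psi x * (x \<bullet> x) / 2) * EV x
      + dderiv (grad psi x) V x * (x \<bullet> x) / 2 = chi x * hessian_form x x x"
    using harmonic[OF assms] unfolding laplacian_eq[OF assms] sum_Hess_diagonal[OF assms] by simp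
  have radial: "hessian_form x x x = dderiv x (dderiv x V) x
     - (omega x * lderiv id psi x * (x \<bullet> x) + chi x * (x \<bullet> x)
     + chi x * lderiv id psi x * (x \<bullet> x) * (x \<bullet> x) / 2) * EV x
     + dderiv (grad psi x) V x * ((x \<bullet> x) * (x \<bullet> x)) / 2"
    unfolding hessian_form_eq[OF assms] by (simp add: chr_form_def lderiv_def field_simps)
  have chi: "(x \<bullet> x) * chi x = 1 - omega x"
    using coefficient_identities(3)[OF assms] by (simp add: algebra_simps)
  have "(x \<bullet> x) * (chi x * hessian_form x x x) - hessian_form x x x
      = (x \<bullet> x) * laplace V x - dderiv x (dderiv x V) x - (n - 1) * ((x \<bullet> x) * chi x) * EV x"
    unfolding trace[symmetric] by (subst radial) (simp add: field_simps)
  moreover have "(x \<bullet> x) * (chi x * hessian_form x x x) - hessian_form x x x = - omega x * hessian_form x x x"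
    unfolding mult.assoc[symmetric] chi by (simp add: algebra_simps)
  ultimately have "- omega x * hessian_form x x x = sphere_laplace V x + (n - 1) * omega x * EV x"
    unfolding chi sphere_laplace_def lderiv_id_lderiv_id[OF open_U smooth_V assms]
    by (simp add: algebra_simps)
  moreover have "omega x * hessian_form x x x = V x * (omega x * ricci_form x x x)"
    by (simp add: hessian_form_eq_ricci_form[OF assms])
  ultimately show ?thesis unfolding ricci_form_radial[OF assms] by (simp add: lderiv_def algebra_simps)
qed

lemma static_trace:
  assumes "x \<in> U"
  shows "sphere_laplace V x + (n - 1) * omega x * EV x = (n - 1) * (n - 2) / 2 * (1 - omega x) * V x"
    "V x * (sphere_laplace u x / u x - (n - 1) * omega x * (Eu x / u x)
      - (n - 1) * (n - 2) / 2 * (1 - omega x)) = 0"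
proof -
  define L where "L = sphere_laplace u x / u x"
  define M where "M = Eu x / u x"
  have "u x * (sphere_laplace V x + V x * L)
      = u x * ((n - 1) * (- omega x * EV x + V x * ((n - 2) * (1 - omega x) + omega x * M)))"
    using static_tangential_trace[OF assms] u_nonzero[OF assms] by (simp add: L_def M_def algebra_simps)
  then have tangential: "sphere_laplace V x + V x * L
      = (n - 1) * (- omega x * EV x + V x * ((n - 2) * (1 - omega x) + omega x * M))"
    using u_nonzero[OF assms] by simp
  have radial: "sphere_laplace V x + (n - 1) * omega x * EV x = - V x * ((n - 1) * omega x * M - L)"
    using harmonic_radial[OF assms] by (simp add: L_def M_def)
  have "2 * (sphere_laplace V x + (n - 1) * omega x * EV x) = (n - 1) * (n - 2) * (1 - omega x) * V x"
    using tangential radial by (simp add: algebra_simps)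
  then show "sphere_laplace V x + (n - 1) * omega x * EV x = (n - 1) * (n - 2) / 2 * (1 - omega x) * V x"
    by simp
  have "V x * (2 * L - 2 * ((n - 1) * omega x * M) - (n - 1) * (n - 2) * (1 - omega x)) = 0"
    using tangential radial by (simp add: algebra_simps)
  moreover have "2 * (L - (n - 1) * omega x * M - (n - 1) * (n - 2) / 2 * (1 - omega x))
      = 2 * L - 2 * ((n - 1) * omega x * M) - (n - 1) * (n - 2) * (1 - omega x)"
    by (simp add: field_simps)
  ultimately have "V x * (2 * (L - (n - 1) * omega x * M - (n - 1) * (n - 2) / 2 * (1 - omega x))) = 0"
    by (simp only:)
  then show "V x * (sphere_laplace u x / u x - (n - 1) * omega x * (Eu x / u x)
      - (n - 1) * (n - 2) / 2 * (1 - omega x)) = 0"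
    unfolding L_def[symmetric] M_def[symmetric] by (metis mult_eq_0_iff zero_neq_numeral)
qed

lemma smooth_ricci: "smooth_on (Ric i j) U"
  unfolding ricci_def
  by (intro smooth_sum smooth_add smooth_diff smooth_mult smooth_pd smooth_christoffel open_U)

lemma unique_continuation_V:
  assumes "connected U" "open W" "W \<subseteq> U" "W \<noteq> {}" "\<And>x. x \<in> W \<Longrightarrow> V x = 0" "y \<in> U"
  shows "V y = 0"
proof -
  interpret closed_linear_system U V \<Gamma> Ric
  proof
    show "continuous_on U (\<Gamma> k i j)" "continuous_on U (Ric i j)" for k i j
      by (intro smooth_continuous smooth_christoffel smooth_ricci)+
    show "pd i (pd j V) x = (\<Sum>k\<in>UNIV. \<Gamma> k i j x * pd k V x) + V x * Ric i j x" if "x \<in> U" for x i j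
      using static[OF that, of i j] by (simp add: hessian_def)
  qed (fact open_U smooth_V)+
  show ?thesis by (rule unique_continuation[OF assms])
qed

lemma scalar_equation:
  assumes "connected U" "\<exists>y\<in>U. V y \<noteq> 0" "x \<in> U"
  shows "sphere_laplace u x / u x - (n - 1) * omega x * (Eu x / u x) = (n - 1) * (n - 2) / 2 * (1 - omega x)"
proof (rule ccontr)
  define F where
    "F x = sphere_laplace u x / u x - (n - 1) * omega x * (Eu x / u x)
      - (n - 1) * (n - 2) / 2 * (1 - omega x)" for x
  define W where "W = {y \<in> U. F y \<noteq> 0}"
  assume "\<not> ?thesis"
  then have "x \<in> W" using assms(3) by (simp add: F_def W_def)
  have "smooth_on F U" unfolding F_def
    by (intro smooth_diff smooth_mult smooth_divide smooth_const smooth_coefficients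
      smooth_sphere_laplace open_U
        smooth_u smooth_lderiv linear_id u_nonzero)
  then have "continuous_on U F" by (rule smooth_continuous)
  then have "open W"
    using continuous_open_preimage[OF _ open_U, of F "- {0}"]
    by (simp add: W_def vimage_def Int_def open_Compl)
  moreover have "V y = 0" if "y \<in> W" for y
    using static_trace(2)[of y] that by (auto simp: F_def W_def)
  ultimately have "V y = 0" if "y \<in> U" for y
    using unique_continuation_V[OF assms(1) _ _ _ _ that, of W] \<open>x \<in> W\<close> by (auto simp: W_def)
  then show False using assms(2) by blast
qed

end

section \<open>Parallel tangential gradients\<close>

definition skew :: "('a::real_inner \<Rightarrow> 'a) \<Rightarrow> bool" where
  "skew A \<longleftrightarrow> linear A \<and> (\<forall>y. y \<bullet> A y = 0)"

lemma skew_rot [simp]: "skew (rot a b)"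
  by (simp add: skew_def inner_rot_self)

lemma skew_commutator:
  assumes "skew A" "skew B"
  shows "skew (\<lambda>y. A (B y) - B (A y))"
  unfolding skew_def
proof (intro conjI allI)
  have A: "linear A" "\<And>y. y \<bullet> A y = 0" and B: "linear B" "\<And>y. y \<bullet> B y = 0"
    using assms by (auto simp: skew_def)
  show "linear (\<lambda>y. A (B y) - B (A y))"
    using linear_compose_sub[OF linear_compose[OF B(1) A(1)] linear_compose[OF A(1) B(1)]]
    by (simp add: o_def)
  show "y \<bullet> (A (B y) - B (A y)) = 0" for y
    using skew_inner[OF A, of y "B y"] skew_inner[OF B, of y "A y"]
    by (simp add: inner_diff_right inner_commute)
qed

context static_quasi_spherical begin

lemma smooth_radial_derivs [smooth_intros]: "smooth_on EV U" "smooth_on Eu U" "smooth_on mixed_coeff U"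
  unfolding mixed_coeff_def
  by (intro smooth_lderiv smooth_add smooth_mult smooth_const open_U linear_id smooth_V smooth_u)+

lemma lderiv_EV:
  assumes "x \<in> U" "skew A"
  shows "u x * lderiv A EV x = u x * lderiv A V x + lderiv A u x * mixed_coeff x"
  using static_mixed[of x "A x"] assms u_nonzero[OF assms(1)]
  by (simp add: skew_def lderiv_def[of A] field_simps)

lemma lderiv_lderiv_EV:
  assumes "x \<in> U" "skew A" "linear B"
  shows "lderiv B u x * lderiv A EV x + u x * lderiv B (lderiv A EV) x
    = lderiv B u x * lderiv A V x + u x * lderiv B (lderiv A V) x
      + lderiv B (lderiv A u) x * mixed_coeff x + lderiv A u x * (lderiv B EV x + (n - 2) * lderiv B V x)"
proof -
  have A: "linear A" using assms(2) by (simp add: skew_def)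
  note smooth = smooth_mult smooth_lderiv smooth_const smooth_u smooth_V smooth_radial_derivs open_U A
  have diff: "u differentiable (at x)" "EV differentiable (at x)" "mixed_coeff differentiable (at x)"
    "lderiv A u differentiable (at x)" "lderiv A V differentiable (at x)" "lderiv A EV differentiable (at x)"
    "(\<lambda>y. u y * lderiv A V y) differentiable (at x)"
      "(\<lambda>y. lderiv A u y * mixed_coeff y) differentiable (at x)"
    by (intro differentiable_U[OF _ assms(1)] smooth)+
  have mixed: "lderiv B mixed_coeff x = lderiv B EV x + (n - 2) * lderiv B V x"
    unfolding mixed_coeff_def
    by (subst lderiv_arith | (intro differentiable_U[OF _ assms(1)] smooth))+ (simp add: lderiv_def)
  have "lderiv B (\<lambda>y. u y * lderiv A EV y) x
      = lderiv B (\<lambda>y. u y * lderiv A V y + lderiv A u y * mixed_coeff y) x"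
    by (rule lderiv_cong_open[OF open_U assms(1)]) (rule lderiv_EV[OF _ assms(2)])
  then show ?thesis
    by (simp add: lderiv_arith diff mixed algebra_simps)
qed

text \<open>Commute \<open>A\<close> and \<open>B\<close> in the previous identity: the commutator is again skew, so all second
  derivatives cancel.\<close>

lemma tangential_grads_parallel:
  assumes "x \<in> U" "skew A" "skew B" "n > 1"
  shows "lderiv A u x * lderiv B V x = lderiv B u x * lderiv A V x"
proof -
  define C where "C y = A (B y) - B (A y)" for y
  have lin: "linear A" "linear B" using assms by (auto simp: skew_def)
  have "skew C" using skew_commutator[OF assms(2,3)] by (simp add: C_def[abs_def])
  have commutator: "lderiv B (lderiv A f) x - lderiv A (lderiv B f) x = lderiv C f x" if "smooth_on f U" for f
    using lderiv_commutator[OF open_U that assms(1) lin(2,1)] by (simp add: C_def lderiv_def[of C])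
  define W where "W = lderiv A u x * lderiv B V x - lderiv B u x * lderiv A V x"
  define W' where "W' = lderiv A u x * lderiv B EV x - lderiv B u x * lderiv A EV x"
  have "u x * (lderiv B (lderiv A EV) x - lderiv A (lderiv B EV) x)
      = u x * (lderiv B (lderiv A V) x - lderiv A (lderiv B V) x)
     + (lderiv B (lderiv A u) x - lderiv A (lderiv B u) x) * mixed_coeff x - W + W' + (n - 2) * W + W'"
    using lderiv_lderiv_EV[OF assms(1,2) lin(2)] lderiv_lderiv_EV[OF assms(1,3) lin(1)]
    by (simp add: W_def W'_def algebra_simps)
  then have sum_zero: "2 * W' + (n - 3) * W = 0"
    unfolding commutator[OF smooth_u] commutator[OF smooth_V] commutator[OF smooth_radial_derivs(1)]
    using lderiv_EV[OF assms(1) \<open>skew C\<close>] by (simp add: algebra_simps)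
  have "u x * W' = lderiv A u x * (u x * lderiv B EV x) - lderiv B u x * (u x * lderiv A EV x)"
    by (simp add: W'_def algebra_simps)
  also have "\<dots> = u x * W"
    unfolding lderiv_EV[OF assms(1,3)] lderiv_EV[OF assms(1,2)] by (simp add: W_def algebra_simps)
  finally have "W' = W" using u_nonzero[OF assms(1)] by simp
  then have "(n - 1) * W = 0" using sum_zero by (simp add: algebra_simps)
  then show ?thesis using assms(4) by (simp add: W_def)
qed

lemma radial_deriv_grads_parallel:
  assumes "x \<in> U" "skew A" "skew B" "n > 1"
  shows "lderiv A Eu x * lderiv B V x = lderiv B Eu x * lderiv A V x"
proof -
  have lin: "linear A" "linear B" using assms by (auto simp: skew_def)
  have diff: "lderiv C u differentiable (at x)" "lderiv C V differentiable (at x)" if "linear C" for C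
    by (intro differentiable_U[OF _ assms(1)] smooth_lderiv[OF open_U] that smooth_u smooth_V)+
  have "lderiv id (\<lambda>y. lderiv A u y * lderiv B V y) x = lderiv id (\<lambda>y. lderiv B u y * lderiv A V y) x"
    by (rule lderiv_cong_open[OF open_U assms(1)]) (rule tangential_grads_parallel[OF _ assms(2-4)])
  then have radial: "lderiv A u x * lderiv B EV x + lderiv A Eu x * lderiv B V x
      = lderiv B u x * lderiv A EV x + lderiv B Eu x * lderiv A V x"
    by (simp add: lderiv_arith diff lin lderiv_id_commute[OF open_U _ assms(1)] smooth_u smooth_V)
  have "u x * (lderiv A u x * lderiv B EV x) - u x * (lderiv B u x * lderiv A EV x)
      = u x * (lderiv A u x * lderiv B V x - lderiv B u x * lderiv A V x)"
    using lderiv_EV[OF assms(1,3)] lderiv_EV[OF assms(1,2)] by algebra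
  then show ?thesis using tangential_grads_parallel[OF assms] radial u_nonzero[OF assms(1)] by simp
qed

lemma radial_deriv_grad_parallel_u:
  assumes "x \<in> U" "skew A" "skew B" "n > 1" "mixed_coeff x \<noteq> 0"
  shows "lderiv A Eu x * lderiv B u x = lderiv B Eu x * lderiv A u x"
proof -
  define D where "D = lderiv A Eu x * lderiv B u x - lderiv B Eu x * lderiv A u x"
  note parallel = tangential_grads_parallel[OF assms(1-4)] radial_deriv_grads_parallel[OF assms(1-4)]
  have "D * lderiv A V x = 0" "D * lderiv B V x = 0" using parallel unfolding D_def by algebra+
  moreover have "D = 0" if zero: "lderiv A V x = 0" "lderiv B V x = 0"
  proof -
    have lin: "linear A" "linear B" using assms by (auto simp: skew_def)
    have diff: "lderiv C Eu differentiable (at x)" "lderiv C V differentiable (at x)" if "linear C" for C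
      by (intro differentiable_U[OF _ assms(1)] smooth_lderiv[OF open_U] that smooth_radial_derivs smooth_V)+
    have "lderiv id (\<lambda>y. lderiv A Eu y * lderiv B V y) x = lderiv id (\<lambda>y. lderiv B Eu y * lderiv A V y) x"
      by (rule lderiv_cong_open[OF open_U assms(1)]) (rule radial_deriv_grads_parallel[OF _ assms(2-4)])
    then have "lderiv A Eu x * lderiv B EV x = lderiv B Eu x * lderiv A EV x"
      using zero by (simp add: lderiv_arith diff lin lderiv_id_commute[OF open_U smooth_V assms(1)])
    then have "D * mixed_coeff x = 0"
      using lderiv_EV[OF assms(1,3)] lderiv_EV[OF assms(1,2)] zero unfolding D_def by algebra
    then show "D = 0" using assms(5) by simp
  qed
  ultimately have "D = 0" by auto
  then show ?thesis by (simp add: D_def)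
qed

lemma tangential_dderivs_parallel:
  assumes "x \<in> U" "x \<bullet> X = 0" "x \<bullet> Y = 0" "n > 1"
  shows "dderiv X u x * dderiv Y V x = dderiv Y u x * dderiv X V x"
  using tangential_grads_parallel[OF assms(1) skew_rot skew_rot assms(4), of x X x Y]
    inner_self_nonzero[OF assms(1)]
  by (simp add: lderiv_rot_at_center assms differentiable_U[OF smooth_u assms(1)]
    differentiable_U[OF smooth_V assms(1)])

lemma radial_deriv_dderivs_parallel:
  assumes "x \<in> U" "x \<bullet> X = 0" "x \<bullet> Y = 0" "n > 1" "mixed_coeff x \<noteq> 0"
  shows "dderiv X Eu x * dderiv Y u x = dderiv Y Eu x * dderiv X u x"
  using radial_deriv_grad_parallel_u[OF assms(1) skew_rot skew_rot assms(4,5), of x X x Y]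
    inner_self_nonzero[OF assms(1)]
  by (simp add: lderiv_rot_at_center assms differentiable_U[OF smooth_u assms(1)]
    differentiable_U[OF smooth_radial_derivs(2) assms(1)])

end

section \<open>Plane slices\<close>

lemma span_orthonormal_pair:
  assumes "orthonormal_pair a b"
  shows "x \<in> span {a, b} \<longleftrightarrow> x = (x \<bullet> a) *\<^sub>R a + (x \<bullet> b) *\<^sub>R b"
proof
  assume "x \<in> span {a, b}"
  then obtain s where "x - s *\<^sub>R a \<in> span {b}" unfolding span_breakdown_eq by blast
  then obtain t where t: "x - s *\<^sub>R a = t *\<^sub>R b" unfolding span_singleton by blast
  then have x: "x = s *\<^sub>R a + t *\<^sub>R b" by (simp add: algebra_simps)
  show "x = (x \<bullet> a) *\<^sub>R a + (x \<bullet> b) *\<^sub>R b"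
    unfolding x using orthonormal_pairD[OF assms] by (simp add: inner_add_left)
next
  assume x: "x = (x \<bullet> a) *\<^sub>R a + (x \<bullet> b) *\<^sub>R b"
  show "x \<in> span {a, b}" by (subst x) (intro span_add span_scale span_base; simp)
qed

lemma inner_span_pair:
  assumes "x \<in> span {a, b}" "e \<bullet> a = 0" "e \<bullet> b = 0"
  shows "x \<bullet> e = 0"
proof -
  have "orthogonal e x"
    by (rule orthogonal_to_span[OF assms(1)]) (use assms(2,3) in \<open>auto simp: orthogonal_def\<close>)
  then show ?thesis by (simp add: orthogonal_def inner_commute)
qed

lemma rot_in_span: "rot a b x \<in> span {a, b}"
  unfolding rot_def by (intro span_diff span_scale span_base) auto

lemma rot_rot_in_plane:
  assumes "orthonormal_pair a b" "x \<in> span {a, b}"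
  shows "rot a b (rot a b x) = - x"
proof -
  have "rot a b (rot a b x) = - ((x \<bullet> a) *\<^sub>R a + (x \<bullet> b) *\<^sub>R b)"
    using orthonormal_pairD[OF assms(1)] by (simp add: rot_def inner_diff_left)
  then show ?thesis using assms(2) unfolding span_orthonormal_pair[OF assms(1)] by simp
qed

lemma inner_rot_rot:
  assumes "orthonormal_pair a b" "x \<in> span {a, b}"
  shows "rot a b x \<bullet> rot a b x = x \<bullet> x"
  using skew_inner[OF linear_rot inner_rot_self, of "rot a b x" a b x]
  by (simp add: rot_rot_in_plane[OF assms])

lemma plane_decomposition:
  assumes "orthonormal_pair a b" "x \<in> span {a, b}" "v \<in> span {a, b}"
  shows "(x \<bullet> x) *\<^sub>R v = (v \<bullet> x) *\<^sub>R x + (v \<bullet> rot a b x) *\<^sub>R rot a b x"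
proof -
  define \<alpha> \<beta> s t where coords: "\<alpha> = x \<bullet> a" "\<beta> = x \<bullet> b" "s = v \<bullet> a" "t = v \<bullet> b"
  note ab = orthonormal_pairD[OF assms(1)]
  have x: "x = \<alpha> *\<^sub>R a + \<beta> *\<^sub>R b" and v: "v = s *\<^sub>R a + t *\<^sub>R b"
    using assms(2,3) unfolding span_orthonormal_pair[OF assms(1)] coords by blast+
  have rot_x: "rot a b x = \<alpha> *\<^sub>R b - \<beta> *\<^sub>R a" by (simp add: rot_def coords)
  have inners: "x \<bullet> x = \<alpha> * \<alpha> + \<beta> * \<beta>" "v \<bullet> x = s * \<alpha> + t * \<beta>" "v \<bullet> (\<alpha> *\<^sub>R b - \<beta> *\<^sub>R a) = t * \<alpha> - s * \<beta>"
    using ab by (simp_all add: x v inner_add_left inner_add_right inner_diff_right)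
  show ?thesis unfolding rot_x inners unfolding x v by (simp add: algebra_simps)
qed

definition sphere_hessian :: "real^'n::finite \<Rightarrow> (real^'n \<Rightarrow> real) \<Rightarrow> real^'n \<Rightarrow> real" where
  "sphere_hessian e f x = (x \<bullet> x) * dderiv e (dderiv e f) x - (e \<bullet> e) * lderiv id f x"

lemma smooth_sphere_hessian [smooth_intros]: "open U \<Longrightarrow> smooth_on f U \<Longrightarrow> smooth_on (sphere_hessian e f) U"
  unfolding sphere_hessian_def
  by (intro smooth_diff smooth_mult smooth_inner_self smooth_dderiv smooth_const smooth_lderiv linear_id)

lemma dderiv_lderiv_id:
  assumes "open U" "smooth_on f U" "x \<in> U"
  shows "dderiv e (lderiv id f) x = dderiv x (dderiv e f) x + dderiv e f x"
  using dderiv_lderiv[OF assms linear_id, of e] dderiv_commute[OF assms, of e x] by simp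

lemma dderiv_lderiv_rot_perp:
  assumes "open U" "smooth_on f U" "x \<in> U" "e \<bullet> a = 0" "e \<bullet> b = 0"
  shows "dderiv e (lderiv (rot a b) f) x = lderiv (rot a b) (dderiv e f) x"
proof -
  have "rot a b e = 0" using assms(4,5) by (simp add: rot_def)
  then show ?thesis
    using dderiv_lderiv[OF assms(1-3) linear_rot, of e a b] dderiv_commute[OF assms(1-3), of e "rot a b x"]
      dderiv_linear(5)[OF smooth_differentiable[OF assms(1-3)]]
        by (simp add: lderiv_def[of "rot a b" "dderiv e f"])
qed

lemma sphere_hessian_rot_commute:
  assumes "open U" "smooth_on f U" "x \<in> U" "e \<bullet> a = 0" "e \<bullet> b = 0"
  shows "sphere_hessian e (lderiv (rot a b) f) x = lderiv (rot a b) (sphere_hessian e f) x"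
proof -
  have "dderiv e (dderiv e (lderiv (rot a b) f)) x = dderiv e (lderiv (rot a b) (dderiv e f)) x"
    by (rule dderiv_cong_open[OF assms(1,3)]) (rule dderiv_lderiv_rot_perp[OF assms(1,2) _ assms(4,5)])
  also have "\<dots> = lderiv (rot a b) (dderiv e (dderiv e f)) x"
    by (rule dderiv_lderiv_rot_perp[OF assms(1) smooth_dderiv[OF assms(1,2)] assms(3-5)])
  finally have second: "dderiv e (dderiv e (lderiv (rot a b) f)) x
      = lderiv (rot a b) (dderiv e (dderiv e f)) x" .
  have "lderiv (rot a b) (sphere_hessian e f) x
      = (x \<bullet> x) * lderiv (rot a b) (dderiv e (dderiv e f)) x - (e \<bullet> e) * lderiv (rot a b) (lderiv id f) x"
    unfolding sphere_hessian_def
    by (subst lderiv_arith |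
      (intro smooth_differentiable[OF assms(1) _ assms(3)] smooth_mult smooth_inner_self smooth_dderiv
          smooth_const smooth_lderiv linear_id assms(1,2)))+
      (simp add: lderiv_def[of "rot a b" "\<lambda>y. y \<bullet> y"] lderiv_def[of "rot a b" "\<lambda>y. e \<bullet> e"] inner_rot_self)
  then show ?thesis
    unfolding sphere_hessian_def[of e "lderiv (rot a b) f"] second lderiv_id_commute[OF assms(1-3) linear_rot]
    by simp
qed

lemma sphere_hessian_radial_commute:
  assumes "open U" "smooth_on f U" "x \<in> U"
  shows "sphere_hessian e (lderiv id f) x = lderiv id (sphere_hessian e f) x"
proof -
  note smooth = smooth_mult smooth_inner_self smooth_dderiv smooth_const smooth_lderiv linear_id assms(1,2)
  have "dderiv e (dderiv e (lderiv id f)) x = dderiv e (\<lambda>y. lderiv id (dderiv e f) y + dderiv e f y) x"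
    by (rule dderiv_cong_open[OF assms(1,3)]) (simp add: dderiv_lderiv_id[OF assms(1,2)] lderiv_def)
  also have "\<dots> = dderiv e (lderiv id (dderiv e f)) x + dderiv e (dderiv e f) x"
    by (subst dderiv_arith | (intro smooth_differentiable[OF assms(1) _ assms(3)] smooth))+ simp
  also have "dderiv e (lderiv id (dderiv e f)) x
      = dderiv x (dderiv e (dderiv e f)) x + dderiv e (dderiv e f) x"
    by (rule dderiv_lderiv_id[OF assms(1) smooth_dderiv[OF assms(1,2)] assms(3)])
  finally have second: "dderiv e (dderiv e (lderiv id f)) x
      = dderiv x (dderiv e (dderiv e f)) x + 2 * dderiv e (dderiv e f) x"
    by linarith
  have "lderiv id (sphere_hessian e f) x
      = (x \<bullet> x) * dderiv x (dderiv e (dderiv e f)) x + 2 * (x \<bullet> x) * dderiv e (dderiv e f) x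
      - (e \<bullet> e) * lderiv id (lderiv id f) x"
    unfolding sphere_hessian_def
    by (subst lderiv_arith | (intro smooth_differentiable[OF assms(1) _ assms(3)] smooth))+
      (simp add: lderiv_def)
  then show ?thesis unfolding sphere_hessian_def[of e "lderiv id f"] second by (simp add: algebra_simps)
qed

lemma laplace_split_plane:
  fixes f :: "real^'n::finite \<Rightarrow> real"
  assumes f: "open U" "smooth_on f U" "x \<in> U" and ab: "orthonormal_pair a b"
    and mixed: "\<And>v e. v \<in> {a, b} \<Longrightarrow> e \<bullet> a = 0 \<Longrightarrow> e \<bullet> b = 0 \<Longrightarrow> dderiv v (dderiv e f) x = 0"
    and normal: "\<And>e. e \<bullet> a = 0 \<Longrightarrow> e \<bullet> b = 0 \<Longrightarrow> dderiv e (dderiv e f) x = k * (e \<bullet> e)"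
  shows "laplace f x = dderiv a (dderiv a f) x + dderiv b (dderiv b f) x + (real CARD('n) - 2) * k"
proof -
  note ab = orthonormal_pairD[OF ab]
  define e where "e i = axis i 1 - (a $ i *\<^sub>R a + b $ i *\<^sub>R b)" for i
  have perp: "e i \<bullet> a = 0" "e i \<bullet> b = 0" for i
    using ab by (simp_all add: e_def inner_diff_left inner_add_left inner_axis')
  have inner_e: "e i \<bullet> e i = 1 - a $ i * a $ i - b $ i * b $ i" for i
    using ab by (simp add: e_def inner_diff_left inner_diff_right inner_add_left inner_add_right inner_axis
      inner_axis')
  have zero: "dderiv a (dderiv (e i) f) x = 0" "dderiv b (dderiv (e i) f) x = 0"
    "dderiv (e i) (dderiv a f) x = 0" "dderiv (e i) (dderiv b f) x = 0" for i
    using mixed[OF _ perp, of _ i] dderiv_commute[OF f, of "e i"] by auto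
  have "dderiv (axis i 1) (dderiv (axis i 1) f) x = (a $ i * a $ i) * dderiv a (dderiv a f) x
      + (2 * dderiv a (dderiv b f) x) * (a $ i * b $ i) + (b $ i * b $ i) * dderiv b (dderiv b f) x
      + k * (e i \<bullet> e i)" for i
  proof -
    have "axis i 1 = a $ i *\<^sub>R a + b $ i *\<^sub>R b + e i" by (simp add: e_def)
    then show ?thesis
      by (simp only: dderiv_dderiv_linear[OF f]
        dderiv_linear[OF smooth_differentiable[OF f(1) smooth_dderiv[OF f(1,2)] f(3)]]
          zero normal[OF perp] dderiv_commute[OF f, of b a]) (simp add: algebra_simps)
  qed
  then have "laplace f x
      = (\<Sum>i\<in>UNIV. a $ i * a $ i) * dderiv a (dderiv a f) x
      + 2 * dderiv a (dderiv b f) x * (\<Sum>i\<in>UNIV. a $ i * b $ i)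
      + (\<Sum>i\<in>UNIV. b $ i * b $ i) * dderiv b (dderiv b f) x
      + k * ((\<Sum>i\<in>(UNIV::'n set). 1) - (\<Sum>i\<in>UNIV. a $ i * a $ i) - (\<Sum>i\<in>UNIV. b $ i * b $ i))"
    unfolding laplace_eq_sum_dderiv inner_e
    by (simp only: sum_distrib_left sum_distrib_right flip: sum.distrib sum_subtractf)
  moreover have "(\<Sum>i\<in>UNIV. a $ i * a $ i) = 1" "(\<Sum>i\<in>UNIV. b $ i * b $ i) = 1" "(\<Sum>i\<in>UNIV. a $ i * b $ i) = 0"
    using ab by (simp_all add: inner_eq_sum)
  ultimately show ?thesis by (simp add: algebra_simps)
qed

lemma plane_second_derivs:
  assumes f: "open U" "smooth_on f U" "x \<in> U" and "orthonormal_pair a b" "x \<in> span {a, b}"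
  shows "(x \<bullet> x) * (dderiv a (dderiv a f) x + dderiv b (dderiv b f) x)
    = dderiv x (dderiv x f) x + dderiv (rot a b x) (dderiv (rot a b x) f) x"
proof -
  define \<alpha> \<beta> where coords: "\<alpha> = x \<bullet> a" "\<beta> = x \<bullet> b"
  define H where "H v w = dderiv v (dderiv w f) x" for v w
  have sym: "H b a = H a b" unfolding H_def by (rule dderiv_commute[OF f])
  have bilinear: "H (s *\<^sub>R a + t *\<^sub>R b) (s *\<^sub>R a + t *\<^sub>R b) = s * s * H a a + 2 * s * t * H a b + t * t * H b b"
    for s t
    unfolding H_def dderiv_dderiv_linear[OF f]
      dderiv_linear[OF smooth_differentiable[OF f(1) smooth_dderiv[OF f(1,2)] f(3)]]
    using sym by (simp add: H_def algebra_simps)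
  have x: "x = \<alpha> *\<^sub>R a + \<beta> *\<^sub>R b" using assms(5) unfolding span_orthonormal_pair[OF assms(4)] coords .
  have rot_x: "rot a b x = (- \<beta>) *\<^sub>R a + \<alpha> *\<^sub>R b" by (simp add: rot_def coords)
  have "x \<bullet> x = \<alpha> * \<alpha> + \<beta> * \<beta>" using arg_cong[OF x, of "inner x"] by (simp add: inner_add_right coords)
  moreover have "H x x = \<alpha> * \<alpha> * H a a + 2 * \<alpha> * \<beta> * H a b + \<beta> * \<beta> * H b b" using x bilinear by metis
  moreover have "H (rot a b x) (rot a b x) = \<beta> * \<beta> * H a a - 2 * \<alpha> * \<beta> * H a b + \<alpha> * \<alpha> * H b b"
    unfolding rot_x bilinear by simp
  ultimately show ?thesis unfolding H_def[symmetric] by (simp add: algebra_simps)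
qed

locale plane_slice = static_quasi_spherical U u V n for U :: "(real^'n::finite) set" and u V n +
  fixes B :: "(real^'n) set" and a b e0 p :: "real^'n"
  assumes open_B: "open B" and convex_B: "convex B" and B_subset: "B \<subseteq> U" and p_in_B: "p \<in> B"
    and n_gt_1: "n > 1"
    and orthonormal: "orthonormal_pair a b" and p_in_plane: "p \<in> span {a, b}"
    and unit_normal: "e0 \<bullet> e0 = 1" "e0 \<bullet> a = 0" "e0 \<bullet> b = 0"
    and normal_deriv_p: "\<And>e. e \<bullet> a = 0 \<Longrightarrow> e \<bullet> b = 0 \<Longrightarrow> dderiv e u p = 0"
    and V_nonzero: "\<And>x. x \<in> B \<Longrightarrow> V x \<noteq> 0"
    and S_u_nonzero: "\<And>x. x \<in> B \<Longrightarrow> lderiv (rot a b) u x \<noteq> 0"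
    and S_uV_nonzero: "\<And>x. x \<in> B \<Longrightarrow> u x * lderiv (rot a b) V x + V x * lderiv (rot a b) u x \<noteq> 0"
    and mixed_coeff_nonzero: "\<And>x. x \<in> B \<Longrightarrow> mixed_coeff x \<noteq> 0"
begin

abbreviation J where "J \<equiv> rot a b"
abbreviation S where "S \<equiv> lderiv J"
definition slice where "slice = B \<inter> span {a, b}"
definition perp where "perp e \<longleftrightarrow> e \<bullet> a = 0 \<and> e \<bullet> b = 0"

lemma B_in_U: "x \<in> B \<Longrightarrow> x \<in> U" using B_subset by blast

lemma sliceD: "x \<in> slice \<Longrightarrow> x \<in> B" "x \<in> slice \<Longrightarrow> x \<in> U" "x \<in> slice \<Longrightarrow> x \<in> span {a, b}"
  using B_subset by (auto simp: slice_def)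

lemma inner_perp: "x \<in> slice \<Longrightarrow> perp e \<Longrightarrow> x \<bullet> e = 0"
  by (auto simp: perp_def intro: inner_span_pair dest: sliceD(3))

lemma smooth_B [smooth_intros]: "smooth_on u B" "smooth_on V B" "smooth_on EV B" "smooth_on Eu B"
  "smooth_on omega B"
  by (intro smooth_on_subset[OF _ B_subset] smooth_u smooth_V smooth_radial_derivs smooth_coefficients)+

lemmas differentiable_B = smooth_differentiable[OF open_B]

lemma omega_nonzero: "x \<in> U \<Longrightarrow> omega x \<noteq> 0"
  using u_nonzero by (simp add: omega_def)

lemma slice_line:
  assumes "x \<in> slice" "v \<in> span {a, b}"
  shows "\<forall>\<^sub>F t in nhds 0. x + t *\<^sub>R v \<in> slice"
proof -
  have "((\<lambda>t. x + t *\<^sub>R v) \<longlongrightarrow> x + 0 *\<^sub>R v) (nhds 0)" by (intro tendsto_intros filterlim_ident)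
  then have "\<forall>\<^sub>F t in nhds 0. x + t *\<^sub>R v \<in> B"
    using topological_tendstoD[OF _ open_B, of "\<lambda>t. x + t *\<^sub>R v"] sliceD(1)[OF assms(1)] by simp
  moreover have "x + t *\<^sub>R v \<in> span {a, b}" for t
    using sliceD(3)[OF assms(1)] assms(2) by (intro span_add span_scale)
  ultimately show ?thesis by (simp add: slice_def)
qed

lemma dderiv_eq_on_slice:
  assumes "x \<in> slice" "v \<in> span {a, b}" "f differentiable (at x)"
    and "\<And>z. z \<in> slice \<Longrightarrow> f z = g z" "((\<lambda>t. g (x + t *\<^sub>R v)) has_real_derivative D) (at 0)"
  shows "dderiv v f x = D"
proof (rule dderiv_eq_line_derivative[OF assms(3)])
  have "\<forall>\<^sub>F t in nhds 0. g (x + t *\<^sub>R v) = f (x + t *\<^sub>R v)"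
    using slice_line[OF assms(1,2)] by (rule eventually_mono) (use assms(4) in auto)
  then show "((\<lambda>t. f (x + t *\<^sub>R v)) has_real_derivative D) (at 0)"
    using DERIV_cong_ev[OF refl _ refl, of "\<lambda>t. g (x + t *\<^sub>R v)" "\<lambda>t. f (x + t *\<^sub>R v)" 0 D] assms(5) by simp
qed

lemma dderiv_cong_slice:
  assumes "x \<in> slice" "v \<in> span {a, b}" "f differentiable (at x)" "g differentiable (at x)"
    and "\<And>z. z \<in> slice \<Longrightarrow> f z = g z"
  shows "dderiv v f x = dderiv v g x"
  using dderiv_eq_on_slice[OF assms(1-3,5)] DERIV_along_line[of g x 0 v] assms(4) by simp

definition grad_ratio where "grad_ratio x = S V x / S u x"
definition radial_rate where "radial_rate x = S Eu x / S u x - 1"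
definition angular_rate where "angular_rate x = - (u x * S grad_ratio x / (u x * grad_ratio x + V x))"

lemma grad_ratio_nonzero: "x \<in> B \<Longrightarrow> u x * grad_ratio x + V x \<noteq> 0"
  using S_uV_nonzero[of x] S_u_nonzero[of x] by (simp add: grad_ratio_def field_simps)

lemma smooth_rates [smooth_intros]: "smooth_on (S u) B" "smooth_on (S V) B" "smooth_on grad_ratio B"
  "smooth_on radial_rate B" "smooth_on angular_rate B"
proof -
  show first: "smooth_on (S u) B" "smooth_on (S V) B" by (intro smooth_lderiv open_B linear_rot smooth_B)+
  show ratio: "smooth_on grad_ratio B"
    unfolding grad_ratio_def by (intro smooth_divide open_B first S_u_nonzero)
  show "smooth_on radial_rate B" unfolding radial_rate_def
    by (intro smooth_divide smooth_diff smooth_const smooth_lderiv open_B linear_rot first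
      S_u_nonzero smooth_B)
  show "smooth_on angular_rate B" unfolding angular_rate_def
    by (intro smooth_minus smooth_divide smooth_mult smooth_add smooth_lderiv linear_rot open_B smooth_B ratio
      grad_ratio_nonzero)
qed

lemma dderiv_V_perp: "x \<in> slice \<Longrightarrow> perp e \<Longrightarrow> dderiv e V x = grad_ratio x * dderiv e u x"
  using tangential_dderivs_parallel[OF sliceD(2) inner_perp inner_rot_self n_gt_1, of x e a b]
    S_u_nonzero[OF sliceD(1), of x]
  by (simp add: grad_ratio_def lderiv_def field_simps)

lemma radial_deriv_normal_u:
  assumes "x \<in> slice" "perp e"
  shows "dderiv x (dderiv e u) x = radial_rate x * dderiv e u x"
proof -
  have "dderiv e Eu x * S u x = S Eu x * dderiv e u x"
    using radial_deriv_dderivs_parallel[OF sliceD(2) inner_perp inner_rot_self n_gt_1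
      mixed_coeff_nonzero[OF sliceD(1)], of x e a b] assms
    by (simp add: lderiv_def)
  then show ?thesis
    using dderiv_lderiv_id[OF open_U smooth_u sliceD(2)[OF assms(1)], of e]
      S_u_nonzero[OF sliceD(1)[OF assms(1)]]
    by (simp add: radial_rate_def field_simps)
qed

lemma angular_deriv_normal_u:
  assumes "x \<in> slice" "perp e"
  shows "dderiv (J x) (dderiv e u) x = angular_rate x * dderiv e u x"
proof -
  note xB = sliceD(1)[OF assms(1)]
  have diff: "dderiv e u differentiable (at x)" "dderiv e V differentiable (at x)"
    "grad_ratio differentiable (at x)"
    by (intro differentiable_B[OF _ xB] smooth_dderiv smooth_rates smooth_B open_B)+
  have "dderiv (J x) (dderiv e V) x = dderiv (J x) (\<lambda>z. grad_ratio z * dderiv e u z) x"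
    by (rule dderiv_cong_slice[OF assms(1) rot_in_span diff(2)])
      (auto intro!: differentiable_B[OF _ xB] smooth_mult smooth_dderiv smooth_rates smooth_B open_B
      dderiv_V_perp assms(2))
  also have "\<dots> = grad_ratio x * dderiv (J x) (dderiv e u) x + S grad_ratio x * dderiv e u x"
    by (subst dderiv_arith[OF diff(3,1)]) (simp add: lderiv_def)
  finally have angular_V: "dderiv (J x) (dderiv e V) x
      = grad_ratio x * dderiv (J x) (dderiv e u) x + S grad_ratio x * dderiv e u x" .
  have "J x \<bullet> e = 0" using assms(2) by (auto simp: perp_def intro: inner_span_pair rot_in_span)
  then have "u x * dderiv (J x) (dderiv e V) x + V x * dderiv (J x) (dderiv e u) x = 0"
    using static_tangential[OF sliceD(2)[OF assms(1)] inner_rot_self inner_perp[OF assms]] by simp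
  then have "(u x * grad_ratio x + V x) * dderiv (J x) (dderiv e u) x
      = - (u x * S grad_ratio x * dderiv e u x)"
    unfolding angular_V by (simp add: algebra_simps)
  then show ?thesis using grad_ratio_nonzero[OF xB] by (simp add: angular_rate_def field_simps)
qed

lemma segment_in_slice:
  assumes "x \<in> slice" "0 \<le> t" "t \<le> 1"
  shows "p + t *\<^sub>R (x - p) \<in> slice"
proof -
  have segment: "p + t *\<^sub>R (x - p) = (1 - t) *\<^sub>R p + t *\<^sub>R x" by (simp add: algebra_simps)
  have "p + t *\<^sub>R (x - p) \<in> B"
    unfolding segment using convex_B p_in_B sliceD(1)[OF assms(1)] assms(2,3) by (simp add: convex_alt)
  moreover have "p + t *\<^sub>R (x - p) \<in> span {a, b}"
    using p_in_plane sliceD(3)[OF assms(1)] by (intro span_add span_scale span_diff)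
  ultimately show ?thesis by (simp add: slice_def)
qed

text \<open>Along a segment in the slice the normal derivative solves a homogeneous linear ordinary differential equation.\<close>

lemma normal_deriv_u:
  assumes "x \<in> slice" "perp e"
  shows "dderiv e u x = 0"
proof -
  define v where "v = x - p"
  note segment = segment_in_slice[OF assms(1), folded v_def]
  have v: "v \<in> span {a, b}" using p_in_plane sliceD(3)[OF assms(1)] unfolding v_def by (intro span_diff)
  define k where "k z = (z \<bullet> v) / (z \<bullet> z) * radial_rate z
      + ((z \<bullet> a) * (b \<bullet> v) - (z \<bullet> b) * (a \<bullet> v)) / (z \<bullet> z) * angular_rate z" for z
  have "smooth_on k B" unfolding k_def
    by (intro smooth_add smooth_mult smooth_divide smooth_diff smooth_const smooth_inner smooth_inner_self
      smooth_rates open_B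
        inner_self_nonzero B_in_U)
  then have "continuous_on {0..1} (\<lambda>t. k (p + t *\<^sub>R v))"
    using segment sliceD(1) by (intro continuous_on_compose2[OF smooth_continuous] continuous_intros) auto
  then have "bounded ((\<lambda>t. k (p + t *\<^sub>R v)) ` {0..1})"
    by (intro compact_imp_bounded compact_continuous_image compact_Icc)
  then obtain K where K: "\<And>t. 0 \<le> t \<Longrightarrow> t \<le> 1 \<Longrightarrow> k (p + t *\<^sub>R v) \<le> K"
    unfolding bounded_iff by (fastforce simp: abs_le_iff)
  have "dderiv e u (p + 1 *\<^sub>R v) = 0"
  proof (rule linear_ode_zero[where \<phi>="\<lambda>t. dderiv e u (p + t *\<^sub>R v)" and k="\<lambda>t. k (p + t *\<^sub>R v)" and K=K])
    show "dderiv e u (p + 0 *\<^sub>R v) = 0" using normal_deriv_p assms(2) by (simp add: perp_def)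
    fix t :: real assume t: "0 \<le> t" "t \<le> 1"
    define z where "z = p + t *\<^sub>R v"
    have z: "z \<in> slice" using segment[OF t] by (simp add: z_def)
    have diff: "dderiv e u differentiable (at z)"
      by (intro differentiable_B smooth_dderiv open_B smooth_B sliceD(1)[OF z])
    have "(z \<bullet> z) * dderiv v (dderiv e u) z = dderiv ((v \<bullet> z) *\<^sub>R z + (v \<bullet> J z) *\<^sub>R J z) (dderiv e u) z"
      unfolding plane_decomposition[OF orthonormal sliceD(3)[OF z] v, symmetric]
      by (simp add: dderiv_linear[OF diff])
    also have "\<dots> = (z \<bullet> z) * (k z * dderiv e u z)"
      unfolding dderiv_linear[OF diff] radial_deriv_normal_u[OF z assms(2)]
        angular_deriv_normal_u[OF z assms(2)]
      using inner_self_nonzero[OF sliceD(2)[OF z]]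
      by (simp add: k_def rot_def inner_diff_right inner_commute field_simps)
    finally have "dderiv v (dderiv e u) z = k z * dderiv e u z"
      using inner_self_nonzero[OF sliceD(2)[OF z]] by simp
    then show "((\<lambda>t. dderiv e u (p + t *\<^sub>R v)) has_real_derivative k (p + t *\<^sub>R v)
        * dderiv e u (p + t *\<^sub>R v)) (at t)"
      using DERIV_along_line[of "dderiv e u" p t v] diff by (simp add: z_def)
  qed (rule K)
  then show ?thesis by (simp add: v_def)
qed

lemma normal_deriv_V: "x \<in> slice \<Longrightarrow> perp e \<Longrightarrow> dderiv e V x = 0"
  using dderiv_V_perp normal_deriv_u by simp

lemma normal_deriv_Eu: "x \<in> slice \<Longrightarrow> perp e \<Longrightarrow> dderiv e Eu x = 0"
  using radial_deriv_dderivs_parallel[OF sliceD(2) inner_perp inner_rot_self n_gt_1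
    mixed_coeff_nonzero[OF sliceD(1)], of x e a b]
    normal_deriv_u S_u_nonzero[OF sliceD(1), of x] by (simp add: lderiv_def)

lemma sphere_hessian_eq_rot:
  assumes "x \<in> slice" "perp e" "smooth_on f U"
  shows "(x \<bullet> a) * dderiv e (lderiv (rot a e) f) x + (x \<bullet> b) * dderiv e (lderiv (rot b e) f) x
      = sphere_hessian e f x"
    "lderiv (rot c e) f x = (x \<bullet> c) * dderiv e f x"
proof -
  note xU = sliceD(2)[OF assms(1)]
  have diff: "f differentiable (at x)" "dderiv e f differentiable (at x)"
    by (intro differentiable_U[OF _ xU] smooth_dderiv open_U assms)+
  have rot_x: "rot c e x = (x \<bullet> c) *\<^sub>R e" for c using inner_perp[OF assms(1,2)] by (simp add: rot_def)
  have rot_e: "rot a e e = - ((e \<bullet> e) *\<^sub>R a)" "rot b e e = - ((e \<bullet> e) *\<^sub>R b)"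
    using assms(2) by (simp_all add: rot_def perp_def)
  have x: "x = (x \<bullet> a) *\<^sub>R a + (x \<bullet> b) *\<^sub>R b"
    using sliceD(3)[OF assms(1)] unfolding span_orthonormal_pair[OF orthonormal] .
  have radial: "dderiv x f x = (x \<bullet> a) * dderiv a f x + (x \<bullet> b) * dderiv b f x"
    "x \<bullet> x = (x \<bullet> a) * (x \<bullet> a) + (x \<bullet> b) * (x \<bullet> b)"
    using arg_cong[OF x, of "\<lambda>v. dderiv v f x"] arg_cong[OF x, of "inner x"]
    by (simp_all only: dderiv_linear[OF diff(1)] inner_add_right inner_scaleR_right)
  show "(x \<bullet> a) * dderiv e (lderiv (rot a e) f) x + (x \<bullet> b) * dderiv e (lderiv (rot b e) f) x
      = sphere_hessian e f x"
    unfolding dderiv_lderiv[OF open_U assms(3) xU linear_rot] rot_x rot_e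
      dderiv_dderiv_linear[OF open_U assms(3) xU]
      sphere_hessian_def dderiv_linear[OF diff(1)]
    by (simp add: lderiv_def radial algebra_simps)
  show "lderiv (rot c e) f x = (x \<bullet> c) * dderiv e f x"
    by (simp add: lderiv_def rot_x dderiv_linear[OF diff(1)])
qed

lemma sphere_hessians_parallel:
  assumes "x \<in> slice" "perp e" "W \<subseteq> U" "open W" "x \<in> W" "smooth_on f U" "smooth_on g U" "smooth_on f' U"
    "smooth_on g' U"
    and parallel: "\<And>c y. y \<in> W \<Longrightarrow> lderiv (rot c e) f y * g' y = lderiv (rot c e) g y * f' y"
    and zero: "dderiv e f x = 0" "dderiv e g x = 0"
  shows "sphere_hessian e f x * g' x = sphere_hessian e g x * f' x"
proof -
  note xU = sliceD(2)[OF assms(1)]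
  have normal: "dderiv e (lderiv (rot c e) f) x * g' x = dderiv e (lderiv (rot c e) g) x * f' x" for c
  proof -
    have "dderiv e (\<lambda>y. lderiv (rot c e) h y * k y) x = dderiv e (lderiv (rot c e) h) x * k x"
      if "smooth_on h U" "smooth_on k U" "dderiv e h x = 0" for h k
    proof -
      have "lderiv (rot c e) h x = 0" using sphere_hessian_eq_rot(2)[OF assms(1,2) that(1)] that(3) by simp
      then show ?thesis
        by (subst dderiv_arith(3))
          (intro differentiable_U[OF _ xU] smooth_lderiv open_U linear_rot that | simp)+
    qed
    moreover have "dderiv e (\<lambda>y. lderiv (rot c e) f y * g' y) x
        = dderiv e (\<lambda>y. lderiv (rot c e) g y * f' y) x"
      by (rule dderiv_cong_open[OF assms(4,5)]) (rule parallel)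
    ultimately show ?thesis using assms(6-9) zero by simp
  qed
  have "sphere_hessian e f x * g' x
      = (x \<bullet> a) * (dderiv e (lderiv (rot a e) f) x * g' x)
      + (x \<bullet> b) * (dderiv e (lderiv (rot b e) f) x * g' x)"
    unfolding sphere_hessian_eq_rot(1)[OF assms(1,2,6), symmetric] by (simp add: algebra_simps)
  also have "\<dots> = sphere_hessian e g x * f' x"
    unfolding sphere_hessian_eq_rot(1)[OF assms(1,2,7), symmetric] normal by (simp add: algebra_simps)
  finally show ?thesis .
qed

lemma sphere_hessian_V:
  assumes "x \<in> slice" "perp e"
  shows "sphere_hessian e V x * S u x = sphere_hessian e u x * S V x"
proof (rule sphere_hessians_parallel[OF assms order_refl open_U sliceD(2)[OF assms(1)] smooth_V smooth_u])
  show "lderiv (rot c e) V y * S u y = lderiv (rot c e) u y * S V y" if "y \<in> U" for c y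
    using tangential_grads_parallel[OF that skew_rot skew_rot n_gt_1, of a b c e] by (simp add: mult.commute)
qed (intro smooth_lderiv open_U linear_rot smooth_u smooth_V normal_deriv_V normal_deriv_u assms)+

lemma sphere_hessian_Eu:
  assumes "x \<in> slice" "perp e"
  shows "sphere_hessian e Eu x * S u x = sphere_hessian e u x * S Eu x"
proof (rule sphere_hessians_parallel[OF assms B_subset open_B sliceD(1)[OF assms(1)]
smooth_radial_derivs(2) smooth_u])
  show "lderiv (rot c e) Eu y * S u y = lderiv (rot c e) u y * S Eu y" if "y \<in> B" for c y
    using radial_deriv_grad_parallel_u[OF B_in_U[OF that] skew_rot skew_rot n_gt_1
      mixed_coeff_nonzero[OF that], of c e a b]
    by (simp add: mult.commute)
qed (intro smooth_lderiv open_U linear_rot smooth_u smooth_radial_derivs normal_deriv_Eu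
normal_deriv_u assms)+

lemma smooth_trace_factor [smooth_intros]: "smooth_on trace_factor U"
proof -
  have "smooth_on (lderiv id chi) U" by (intro smooth_lderiv open_U linear_id smooth_coefficients)
  moreover have "lderiv id chi = (\<lambda>x. dderiv x chi x)" by (simp add: lderiv_def fun_eq_iff)
  ultimately have "smooth_on (\<lambda>x. dderiv x chi x) U" by simp
  then show ?thesis unfolding trace_factor_def
    by (intro smooth_mult smooth_add smooth_divide smooth_const open_U smooth_u smooth_V smooth_coefficients
      smooth_radial_derivs)
      (use u_nonzero in auto)
qed

lemma static_tangential_field:
  assumes "y \<in> U" "perp e"
  shows "u y * (lderiv (rot c e) (S V) y + (y \<bullet> e) * dderiv (J c) V y)
      + V y * (lderiv (rot c e) (S u) y + (y \<bullet> e) * dderiv (J c) u y)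
    = trace_factor y * ((y \<bullet> e) * (y \<bullet> J c))"
proof -
  have e: "e \<bullet> a = 0" "e \<bullet> b = 0" using assms(2) by (auto simp: perp_def)
  have rotated: "J (rot c e y) = (- (y \<bullet> e)) *\<^sub>R J c" "rot c e y \<bullet> J y = (y \<bullet> e) * (y \<bullet> J c)"
    using e by (simp_all add: rot_def inner_diff_left inner_diff_right inner_commute algebra_simps)
  have "lderiv (rot c e) (S f) y + (y \<bullet> e) * dderiv (J c) f y = dderiv (rot c e y) (dderiv (J y) f) y"
    if "smooth_on f U" for f
    unfolding lderiv_def[of "rot c e"] dderiv_lderiv[OF open_U that assms(1) linear_rot] rotated(1)
    by (simp add: dderiv_linear[OF differentiable_U[OF that assms(1)]])
  then show ?thesis
    using static_tangential[OF assms(1) inner_rot_self inner_rot_self, of c e a b] smooth_u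
      smooth_V rotated(2)
    by simp
qed

lemma normal_deriv_static_tangential:
  assumes "x \<in> slice" "perp e"
  shows "u x * (dderiv e (lderiv (rot c e) (S V)) x + (e \<bullet> e) * dderiv (J c) V x)
    + V x * (dderiv e (lderiv (rot c e) (S u)) x + (e \<bullet> e) * dderiv (J c) u x)
    = trace_factor x * ((e \<bullet> e) * (x \<bullet> J c))"
proof -
  note xU = sliceD(2)[OF assms(1)]
  note smooth = smooth_add smooth_mult smooth_inner smooth_const smooth_dderiv smooth_lderiv linear_rot
    smooth_u smooth_V smooth_trace_factor open_U
  have "dderiv e (\<lambda>y. u y * (lderiv (rot c e) (S V) y + (y \<bullet> e) * dderiv (J c) V y)
      + V y * (lderiv (rot c e) (S u) y + (y \<bullet> e) * dderiv (J c) u y)) x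
     = dderiv e (\<lambda>y. trace_factor y * ((y \<bullet> e) * (y \<bullet> J c))) x"
    by (rule dderiv_cong_open[OF open_U xU]) (rule static_tangential_field[OF _ assms(2)])
  moreover have "dderiv e (\<lambda>y. u y * (lderiv (rot c e) (S V) y + (y \<bullet> e) * dderiv (J c) V y)
      + V y * (lderiv (rot c e) (S u) y + (y \<bullet> e) * dderiv (J c) u y)) x
    = u x * (dderiv e (lderiv (rot c e) (S V)) x + (e \<bullet> e) * dderiv (J c) V x)
    + V x * (dderiv e (lderiv (rot c e) (S u)) x + (e \<bullet> e) * dderiv (J c) u x)"
    by (subst dderiv_arith dderiv_inner dderiv_const | (intro differentiable_U[OF _ xU] smooth))+
      (simp add: inner_perp[OF assms] normal_deriv_u[OF assms] normal_deriv_V[OF assms] algebra_simps)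
  moreover have "dderiv e (\<lambda>y. trace_factor y * ((y \<bullet> e) * (y \<bullet> J c))) x
      = trace_factor x * ((e \<bullet> e) * (x \<bullet> J c))"
    by (subst dderiv_arith dderiv_inner dderiv_const | (intro differentiable_U[OF _ xU] smooth))+
      (simp add: inner_perp[OF assms] algebra_simps)
  ultimately show ?thesis by simp
qed

lemma static_sphere_hessian_S:
  assumes "x \<in> slice" "perp e"
  shows "u x * (sphere_hessian e (S V) x + (e \<bullet> e) * S V x)
      + V x * (sphere_hessian e (S u) x + (e \<bullet> e) * S u x) = 0"
proof -
  note xU = sliceD(2)[OF assms(1)] and ab = orthonormal_pairD[OF orthonormal]
  have J: "J a = b" "J b = - a" using ab by (simp_all add: rot_def)
  have smooth_S: "smooth_on (S u) U" "smooth_on (S V) U"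
    by (intro smooth_lderiv open_U linear_rot smooth_u smooth_V)+
  have S_eq: "S f x = (x \<bullet> a) * dderiv b f x + (x \<bullet> b) * dderiv (- a) f x" if "smooth_on f U" for f
    using differentiable_U[OF that xU] by (simp add: lderiv_def rot_def dderiv_linear)
  have "u x * (sphere_hessian e (S V) x + (e \<bullet> e) * S V x)
      + V x * (sphere_hessian e (S u) x + (e \<bullet> e) * S u x)
     = (x \<bullet> a) * (trace_factor x * ((e \<bullet> e) * (x \<bullet> b))) + (x \<bullet> b) * (trace_factor x * ((e \<bullet> e) * (x \<bullet> - a)))"
    unfolding normal_deriv_static_tangential[OF assms, of a, unfolded J, symmetric]
      normal_deriv_static_tangential[OF assms, of b, unfolded J, symmetric]
      sphere_hessian_eq_rot(1)[OF assms smooth_S(1), symmetric]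
      sphere_hessian_eq_rot(1)[OF assms smooth_S(2), symmetric]
      S_eq[OF smooth_u] S_eq[OF smooth_V] by (simp add: algebra_simps)
  then show ?thesis by (simp add: algebra_simps)
qed

definition sphere_factor where "sphere_factor x = (x \<bullet> x) * trace_factor x - u x * EV x - V x * Eu x"

lemma static_sphere_hessian:
  assumes "x \<in> slice" "perp e"
  shows "u x * sphere_hessian e V x + V x * sphere_hessian e u x = (e \<bullet> e) * sphere_factor x"
proof -
  have "u x * sphere_hessian e V x + V x * sphere_hessian e u x
      = (x \<bullet> x) * (u x * dderiv e (dderiv e V) x + V x * dderiv e (dderiv e u) x)
      - (e \<bullet> e) * (u x * EV x + V x * Eu x)"
    by (simp add: sphere_hessian_def algebra_simps)
  then show ?thesis
    unfolding static_tangential[OF sliceD(2)[OF assms(1)] inner_perp[OF assms] inner_perp[OF assms]]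
    by (simp add: sphere_factor_def algebra_simps)
qed

lemma dderiv_J_J:
  assumes "x \<in> slice" "smooth_on f U"
  shows "dderiv (J x) (dderiv (J x) f) x = S (S f) x + lderiv id f x"
  using dderiv_lderiv[OF open_U assms(2) sliceD(2)[OF assms(1)] linear_rot, of "J x" a b]
    dderiv_linear(4)[OF differentiable_U[OF assms(2) sliceD(2)[OF assms(1)]], of x]
  by (simp add: lderiv_def[of J "S f"] rot_rot_in_plane[OF orthonormal sliceD(3)[OF assms(1)]]
    lderiv_def[of id])

lemma static_S_S:
  assumes "x \<in> slice"
  shows "u x * S (S V) x + V x * S (S u) x = sphere_factor x"
proof -
  have "u x * (S (S V) x + EV x) + V x * (S (S u) x + Eu x) = trace_factor x * (x \<bullet> x)"
    using static_tangential[OF sliceD(2)[OF assms] inner_rot_self inner_rot_self, of a b a b]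
    unfolding dderiv_J_J[OF assms smooth_V] dderiv_J_J[OF assms smooth_u]
      inner_rot_rot[OF orthonormal sliceD(3)[OF assms]] .
  then show ?thesis by (simp add: sphere_factor_def algebra_simps)
qed

lemma sphere_factor_eq:
  assumes "x \<in> B"
  shows "sphere_factor x = u x * V x * ((n - 2) * (1 - omega x) + omega x * (Eu x / u x - EV x / V x))"
proof -
  define M where "M = Eu x / u x"
  define W where "W = EV x / V x"
  have radial: "Eu x = u x * M" "EV x = V x * W"
    using u_nonzero[OF B_in_U[OF assms]] V_nonzero[OF assms] by (simp_all add: M_def W_def)
  have "sphere_factor x
      = u x * ((1 - omega x) * EV x + V x * ((n - 2) * (1 - omega x) + (1 + omega x) * M))
      - u x * EV x - V x * Eu x"
    unfolding sphere_factor_def trace_factor_eq[OF B_in_U[OF assms]] by (simp add: M_def)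
  then show ?thesis unfolding M_def[symmetric] W_def[symmetric] radial
    using u_nonzero[OF B_in_U[OF assms]] V_nonzero[OF assms] by (simp add: algebra_simps)
qed

text \<open>For a rotationally symmetric solution about an axis in the plane, \<open>axis_tan\<close> is the tangent of the angle
  measured from the normal to the axis.\<close>

definition axis_tan where "axis_tan x = - (sphere_hessian e0 u x / S u x)"

lemma perp_e0: "perp e0" using unit_normal by (simp add: perp_def)

lemma sphere_hessian_axis_tan:
  assumes "x \<in> slice" "perp e"
  shows "sphere_hessian e u x = - ((e \<bullet> e) * axis_tan x * S u x)"
    "sphere_hessian e V x = - ((e \<bullet> e) * axis_tan x * S V x)"
proof -
  note xB = sliceD(1)[OF assms(1)]
  have factor: "(u x * S V x + V x * S u x) * sphere_hessian e u x = (e \<bullet> e) * (sphere_factor x * S u x)"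
    if "perp e" for e
    using static_sphere_hessian[OF assms(1) that] sphere_hessian_V[OF assms(1) that] by algebra
  have "(u x * S V x + V x * S u x) * (sphere_hessian e u x - (e \<bullet> e) * sphere_hessian e0 u x) = 0"
    using factor[OF assms(2)] factor[OF perp_e0] unit_normal(1) by algebra
  then have "sphere_hessian e u x = (e \<bullet> e) * sphere_hessian e0 u x" using S_uV_nonzero[OF xB] by simp
  then show u: "sphere_hessian e u x = - ((e \<bullet> e) * axis_tan x * S u x)"
    using S_u_nonzero[OF xB] by (simp add: axis_tan_def)
  have "(sphere_hessian e V x + (e \<bullet> e) * axis_tan x * S V x) * S u x = 0"
    using sphere_hessian_V[OF assms] u by algebra
  then show "sphere_hessian e V x = - ((e \<bullet> e) * axis_tan x * S V x)"
    using S_u_nonzero[OF xB] by (simp add: eq_neg_iff_add_eq_0)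
qed

lemma sphere_factor_axis_tan: "x \<in> slice \<Longrightarrow> sphere_factor x = - axis_tan x * (u x * S V x + V x * S u x)"
  using static_sphere_hessian[OF _ perp_e0, of x] sphere_hessian_axis_tan[OF _ perp_e0, of x] unit_normal(1)
  by (simp add: algebra_simps)

lemma smooth_sphere_hessian_B: "smooth_on f U \<Longrightarrow> smooth_on (sphere_hessian e f) B"
  by (rule smooth_on_subset[OF smooth_sphere_hessian[OF open_U] B_subset])

lemma smooth_axis_tan [smooth_intros]: "smooth_on axis_tan B"
  unfolding axis_tan_def
  by (intro smooth_minus smooth_divide open_B smooth_rates S_u_nonzero smooth_sphere_hessian_B smooth_u)

lemma E_axis_tan:
  assumes "x \<in> slice"
  shows "lderiv id axis_tan x = 0"
proof -
  note xB = sliceD(1)[OF assms]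
  have smooth: "smooth_on (sphere_hessian e0 u) B" by (rule smooth_sphere_hessian_B[OF smooth_u])
  have "dderiv x axis_tan x = - dderiv x (\<lambda>x. sphere_hessian e0 u x / S u x) x"
    unfolding axis_tan_def
    by (rule dderiv_minus[OF differentiable_B[OF _ xB]])
      (intro smooth_divide open_B smooth_rates S_u_nonzero smooth)
  also have "\<dots> = - (lderiv id (sphere_hessian e0 u) x / S u x
      - sphere_hessian e0 u x * lderiv id (S u) x / (S u x)\<^sup>2)"
    by (subst dderiv_divide[OF differentiable_B[OF smooth xB] differentiable_B[OF smooth_rates(1) xB]
      S_u_nonzero[OF xB]])
      (simp add: lderiv_def[of id])
  also have "lderiv id (sphere_hessian e0 u) x * S u x = sphere_hessian e0 u x * lderiv id (S u) x"
    using sphere_hessian_Eu[OF assms perp_e0]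
      sphere_hessian_radial_commute[OF open_U smooth_u sliceD(2)[OF assms], of e0]
      lderiv_id_commute[OF open_U smooth_u sliceD(2)[OF assms] linear_rot, of a b] by simp
  then have "lderiv id (sphere_hessian e0 u) x / S u x
      - sphere_hessian e0 u x * lderiv id (S u) x / (S u x)\<^sup>2 = 0"
    using S_u_nonzero[OF xB] by (simp add: field_simps power2_eq_square)
  finally show ?thesis by (simp add: lderiv_def)
qed

lemma S_sphere_hessian:
  assumes "x \<in> slice" "smooth_on f U" "\<And>y. y \<in> slice \<Longrightarrow> sphere_hessian e0 f y = - (axis_tan y * S f y)"
  shows "S (sphere_hessian e0 f) x = - (axis_tan x * S (S f) x + S axis_tan x * S f x)"
proof -
  note diff = differentiable_B[OF _ sliceD(1)[OF assms(1)]]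
  have smooth: "smooth_on (S f) B" "smooth_on (\<lambda>y. axis_tan y * S f y) B"
    by (intro smooth_lderiv smooth_mult smooth_axis_tan open_B linear_rot
      smooth_on_subset[OF assms(2) B_subset])+
  have "S (sphere_hessian e0 f) x = dderiv (J x) (\<lambda>y. - (axis_tan y * S f y)) x"
    unfolding lderiv_def[of J "sphere_hessian e0 f"]
    by (rule dderiv_cong_slice[OF assms(1) rot_in_span diff diff assms(3)])
      (intro smooth_sphere_hessian_B smooth_minus open_B smooth assms(2))+
  also have "\<dots> = - (axis_tan x * S (S f) x + S axis_tan x * S f x)"
    unfolding dderiv_minus[OF diff[OF smooth(2)]]
      dderiv_arith(3)[OF diff[OF smooth_axis_tan] diff[OF smooth(1)]]
    by (simp add: lderiv_def)
  finally show ?thesis .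
qed

lemma S_axis_tan:
  assumes "x \<in> slice"
  shows "S axis_tan x = 1 + (axis_tan x)\<^sup>2"
proof -
  note commute = sphere_hessian_rot_commute[OF open_U _ sliceD(2)[OF assms] unit_normal(2,3)]
  have "u x * (S (sphere_hessian e0 V) x + S V x) + V x * (S (sphere_hessian e0 u) x + S u x) = 0"
    using static_sphere_hessian_S[OF assms perp_e0] commute[OF smooth_V] commute[OF smooth_u] unit_normal(1)
    by simp
  then have "u x * (- (axis_tan x * S (S V) x + S axis_tan x * S V x) + S V x)
      + V x * (- (axis_tan x * S (S u) x + S axis_tan x * S u x) + S u x) = 0"
    using S_sphere_hessian[OF assms smooth_V] S_sphere_hessian[OF assms smooth_u]
      sphere_hessian_axis_tan[OF _ perp_e0] unit_normal(1)
    by simp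
  then have "(u x * S V x + V x * S u x) * (1 - S axis_tan x)
      = axis_tan x * (u x * S (S V) x + V x * S (S u) x)"
    by algebra
  also have "\<dots> = - (axis_tan x)\<^sup>2 * (u x * S V x + V x * S u x)"
    unfolding static_S_S[OF assms] sphere_factor_axis_tan[OF assms] by (simp add: power2_eq_square)
  finally have "(u x * S V x + V x * S u x) * (1 - S axis_tan x + (axis_tan x)\<^sup>2) = 0"
    by (simp add: algebra_simps)
  then show ?thesis using S_uV_nonzero[OF sliceD(1)[OF assms]] by simp
qed

lemma sphere_laplace_V_slice:
  assumes "x \<in> slice"
  shows "sphere_laplace V x = S (S V) x - (n - 2) * axis_tan x * S V x"
proof -
  note V = open_U smooth_V sliceD(2)[OF assms]
  define k where "k = (EV x - axis_tan x * S V x) / (x \<bullet> x)"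
  have k: "(x \<bullet> x) * k = EV x - axis_tan x * S V x" using inner_self_nonzero[OF V(3)] by (simp add: k_def)
  have "laplace V x = dderiv a (dderiv a V) x + dderiv b (dderiv b V) x + (real CARD('n) - 2) * k"
  proof (rule laplace_split_plane[OF V orthonormal])
    fix e assume "e \<bullet> a = 0" "e \<bullet> b = 0"
    then have e: "perp e" by (simp add: perp_def)
    have "dderiv v (dderiv e V) x = dderiv v (\<lambda>_. 0) x" if "v \<in> {a, b}" for v
      using that by (intro dderiv_cong_slice[OF assms]
        differentiable_U[OF smooth_dderiv[OF open_U smooth_V] V(3)] normal_deriv_V e)
        (auto intro: span_base)
    then show "dderiv v (dderiv e V) x = 0" if "v \<in> {a, b}" for v using that by simp
    show "dderiv e (dderiv e V) x = k * (e \<bullet> e)"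
      using sphere_hessian_axis_tan(2)[OF assms e] inner_self_nonzero[OF V(3)]
      by (simp add: sphere_hessian_def k_def field_simps)
  qed
  then have "(x \<bullet> x) * laplace V x
      = (x \<bullet> x) * (dderiv a (dderiv a V) x + dderiv b (dderiv b V) x) + (n - 2) * ((x \<bullet> x) * k)"
    by (simp only: CARD_eq) (simp add: algebra_simps)
  then have "(x \<bullet> x) * laplace V x
      = dderiv x (dderiv x V) x + (S (S V) x + EV x) + (n - 2) * (EV x - axis_tan x * S V x)"
    unfolding plane_second_derivs[OF V orthonormal sliceD(3)[OF assms]] dderiv_J_J[OF assms smooth_V] k .
  then show ?thesis
    unfolding sphere_laplace_def CARD_eq lderiv_id_lderiv_id[OF V] by (simp add: algebra_simps)
qed

end

section \<open>Polynomial relations on a slice\<close>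

text \<open>On a slice put \<open>N = n - 1\<close>, \<open>X = S log (u V)\<close>, \<open>d = S log (u / V)\<close>, \<open>w = \<omega>\<close> and \<open>c = axis_tan\<close>, and introduce
  \<open>l\<close> for the \<open>S\<close>-derivative of \<open>d\<close>. The polynomials \<open>S_f_poly\<close> express \<open>S f\<close>, the polynomials \<open>E_f_poly\<close>
  express \<open>\<omega> E f\<close>. The relation \<open>Phi_poly = 0\<close> is the identity \<open>[E, S] X = 0\<close>.\<close>

type_synonym slice_poly = "real \<Rightarrow> real \<Rightarrow> real \<Rightarrow> real \<Rightarrow> real \<Rightarrow> real \<Rightarrow> real"

definition Phi_cubic :: "real \<Rightarrow> real \<Rightarrow> real" where
  "Phi_cubic X d = X^3 + 3*X\<^sup>2*d + X*d\<^sup>2 - d^3"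

definition Phi_quadratic :: "real \<Rightarrow> real \<Rightarrow> real \<Rightarrow> real \<Rightarrow> real" where
  "Phi_quadratic N X d w = w*((N/2+1)*d\<^sup>2 - N*X*d - N/2*X\<^sup>2) + ((3*N+1)/2*X\<^sup>2 + 3*N*X*d + (N-3)/2*d\<^sup>2)"

definition Phi_poly :: slice_poly where
  "Phi_poly N X d w c l = N*l*(w-l) - l*d\<^sup>2 + Phi_quadratic N X d w + c/2*Phi_cubic X d"

definition Phi_poly_deriv :: "real \<Rightarrow> real \<Rightarrow> real \<Rightarrow> real \<Rightarrow> real \<Rightarrow> slice_poly" where
  "Phi_poly_deriv N X d w c l X' d' w' c' l' = N*l'*(w-l) + N*l*(w'-l') - l'*d\<^sup>2 - 2*l*d*d'
     + w'*((N/2+1)*d\<^sup>2 - N*X*d - N/2*X\<^sup>2) + w*((N+2)*d*d' - N*(X'*d + X*d') - N*X*X')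
     + ((3*N+1)*X*X' + 3*N*(X'*d + X*d') + (N-3)*d*d') + c'/2*Phi_cubic X d
     + c/2*(3*X\<^sup>2*X' + 6*X*X'*d + 3*X\<^sup>2*d' + X'*d\<^sup>2 + 2*X*d*d' - 3*d\<^sup>2*d')"

definition S_X_poly :: slice_poly where
  "S_X_poly N X d w c l = - (X\<^sup>2 + d\<^sup>2)/2 - c*X"

definition S_d_poly :: slice_poly where
  "S_d_poly N X d w c l = N*l - (X+c)*d"

definition S_w_poly :: slice_poly where
  "S_w_poly N X d w c l = - w*(X+d)"

definition S_l_poly :: slice_poly where
  "S_l_poly N X d w c l = (w-1)*(N*X-d) - l*X + c*N*l + c*(d\<^sup>2-X\<^sup>2)/2"

definition E_X_poly :: slice_poly where
  "E_X_poly N X d w c l = (w-1)*(N*X-d) + l*d - d - c*(X\<^sup>2+d\<^sup>2)/2"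

definition E_d_poly :: slice_poly where
  "E_d_poly N X d w c l = - N*X - (N-1)*d - c*X\<^sup>2/2 - c*X*d + c*d\<^sup>2/2"

definition E_w_poly :: slice_poly where
  "E_w_poly N X d w c l = - w*(l - c*d + (N-1)*(w-1) - c*X)"

definition S_E_X_poly :: slice_poly where
  "S_E_X_poly N X d w c l
    = (let X' = S_X_poly N X d w c l; d' = S_d_poly N X d w c l; w' = S_w_poly N X d w c l;
       c' = 1 + c\<^sup>2; l' = S_l_poly N X d w c l in
     w'*(N*X-d) + (w-1)*(N*X'-d') + l'*d + l*d' - d' - c'*(X\<^sup>2+d\<^sup>2)/2 - c*(X*X'+d*d'))"

definition S_E_d_poly :: slice_poly where
  "S_E_d_poly N X d w c l = (let X' = S_X_poly N X d w c l; d' = S_d_poly N X d w c l; c' = 1 + c\<^sup>2 in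
     - N*X' - (N-1)*d' - c'*X\<^sup>2/2 - c*X*X' - c'*X*d - c*X'*d - c*X*d' + c'*d\<^sup>2/2 + c*d*d')"

definition E_l_poly :: slice_poly where
  "E_l_poly N X d w c l = (S_E_d_poly N X d w c l + (X+d)*E_d_poly N X d w c l + (X+c)*E_d_poly N X d w c l
     + d*E_X_poly N X d w c l)/N"

definition S_Phi_poly :: slice_poly where
  "S_Phi_poly N X d w c l
    = Phi_poly_deriv N X d w c l (S_X_poly N X d w c l) (S_d_poly N X d w c l) (S_w_poly N X d w c l)
     (1 + c\<^sup>2) (S_l_poly N X d w c l)"

definition E_Phi_poly :: slice_poly where
  "E_Phi_poly N X d w c l
    = Phi_poly_deriv N X d w c l (E_X_poly N X d w c l) (E_d_poly N X d w c l) (E_w_poly N X d w c l)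
     0 (E_l_poly N X d w c l)"

definition slice_relations :: "real \<Rightarrow> real \<Rightarrow> real \<Rightarrow> real \<Rightarrow> real \<Rightarrow> real \<Rightarrow> bool" where
  "slice_relations N X d w c l
    \<longleftrightarrow> Phi_poly N X d w c l = 0 \<and> S_Phi_poly N X d w c l = 0 \<and> E_Phi_poly N X d w c l = 0"

lemma DERIV_Phi_poly:
  assumes "(X has_real_derivative X') (at t)" "(d has_real_derivative d') (at t)"
    "(w has_real_derivative w') (at t)"
    "(c has_real_derivative c') (at t)" "(l has_real_derivative l') (at t)"
  shows "((\<lambda>t. Phi_poly N (X t) (d t) (w t) (c t) (l t)) has_real_derivative
    Phi_poly_deriv N (X t) (d t) (w t) (c t) (l t) X' d' w' c' l') (at t)"
  unfolding Phi_poly_def Phi_poly_deriv_def Phi_quadratic_def Phi_cubic_def using assms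
  by (auto intro!: derivative_eq_intros simp: field_simps power2_eq_square power3_eq_cube)

lemma Phi_poly_deriv_scale:
  "Phi_poly_deriv N X d w c l (X'/k) (d'/k) (w'/k) 0 (l'/k) = Phi_poly_deriv N X d w c l X' d' w' 0 l' / k"
  by (cases "k = 0") (simp_all add: Phi_poly_deriv_def field_simps)

lemma Phi_poly_eq_commutator:
  "Phi_poly N X d w c l = - (S_E_X_poly N X d w c l + E_X_poly N X d w c l * (X + d))
     - (X * E_X_poly N X d w c l + d * E_d_poly N X d w c l) - c * E_X_poly N X d w c l"
  unfolding Phi_poly_def Phi_quadratic_def Phi_cubic_def S_E_X_poly_def Let_def S_X_poly_def S_d_poly_def
    S_w_poly_def S_l_poly_def E_X_poly_def E_d_poly_def
  by (simp add: field_simps power2_eq_square power3_eq_cube)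

context plane_slice begin

definition S_log_u where "S_log_u x = S u x / u x"
definition S_log_V where "S_log_V x = S V x / V x"
definition E_log_u where "E_log_u x = Eu x / u x"
definition E_log_V where "E_log_V x = EV x / V x"
definition S_log_uV where "S_log_uV x = S_log_V x + S_log_u x"
definition S_log_quot where "S_log_quot x = S_log_u x - S_log_V x"
definition quot_rate
  where "quot_rate x = (S S_log_quot x + (S_log_uV x + axis_tan x) * S_log_quot x) / (n - 1)"

abbreviation at_slice where
  "at_slice P x \<equiv> P (n - 1) (S_log_uV x) (S_log_quot x) (omega x) (axis_tan x) (quot_rate x)"

lemma smooth_slice_functions [smooth_intros]:
  "smooth_on S_log_u B" "smooth_on S_log_V B" "smooth_on E_log_u B" "smooth_on E_log_V B"
  "smooth_on S_log_uV B" "smooth_on S_log_quot B" "smooth_on quot_rate B"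
proof -
  show logs: "smooth_on S_log_u B" "smooth_on S_log_V B" "smooth_on E_log_u B" "smooth_on E_log_V B"
    unfolding S_log_u_def S_log_V_def E_log_u_def E_log_V_def
    by (rule smooth_divide[OF open_B]; use V_nonzero u_nonzero B_in_U smooth_B smooth_rates in \<open>auto\<close>)+
  show sums: "smooth_on S_log_uV B" "smooth_on S_log_quot B"
    unfolding S_log_uV_def S_log_quot_def by (intro smooth_add smooth_diff open_B logs)+
  show "smooth_on quot_rate B" unfolding quot_rate_def
    by (intro smooth_divide smooth_add smooth_mult smooth_const smooth_lderiv linear_rot open_B sums
      smooth_axis_tan)
      (use n_gt_1 in auto)
qed

lemma lderiv_log_sums:
  assumes "x \<in> B"
  shows "lderiv M S_log_uV x = lderiv M S_log_V x + lderiv M S_log_u x"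
    "lderiv M S_log_quot x = lderiv M S_log_u x - lderiv M S_log_V x"
  unfolding S_log_uV_def S_log_quot_def
  by (rule lderiv_arith; intro differentiable_B[OF _ assms] smooth_slice_functions)+

lemma S_log_eq: "S_log_V x = (S_log_uV x - S_log_quot x) / 2" "S_log_u x = (S_log_uV x + S_log_quot x) / 2"
  by (simp_all add: S_log_uV_def S_log_quot_def)

lemma lderiv_logs:
  assumes "x \<in> B"
  shows "lderiv M S_log_u x = lderiv M (S u) x / u x - S_log_u x * (lderiv M u x / u x)"
    "lderiv M S_log_V x = lderiv M (S V) x / V x - S_log_V x * (lderiv M V x / V x)"
    "lderiv M E_log_u x = lderiv M Eu x / u x - E_log_u x * (lderiv M u x / u x)"
    "lderiv M E_log_V x = lderiv M EV x / V x - E_log_V x * (lderiv M V x / V x)"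
  unfolding lderiv_def[of M] S_log_u_def S_log_V_def E_log_u_def E_log_V_def
  using u_nonzero[OF B_in_U[OF assms]] V_nonzero[OF assms]
  by (subst dderiv_divide, (intro differentiable_B[OF _ assms] smooth_B smooth_rates)+, simp, simp
    add: field_simps power2_eq_square)+

lemma axis_tan_S_log_uV:
  assumes "x \<in> slice"
  shows "axis_tan x * S_log_uV x = (n - 2) * (omega x - 1) - omega x * (E_log_u x - E_log_V x)"
proof -
  note xB = sliceD(1)[OF assms]
  have nonzero: "u x \<noteq> 0" "V x \<noteq> 0" using u_nonzero[OF B_in_U[OF xB]] V_nonzero[OF xB] by auto
  have "u x * S V x + V x * S u x = u x * V x * S_log_uV x"
    using nonzero by (simp add: S_log_uV_def S_log_V_def S_log_u_def field_simps)
  then have "u x * V x * ((n - 2) * (1 - omega x) + omega x * (E_log_u x - E_log_V x))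
      = u x * V x * (- axis_tan x * S_log_uV x)"
    using sphere_factor_axis_tan[OF assms] sphere_factor_eq[OF xB] by (simp add: E_log_u_def E_log_V_def)
  then have "(n - 2) * (1 - omega x) + omega x * (E_log_u x - E_log_V x) = - axis_tan x * S_log_uV x"
    using nonzero by (metis mult_left_cancel mult_eq_0_iff)
  then show ?thesis by (simp add: algebra_simps)
qed

lemma S_S_log_uV:
  assumes "x \<in> slice"
  shows "S S_log_uV x = at_slice S_X_poly x"
proof -
  note xB = sliceD(1)[OF assms]
  have nonzero: "u x \<noteq> 0" "V x \<noteq> 0" using u_nonzero[OF B_in_U[OF xB]] V_nonzero[OF xB] by auto
  have "S S_log_uV x = S (S V) x / V x + S (S u) x / u x - (S_log_V x)\<^sup>2 - (S_log_u x)\<^sup>2"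
    unfolding lderiv_log_sums[OF xB] lderiv_logs[OF xB]
    by (simp add: S_log_V_def S_log_u_def power2_eq_square)
  also have "S (S V) x / V x + S (S u) x / u x = sphere_factor x / (u x * V x)"
    unfolding static_S_S[OF assms, symmetric] using nonzero by (simp add: field_simps)
  also have "\<dots> = - axis_tan x * S_log_uV x"
    unfolding sphere_factor_axis_tan[OF assms] using nonzero
    by (simp add: S_log_uV_def S_log_V_def S_log_u_def field_simps)
  finally show ?thesis by (simp add: S_X_poly_def S_log_eq power2_eq_square field_simps)
qed

lemma S_S_log_quot: "S S_log_quot x = at_slice S_d_poly x"
  using n_gt_1 by (simp add: S_d_poly_def quot_rate_def field_simps)

lemma S_omega: "x \<in> B \<Longrightarrow> S omega x = at_slice S_w_poly x"
  using dderiv_omega[OF B_in_U, of x "J x"]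
  by (simp add: lderiv_def S_w_poly_def S_log_uV_def S_log_quot_def S_log_u_def)

lemma S_E_log_V:
  assumes "x \<in> slice"
  shows "S E_log_V x = - (1 - E_log_V x) * S_log_quot x + (n - 1) * S_log_u x"
proof -
  note xB = sliceD(1)[OF assms]
  have nonzero: "u x \<noteq> 0" "V x \<noteq> 0" using u_nonzero[OF B_in_U[OF xB]] V_nonzero[OF xB] by auto
  have S_EV: "S EV x = S V x + S_log_u x * (EV x + (n - 2) * V x)"
    using lderiv_EV[OF B_in_U[OF xB] skew_rot, of a b] nonzero
    by (simp add: S_log_u_def mixed_coeff_def field_simps)
  have "S E_log_V x = S_log_V x + S_log_u x * (E_log_V x + (n - 2)) - E_log_V x * S_log_V x"
    unfolding lderiv_logs[OF xB] S_EV S_log_V_def E_log_V_def using nonzero by (simp add: field_simps)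
  then show ?thesis by (simp add: S_log_quot_def algebra_simps)
qed

lemma S_S_log_V:
  assumes "x \<in> slice"
  shows "S S_log_V x = - (S_log_V x)\<^sup>2 + (n - 2) * axis_tan x * S_log_V x
      + (n - 1) * (n - 2) / 2 * (1 - omega x)
    - (n - 1) * omega x * E_log_V x"
proof -
  note xB = sliceD(1)[OF assms]
  have "S (S V) x = (n - 2) * axis_tan x * S V x - (n - 1) * omega x * EV x
      + (n - 1) * (n - 2) / 2 * (1 - omega x) * V x"
    using static_trace(1)[OF B_in_U[OF xB]] sphere_laplace_V_slice[OF assms] by simp
  then have "S (S V) x / V x
      = (n - 2) * axis_tan x * S_log_V x - (n - 1) * omega x * E_log_V x
      + (n - 1) * (n - 2) / 2 * (1 - omega x)"
    unfolding S_log_V_def E_log_V_def using V_nonzero[OF xB]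
    by (simp add: add_divide_distrib diff_divide_distrib)
  then show ?thesis unfolding lderiv_logs[OF xB] by (simp add: S_log_V_def power2_eq_square)
qed

lemma quot_rate_eq:
  assumes "x \<in> slice"
  shows "quot_rate x = - 2 * axis_tan x * S_log_V x - (n - 2) * (1 - omega x) + 2 * omega x * E_log_V x"
proof -
  have S_quot: "S S_log_quot x = S S_log_uV x - 2 * S S_log_V x"
    using lderiv_log_sums[OF sliceD(1)[OF assms]] by simp
  have "(n - 1) * quot_rate x = S S_log_quot x + (S_log_uV x + axis_tan x) * S_log_quot x"
    using n_gt_1 by (simp add: quot_rate_def)
  also have "\<dots> = (n - 1) * (- 2 * axis_tan x * S_log_V x - (n - 2) * (1 - omega x) + 2 * omega x * E_log_V x)"
    unfolding S_quot S_S_log_uV[OF assms] S_S_log_V[OF assms] S_X_poly_def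
    unfolding S_log_uV_def S_log_quot_def by (simp add: power2_eq_square field_simps)
  finally show ?thesis using n_gt_1 by simp
qed

lemma E_logs:
  assumes "x \<in> slice"
  shows "E_log_u x + E_log_V x = (quot_rate x - axis_tan x * S_log_quot x) / omega x"
    "E_log_u x - E_log_V x = ((n - 2) * (omega x - 1) - axis_tan x * S_log_uV x) / omega x"
  using axis_tan_S_log_uV[OF assms] quot_rate_eq[OF assms] omega_nonzero[OF sliceD(2)[OF assms]]
  by (simp_all add: S_log_uV_def S_log_quot_def field_simps)

lemma slice_line_DERIV:
  assumes "x \<in> slice" "smooth_on f B"
  shows "((\<lambda>t. f (x + t *\<^sub>R v)) has_real_derivative dderiv v f x) (at 0)"
  using DERIV_along_line[of f x 0 v] differentiable_B[OF assms(2)] sliceD(1)[OF assms(1)] by simp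

lemmas slice_DERIVs =
  slice_line_DERIV[OF _ smooth_slice_functions(5)] slice_line_DERIV[OF _ smooth_slice_functions(6)]
  slice_line_DERIV[OF _ smooth_B(5)] slice_line_DERIV[OF _ smooth_axis_tan]
  slice_line_DERIV[OF _ smooth_slice_functions(7)]

lemma S_eq_on_slice:
  assumes "x \<in> slice" "smooth_on f B" "\<And>z. z \<in> slice \<Longrightarrow> f z = g z"
    "((\<lambda>t. g (x + t *\<^sub>R J x)) has_real_derivative D) (at 0)"
  shows "S f x = D"
  unfolding lderiv_def
  by (rule dderiv_eq_on_slice[OF assms(1) rot_in_span differentiable_B[OF assms(2) sliceD(1)[OF assms(1)]]
    assms(3,4)])

lemma E_eq_on_slice:
  assumes "x \<in> slice" "smooth_on f B" "\<And>z. z \<in> slice \<Longrightarrow> f z = g z"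
    "((\<lambda>t. g (x + t *\<^sub>R x)) has_real_derivative D) (at 0)"
  shows "lderiv id f x = D"
  unfolding lderiv_def id_apply
  by (rule dderiv_eq_on_slice[OF assms(1) sliceD(3)[OF assms(1)]
    differentiable_B[OF assms(2) sliceD(1)[OF assms(1)]] assms(3,4)])

lemma S_quotient_omega:
  assumes "x \<in> slice" "smooth_on f B" "\<And>z. z \<in> slice \<Longrightarrow> f z = g z / omega z"
    "((\<lambda>t. g (x + t *\<^sub>R J x)) has_real_derivative D) (at 0)"
  shows "S f x = (D + g x * (S_log_uV x + S_log_quot x)) / omega x"
proof -
  have "((\<lambda>t. omega (x + t *\<^sub>R J x)) has_real_derivative - omega x * (S_log_uV x + S_log_quot x)) (at 0)"
    using slice_line_DERIV[OF assms(1) smooth_B(5), of "J x"] S_omega[OF sliceD(1)[OF assms(1)]]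
    by (simp add: lderiv_def S_w_poly_def)
  then have "((\<lambda>t. g (x + t *\<^sub>R J x) / omega (x + t *\<^sub>R J x)) has_real_derivative
      (D * omega x + g x * (omega x * (S_log_uV x + S_log_quot x))) / (omega x * omega x)) (at 0)"
    using DERIV_divide[OF assms(4)] omega_nonzero[OF sliceD(2)[OF assms(1)]] by fastforce
  then have "S f x = (D * omega x + g x * (omega x * (S_log_uV x + S_log_quot x))) / (omega x * omega x)"
    by (intro S_eq_on_slice[OF assms(1,2), where g="\<lambda>z. g z / omega z"] assms(3))
  moreover have "(D * w + k * (w * s)) / (w * w) = (D + k * s) / w" if "w \<noteq> 0" for w k s :: real
    using that by (simp add: field_simps)
  ultimately show ?thesis using omega_nonzero[OF sliceD(2)[OF assms(1)]] by simp
qed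

lemma S_quot_rate:
  assumes "x \<in> slice"
  shows "S quot_rate x = at_slice S_l_poly x"
proof -
  note xB = sliceD(1)[OF assms]
  have expanded: "S quot_rate x
      = - 2 * (S axis_tan x * S_log_V x + axis_tan x * S S_log_V x) + (n - 2) * S omega x
      + 2 * (S omega x * E_log_V x + omega x * S E_log_V x)"
    using slice_DERIVs[OF assms, of "J x"] slice_line_DERIV[OF assms smooth_slice_functions(2), of "J x"]
      slice_line_DERIV[OF assms smooth_slice_functions(4), of "J x"]
    by (intro S_eq_on_slice[OF assms smooth_slice_functions(7) quot_rate_eq])
      (auto intro!: derivative_eq_intros simp: lderiv_def algebra_simps)
  have E_V: "2 * omega x * E_log_V x = quot_rate x + 2 * axis_tan x * S_log_V x + (n - 2) * (1 - omega x)"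
    using quot_rate_eq[OF assms] by simp
  have S_V: "S S_log_V x = (S S_log_uV x - S S_log_quot x) / 2" using lderiv_log_sums[OF xB] by simp
  have "2 * (S omega x * E_log_V x + omega x * S E_log_V x)
      = - (S_log_uV x + S_log_quot x) * (2 * omega x * E_log_V x)
      + 2 * omega x * (- S_log_quot x + (n - 1) * S_log_u x)
        + (2 * omega x * E_log_V x) * S_log_quot x"
    unfolding S_E_log_V[OF assms] S_omega[OF xB] S_w_poly_def by (simp add: algebra_simps)
  then show ?thesis
    unfolding expanded E_V S_V S_axis_tan[OF assms] S_S_log_uV[OF assms] S_S_log_quot S_omega[OF xB]
      S_X_poly_def S_w_poly_def S_d_poly_def S_l_poly_def unfolding S_log_eq
    by (simp add: field_simps power2_eq_square)
qed

lemma S_slice_functions: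
  assumes "x \<in> slice"
  shows "S S_log_uV x = at_slice S_X_poly x" "S S_log_quot x = at_slice S_d_poly x"
    "S omega x = at_slice S_w_poly x"
    "S axis_tan x = 1 + (axis_tan x)\<^sup>2" "S quot_rate x = at_slice S_l_poly x"
  using assms sliceD(1) by (simp_all add: S_S_log_uV S_S_log_quot S_omega S_axis_tan S_quot_rate)

lemma E_S_logs:
  assumes "x \<in> B"
  shows "lderiv id S_log_u x = S E_log_u x" "lderiv id S_log_V x = S E_log_V x"
  unfolding lderiv_logs[OF assms]
  using lderiv_id_commute[OF open_U _ B_in_U[OF assms] linear_rot] smooth_u smooth_V
  by (simp_all add: E_log_u_def E_log_V_def S_log_u_def S_log_V_def)

lemma E_slice_functions:
  assumes "x \<in> slice"
  shows "lderiv id S_log_uV x = at_slice E_X_poly x / omega x"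
    "lderiv id S_log_quot x = at_slice E_d_poly x / omega x"
proof -
  note xB = sliceD(1)[OF assms]
  have E_logs_S: "lderiv id S_log_uV x = S (\<lambda>z. E_log_u z + E_log_V z) x"
    "lderiv id S_log_quot x = S (\<lambda>z. E_log_u z - E_log_V z) x"
    by (simp_all add: lderiv_log_sums[OF xB] E_S_logs[OF xB] lderiv_arith differentiable_B[OF _ xB]
      smooth_slice_functions)
  note DERIVs = slice_DERIVs[OF assms, of "J x", folded lderiv_def[of J], unfolded
    S_slice_functions[OF assms]]
  have "S (\<lambda>z. E_log_u z + E_log_V z) x
      = (at_slice S_l_poly x - ((1 + (axis_tan x)\<^sup>2) * S_log_quot x + axis_tan x * at_slice S_d_poly x)
        + (quot_rate x - axis_tan x * S_log_quot x) * (S_log_uV x + S_log_quot x)) / omega x"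
    using DERIVs by (intro S_quotient_omega[OF assms _ E_logs(1)] smooth_add open_B smooth_slice_functions)
      (auto intro!: derivative_eq_intros)
  then show "lderiv id S_log_uV x = at_slice E_X_poly x / omega x"
    unfolding E_logs_S S_l_poly_def S_d_poly_def E_X_poly_def by (simp add: field_simps power2_eq_square)
  have "S (\<lambda>z. E_log_u z - E_log_V z) x
      = ((n - 2) * at_slice S_w_poly x - ((1 + (axis_tan x)\<^sup>2) * S_log_uV x + axis_tan x * at_slice S_X_poly x)
        + ((n - 2) * (omega x - 1) - axis_tan x * S_log_uV x) * (S_log_uV x + S_log_quot x)) / omega x"
    using DERIVs by (intro S_quotient_omega[OF assms _ E_logs(2)] smooth_diff open_B smooth_slice_functions)
      (auto intro!: derivative_eq_intros)
  then show "lderiv id S_log_quot x = at_slice E_d_poly x / omega x"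
    unfolding E_logs_S S_w_poly_def S_X_poly_def E_d_poly_def by (simp add: field_simps power2_eq_square)
qed

lemma S_E_slice_functions:
  assumes "x \<in> slice"
  shows "S (lderiv id S_log_uV) x
      = (at_slice S_E_X_poly x + at_slice E_X_poly x * (S_log_uV x + S_log_quot x)) / omega x"
    "S (lderiv id S_log_quot) x
      = (at_slice S_E_d_poly x + at_slice E_d_poly x * (S_log_uV x + S_log_quot x)) / omega x"
proof -
  note DERIVs = slice_DERIVs[OF assms, of "J x", folded lderiv_def[of J], unfolded
    S_slice_functions[OF assms]]
  show "S (lderiv id S_log_uV) x
      = (at_slice S_E_X_poly x + at_slice E_X_poly x * (S_log_uV x + S_log_quot x)) / omega x"
    unfolding S_E_X_poly_def Let_def using DERIVs
    by (intro S_quotient_omega[OF assms _ E_slice_functions(1)] smooth_lderiv open_B linear_id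
      smooth_slice_functions,
        unfold E_X_poly_def) (auto intro!: derivative_eq_intros simp: field_simps power2_eq_square)
  show "S (lderiv id S_log_quot) x
      = (at_slice S_E_d_poly x + at_slice E_d_poly x * (S_log_uV x + S_log_quot x)) / omega x"
    unfolding S_E_d_poly_def Let_def using DERIVs
    by (intro S_quotient_omega[OF assms _ E_slice_functions(2)] smooth_lderiv open_B linear_id
      smooth_slice_functions,
        unfold E_d_poly_def) (auto intro!: derivative_eq_intros simp: field_simps power2_eq_square)
qed

lemma Phi_poly_zero:
  assumes "x \<in> slice"
  shows "at_slice Phi_poly x = 0"
proof -
  have "lderiv id (S S_log_uV) x
      = - (S_log_uV x * lderiv id S_log_uV x + S_log_quot x * lderiv id S_log_quot x)
      - axis_tan x * lderiv id S_log_uV x"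
  proof (rule E_eq_on_slice[OF assms smooth_lderiv[OF open_B linear_rot smooth_slice_functions(5)]
  S_S_log_uV])
    show "((\<lambda>t. at_slice S_X_poly (x + t *\<^sub>R x)) has_real_derivative
      - (S_log_uV x * lderiv id S_log_uV x + S_log_quot x * lderiv id S_log_quot x)
      - axis_tan x * lderiv id S_log_uV x) (at 0)"
      unfolding S_X_poly_def using slice_DERIVs[OF assms, of x] E_axis_tan[OF assms]
      by (auto intro!: derivative_eq_intros simp: lderiv_def field_simps power2_eq_square)
  qed
  then have "S (lderiv id S_log_uV) x
      = - (S_log_uV x * lderiv id S_log_uV x + S_log_quot x * lderiv id S_log_quot x)
      - axis_tan x * lderiv id S_log_uV x"
    using lderiv_id_commute[OF open_B smooth_slice_functions(5) sliceD(1)[OF assms] linear_rot, of a b]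
    by simp
  then have "at_slice S_E_X_poly x + at_slice E_X_poly x * (S_log_uV x + S_log_quot x)
      = - (S_log_uV x * at_slice E_X_poly x + S_log_quot x * at_slice E_d_poly x)
      - axis_tan x * at_slice E_X_poly x"
    unfolding S_E_slice_functions[OF assms] E_slice_functions[OF assms]
    using omega_nonzero[OF sliceD(2)[OF assms]]
    by (simp only: times_divide_eq_right add_divide_distrib[symmetric] minus_divide_left
      diff_divide_distrib[symmetric]
        divide_cancel_right simp_thms)
  then show ?thesis unfolding Phi_poly_eq_commutator by simp
qed

lemma S_Phi_poly_zero:
  assumes "x \<in> slice"
  shows "at_slice S_Phi_poly x = 0"
proof -
  note DERIVs = slice_DERIVs[OF assms, of "J x", folded lderiv_def[of J], unfolded
    S_slice_functions[OF assms]]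
  have "((\<lambda>t. at_slice Phi_poly (x + t *\<^sub>R J x)) has_real_derivative at_slice S_Phi_poly x) (at 0)"
    unfolding S_Phi_poly_def using DERIV_Phi_poly[OF DERIVs, of "n - 1"] by simp
  then have "S (\<lambda>_. 0) x = at_slice S_Phi_poly x"
    by (intro S_eq_on_slice[OF assms smooth_const[OF open_B]]) (simp_all add: Phi_poly_zero)
  then show ?thesis by (simp add: lderiv_def)
qed

lemma E_quot_rate:
  assumes "x \<in> slice"
  shows "lderiv id quot_rate x = at_slice E_l_poly x / omega x"
proof -
  have commute: "dderiv x (S S_log_quot) x = S (lderiv id S_log_quot) x"
    using lderiv_id_commute[OF open_B smooth_slice_functions(6) sliceD(1)[OF assms] linear_rot, of a b]
    by (simp add: lderiv_def[of id])
  have "lderiv id quot_rate x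
      = (S (lderiv id S_log_quot) x + (S_log_uV x + axis_tan x) * lderiv id S_log_quot x
      + lderiv id S_log_uV x * S_log_quot x) / (n - 1)"
  proof (rule E_eq_on_slice[OF assms smooth_slice_functions(7) quot_rate_def])
    show "((\<lambda>t. (S S_log_quot (x + t *\<^sub>R x)
        + (S_log_uV (x + t *\<^sub>R x) + axis_tan (x + t *\<^sub>R x)) * S_log_quot (x + t *\<^sub>R x)) / (n - 1))
      has_real_derivative (S (lderiv id S_log_quot) x + (S_log_uV x + axis_tan x) * lderiv id S_log_quot x
        + lderiv id S_log_uV x * S_log_quot x) / (n - 1)) (at 0)"
      using slice_DERIVs[OF assms, of x] E_axis_tan[OF assms]
        slice_line_DERIV[OF assms smooth_lderiv[OF open_B linear_rot[of a b] smooth_slice_functions(6)], of x]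
          unfolding commute
      by (intro DERIV_cdivide) (auto intro!: derivative_eq_intros simp: lderiv_def[of id] algebra_simps)
  qed
  then show ?thesis
    unfolding S_E_slice_functions[OF assms] E_slice_functions[OF assms] E_l_poly_def
    by (simp add: add_divide_distrib mult.commute)
qed

lemma E_omega:
  assumes "x \<in> slice"
  shows "lderiv id omega x = at_slice E_w_poly x / omega x"
proof -
  note nonzero = omega_nonzero[OF sliceD(2)[OF assms]]
  have "lderiv id omega x = - (omega x * (E_log_u x + E_log_V x) + omega x * (E_log_u x - E_log_V x))"
    using dderiv_omega[OF sliceD(2)[OF assms], of x] by (simp add: lderiv_def E_log_u_def algebra_simps)
  then show ?thesis unfolding E_logs[OF assms] E_w_poly_def using nonzero by simp
qed

lemma E_Phi_poly_zero:
  assumes "x \<in> slice"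
  shows "at_slice E_Phi_poly x = 0"
proof -
  have "((\<lambda>t. at_slice Phi_poly (x + t *\<^sub>R x)) has_real_derivative at_slice Phi_poly_deriv x
      (lderiv id S_log_uV x) (lderiv id S_log_quot x) (lderiv id omega x) (lderiv id axis_tan x) (lderiv id quot_rate x)) (at 0)"
    using DERIV_Phi_poly[OF slice_DERIVs[OF assms], of "n - 1"] by (simp add: lderiv_def)
  then have "lderiv id (\<lambda>_. 0) x = at_slice Phi_poly_deriv x
      (lderiv id S_log_uV x) (lderiv id S_log_quot x) (lderiv id omega x) (lderiv id axis_tan x) (lderiv id quot_rate x)"
    by (intro E_eq_on_slice[OF assms smooth_const[OF open_B]]) (simp_all add: Phi_poly_zero)
  then show ?thesis
    unfolding E_slice_functions[OF assms] E_axis_tan[OF assms] E_quot_rate[OF assms] E_omega[OF assms]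
      Phi_poly_deriv_scale
    using omega_nonzero[OF sliceD(2)[OF assms]] by (simp add: E_Phi_poly_def lderiv_def)
qed

lemma quot_rate_S_log_u:
  assumes "x \<in> slice"
  shows "(n - 1) * quot_rate x = 2 * S S_log_u x + 2 * (S_log_u x)\<^sup>2 + 2 * axis_tan x * S_log_u x"
proof -
  have "2 * S S_log_u x = S S_log_quot x + S S_log_uV x" using lderiv_log_sums[OF sliceD(1)[OF assms]] by simp
  then show ?thesis
    unfolding S_S_log_uV[OF assms] S_S_log_quot S_d_poly_def S_X_poly_def unfolding S_log_eq
    by (simp add: power2_eq_square field_simps)
qed

end

lemma (in static_quasi_spherical) slice_identities:
  assumes n3: "n \<ge> 3" and p: "p \<in> U" and ab: "orthonormal_pair a b" "p = norm p *\<^sub>R a"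
    and normal_deriv: "\<And>e. e \<bullet> a = 0 \<Longrightarrow> e \<bullet> b = 0 \<Longrightarrow> dderiv e u p = 0"
    and nonzero: "V p \<noteq> 0" "Z \<noteq> 0" "Y + Z \<noteq> 0" "mixed_coeff p \<noteq> 0"
    and Z: "Z = lderiv (rot a b) u p / u p" and Y: "Y = lderiv (rot a b) V p / V p"
  obtains c l where "slice_relations (n - 1) (Y + Z) (Z - Y) (omega p) c l"
    "(n - 1) * l = 2 * lderiv (rot a b) (\<lambda>x. lderiv (rot a b) u x / u x) p + 2 * Z\<^sup>2 + 2 * c * Z"
proof -
  define S_uV where "S_uV x = u x * lderiv (rot a b) V x + V x * lderiv (rot a b) u x" for x
  define k where "k x = V x * lderiv (rot a b) u x * (S_uV x * mixed_coeff x)" for x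
  have "continuous_on U k" unfolding S_uV_def k_def
    by (intro smooth_continuous[where U=U] smooth_mult smooth_add smooth_lderiv open_U linear_rot smooth_u
      smooth_V smooth_radial_derivs)
  then have "open (U \<inter> k -` (- {0}))"
    by (rule continuous_open_preimage[OF _ open_U]) (rule open_Compl[OF closed_singleton])
  moreover have "S_uV p = u p * V p * (Y + Z)"
    using nonzero(1) u_nonzero[OF p] by (simp add: S_uV_def Y Z field_simps)
  then have "p \<in> U \<inter> k -` (- {0})" using p nonzero u_nonzero[OF p] by (simp add: k_def Z)
  ultimately obtain \<epsilon> where \<epsilon>: "\<epsilon> > 0" "ball p \<epsilon> \<subseteq> U \<inter> k -` (- {0})" using open_contains_ball by blast
  have "card {a, b} \<le> 2" by (simp add: card_insert_le_m1)
  also have "2 < DIM(real^'n)"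
  proof -
    have "real CARD('n) \<ge> 3" using n3 CARD_eq by linarith
    then have "CARD('n) \<ge> 3" by linarith
    then show ?thesis by simp
  qed
  finally obtain e0 where e0: "e0 \<bullet> e0 = 1" "\<And>y. y \<in> {a, b} \<Longrightarrow> e0 \<bullet> y = 0"
    using exists_unit_orthogonal[of "{a, b}"] by blast
  interpret plane_slice U u V n "ball p \<epsilon>" a b e0 p
  proof
    show "p \<in> span {a, b}" by (subst ab(2)) (simp add: span_base span_scale)
    show "ball p \<epsilon> \<subseteq> U" using \<epsilon> by auto
    show "V x \<noteq> 0" "lderiv (rot a b) u x \<noteq> 0" "u x * lderiv (rot a b) V x + V x * lderiv (rot a b) u x \<noteq> 0"
      "mixed_coeff x \<noteq> 0"
      if "x \<in> ball p \<epsilon>" for x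
      using subsetD[OF \<epsilon>(2) that] by (auto simp: k_def S_uV_def)
  qed (use n3 ab(1) normal_deriv \<epsilon> e0 in auto)
  have slice: "p \<in> slice" using p_in_B p_in_plane by (simp add: slice_def)
  have at_p: "S_log_uV p = Y + Z" "S_log_quot p = Z - Y" "S_log_u p = Z"
    "S_log_u = (\<lambda>x. lderiv (rot a b) u x / u x)"
    by (simp_all add: S_log_uV_def S_log_quot_def S_log_u_def S_log_V_def Y Z fun_eq_iff)
  show ?thesis
    using Phi_poly_zero[OF slice] S_Phi_poly_zero[OF slice] E_Phi_poly_zero[OF slice]
      quot_rate_S_log_u[OF slice]
    unfolding at_p(1-3) unfolding at_p(4) by (intro that) (auto simp: slice_relations_def)
qed

section \<open>Small solutions of the polynomial relations\<close>

lemma abs_quadratic_root_le: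
  fixes t :: real
  assumes "t\<^sup>2 = p * t + q"
  shows "\<bar>t\<bar> \<le> 1 + \<bar>p\<bar> + \<bar>q\<bar>"
proof (cases "\<bar>t\<bar> \<le> 1")
  case False
  have "\<bar>t\<bar> * \<bar>t\<bar> = \<bar>p * t + q\<bar>" using assms by (metis abs_mult power2_eq_square)
  also have "\<dots> \<le> \<bar>p\<bar> * \<bar>t\<bar> + \<bar>q\<bar>" using abs_triangle_ineq[of "p * t" q] by (simp add: abs_mult)
  also have "\<dots> \<le> \<bar>p\<bar> * \<bar>t\<bar> + \<bar>q\<bar> * \<bar>t\<bar>" using False mult_left_mono[of 1 "\<bar>t\<bar>" "\<bar>q\<bar>"] by simp
  finally have "\<bar>t\<bar> * \<bar>t\<bar> \<le> (\<bar>p\<bar> + \<bar>q\<bar>) * \<bar>t\<bar>" by (simp add: algebra_simps)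
  then have "\<bar>t\<bar> \<le> \<bar>p\<bar> + \<bar>q\<bar>" by (rule mult_right_le_imp_le) (use False in simp)
  then show ?thesis by simp
qed simp

lemma Phi_poly_scale:
  assumes "N*l = 2*Z\<^sup>2 + 2*c*Z"
  shows "Phi_poly N (Z*x) (Z*y) w c l = N*l*(w-l)
    + Z\<^sup>2 * (l*(N/4*Phi_cubic x y - y\<^sup>2) + (Phi_quadratic N x y w - Z\<^sup>2/2*Phi_cubic x y))"
proof -
  have cubic: "Phi_cubic (Z*x) (Z*y) = Z^3 * Phi_cubic x y"
    and quadratic: "Phi_quadratic N (Z*x) (Z*y) w = Z\<^sup>2 * Phi_quadratic N x y w"
    by (simp_all add: Phi_cubic_def Phi_quadratic_def field_simps power2_eq_square power3_eq_cube)
  have cZ: "c*Z = N*l/2 - Z\<^sup>2" unfolding assms by (simp add: add_divide_distrib)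
  have "c/2*(Z^3 * Phi_cubic x y) = Z\<^sup>2 * (c*Z/2 * Phi_cubic x y)"
    by (simp add: power2_eq_square power3_eq_cube)
  then show ?thesis unfolding Phi_poly_def cubic quadratic cZ by (simp add: algebra_simps power2_eq_square)
qed

lemma Phi_poly_root_bounded:
  fixes Z x y w c l :: "nat \<Rightarrow> real"
  assumes "N > 0" "convergent Z" "convergent x" "convergent y" "convergent w"
    and l: "\<And>k. N * l k = 2*(Z k)\<^sup>2 + 2*c k*Z k"
    and root: "\<And>k. Phi_poly N (Z k*x k) (Z k*y k) (w k) (c k) (l k) = 0"
  shows "Bseq l"
proof -
  define p where "p k = w k + (Z k)\<^sup>2 * (N/4*Phi_cubic (x k) (y k) - (y k)\<^sup>2) / N" for k
  define q where "q k = (Z k)\<^sup>2 * (Phi_quadratic N (x k) (y k) (w k) - (Z k)\<^sup>2/2*Phi_cubic (x k) (y k)) / N"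
    for k
  obtain Z' x' y' w' where lims: "Z \<longlonglongrightarrow> Z'" "x \<longlonglongrightarrow> x'" "y \<longlonglongrightarrow> y'" "w \<longlonglongrightarrow> w'"
    using assms(2-5) unfolding convergent_def by blast
  have "(\<lambda>k. 1 + \<bar>p k\<bar> + \<bar>q k\<bar>) \<longlonglongrightarrow> 1 + \<bar>w' + Z'\<^sup>2 * (N/4*Phi_cubic x' y' - y'\<^sup>2) / N\<bar>
      + \<bar>Z'\<^sup>2 * (Phi_quadratic N x' y' w' - Z'\<^sup>2/2*Phi_cubic x' y') / N\<bar>"
    unfolding p_def q_def Phi_cubic_def Phi_quadratic_def by (intro tendsto_intros lims)
      (use assms(1) in auto)
  then have "Bseq (\<lambda>k. 1 + \<bar>p k\<bar> + \<bar>q k\<bar>)" by (rule convergent_imp_Bseq[OF convergentI])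
  then obtain K where K: "\<And>k. \<bar>1 + \<bar>p k\<bar> + \<bar>q k\<bar>\<bar> \<le> K" unfolding Bseq_def real_norm_def by blast
  have "(l k)\<^sup>2 = p k * l k + q k" for k
  proof -
    have "N * p k = N * w k + (Z k)\<^sup>2 * (N/4*Phi_cubic (x k) (y k) - (y k)\<^sup>2)"
      "N * q k = (Z k)\<^sup>2 * (Phi_quadratic N (x k) (y k) (w k) - (Z k)\<^sup>2/2*Phi_cubic (x k) (y k))"
      using assms(1) by (simp_all add: p_def q_def distrib_left)
    then have "N * (l k)\<^sup>2 = N * (p k * l k + q k)" using root[of k] unfolding Phi_poly_scale[OF l] by algebra
    then show ?thesis using assms(1) by simp
  qed
  then have "\<bar>l k\<bar> \<le> K" for k using abs_quadratic_root_le[of "l k" "p k" "q k"] K[of k] by force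
  then show ?thesis by (intro BseqI'[of _ K]) simp
qed

lemma slice_polys_scale:
  shows "S_X_poly N (Z*x) (Z*y) w (Z*G) (Z\<^sup>2*L) = Z\<^sup>2 * S_X_poly N x y w G L"
    "S_d_poly N (Z*x) (Z*y) w (Z*G) (Z\<^sup>2*L) = Z\<^sup>2 * S_d_poly N x y w G L"
    "S_w_poly N (Z*x) (Z*y) w (Z*G) (Z\<^sup>2*L) = Z * S_w_poly N x y w G L"
    "S_l_poly N (Z*x) (Z*y) w (Z*G) (Z\<^sup>2*L) = Z * ((w-1)*(N*x-y) + Z\<^sup>2*(N*G*L - L*x + G*(y\<^sup>2-x\<^sup>2)/2))"
    "E_X_poly N (Z*x) (Z*y) w (Z*G) (Z\<^sup>2*L) = Z * ((w-1)*(N*x-y) - y + Z\<^sup>2*(L*y - G*(x\<^sup>2+y\<^sup>2)/2))"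
    "E_d_poly N (Z*x) (Z*y) w (Z*G) (Z\<^sup>2*L) = Z * (- N*x - (N-1)*y + Z\<^sup>2*G*(y\<^sup>2/2 - x*y - x\<^sup>2/2))"
    "E_w_poly N (Z*x) (Z*y) w (Z*G) (Z\<^sup>2*L) = - w*((N-1)*(w-1) + Z\<^sup>2*(L - G*y - G*x))"
  by (simp_all add: S_X_poly_def S_d_poly_def S_w_poly_def S_l_poly_def E_X_poly_def E_d_poly_def E_w_poly_def
      field_simps power2_eq_square power3_eq_cube)

lemma S_E_d_poly_scale:
  fixes N Z x y w G L :: real
  defines "a \<equiv> S_X_poly N x y w G L" and "b \<equiv> S_d_poly N x y w G L"
  shows "S_E_d_poly N (Z*x) (Z*y) w (Z*G) (Z\<^sup>2*L) = Z\<^sup>2 * ((1 + Z\<^sup>2*G\<^sup>2)*(y\<^sup>2/2 - x*y - x\<^sup>2/2) - N*a - (N-1)*b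
    + Z\<^sup>2*G*(y*b - x*b - a*y - x*a))"
  unfolding S_E_d_poly_def Let_def slice_polys_scale a_def[symmetric] b_def[symmetric]
  by (simp add: field_simps power2_eq_square)

lemma Phi_poly_deriv_scale_S:
  "Phi_poly_deriv N (Z*x) (Z*y) w (Z*G) (Z\<^sup>2*L) (Z\<^sup>2*a) (Z\<^sup>2*b) (Z*e) (1 + (Z*G)\<^sup>2) (Z*g)
    = Z * (N*g*(w - Z\<^sup>2*L) + Z\<^sup>2*(N*L*(e-g) - g*y\<^sup>2 - Z\<^sup>2*(2*L*y*b) + e*((N/2+1)*y\<^sup>2 - N*x*y - N/2*x\<^sup>2)
      + w*((N+2)*y*b - N*(a*y + x*b) - N*x*a) + ((3*N+1)*x*a + 3*N*(a*y + x*b) + (N-3)*y*b)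
      + (1 + (Z*G)\<^sup>2)/2*Phi_cubic x y
      + Z\<^sup>2*(G/2*(3*x\<^sup>2*a + 6*x*a*y + 3*x\<^sup>2*b + a*y\<^sup>2 + 2*x*y*b - 3*y\<^sup>2*b))))"
  unfolding Phi_poly_deriv_def Phi_cubic_def by (simp add: field_simps power2_eq_square power3_eq_cube)

lemma Phi_poly_deriv_scale_E:
  "Phi_poly_deriv N (Z*x) (Z*y) w (Z*G) (Z\<^sup>2*L) (Z*a) (Z*b) e 0 (Z\<^sup>2*g)
    = Z\<^sup>2 * (N*g*(w - Z\<^sup>2*L) + N*L*(e - Z\<^sup>2*g) - Z\<^sup>2*(g*y\<^sup>2 + 2*L*y*b) + e*((N/2+1)*y\<^sup>2 - N*x*y - N/2*x\<^sup>2)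
      + w*((N+2)*y*b - N*(a*y + x*b) - N*x*a) + ((3*N+1)*x*a + 3*N*(a*y + x*b) + (N-3)*y*b)
      + Z\<^sup>2*(G/2*(3*x\<^sup>2*a + 6*x*a*y + 3*x\<^sup>2*b + a*y\<^sup>2 + 2*x*y*b - 3*y\<^sup>2*b)))"
  unfolding Phi_poly_deriv_def by (simp add: field_simps power2_eq_square power3_eq_cube)

locale shrinking_relations =
  fixes N :: real and Z x y w c l :: "nat \<Rightarrow> real" and x' y' w' l' :: real
  assumes N_pos: "N > 0" and w'_pos: "w' > 0" and Z_nonzero: "\<And>k. Z k \<noteq> 0"
    and lims: "Z \<longlonglongrightarrow> 0" "x \<longlonglongrightarrow> x'" "y \<longlonglongrightarrow> y'" "w \<longlonglongrightarrow> w'" "l \<longlonglongrightarrow> l'"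
    and l_eq: "\<And>k. N * l k = 2*(Z k)\<^sup>2 + 2*c k*Z k"
    and relations: "\<And>k. slice_relations N (Z k*x k) (Z k*y k) (w k) (c k) (l k)"
begin

lemma axis_tan_eq: "c k = (N * l k / 2 - (Z k)\<^sup>2) / Z k"
  using l_eq[of k] Z_nonzero[of k] by (simp add: field_simps)

lemma S_Phi_poly_scale:
  fixes k :: nat
  defines "C \<equiv> c k * Z k"
  defines "a \<equiv> S_X_poly N (Z k*x k) (Z k*y k) (w k) (c k) (l k)"
    and "b \<equiv> S_d_poly N (Z k*x k) (Z k*y k) (w k) (c k) (l k)"
  defines "e \<equiv> S_w_poly N (Z k*x k) (Z k*y k) (w k) (c k) (l k)"
    and "g \<equiv> Z k * S_l_poly N (Z k*x k) (Z k*y k) (w k) (c k) (l k)"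
  shows "Z k * S_Phi_poly N (Z k*x k) (Z k*y k) (w k) (c k) (l k) = N*g*(w k - l k) + N*l k*(Z k*e - g)
    + (Z k)\<^sup>2 * (- g*(y k)\<^sup>2 - 2*l k*y k*b + Z k*e*((N/2+1)*(y k)\<^sup>2 - N*x k*y k - N/2*(x k)\<^sup>2)
      + w k*((N+2)*y k*b - N*(a*y k + x k*b) - N*x k*a) + ((3*N+1)*x k*a + 3*N*(a*y k + x k*b) + (N-3)*y k*b)
      + ((Z k)\<^sup>2 + C\<^sup>2)/2*Phi_cubic (x k) (y k)
      + C/2*(3*(x k)\<^sup>2*a + 6*x k*a*y k + 3*(x k)\<^sup>2*b + a*(y k)\<^sup>2 + 2*x k*y k*b - 3*(y k)\<^sup>2*b))"
  unfolding S_Phi_poly_def Phi_poly_deriv_def Phi_cubic_def a_def[symmetric] b_def[symmetric] e_def[symmetric]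
    g_def C_def
  by (simp add: field_simps power2_eq_square power3_eq_cube)

lemma rate_limit_zero: "l' = 0"
proof -
  define C where "C k = c k * Z k" for k
  define a where "a k = S_X_poly N (Z k*x k) (Z k*y k) (w k) (c k) (l k)" for k
  define b where "b k = S_d_poly N (Z k*x k) (Z k*y k) (w k) (c k) (l k)" for k
  define e where "e k = S_w_poly N (Z k*x k) (Z k*y k) (w k) (c k) (l k)" for k
  define g where "g k = Z k * S_l_poly N (Z k*x k) (Z k*y k) (w k) (c k) (l k)" for k
  have C_eq: "C k = N * l k / 2 - (Z k)\<^sup>2" for k using axis_tan_eq[of k] Z_nonzero[of k] by (simp add: C_def)
  have C: "C \<longlonglongrightarrow> N*l'/2 - 0\<^sup>2" unfolding C_eq[abs_def] by (intro tendsto_intros lims) simp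
  have explicit: "a = (\<lambda>k. - (Z k)\<^sup>2*((x k)\<^sup>2 + (y k)\<^sup>2)/2 - C k*x k)"
    "b = (\<lambda>k. N*l k - (Z k)\<^sup>2*x k*y k - C k*y k)"
    "e = (\<lambda>k. - w k*Z k*(x k + y k))"
    "g = (\<lambda>k. (w k - 1)*(Z k)\<^sup>2*(N*x k - y k) - l k*x k*(Z k)\<^sup>2 + C k*N*l k + C k*(Z k)\<^sup>2*((y k)\<^sup>2 - (x k)\<^sup>2)/2)"
    by (simp_all add: a_def b_def e_def g_def C_def S_X_poly_def S_d_poly_def S_w_poly_def
      S_l_poly_def fun_eq_iff field_simps power2_eq_square)
  have derivs: "a \<longlonglongrightarrow> - (N*l'/2*x')" "b \<longlonglongrightarrow> N*l' - N*l'/2*y'" "e \<longlonglongrightarrow> 0" "g \<longlonglongrightarrow> (N*l')\<^sup>2/2"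
    unfolding explicit by (auto intro!: tendsto_eq_intros lims C simp: power2_eq_square)
  have "(\<lambda>k. Z k * S_Phi_poly N (Z k*x k) (Z k*y k) (w k) (c k) (l k))
      \<longlonglongrightarrow> N*((N*l')\<^sup>2/2)*(w' - l') - N*l'*((N*l')\<^sup>2/2)"
    unfolding S_Phi_poly_scale Phi_cubic_def C_def[symmetric] a_def[symmetric] b_def[symmetric]
      e_def[symmetric] g_def[symmetric]
    by (auto intro!: tendsto_eq_intros lims C derivs)
  moreover have "S_Phi_poly N (Z k*x k) (Z k*y k) (w k) (c k) (l k) = 0" for k
    using relations by (simp add: slice_relations_def)
  ultimately have S_limit: "N*((N*l')\<^sup>2/2)*(w' - l') - N*l'*((N*l')\<^sup>2/2) = 0" by (simp add: LIMSEQ_const_iff)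
  have "(\<lambda>k. Phi_poly N (Z k*x k) (Z k*y k) (w k) (c k) (l k)) \<longlonglongrightarrow> N*l'*(w' - l')"
    unfolding Phi_poly_scale[OF l_eq] Phi_cubic_def Phi_quadratic_def by (auto intro!: tendsto_eq_intros lims)
  then have "N*l'*(w' - l') = 0" using relations by (simp add: slice_relations_def LIMSEQ_const_iff)
  with S_limit have "N*l'*(N*l')\<^sup>2 = 0" by algebra
  then show ?thesis using N_pos by simp
qed

definition G where "G k = c k / Z k"
definition L where "L k = l k / (Z k)\<^sup>2"
definition \<rho> where "\<rho> = - Phi_quadratic N x' y' w' / (N*w')"
definition \<gamma> where "\<gamma> = N*\<rho>/2 - 1"

lemma scaled_rate_limit: "L \<longlonglongrightarrow> \<rho>"
proof -
  define P where "P k = N*(w k - l k) + (Z k)\<^sup>2*(N/4*Phi_cubic (x k) (y k) - (y k)\<^sup>2)" for k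
  define Q where "Q k = Phi_quadratic N (x k) (y k) (w k) - (Z k)\<^sup>2/2*Phi_cubic (x k) (y k)" for k
  have P: "P \<longlonglongrightarrow> N*w'" unfolding P_def Phi_cubic_def by (auto intro!: tendsto_eq_intros lims simp: rate_limit_zero)
  have Q: "Q \<longlonglongrightarrow> Phi_quadratic N x' y' w'"
    unfolding Q_def Phi_cubic_def Phi_quadratic_def by (auto intro!: tendsto_eq_intros lims)
  have nonzero: "N*w' \<noteq> 0" using N_pos w'_pos by simp
  have "l k * P k = - ((Z k)\<^sup>2 * Q k)" for k
    using relations[of k] unfolding slice_relations_def Phi_poly_scale[OF l_eq] P_def Q_def
    by (simp add: algebra_simps)
  then have "L k = - Q k / P k" if "P k \<noteq> 0" for k
    using that Z_nonzero[of k] by (simp add: L_def field_simps)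
  then have "\<forall>\<^sub>F k in sequentially. - Q k / P k = L k"
    using tendsto_imp_eventually_ne[OF P nonzero] by (auto elim: eventually_mono)
  moreover have "(\<lambda>k. - Q k / P k) \<longlonglongrightarrow> \<rho>"
    unfolding \<rho>_def by (intro tendsto_intros P Q nonzero)
  ultimately show ?thesis by (simp cong: filterlim_cong)
qed

lemma scaled_axis_tan_limit: "G \<longlonglongrightarrow> \<gamma>"
proof -
  have "G = (\<lambda>k. N*L k/2 - 1)"
    unfolding G_def L_def fun_eq_iff axis_tan_eq using Z_nonzero by (simp add: field_simps power2_eq_square)
  then show ?thesis unfolding \<gamma>_def by (auto intro!: tendsto_eq_intros scaled_rate_limit)
qed

lemma relations_scaled:
  "S_Phi_poly N (Z k*x k) (Z k*y k) (w k) (Z k*G k) ((Z k)\<^sup>2*L k) = 0"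
  "E_Phi_poly N (Z k*x k) (Z k*y k) (w k) (Z k*G k) ((Z k)\<^sup>2*L k) = 0"
  using relations[of k] Z_nonzero[of k] by (simp_all add: slice_relations_def G_def L_def)

lemmas scaled_lims = lims(1-4) scaled_rate_limit scaled_axis_tan_limit

definition S_X_seq where "S_X_seq k = S_X_poly N (x k) (y k) (w k) (G k) (L k)"
definition S_d_seq where "S_d_seq k = S_d_poly N (x k) (y k) (w k) (G k) (L k)"

lemma S_limits: "S_X_seq \<longlonglongrightarrow> S_X_poly N x' y' w' \<gamma> \<rho>" "S_d_seq \<longlonglongrightarrow> S_d_poly N x' y' w' \<gamma> \<rho>"
  unfolding S_X_seq_def S_d_seq_def S_X_poly_def S_d_poly_def by (auto intro!: tendsto_eq_intros scaled_lims)

lemma S_Phi_limit: "(w' - 1)*(N*x' - y') = 0"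
proof -
  define e where "e k = S_w_poly N (x k) (y k) (w k) (G k) (L k)" for k
  define g where "g k = (w k - 1)*(N*x k - y k) + (Z k)\<^sup>2*(N*G k*L k - L k*x k
      + G k*((y k)\<^sup>2 - (x k)\<^sup>2)/2)" for k
  have derivs: "e \<longlonglongrightarrow> S_w_poly N x' y' w' \<gamma> \<rho>"
    "g \<longlonglongrightarrow> (w' - 1)*(N*x' - y')"
    unfolding e_def g_def S_w_poly_def
    by (auto intro!: tendsto_eq_intros scaled_lims)
  have zero: "N*g k*(w k - (Z k)\<^sup>2*L k) + (Z k)\<^sup>2*(N*L k*(e k - g k) - g k*(y k)\<^sup>2
      - (Z k)\<^sup>2*(2*L k*y k*S_d_seq k) + e k*((N/2+1)*(y k)\<^sup>2 - N*x k*y k - N/2*(x k)\<^sup>2)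
      + w k*((N+2)*y k*S_d_seq k - N*(S_X_seq k*y k + x k*S_d_seq k) - N*x k*S_X_seq k)
      + ((3*N+1)*x k*S_X_seq k + 3*N*(S_X_seq k*y k + x k*S_d_seq k) + (N-3)*y k*S_d_seq k)
      + (1 + (Z k*G k)\<^sup>2)/2*Phi_cubic (x k) (y k)
      + (Z k)\<^sup>2*(G k/2*(3*(x k)\<^sup>2*S_X_seq k + 6*x k*S_X_seq k*y k + 3*(x k)\<^sup>2*S_d_seq k + S_X_seq k*(y k)\<^sup>2
      + 2*x k*y k*S_d_seq k - 3*(y k)\<^sup>2*S_d_seq k))) = 0"
      (is "?lhs k = 0") for k
    using relations_scaled(1)[of k] Z_nonzero[of k]
    unfolding S_Phi_poly_def slice_polys_scale S_X_seq_def[symmetric] S_d_seq_def[symmetric] e_def[symmetric]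
      g_def[symmetric] Phi_poly_deriv_scale_S
    by (simp only: mult_eq_0_iff simp_thms)
  have "?lhs \<longlonglongrightarrow> N*((w' - 1)*(N*x' - y'))*w'"
    unfolding Phi_cubic_def by (auto intro!: tendsto_eq_intros scaled_lims S_limits derivs)
  then have "N*((w' - 1)*(N*x' - y'))*w' = 0" unfolding zero by (simp only: LIMSEQ_const_iff)
  then show ?thesis using N_pos w'_pos by simp
qed

lemma axis_limits:
  assumes "w' = 1" "y' = 2 - x'"
  shows "N*\<rho> = 2 - 2*x' - 4*N" "\<gamma> = - (x' + 2*N)"
proof -
  have "w'*(N*\<rho>) = - Phi_quadratic N x' y' w'" using N_pos w'_pos by (simp add: \<rho>_def)
  moreover have "Phi_quadratic N x' y' w' = 4*N - 2 + 2*x'"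
    unfolding Phi_quadratic_def assms by (simp add: field_simps power2_eq_square)
  ultimately show \<rho>: "N*\<rho> = 2 - 2*x' - 4*N" using assms(1) by simp
  show "\<gamma> = - (x' + 2*N)" unfolding \<gamma>_def \<rho> by (simp add: field_simps)
qed

definition E_X_seq
  where "E_X_seq k = (w k - 1)*(N*x k - y k) - y k + (Z k)\<^sup>2*(L k*y k - G k*((x k)\<^sup>2 + (y k)\<^sup>2)/2)"
definition E_d_seq where "E_d_seq k = - N*x k - (N-1)*y k + (Z k)\<^sup>2*G k*((y k)\<^sup>2/2 - x k*y k - (x k)\<^sup>2/2)"
definition E_w_seq where "E_w_seq k = - w k*((N-1)*(w k - 1) + (Z k)\<^sup>2*(L k - G k*y k - G k*x k))"
definition S_E_d_seq
  where "S_E_d_seq k = (1 + (Z k)\<^sup>2*(G k)\<^sup>2)*((y k)\<^sup>2/2 - x k*y k - (x k)\<^sup>2/2) - N*S_X_seq k - (N-1)*S_d_seq k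
  + (Z k)\<^sup>2*G k*(y k*S_d_seq k - x k*S_d_seq k - S_X_seq k*y k - x k*S_X_seq k)"
definition E_l_seq
  where "E_l_seq k = (S_E_d_seq k + (x k + y k)*E_d_seq k + (x k + G k)*E_d_seq k + y k*E_X_seq k)/N"

definition E_d_lim where "E_d_lim = - N*x' - (N-1)*y'"
definition S_E_d_lim where
  "S_E_d_lim = y'\<^sup>2/2 - x'*y' - x'\<^sup>2/2 - N*S_X_poly N x' y' w' \<gamma> \<rho> - (N-1)*S_d_poly N x' y' w' \<gamma> \<rho>"
definition E_l_lim where "E_l_lim = (S_E_d_lim + (x' + y')*E_d_lim + (x' + \<gamma>)*E_d_lim - y'*y')/N"

lemma E_limits:
  assumes "w' = 1"
  shows "E_X_seq \<longlonglongrightarrow> - y'" "E_d_seq \<longlonglongrightarrow> E_d_lim" "E_w_seq \<longlonglongrightarrow> 0" "E_l_seq \<longlonglongrightarrow> E_l_lim"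
proof -
  have "S_E_d_seq \<longlonglongrightarrow> S_E_d_lim"
    unfolding S_E_d_seq_def S_E_d_lim_def by (auto intro!: tendsto_eq_intros scaled_lims S_limits simp: assms)
  moreover show E: "E_X_seq \<longlonglongrightarrow> - y'" "E_d_seq \<longlonglongrightarrow> E_d_lim" "E_w_seq \<longlonglongrightarrow> 0"
    unfolding E_X_seq_def E_d_seq_def E_w_seq_def E_d_lim_def
    by (auto intro!: tendsto_eq_intros scaled_lims simp: assms)
  ultimately show "E_l_seq \<longlonglongrightarrow> E_l_lim"
    unfolding E_l_seq_def E_l_lim_def using N_pos by (auto intro!: tendsto_eq_intros scaled_lims)
qed

lemma E_l_poly_scaled: "E_l_poly N (Z k*x k) (Z k*y k) (w k) (Z k*G k) ((Z k)\<^sup>2*L k) = (Z k)\<^sup>2*E_l_seq k"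
  unfolding E_l_poly_def S_E_d_poly_scale slice_polys_scale S_X_seq_def[symmetric] S_d_seq_def[symmetric]
    E_X_seq_def[symmetric] E_d_seq_def[symmetric] S_E_d_seq_def[symmetric] E_l_seq_def
  by (simp add: algebra_simps power2_eq_square add_divide_distrib)

definition scaled_E_Phi where
  "scaled_E_Phi k = N*E_l_seq k*(w k - (Z k)\<^sup>2*L k) + N*L k*(E_w_seq k - (Z k)\<^sup>2*E_l_seq k)
    - (Z k)\<^sup>2*(E_l_seq k*(y k)\<^sup>2 + 2*L k*y k*E_d_seq k)
    + E_w_seq k*((N/2+1)*(y k)\<^sup>2 - N*x k*y k - N/2*(x k)\<^sup>2)
    + w k*((N+2)*y k*E_d_seq k - N*(E_X_seq k*y k + x k*E_d_seq k) - N*x k*E_X_seq k)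
    + ((3*N+1)*x k*E_X_seq k + 3*N*(E_X_seq k*y k + x k*E_d_seq k) + (N-3)*y k*E_d_seq k)
    + (Z k)\<^sup>2*(G k/2*(3*(x k)\<^sup>2*E_X_seq k + 6*x k*E_X_seq k*y k + 3*(x k)\<^sup>2*E_d_seq k + E_X_seq k*(y k)\<^sup>2
    + 2*x k*y k*E_d_seq k - 3*(y k)\<^sup>2*E_d_seq k))"

lemma scaled_E_Phi_zero: "scaled_E_Phi k = 0"
  using relations_scaled(2)[of k] Z_nonzero[of k]
  unfolding E_Phi_poly_def E_l_poly_scaled slice_polys_scale E_X_seq_def[symmetric] E_d_seq_def[symmetric]
    E_w_seq_def[symmetric] Phi_poly_deriv_scale_E scaled_E_Phi_def
  by (simp only: mult_eq_0_iff power_eq_0_iff simp_thms)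

lemma E_Phi_limit:
  assumes "w' = 1" "y' = 2 - x'"
  shows "(N + 1)*(x' + 2*N) = 0"
proof -
  have "scaled_E_Phi \<longlonglongrightarrow> N*E_l_lim + (N+2)*y'*E_d_lim - N*(x'*E_d_lim - y'*y') + N*x'*y'
      + (3*N*(x'*E_d_lim - y'*y') - (3*N+1)*x'*y' + (N-3)*y'*E_d_lim)"
    unfolding scaled_E_Phi_def
    by (auto intro!: tendsto_eq_intros scaled_lims E_limits[OF assms(1)] simp: assms(1) algebra_simps)
  then have "N*E_l_lim + (N+2)*y'*E_d_lim - N*(x'*E_d_lim - y'*y') + N*x'*y'
      + (3*N*(x'*E_d_lim - y'*y') - (3*N+1)*x'*y' + (N-3)*y'*E_d_lim) = 0"
    unfolding scaled_E_Phi_zero by (simp only: LIMSEQ_const_iff)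
  moreover have "N*E_l_lim = S_E_d_lim + (x' + y')*E_d_lim + (x' + \<gamma>)*E_d_lim - y'*y'"
    using N_pos by (simp add: E_l_lim_def)
  ultimately have limit: "S_E_d_lim + (x' + y')*E_d_lim + (x' + \<gamma>)*E_d_lim - y'*y'
      + (N+2)*y'*E_d_lim - N*(x'*E_d_lim - y'*y') + N*x'*y'
      + (3*N*(x'*E_d_lim - y'*y') - (3*N+1)*x'*y' + (N-3)*y'*E_d_lim) = 0" by simp
  have S_E_d_lim: "S_E_d_lim
      = y'\<^sup>2/2 - x'*y' - x'\<^sup>2/2 - N*((x' + 2*N)*x' - (x'\<^sup>2 + y'\<^sup>2)/2) - (N-1)*(2 - 2*x' - 4*N + 2*N*y')"
    unfolding S_E_d_lim_def S_X_poly_def S_d_poly_def axis_limits[OF assms] by (simp add: field_simps)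
  show ?thesis
    using limit unfolding S_E_d_lim axis_limits(2)[OF assms] E_d_lim_def unfolding assms(2)
    by (simp add: field_simps power2_eq_square)
qed

end

lemma small_relations_contradiction:
  fixes Y Z w c l :: "nat \<Rightarrow> real"
  assumes N: "N > 1" and w0: "w0 > 0" and Z: "\<And>k. Z k \<noteq> 0" "Z \<longlonglongrightarrow> 0" and w: "w \<longlonglongrightarrow> w0"
    and Y: "\<And>k. \<bar>Y k / Z k\<bar> \<le> 1" "w0 \<noteq> 1 \<Longrightarrow> (\<lambda>k. Y k / Z k) \<longlonglongrightarrow> 0"
    and l: "\<And>k. N * l k = 2*(Z k)\<^sup>2 + 2*c k*Z k"
    and relations: "\<And>k. slice_relations N (Y k + Z k) (Z k - Y k) (w k) (c k) (l k)"
  shows False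
proof -
  have "bounded (range (\<lambda>k. Y k / Z k))" unfolding bounded_iff using Y(1) by auto
  then obtain t r where r: "strict_mono r" "((\<lambda>k. Y k / Z k) \<circ> r) \<longlonglongrightarrow> t"
    using bounded_imp_convergent_subsequence by blast
  then have t: "(\<lambda>k. Y (r k) / Z (r k)) \<longlonglongrightarrow> t" by (simp add: o_def)
  have lims_r: "(\<lambda>k. Z (r k)) \<longlonglongrightarrow> 0" "(\<lambda>k. w (r k)) \<longlonglongrightarrow> w0"
    using LIMSEQ_subseq_LIMSEQ[OF Z(2) r(1)] LIMSEQ_subseq_LIMSEQ[OF w r(1)] by (simp_all add: o_def)
  have xy: "(\<lambda>k. 1 + Y (r k) / Z (r k)) \<longlonglongrightarrow> 1 + t" "(\<lambda>k. 1 - Y (r k) / Z (r k)) \<longlonglongrightarrow> 1 - t"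
    by (intro tendsto_intros t)+
  have scaled: "Z k * (1 + Y k / Z k) = Y k + Z k" "Z k * (1 - Y k / Z k) = Z k - Y k" for k
    using Z(1)[of k] by (simp_all add: field_simps)
  have "Bseq (\<lambda>k. l (r k))"
    by (rule Phi_poly_root_bounded[of N "\<lambda>k. Z (r k)" "\<lambda>k. 1 + Y (r k) / Z (r k)" "\<lambda>k. 1
        - Y (r k) / Z (r k)" "\<lambda>k. w (r k)" _ "\<lambda>k. c (r k)"])
      (use N l relations lims_r xy in \<open>auto simp: scaled slice_relations_def intro: convergentI\<close>)
  then obtain l' s where s: "strict_mono s" "((\<lambda>k. l (r k)) \<circ> s) \<longlonglongrightarrow> l'"
    using bounded_imp_convergent_subsequence by (metis Bseq_eq_bounded)
  interpret shrinking_relations N "\<lambda>k. Z (r (s k))" "\<lambda>k. 1 + Y (r (s k)) / Z (r (s k))"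
    "\<lambda>k. 1 - Y (r (s k)) / Z (r (s k))"
    "\<lambda>k. w (r (s k))" "\<lambda>k. c (r (s k))" "\<lambda>k. l (r (s k))" "1 + t" "1 - t" w0 l'
    using N w0 Z(1) l relations s(2) LIMSEQ_subseq_LIMSEQ[OF _ s(1)] lims_r xy
    by unfold_locales (auto simp: scaled o_def)
  have "w0 = 1"
  proof (rule ccontr)
    assume "w0 \<noteq> 1"
    then have "t = 0" using LIMSEQ_unique[OF t] LIMSEQ_subseq_LIMSEQ[OF Y(2) r(1)] by (simp add: o_def)
    then show False using S_Phi_limit \<open>w0 \<noteq> 1\<close> N by simp
  qed
  then have "(N + 1)*((1 + t) + 2*N) = 0" by (intro E_Phi_limit) simp_all
  moreover have "\<bar>t\<bar> \<le> 1" using tendsto_rabs[OF t] by (rule LIMSEQ_le_const2) (use Y(1) in auto)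
  ultimately show False using N by simp
qed

definition no_small_relations :: "real \<Rightarrow> real \<Rightarrow> real \<Rightarrow> bool" where
  "no_small_relations N w0 \<epsilon> \<longleftrightarrow> (\<forall>Y Z w c l. Z \<noteq> 0 \<longrightarrow> \<bar>Z\<bar> < \<epsilon> \<longrightarrow> \<bar>w - w0\<bar> < \<epsilon> \<longrightarrow>
    \<bar>Y\<bar> \<le> (if w0 = 1 then 1 else \<epsilon>) * \<bar>Z\<bar> \<longrightarrow> N * l = 2 * Z\<^sup>2 + 2 * c * Z
    \<longrightarrow> \<not> slice_relations N (Y + Z) (Z - Y) w c l)"

lemma ex_no_small_relations:
  assumes "N > 1" "w0 > 0"
  obtains \<epsilon> where "\<epsilon> > 0" "no_small_relations N w0 \<epsilon>"
proof (rule ccontr)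
  define e where "e k = 1 / real (Suc k)" for k
  have e: "e k > 0" "e k \<le> 1" "e \<longlonglongrightarrow> 0" for k
    using LIMSEQ_Suc[OF lim_1_over_n[where 'a=real]] by (simp_all add: e_def[abs_def])
  assume "\<not> thesis"
  then have "\<not> no_small_relations N w0 (e k)" for k using that e(1) by blast
  then obtain Y Z w c l where small: "\<And>k. Z k \<noteq> 0" "\<And>k. \<bar>Z k\<bar> < e k" "\<And>k. \<bar>w k - w0\<bar> < e k"
      "\<And>k. \<bar>Y k\<bar> \<le> (if w0 = 1 then 1 else e k) * \<bar>Z k\<bar>"
    and relations: "\<And>k. N * l k = 2 * (Z k)\<^sup>2 + 2 * c k * Z k"
      "\<And>k. slice_relations N (Y k + Z k) (Z k - Y k) (w k) (c k) (l k)"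
    unfolding no_small_relations_def by metis
  have ratio: "\<bar>Y k / Z k\<bar> \<le> (if w0 = 1 then 1 else e k)" for k
    using small(4)[of k] small(1)[of k] by (simp add: abs_divide divide_le_eq)
  show False
  proof (rule small_relations_contradiction[OF assms small(1) _ _ _ _ relations])
    show "Z \<longlonglongrightarrow> 0"
      by (rule Lim_null_comparison[OF _ e(3)]) (use small(2) less_imp_le in \<open>auto intro!: always_eventually\<close>)
    have "(\<lambda>k. w k - w0) \<longlonglongrightarrow> 0"
      by (rule Lim_null_comparison[OF _ e(3)]) (use small(3) less_imp_le in \<open>auto intro!: always_eventually\<close>)
    then show "w \<longlonglongrightarrow> w0" by (simp add: LIM_zero_iff)
    show "\<bar>Y k / Z k\<bar> \<le> 1" for k using ratio[of k] e(2)[of k] by (auto split: if_splits)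
    show "(\<lambda>k. Y k / Z k) \<longlonglongrightarrow> 0" if "w0 \<noteq> 1"
      by (rule Lim_null_comparison[OF _ e(3)]) (use ratio that in \<open>auto intro!: always_eventually\<close>)
  qed
qed

section \<open>Decay of the metric\<close>

lemma sphere_laplace_cong_open:
  assumes "open U" "smooth_on f U" "smooth_on g U" "x \<in> U" "\<And>y. y \<in> U \<Longrightarrow> f y = g y"
  shows "sphere_laplace f x = sphere_laplace g x"
proof -
  have "rot_deriv p f y = rot_deriv p g y" if "y \<in> U" for p y
    by (rule lderiv_cong_open[OF assms(1) that assms(5)])
  then have "rot_deriv p (rot_deriv p f) x = rot_deriv p (rot_deriv p g) x" for p
    by (rule lderiv_cong_open[OF assms(1,4)])
  then show ?thesis
    unfolding sphere_laplace_eq_rot_derivs[OF assms(1,2,4)] sphere_laplace_eq_rot_derivs[OF assms(1,3,4)]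
    by simp
qed

lemma sphere_max_quotient_sphere_laplace:
  assumes U: "open U" "\<And>y. norm y = norm x \<Longrightarrow> y \<in> U" and smooth: "smooth_on f U" "smooth_on g U"
    and pos: "\<And>y. y \<in> U \<Longrightarrow> g y > 0" and max: "\<And>y. norm y = norm x \<Longrightarrow> f y / g y \<le> f x / g x"
  shows "sphere_laplace f x \<le> f x / g x * sphere_laplace g x"
proof -
  have x: "x \<in> U" by (rule U(2)) simp
  have quotient: "smooth_on (\<lambda>y. f y / g y) U" by (intro smooth_divide U(1) smooth) (use pos in force)
  note maximum = sphere_max_sphere_laplace[OF U(1) quotient U(2) max]
  have gradient: "rot_deriv p (\<lambda>y. f y / g y) x = 0" for p by (rule maximum(2))
  have "sphere_laplace f x = sphere_laplace (\<lambda>y. f y / g y * g y) x"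
    by (rule sphere_laplace_cong_open[OF U(1) smooth(1) smooth_mult[OF U(1) quotient smooth(2)] x])
      (use pos in force)
  also have "\<dots> = f x / g x * sphere_laplace g x + g x * sphere_laplace (\<lambda>y. f y / g y) x"
    unfolding sphere_laplace_mult[OF U(1) quotient smooth(2) x] gradient by simp
  also have "\<dots> \<le> f x / g x * sphere_laplace g x" using pos[OF x] maximum(1) by (simp add: mult_le_0_iff)
  finally show ?thesis .
qed

lemma exterior_weighted_max_principle:
  fixes G :: "'a::euclidean_space \<Rightarrow> real"
  assumes "r1 > 0" "\<And>x. norm x = r1 \<Longrightarrow> G x \<le> K" "\<And>x. norm x \<ge> r1 \<Longrightarrow> G differentiable (at x)"
    and decreasing: "\<And>x. norm x > r1 \<Longrightarrow> (\<And>y. norm y = norm x \<Longrightarrow> G y \<le> G x) \<Longrightarrow> lderiv id G x \<le> - k * G x"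
    and "norm y \<ge> r1"
  shows "G y * norm y powr k \<le> K * r1 powr k"
proof (rule exterior_max_principle[OF assms(1) _ _ _ assms(5), where H="\<lambda>x. G x * norm x powr k"])
  show "G x * norm x powr k \<le> K * r1 powr k" if "norm x = r1" for x
    unfolding that by (rule mult_right_mono[OF assms(2)[OF that]]) simp
  have weight: "x \<noteq> 0" "norm x powr k > 0" if "norm x \<ge> r1" for x :: 'a using that assms(1) by auto
  show "(\<lambda>x. G x * norm x powr k) differentiable (at x)" if "norm x \<ge> r1" for x
    by (intro differentiable_mult assms(3) lderiv_id_norm_powr weight(1) that)
  show "lderiv id (\<lambda>x. G x * norm x powr k) x \<le> 0"
    if x: "norm x > r1" and max: "\<And>y. norm y = norm x \<Longrightarrow> G y * norm y powr k \<le> G x * norm x powr k" for x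
  proof -
    have x': "norm x \<ge> r1" using x by simp
    note power = lderiv_id_norm_powr[OF weight(1)[OF x'], of k]
    have "G y \<le> G x" if "norm y = norm x" for y
      using max[OF that] weight(2)[OF x'] by (simp add: that mult_le_cancel_right)
    then have "lderiv id G x \<le> - k * G x" by (rule decreasing[OF x])
    then have "norm x powr k * (k * G x + lderiv id G x) \<le> 0" by (simp add: mult_le_0_iff)
    moreover have "lderiv id (\<lambda>x. G x * norm x powr k) x = norm x powr k * (k * G x + lderiv id G x)"
      unfolding lderiv_arith(3)[OF assms(3)[OF x'] power(1)] power(2) by (simp add: algebra_simps)
    ultimately show ?thesis by simp
  qed
qed

locale exterior_static = static_quasi_spherical U u V n for U :: "(real^'n::finite) set" and u V n +
  fixes r0 :: real
  assumes U_eq: "U = ext_region r0" and r0_pos: "r0 > 0" and n_ge_3: "n \<ge> 3"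
    and V_bounded: "bounded (V ` U)" and V_nontrivial: "\<exists>x\<in>U. V x \<noteq> 0"
begin

lemma mem_U_iff: "x \<in> U \<longleftrightarrow> norm x > r0"
  by (simp add: U_eq ext_region_def)

lemma U_nonzero: "x \<in> U \<Longrightarrow> x \<noteq> 0"
  using r0_pos by (auto simp: mem_U_iff)

lemma sphere_in_U: "x \<in> U \<Longrightarrow> norm y = norm x \<Longrightarrow> y \<in> U"
  by (simp add: mem_U_iff)

lemma CARD_ge_3: "CARD('n) \<ge> 3"
  using n_ge_3 CARD_eq by linarith

lemma connected_U: "connected U"
proof -
  have "U = - cball 0 r0" by (auto simp: mem_U_iff)
  moreover have "connected (- cball 0 r0 :: (real^'n) set)"
    by (rule connected_complement_bounded_convex) (use CARD_ge_3 in auto)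
  ultimately show ?thesis by simp
qed

lemma Eu_eq:
  assumes "x \<in> U"
  shows "(n - 1) * Eu x = (u x)\<^sup>2 * sphere_laplace u x - (n - 1) * (n - 2) / 2 * ((u x)^3 - u x)"
proof -
  define a where "a = sphere_laplace u x / u x"
  define M where "M = Eu x / u x"
  define k where "k = (n - 1) * (n - 2) / 2"
  have eqs: "sphere_laplace u x = u x * a" "Eu x = u x * M" "omega x * (u x)\<^sup>2 = 1"
    using u_nonzero[OF assms] by (simp_all add: a_def M_def omega_def)
  have "a - (n - 1) * omega x * M = k * (1 - omega x)"
    unfolding a_def M_def k_def by (rule scalar_equation[OF connected_U V_nontrivial assms])
  then have "(n - 1) * (u x * M) = (u x)\<^sup>2 * (u x * a) - k * ((u x)^3 - u x)" using eqs(3) by algebra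
  then show ?thesis unfolding eqs(1,2) k_def[symmetric] .
qed

definition mass_fun where "mass_fun x = (1 - omega x) * norm x powr (n - 2)"

lemma lderiv_id_mass_fun:
  assumes "x \<in> U"
  shows "mass_fun differentiable (at x)"
    "lderiv id mass_fun x = norm x powr (n - 2) * (2 / (n - 1) * (sphere_laplace u x / u x))"
proof -
  have omega: "omega differentiable (at x)" by (intro differentiable_U[OF _ assms] smooth_coefficients)
  have diff: "(\<lambda>y. 1 - omega y) differentiable (at x)" using omega by simp
  note power = lderiv_id_norm_powr[OF U_nonzero[OF assms], of "n - 2"]
  show "mass_fun differentiable (at x)" unfolding mass_fun_def by (intro differentiable_mult diff power)
  define a where "a = sphere_laplace u x / u x"
  define M where "M = Eu x / u x"
  have "lderiv id (\<lambda>y. 1 - omega y) x = 2 * omega x * M"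
    using dderiv_omega[OF assms, of x] lderiv_arith(2)[of "\<lambda>_. 1" x omega id] omega
    by (simp add: lderiv_def M_def)
  then have "lderiv id mass_fun x = norm x powr (n - 2) * ((n - 2) * (1 - omega x) + 2 * omega x * M)"
    unfolding mass_fun_def lderiv_arith(3)[OF diff power(1)] power(2) by (simp add: algebra_simps)
  moreover have "a - (n - 1) * omega x * M = (n - 1) * (n - 2) / 2 * (1 - omega x)"
    unfolding a_def M_def by (rule scalar_equation[OF connected_U V_nontrivial assms])
  then have "(n - 2) * (1 - omega x) + 2 * omega x * M = 2 / (n - 1) * a"
    using n_ge_3 by (simp add: field_simps)
  ultimately show "lderiv id mass_fun x = norm x powr (n - 2) * (2 / (n - 1) * (sphere_laplace u x / u x))"
    by (simp add: a_def)
qed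

lemma mass_fun_le_iff:
  assumes "x \<in> U" "norm y = norm x"
  shows "mass_fun y \<le> mass_fun x \<longleftrightarrow> u y \<le> u x"
proof -
  have pos: "u x > 0" "u y > 0" using u_pos assms sphere_in_U by blast+
  have "mass_fun y \<le> mass_fun x \<longleftrightarrow> 1 / (u x)\<^sup>2 \<le> 1 / (u y)\<^sup>2"
    using U_nonzero[OF assms(1)] by (simp add: mass_fun_def omega_def assms(2))
  also have "\<dots> \<longleftrightarrow> (u y)\<^sup>2 \<le> (u x)\<^sup>2" using pos by (simp add: field_simps)
  also have "\<dots> \<longleftrightarrow> u y \<le> u x" using pos by (simp add: power2_le_iff_abs_le)
  finally show ?thesis .
qed

lemma signed_mass_fun_le:
  assumes "r > r0" "s = 1 \<or> s = -1" "\<And>x. norm x = r \<Longrightarrow> \<bar>mass_fun x\<bar> \<le> K" "norm y \<ge> r"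
  shows "s * mass_fun y \<le> K"
proof (rule exterior_max_principle[OF _ _ _ _ assms(4)])
  have inU: "x \<in> U" if "norm x \<ge> r" for x using that assms(1) by (simp add: mem_U_iff)
  show "s * mass_fun x \<le> K" if "norm x = r" for x using assms(2) assms(3)[OF that] by auto
  show "(\<lambda>x. s * mass_fun x) differentiable (at x)" if "norm x \<ge> r" for x
    using lderiv_id_mass_fun(1)[OF inU[OF that]] by (intro differentiable_mult) simp_all
  show "lderiv id (\<lambda>x. s * mass_fun x) x \<le> 0"
    if x: "norm x > r" and max: "\<And>y. norm y = norm x \<Longrightarrow> s * mass_fun y \<le> s * mass_fun x" for x
  proof -
    have xU: "x \<in> U" using inU x by simp
    have "s * u y \<le> s * u x" if "norm y = norm x" for y
      using assms(2) max[OF that] mass_fun_le_iff[OF xU that]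
        mass_fun_le_iff[OF sphere_in_U[OF xU that] that[symmetric]]
      by auto
    then have "sphere_laplace (\<lambda>y. s * u y) x \<le> 0"
      by (intro sphere_max_sphere_laplace(1)[OF open_U] smooth_mult smooth_const smooth_u open_U
        sphere_in_U[OF xU])
    then have "s * sphere_laplace u x \<le> 0" unfolding sphere_laplace_cmult[OF open_U smooth_u xU] .
    moreover define c where "c = norm x powr (n - 2) * (2 / (n - 1)) / u x"
    have "c \<ge> 0" unfolding c_def using u_pos[OF xU] n_ge_3 by simp
    ultimately have "(s * sphere_laplace u x) * c \<le> 0" by (rule mult_nonpos_nonneg)
    moreover have "lderiv id (\<lambda>x. s * mass_fun x) x = s * lderiv id mass_fun x"
      using lderiv_arith(3)[OF _ lderiv_id_mass_fun(1)[OF xU], of "\<lambda>_. s" id] by simp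
    moreover have "lderiv id mass_fun x = sphere_laplace u x * c"
      unfolding lderiv_id_mass_fun(2)[OF xU] c_def by simp
    ultimately show ?thesis by (simp only: mult.assoc)
  qed
qed (use assms(1) r0_pos in simp)

lemma omega_decay:
  assumes "r > r0"
  obtains C where "C > 0" "\<And>x. norm x \<ge> r \<Longrightarrow> \<bar>1 - omega x\<bar> \<le> C * norm x powr (2 - n)"
proof -
  have "mass_fun differentiable (at x within sphere 0 r)" if "x \<in> sphere 0 r" for x
    by (rule differentiable_at_withinI[OF lderiv_id_mass_fun(1)]) (use that assms in \<open>simp add: mem_U_iff\<close>)
  then have "continuous_on (sphere 0 r) mass_fun"
    by (intro differentiable_imp_continuous_on) (simp add: differentiable_on_def)
  from bounded_on_sphere[OF this] obtain K where K: "\<And>x. norm x = r \<Longrightarrow> \<bar>mass_fun x\<bar> \<le> K" by metis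
  show ?thesis
  proof (rule that[of "max K 1"])
    fix x :: "real^'n" assume x: "norm x \<ge> r"
    have pos: "norm x > 0" using x assms r0_pos by linarith
    have "\<bar>mass_fun x\<bar> \<le> max K 1"
      using signed_mass_fun_le[OF assms _ K x, of 1] signed_mass_fun_le[OF assms _ K x, of "-1"] by simp
    then have "\<bar>1 - omega x\<bar> * norm x powr (n - 2) \<le> max K 1" by (simp add: mass_fun_def abs_mult)
    then have "\<bar>1 - omega x\<bar> * norm x powr (n - 2) * norm x powr (2 - n) \<le> max K 1 * norm x powr (2 - n)"
      by (rule mult_right_mono) simp
    moreover have "norm x powr (n - 2) * norm x powr (2 - n) = 1" using pos by (simp add: powr_add[symmetric])
    ultimately show "\<bar>1 - omega x\<bar> \<le> max K 1 * norm x powr (2 - n)" by (simp add: mult.assoc)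
  qed simp
qed

lemma u_bounds_of_omega:
  assumes "x \<in> U" "\<bar>1 - omega x\<bar> \<le> \<delta>" "\<delta> \<le> 1/2"
  shows "\<bar>(u x)\<^sup>2 - 1\<bar> \<le> 2 * \<delta>" "\<bar>u x - 1\<bar> \<le> 2 * \<delta>"
proof -
  have omega: "omega x \<ge> 1/2" "omega x * (u x)\<^sup>2 = 1"
    using assms(2,3) u_nonzero[OF assms(1)] by (linarith, simp add: omega_def)
  then have "(u x)\<^sup>2 \<le> 2" using mult_right_mono[OF omega(1), of "(u x)\<^sup>2"] by simp
  then have "\<bar>1 - omega x\<bar> * (u x)\<^sup>2 \<le> \<delta> * 2" using assms(2) by (intro mult_mono) auto
  moreover have "(u x)\<^sup>2 - 1 = (1 - omega x) * (u x)\<^sup>2" using omega(2) by (simp add: algebra_simps)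
  then have "\<bar>(u x)\<^sup>2 - 1\<bar> = \<bar>1 - omega x\<bar> * (u x)\<^sup>2" by (simp add: abs_mult)
  ultimately show square: "\<bar>(u x)\<^sup>2 - 1\<bar> \<le> 2 * \<delta>" by linarith
  have "\<bar>u x - 1\<bar> * 1 \<le> \<bar>u x - 1\<bar> * (u x + 1)" using u_pos[OF assms(1)] by (intro mult_left_mono) auto
  also have "\<dots> = \<bar>(u x - 1) * (u x + 1)\<bar>" using u_pos[OF assms(1)] by (simp add: abs_mult)
  also have "(u x - 1) * (u x + 1) = (u x)\<^sup>2 - 1" by (simp add: power2_eq_square algebra_simps)
  finally show "\<bar>u x - 1\<bar> \<le> 2 * \<delta>" using square by simp
qed

lemma metric_decay:
  obtains C r where "C > 0" "r > r0" "r \<ge> 1" "\<And>x. norm x \<ge> r \<Longrightarrow> \<bar>1 - omega x\<bar> \<le> C / norm x"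
    "\<And>x. norm x \<ge> r \<Longrightarrow> \<bar>(u x)\<^sup>2 - 1\<bar> \<le> C / norm x" "\<And>x. norm x \<ge> r \<Longrightarrow> \<bar>u x - 1\<bar> \<le> C / norm x"
proof -
  obtain C where C: "C > 0" "\<And>x. norm x \<ge> r0 + 1 \<Longrightarrow> \<bar>1 - omega x\<bar> \<le> C * norm x powr (2 - n)"
    using omega_decay[of "r0 + 1"] by auto
  define r where "r = max (r0 + 1) (2 * C)"
  have r: "r \<ge> r0 + 1" "r > r0" "r \<ge> 1" "r \<ge> 2 * C" using r0_pos by (auto simp: r_def)
  have omega: "\<bar>1 - omega x\<bar> \<le> C / norm x" if "norm x \<ge> r" for x
  proof -
    have pos: "norm x \<ge> 1" using that r by linarith
    have "norm x powr (2 - n) \<le> norm x powr (-1)" using pos n_ge_3 by (intro powr_mono) auto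
    also have "\<dots> = 1 / norm x" using pos by (simp add: powr_minus_divide)
    finally have "C * norm x powr (2 - n) \<le> C * (1 / norm x)" using C(1) by (intro mult_left_mono) auto
    then show ?thesis using C(2)[of x] that r by simp
  qed
  have bounds: "\<bar>(u x)\<^sup>2 - 1\<bar> \<le> 2 * C / norm x" "\<bar>u x - 1\<bar> \<le> 2 * C / norm x" if x: "norm x \<ge> r" for x
  proof -
    have "C / norm x \<le> 1/2" using x r by (simp add: divide_le_eq)
    moreover have "x \<in> U" using x r by (simp add: mem_U_iff)
    ultimately show "\<bar>(u x)\<^sup>2 - 1\<bar> \<le> 2 * C / norm x" "\<bar>u x - 1\<bar> \<le> 2 * C / norm x"
      using u_bounds_of_omega[OF _ omega[OF x]] by simp_all
  qed
  have "\<bar>1 - omega x\<bar> \<le> 2 * C / norm x" if "norm x \<ge> r" for x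
    using omega[OF that] divide_right_mono[of C "2 * C" "norm x"] C(1) by simp
  then show ?thesis using that[of "2 * C" r] C(1) r bounds by simp
qed

lemma radial_deriv_rot_deriv_u:
  assumes "x \<in> U"
  shows "(n - 1) * lderiv id (rot_deriv p u) x = 2 * u x * rot_deriv p u x * sphere_laplace u x
    + (u x)\<^sup>2 * sphere_laplace (rot_deriv p u) x - (n - 1) * (n - 2) / 2 * (3 * (u x)\<^sup>2 - 1) * rot_deriv p u x"
proof -
  define k where "k = (n - 1) * (n - 2) / 2"
  note smooth = smooth_diff smooth_mult smooth_const open_U smooth_u smooth_sphere_laplace[OF open_U smooth_u]
  have diff: "h differentiable (at x)" if "smooth_on h U" for h by (rule differentiable_U[OF that assms])
  have "rot_deriv p (\<lambda>y. (n - 1) * Eu y) x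
      = rot_deriv p (\<lambda>y. u y * u y * sphere_laplace u y - k * (u y * u y * u y - u y)) x"
    by (rule lderiv_cong_open[OF open_U assms])
      (use Eu_eq in \<open>simp add: k_def power2_eq_square power3_eq_cube mult.assoc\<close>)
  moreover have "rot_deriv p (\<lambda>y. (n - 1) * Eu y) x = (n - 1) * lderiv id (rot_deriv p u) x"
    by (subst lderiv_arith(3))
      (auto intro!: diff smooth_const smooth_radial_derivs open_U
      simp: lderiv_id_commute[OF open_U smooth_u assms linear_rot])
  moreover have "rot_deriv p (\<lambda>y. u y * u y * sphere_laplace u y - k * (u y * u y * u y - u y)) x
     = u x * u x * rot_deriv p (sphere_laplace u) x + 2 * u x * rot_deriv p u x * sphere_laplace u x
     - k * (3 * (u x * u x) * rot_deriv p u x - rot_deriv p u x)"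
    by (subst lderiv_arith | (intro diff smooth))+ (simp add: algebra_simps)
  ultimately show ?thesis
    unfolding sphere_laplace_rot_commute[OF open_U smooth_u assms] k_def[symmetric]
    by (simp add: power2_eq_square algebra_simps)
qed

lemma bochner_inequality:
  assumes "x \<in> U"
  shows "(n - 1) * lderiv id (tangrad_sq u) x
      \<le> (u x)\<^sup>2 * sphere_laplace (tangrad_sq u) x + 2 * n\<^sup>2 * (tangrad_sq u x)\<^sup>2
    - (n - 1) * (n - 2) * (3 * (u x)\<^sup>2 - 1) * tangrad_sq u x"
proof -
  define k where "k = (n - 1) * (n - 2) / 2 * (3 * (u x)\<^sup>2 - 1)"
  define T where "T = (\<Sum>p\<in>UNIV. \<Sum>q\<in>UNIV. (rot_deriv q (rot_deriv p u) x)\<^sup>2)"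
  have "(n - 1) * lderiv id (tangrad_sq u) x
      = (\<Sum>p\<in>UNIV. rot_deriv p u x * ((n - 1) * lderiv id (rot_deriv p u) x))"
    unfolding lderiv_tangrad_sq[OF open_U smooth_u assms] by (simp add: sum_distrib_left algebra_simps)
  also have "\<dots> = (\<Sum>p\<in>UNIV. (2 * u x * sphere_laplace u x - k) * (rot_deriv p u x)\<^sup>2
      + (u x)\<^sup>2 * (rot_deriv p u x * sphere_laplace (rot_deriv p u) x))"
    unfolding radial_deriv_rot_deriv_u[OF assms] by (simp add: k_def power2_eq_square algebra_simps)
  also have "\<dots> = (2 * u x * sphere_laplace u x - k) * (2 * tangrad_sq u x)
      + (u x)\<^sup>2 * (sphere_laplace (tangrad_sq u) x - T / 2)"
    unfolding sphere_laplace_tangrad_sq[OF open_U smooth_u assms] tangrad_sq_def T_def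
    by (simp only: sum.distrib sum_distrib_left[symmetric]) simp
  finally have radial: "(n - 1) * lderiv id (tangrad_sq u) x = 4 * u x * sphere_laplace u x * tangrad_sq u x
      - (u x)\<^sup>2 * (T / 2) + (u x)\<^sup>2 * sphere_laplace (tangrad_sq u) x - 2 * k * tangrad_sq u x"
    by (simp add: algebra_simps)
  have n: "n > 0" using n_ge_3 by simp
  have "2 * (u x * sphere_laplace u x / n) * (n * tangrad_sq u x)
      \<le> (u x * sphere_laplace u x / n)\<^sup>2 + (n * tangrad_sq u x)\<^sup>2"
    by (rule sum_squares_bound)
  then have "4 * u x * sphere_laplace u x * tangrad_sq u x
      \<le> 2 * (u x)\<^sup>2 * ((sphere_laplace u x)\<^sup>2 / n\<^sup>2) + 2 * n\<^sup>2 * (tangrad_sq u x)\<^sup>2"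
    using n by (simp add: power_mult_distrib power_divide)
  moreover have "(sphere_laplace u x)\<^sup>2 / n\<^sup>2 \<le> T / 4"
    using sphere_laplace_sq_le[OF open_U smooth_u assms] n by (simp add: T_def field_simps)
  then have "2 * (u x)\<^sup>2 * ((sphere_laplace u x)\<^sup>2 / n\<^sup>2) \<le> 2 * (u x)\<^sup>2 * (T / 4)" by (intro mult_left_mono) auto
  ultimately have "4 * u x * sphere_laplace u x * tangrad_sq u x
      \<le> (u x)\<^sup>2 * (T / 2) + 2 * n\<^sup>2 * (tangrad_sq u x)\<^sup>2"
    by argo
  moreover have "2 * k * tangrad_sq u x = (n - 1) * (n - 2) * (3 * (u x)\<^sup>2 - 1) * tangrad_sq u x"
    by (simp add: k_def)
  ultimately show ?thesis using radial by linarith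
qed

text \<open>The weight of Bernstein's trick: dividing the squared gradient by \<open>bernstein_weight\<close> absorbs the quadratic term of the
  Bochner inequality.\<close>

definition bernstein_weight where "bernstein_weight x = 1 - 2 * n\<^sup>2 * ((u x - 1) * (u x - 1))"

lemma smooth_bernstein_weight: "smooth_on bernstein_weight U"
  unfolding bernstein_weight_def by (intro smooth_diff smooth_mult smooth_const open_U smooth_u)

lemma bernstein_weight_derivs:
  assumes "x \<in> U"
  shows "sphere_laplace bernstein_weight x
      = - 4 * n\<^sup>2 * (u x - 1) * sphere_laplace u x - 4 * n\<^sup>2 * tangrad_sq u x"
    "lderiv id bernstein_weight x = - 4 * n\<^sup>2 * (u x - 1) * Eu x"
proof -
  have shifted: "smooth_on (\<lambda>y. u y - 1) U" by (intro smooth_diff smooth_const open_U smooth_u)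
  have square: "smooth_on (\<lambda>y. (u y - 1) * (u y - 1)) U"
    "smooth_on (\<lambda>y. (- 2 * n\<^sup>2) * ((u y - 1) * (u y - 1))) U"
    by (intro smooth_mult smooth_const open_U shifted)+
  have diff: "h differentiable (at x)" if "smooth_on h U" for h by (rule differentiable_U[OF that assms])
  have lderiv_shifted: "lderiv A (\<lambda>y. u y - 1) x = lderiv A u x" for A
    by (subst lderiv_arith(2)) (auto intro: diff smooth_u)
  have weight: "bernstein_weight = (\<lambda>x. 1 + (- 2 * n\<^sup>2) * ((u x - 1) * (u x - 1)))"
    by (simp add: bernstein_weight_def fun_eq_iff)
  have laplace_shifted: "sphere_laplace (\<lambda>y. u y - 1) x = sphere_laplace u x"
    using sphere_laplace_add[OF open_U smooth_u smooth_const assms, of "-1"]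
      sphere_laplace_const[OF open_U assms, of "-1"] open_U
    by simp
  have "sphere_laplace bernstein_weight x = (- 2 * n\<^sup>2) * sphere_laplace (\<lambda>x. (u x - 1) * (u x - 1)) x"
    unfolding weight sphere_laplace_add[OF open_U smooth_const[OF open_U] square(2) assms]
      sphere_laplace_cmult[OF open_U square(1) assms]
    using sphere_laplace_const[OF open_U assms] by simp
  also have "sphere_laplace (\<lambda>x. (u x - 1) * (u x - 1)) x
      = 2 * (u x - 1) * sphere_laplace u x + 2 * tangrad_sq u x"
    unfolding sphere_laplace_mult[OF open_U shifted shifted assms] lderiv_shifted laplace_shifted
      tangrad_sq_def
    by (simp add: power2_eq_square)
  finally show "sphere_laplace bernstein_weight x
      = - 4 * n\<^sup>2 * (u x - 1) * sphere_laplace u x - 4 * n\<^sup>2 * tangrad_sq u x"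
    by (simp add: algebra_simps)
  show "lderiv id bernstein_weight x = - 4 * n\<^sup>2 * (u x - 1) * Eu x" unfolding weight
    by (subst lderiv_arith lderiv_shifted | (intro diff smooth_const open_U square shifted))+
      (simp add: algebra_simps)
qed

lemma bernstein_weight_bounds:
  assumes "\<bar>u y - 1\<bar> \<le> 1 / (24 * n)"
  shows "1/2 \<le> bernstein_weight y" "bernstein_weight y \<le> 1" "(u y)\<^sup>2 \<ge> 1 - 1 / (12 * n)"
proof -
  have n: "n > 0" using n_ge_3 by simp
  have "\<bar>u y - 1\<bar> * \<bar>u y - 1\<bar> \<le> (1 / (24 * n)) * (1 / (24 * n))" using assms n by (intro mult_mono) auto
  then have "(u y - 1) * (u y - 1) \<le> 1 / (576 * n\<^sup>2)" by (simp add: power2_eq_square)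
  then have "2 * n\<^sup>2 * ((u y - 1) * (u y - 1)) \<le> 2 * n\<^sup>2 * (1 / (576 * n\<^sup>2))" by (intro mult_left_mono) auto
  also have "\<dots> \<le> 1/2" using n by simp
  finally show "1/2 \<le> bernstein_weight y" by (simp add: bernstein_weight_def)
  show "bernstein_weight y \<le> 1" by (simp add: bernstein_weight_def)
  have "0 \<le> (u y - 1)\<^sup>2" by simp
  then have "(u y)\<^sup>2 \<ge> 1 + 2 * (u y - 1)" by (simp add: power2_eq_square algebra_simps)
  moreover have "1 / (12 * n) = 2 * (1 / (24 * n))" by simp
  ultimately show "(u y)\<^sup>2 \<ge> 1 - 1 / (12 * n)" using assms by argo
qed

lemma tangrad_sq_sq_absorbed:
  assumes "\<bar>u x - 1\<bar> \<le> 1 / (24 * n)" "g \<ge> 0" "tangrad_sq u x = g * bernstein_weight x"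
  shows "2 * n\<^sup>2 * (tangrad_sq u x)\<^sup>2 \<le> 4 * n\<^sup>2 * (u x)\<^sup>2 * g * tangrad_sq u x"
proof -
  define q where "q = tangrad_sq u x"
  note weight = bernstein_weight_bounds[OF assms(1)]
  have q: "q \<ge> 0" "q \<le> g" using assms(2,3) weight by (auto simp: q_def tangrad_sq_nonneg mult_left_le)
  have "1 / (12 * n) \<le> 1/2" using n_ge_3 by (simp add: field_simps)
  then have "2 * (u x)\<^sup>2 \<ge> 1" using weight(3) by linarith
  then have "1 * (g * q) \<le> (2 * (u x)\<^sup>2) * (g * q)" using assms(2) q(1) by (intro mult_right_mono) auto
  moreover have "q * q \<le> g * q" using q(2,1) by (rule mult_right_mono)
  ultimately have "2 * n\<^sup>2 * (q * q) \<le> 2 * n\<^sup>2 * ((2 * (u x)\<^sup>2) * (g * q))" by (intro mult_left_mono) auto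
  then show ?thesis by (simp add: q_def[symmetric] power2_eq_square algebra_simps)
qed

lemma bernstein_inequality:
  assumes x: "x \<in> U" "\<bar>u x - 1\<bar> \<le> 1 / (24 * n)" and g: "g \<ge> 0" "tangrad_sq u x = g * bernstein_weight x"
    and spatial: "sphere_laplace (tangrad_sq u) x \<le> g * sphere_laplace bernstein_weight x"
    and radial: "lderiv id (tangrad_sq u) x = g * lderiv id bernstein_weight x + g' * bernstein_weight x"
  shows "g' * bernstein_weight x \<le> - (n - 2) * (3 * (u x)\<^sup>2 - 1) * tangrad_sq u x"
proof -
  define q where "q = tangrad_sq u x"
  define a where "a = sphere_laplace u x"
  define w where "w = u x"
  define k where "k = (n - 1) * (n - 2)"
  define e where "e = Eu x"
  define D where "D = g' * bernstein_weight x"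
  have "w\<^sup>2 * sphere_laplace (tangrad_sq u) x \<le> w\<^sup>2 * (g * sphere_laplace bernstein_weight x)"
    using spatial by (intro mult_left_mono) auto
  then have bochner: "(n - 1) * (g * (- 4 * n\<^sup>2 * (w - 1) * e) + D)
      \<le> w\<^sup>2 * (g * (- 4 * n\<^sup>2 * (w - 1) * a - 4 * n\<^sup>2 * q)) + 2 * n\<^sup>2 * q\<^sup>2 - k * (3 * w\<^sup>2 - 1) * q"
    using bochner_inequality[OF x(1)]
    unfolding radial bernstein_weight_derivs[OF x(1)] q_def a_def w_def k_def e_def D_def by linarith
  have "(n - 1) * e = w\<^sup>2 * a - k / 2 * (w^3 - w)" using Eu_eq[OF x(1)] by (simp add: w_def a_def k_def e_def)
  then have "(n - 1) * (g * (- 4 * n\<^sup>2 * (w - 1) * e) + D)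
      = (n - 1) * D - 4 * n\<^sup>2 * g * (w - 1) * (w\<^sup>2 * a - k / 2 * (w^3 - w))"
    by algebra
  moreover have "w\<^sup>2 * (g * (- 4 * n\<^sup>2 * (w - 1) * a - 4 * n\<^sup>2 * q))
      + 4 * n\<^sup>2 * g * (w - 1) * (w\<^sup>2 * a - k / 2 * (w^3 - w))
     = - 4 * n\<^sup>2 * w\<^sup>2 * g * q - 2 * n\<^sup>2 * g * k * ((w - 1) * (w^3 - w))" by (simp add: field_simps)
  ultimately have "(n - 1) * D
      \<le> - 4 * n\<^sup>2 * w\<^sup>2 * g * q + 2 * n\<^sup>2 * q\<^sup>2 - k * (3 * w\<^sup>2 - 1) * q - 2 * n\<^sup>2 * g * k * ((w - 1) * (w^3 - w))"
    using bochner by argo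
  moreover have "2 * n\<^sup>2 * q\<^sup>2 \<le> 4 * n\<^sup>2 * w\<^sup>2 * g * q"
    unfolding q_def w_def by (rule tangrad_sq_sq_absorbed[OF x(2) g])
  moreover have "2 * n\<^sup>2 * g * k * ((w - 1) * (w^3 - w)) \<ge> 0"
  proof -
    have "(w - 1) * (w^3 - w) = (w - 1)\<^sup>2 * (w * (w + 1))"
      by (simp add: power2_eq_square power3_eq_cube algebra_simps)
    then show ?thesis using u_pos[OF x(1)] g(1) n_ge_3 by (simp add: w_def k_def)
  qed
  ultimately have "(n - 1) * D \<le> (n - 1) * (- (n - 2) * (3 * w\<^sup>2 - 1) * q)" unfolding k_def by argo
  then show ?thesis using n_ge_3 by (simp add: D_def w_def q_def)
qed

lemma bernstein_rate:
  assumes "\<bar>u x - 1\<bar> \<le> 1 / (24 * n)"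
  shows "2 * (n - 2) - 1/4 \<le> (n - 2) * (3 * (u x)\<^sup>2 - 1)"
proof -
  have "(n - 2) * (1 - 1 / (12 * n)) \<le> (n - 2) * (u x)\<^sup>2"
    using bernstein_weight_bounds(3)[OF assms] n_ge_3 by (intro mult_left_mono) auto
  moreover have "(n - 2) * (1 - 1 / (12 * n)) = (n - 2) - (n - 2) * (1 / (12 * n))"
    by (simp add: algebra_simps)
  moreover have "(n - 2) * (1 / (12 * n)) \<le> 1/12" using n_ge_3 by (simp add: field_simps)
  ultimately have "(n - 2) - 1/12 \<le> (n - 2) * (u x)\<^sup>2" by linarith
  then show ?thesis by (simp add: algebra_simps)
qed

lemma bernstein_quotient_decreasing:
  assumes r: "r > r0" and small: "\<And>x. norm x > r \<Longrightarrow> \<bar>u x - 1\<bar> \<le> 1 / (24 * n)"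
    and x: "norm x > r"
    and max: "\<And>y. norm y = norm x \<Longrightarrow> tangrad_sq u y / bernstein_weight y \<le> tangrad_sq u x / bernstein_weight x"
  shows "lderiv id (\<lambda>y. tangrad_sq u y / bernstein_weight y) x
      \<le> - (2 * (n - 2) - 1/4) * (tangrad_sq u x / bernstein_weight x)"
proof -
  define W where "W = {y::real^'n. norm y > r}"
  define G where "G y = tangrad_sq u y / bernstein_weight y" for y
  have W: "open W" "W \<subseteq> U" "x \<in> W"
    unfolding W_def using r x by (auto intro!: open_Collect_less continuous_intros simp: mem_U_iff)
  have xU: "x \<in> U" using W by blast
  note weight = bernstein_weight_bounds[OF small]
  have pos: "bernstein_weight y > 0" if "y \<in> W" for y using weight(1)[of y] that by (simp add: W_def)
  have smooth: "smooth_on (tangrad_sq u) W" "smooth_on bernstein_weight W"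
    by (intro smooth_on_subset[OF _ W(2)] smooth_tangrad_sq open_U smooth_u smooth_bernstein_weight)+
  have smooth_G: "smooth_on G W" unfolding G_def by (intro smooth_divide W(1) smooth) (use pos in force)
  have "lderiv id (tangrad_sq u) x = lderiv id (\<lambda>z. G z * bernstein_weight z) x"
    by (rule lderiv_cong_open[OF W(1,3)]) (use pos in \<open>force simp: G_def\<close>)
  also have "\<dots> = G x * lderiv id bernstein_weight x + lderiv id G x * bernstein_weight x"
    by (rule lderiv_arith) (intro smooth_differentiable[OF W(1) _ W(3)] smooth_G smooth)+
  finally have radial: "lderiv id (tangrad_sq u) x
      = G x * lderiv id bernstein_weight x + lderiv id G x * bernstein_weight x" .
  have G: "G x \<ge> 0" "tangrad_sq u x = G x * bernstein_weight x"
    using pos[OF W(3)] by (simp_all add: G_def tangrad_sq_nonneg)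
  have "sphere_laplace (tangrad_sq u) x \<le> G x * sphere_laplace bernstein_weight x"
    unfolding G_def by (rule sphere_max_quotient_sphere_laplace[OF W(1) _ smooth pos max])
      (use x in \<open>auto simp: W_def\<close>)
  then have "lderiv id G x * bernstein_weight x \<le> - (n - 2) * (3 * (u x)\<^sup>2 - 1) * tangrad_sq u x"
    by (rule bernstein_inequality[OF xU small[OF x] G _ radial])
  then have "lderiv id G x * bernstein_weight x \<le> (- (n - 2) * (3 * (u x)\<^sup>2 - 1) * G x) * bernstein_weight x"
    unfolding G(2) by (simp add: algebra_simps)
  then have "lderiv id G x \<le> - (n - 2) * (3 * (u x)\<^sup>2 - 1) * G x"
    by (rule mult_right_le_imp_le) (rule pos[OF W(3)])
  also have "\<dots> \<le> - (2 * (n - 2) - 1/4) * G x"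
    using bernstein_rate[OF small[OF x]] by (intro mult_right_mono G(1))
      (simp only: mult_minus_left neg_le_iff_le)
  finally show ?thesis by (simp add: G_def[abs_def])
qed

lemma bernstein_quotient_decay:
  assumes r: "r > r0" and small: "\<And>x. norm x \<ge> r \<Longrightarrow> \<bar>u x - 1\<bar> \<le> 1 / (24 * n)" and "r1 > r"
  obtains K where "\<And>x. norm x \<ge> r1
      \<Longrightarrow> tangrad_sq u x / bernstein_weight x * norm x powr (2 * (n - 2) - 1/4) \<le> K"
proof -
  define k where "k = 2 * (n - 2) - 1/4"
  define G where "G x = tangrad_sq u x / bernstein_weight x" for x
  have open_W: "open {x::real^'n. norm x > r}" by (intro open_Collect_less continuous_intros)
  have W_subset: "{x. norm x > r} \<subseteq> U" using r by (auto simp: mem_U_iff)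
  have "bernstein_weight x \<noteq> 0" if "norm x > r" for x
    using bernstein_weight_bounds(1)[OF small[of x]] that by simp
  then have smooth: "smooth_on G {x. norm x > r}"
    unfolding G_def using smooth_tangrad_sq[OF open_U smooth_u] smooth_bernstein_weight
    by (intro smooth_divide open_W smooth_on_subset[OF _ W_subset]) simp_all
  have "continuous_on (sphere 0 r1) G"
    by (rule continuous_on_subset[OF smooth_continuous[OF smooth]]) (use assms(3) in auto)
  from bounded_on_sphere[OF this] obtain K where K: "\<And>x. norm x = r1 \<Longrightarrow> \<bar>G x\<bar> \<le> K" by metis
  have "G y * norm y powr k \<le> K * r1 powr k" if "norm y \<ge> r1" for y
  proof (rule exterior_weighted_max_principle[OF _ _ _ _ that])
    show "r1 > 0" using r0_pos r assms(3) by simp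
    show "G x \<le> K" if "norm x = r1" for x using K[OF that] by simp
    show "G differentiable (at x)" if "norm x \<ge> r1" for x
      by (rule smooth_differentiable[OF open_W smooth]) (use that assms(3) in simp)
    show "lderiv id G x \<le> - k * G x" if "norm x > r1" "\<And>y. norm y = norm x \<Longrightarrow> G y \<le> G x" for x
      using bernstein_quotient_decreasing[OF r small _ that(2)[unfolded G_def]] that(1) assms(3)
      by (simp add: k_def G_def[abs_def])
  qed
  then show ?thesis using that[of "K * r1 powr k"] by (simp add: k_def G_def)
qed

lemma tangrad_sq_u_decay:
  assumes r: "r > r0" and small: "\<And>x. norm x \<ge> r \<Longrightarrow> \<bar>u x - 1\<bar> \<le> 1 / (24 * n)" and "r1 > r"
  obtains D where "D > 0" "\<And>x. norm x \<ge> r1 \<Longrightarrow> tangrad_sq u x \<le> D\<^sup>2 * norm x powr (1/4 - 2 * (n - 2))"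
proof -
  define k where "k = 2 * (n - 2) - 1/4"
  obtain K where K: "\<And>x. norm x \<ge> r1 \<Longrightarrow> tangrad_sq u x / bernstein_weight x * norm x powr k \<le> K"
    unfolding k_def using bernstein_quotient_decay[OF assms] by metis
  have "tangrad_sq u x \<le> (sqrt (max 1 K))\<^sup>2 * norm x powr (1/4 - 2 * (n - 2))" if x: "norm x \<ge> r1" for x
  proof -
    have far: "norm x \<ge> r" "norm x > 0" using x r r0_pos assms(3) by auto
    have "tangrad_sq u x / 1 \<le> tangrad_sq u x / bernstein_weight x"
      using bernstein_weight_bounds(1,2)[OF small[OF far(1)]] tangrad_sq_nonneg[of u x]
      by (intro divide_left_mono) auto
    then have "tangrad_sq u x * norm x powr k \<le> tangrad_sq u x / bernstein_weight x * norm x powr k"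
      by (intro mult_right_mono) auto
    also have "\<dots> \<le> max 1 K" using K[OF x] by simp
    finally have "tangrad_sq u x * norm x powr k * norm x powr (- k) \<le> max 1 K * norm x powr (- k)"
      by (rule mult_right_mono) simp
    moreover have "norm x powr k * norm x powr (- k) = 1" using far(2) by (simp add: powr_add[symmetric])
    moreover have "- k = 1/4 - 2 * (n - 2)" by (simp add: k_def)
    ultimately show ?thesis by (simp add: mult.assoc)
  qed
  then show ?thesis by (intro that[of "sqrt (max 1 K)"]) simp_all
qed

end

section \<open>Decay of the potential\<close>

lemma norm_powr_tendsto_0: "a < 0 \<Longrightarrow> ((\<lambda>x::'a::real_normed_vector. norm x powr a) \<longlongrightarrow> 0) at_infinity"
  by (rule tendsto_neg_powr[OF _ filterlim_norm_at_top])

lemma ge_of_mult_ge_half: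
  fixes w e k :: real
  assumes "1/2 \<le> w" "- (k/2) \<le> w * e" "0 \<le> k"
  shows "- k \<le> e"
proof (cases "0 \<le> e")
  case False
  then have "w * e \<le> 1/2 * e" using assms(1) by (intro mult_right_mono_neg) auto
  then show ?thesis using assms(2) by simp
qed (use assms(3) in simp)

locale exterior_decay = exterior_static U u V n r0 for U :: "(real^'n::finite) set" and u V n r0 +
  fixes C r1 Vm :: real
  assumes C_pos: "C > 0" and r1: "r1 > r0" "r1 \<ge> 1"
    and tangrad_sq_u_le: "\<And>x. norm x \<ge> r1 \<Longrightarrow> tangrad_sq u x \<le> C\<^sup>2 * norm x powr (1/4 - 2 * (n - 2))"
    and omega_le: "\<And>x. norm x \<ge> r1 \<Longrightarrow> \<bar>1 - omega x\<bar> \<le> C / norm x"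
    and u_le: "\<And>x. norm x \<ge> r1 \<Longrightarrow> \<bar>u x - 1\<bar> \<le> C / norm x" "\<And>x. norm x \<ge> r1 \<Longrightarrow> \<bar>u x - 1\<bar> \<le> 1/4"
    and V_le: "Vm > 0" "\<And>x. x \<in> U \<Longrightarrow> \<bar>V x\<bar> \<le> Vm"

lemma (in exterior_static) ex_exterior_decay:
  obtains C r1 Vm where "exterior_decay U u V n r0 C r1 Vm"
proof -
  obtain B where B: "\<And>x. x \<in> U \<Longrightarrow> \<bar>V x\<bar> \<le> B" using V_bounded unfolding bounded_iff by auto
  obtain C r where C: "C > 0" "r > r0" "r \<ge> 1" "\<And>x. norm x \<ge> r \<Longrightarrow> \<bar>1 - omega x\<bar> \<le> C / norm x"
    "\<And>x. norm x \<ge> r \<Longrightarrow> \<bar>u x - 1\<bar> \<le> C / norm x" using metric_decay by metis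
  define r1 where "r1 = max r (24 * n * C) + 1"
  have r1: "r1 > r0" "r1 \<ge> 1" "r1 \<ge> r" using C by (auto simp: r1_def)
  have small: "\<bar>u x - 1\<bar> \<le> 1 / (24 * n)" if "norm x \<ge> max r (24 * n * C)" for x
  proof -
    have "norm x \<ge> r" "norm x \<ge> 24 * n * C" "norm x > 0" using that C(3) by auto
    then have "C / norm x \<le> 1 / (24 * n)" using n_ge_3 by (simp add: field_simps)
    then show ?thesis using C(5)[OF \<open>norm x \<ge> r\<close>] by linarith
  qed
  have "max r (24 * n * C) > r0" "max r (24 * n * C) < r1" using C(2) by (simp_all add: r1_def)
  from tangrad_sq_u_decay[OF this(1) small this(2)] obtain D
    where D: "D > 0" "\<And>x. norm x \<ge> r1 \<Longrightarrow> tangrad_sq u x \<le> D\<^sup>2 * norm x powr (1/4 - 2 * (n - 2))" by metis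
  have C_le: "C / norm x \<le> max C D / norm x" for x :: "real^'n" by (rule divide_right_mono) simp_all
  have "exterior_decay U u V n r0 (max C D) r1 (max B 1)"
  proof
    show "tangrad_sq u x \<le> (max C D)\<^sup>2 * norm x powr (1/4 - 2 * (n - 2))" if "norm x \<ge> r1" for x
    proof -
      have "D\<^sup>2 \<le> (max C D)\<^sup>2" using D(1) by (intro power_mono) auto
      then show ?thesis
        using D(2)[OF that] mult_right_mono[of "D\<^sup>2" _ "norm x powr (1/4 - 2 * (n - 2))"] by fastforce
    qed
    show "\<bar>1 - omega x\<bar> \<le> max C D / norm x" "\<bar>u x - 1\<bar> \<le> max C D / norm x" if "norm x \<ge> r1" for x
      using order_trans[OF C(4) C_le, of x] order_trans[OF C(5) C_le, of x] that r1 by simp_all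
    have "1 / (24 * n) \<le> 1/4" using n_ge_3 by (simp add: field_simps)
    then show "\<bar>u x - 1\<bar> \<le> 1/4" if "norm x \<ge> r1" for x
      using small[of x] that unfolding r1_def by linarith
    show "\<bar>V x\<bar> \<le> max B 1" if "x \<in> U" for x using B[OF that] by simp
  qed (use C r1 in auto)
  then show ?thesis by (rule that)
qed

context exterior_static begin

lemma DERIV_S_V_ray:
  assumes "s > 0" "s *\<^sub>R x \<in> U"
  shows "((\<lambda>s. lderiv (rot a b) V (s *\<^sub>R x) / s) has_real_derivative
    lderiv (rot a b) u (s *\<^sub>R x) / u (s *\<^sub>R x) * mixed_coeff (s *\<^sub>R x) / s\<^sup>2) (at s)"
proof -
  let ?S = "lderiv (rot a b)" and ?y = "s *\<^sub>R x"
  have "((\<lambda>s. ?S V (s *\<^sub>R x)) has_real_derivative lderiv id (?S V) ?y / s) (at s)"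
    by (rule DERIV_along_ray)
      (use assms in \<open>auto intro!: differentiable_U smooth_lderiv open_U linear_rot smooth_V\<close>)
  then have "((\<lambda>s. ?S V (s *\<^sub>R x) / s) has_real_derivative (lderiv id (?S V) ?y / s * s - ?S V ?y * 1)
      / (s * s)) (at s)"
    using assms(1) by (intro DERIV_divide DERIV_ident) auto
  moreover have "lderiv id (?S V) ?y - ?S V ?y = ?S u ?y / u ?y * mixed_coeff ?y"
    using lderiv_EV[OF assms(2) skew_rot, of a b]
      lderiv_id_commute[OF open_U smooth_V assms(2) linear_rot, of a b] u_nonzero[OF assms(2)]
    by (simp add: field_simps)
  ultimately show ?thesis using assms(1) by (simp add: power2_eq_square)
qed

lemma S_V_ray_diff_le:
  assumes "s \<ge> 1" "i > -1" "\<And>z. 1 \<le> z \<Longrightarrow> z \<le> s \<Longrightarrow> z *\<^sub>R x \<in> U"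
    and bound: "\<And>z. 1 \<le> z \<Longrightarrow> z \<le> s
        \<Longrightarrow> \<bar>lderiv (rot a b) u (z *\<^sub>R x) / u (z *\<^sub>R x)\<bar> * \<bar>mixed_coeff (z *\<^sub>R x)\<bar> \<le> A * z powr (- i)"
  shows "\<bar>lderiv (rot a b) V (s *\<^sub>R x) / s - lderiv (rot a b) V x\<bar> \<le> A / (i + 1)"
proof -
  have "\<bar>lderiv (rot a b) V (s *\<^sub>R x) / s - lderiv (rot a b) V (1 *\<^sub>R x) / 1\<bar>
      \<le> A / (i + 1) * 1 powr (- (i + 1))"
  proof (rule abs_diff_le_powr[OF _ assms(1)])
    fix z :: real assume z: "1 \<le> z" "z \<le> s"
    show "((\<lambda>s. lderiv (rot a b) V (s *\<^sub>R x) / s) has_real_derivative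
        lderiv (rot a b) u (z *\<^sub>R x) / u (z *\<^sub>R x) * mixed_coeff (z *\<^sub>R x) / z\<^sup>2) (at z)"
      by (rule DERIV_S_V_ray) (use z assms(3) in auto)
    have "\<bar>lderiv (rot a b) u (z *\<^sub>R x) / u (z *\<^sub>R x) * mixed_coeff (z *\<^sub>R x)\<bar> / z\<^sup>2 \<le> A * z powr (- i) / z\<^sup>2"
      using bound[OF z] unfolding abs_mult by (rule divide_right_mono) simp
    also have "A * z powr (- i) / z\<^sup>2 = A * z powr (- (i + 1) - 1)"
    proof -
      have "- (i + 1) - 1 = - i - 2" by simp
      moreover have "z powr (- i - 2) = z powr (- i) / z\<^sup>2" unfolding powr_diff using z by simp
      ultimately show ?thesis by (metis times_divide_eq_right)
    qed
    finally show "\<bar>lderiv (rot a b) u (z *\<^sub>R x) / u (z *\<^sub>R x) * mixed_coeff (z *\<^sub>R x) / z\<^sup>2\<bar>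
        \<le> A * z powr (- (i + 1) - 1)"
      unfolding abs_divide[of _ "z\<^sup>2"] by simp
  qed (use assms(2) in simp_all)
  then show ?thesis by simp
qed

lemma sphere_laplace_V_eq:
  "x \<in> U \<Longrightarrow> sphere_laplace V x = (n - 1) * ((n - 2) / 2 * (1 - omega x) * V x - omega x * EV x)"
  using static_trace(1)[of x] by (simp add: field_simps)

lemma omega_EV_at_sphere_max:
  assumes "x \<in> U" "\<And>y. norm y = norm x \<Longrightarrow> s * V y \<le> s * V x"
  shows "(n - 2) / 2 * (1 - omega x) * (s * V x) \<le> omega x * (s * EV x)"
proof -
  have "smooth_on (\<lambda>y. s * V y) U" by (intro smooth_mult smooth_const smooth_V open_U)
  then have "sphere_laplace (\<lambda>y. s * V y) x \<le> 0"
    by (intro sphere_max_sphere_laplace(1)[OF open_U] sphere_in_U[OF assms(1)] assms(2))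
  then have "(n - 1) * ((n - 2) / 2 * (1 - omega x) * (s * V x) - omega x * (s * EV x)) \<le> 0"
    unfolding sphere_laplace_cmult[OF open_U smooth_V assms(1)] sphere_laplace_V_eq[OF assms(1)]
    by (simp add: algebra_simps)
  then show ?thesis using n_ge_3 by (simp add: mult_le_0_iff)
qed

definition radial_quot where "radial_quot x = (EV x - V x) / u x"

lemma EV_eq_radial_quot: "x \<in> U \<Longrightarrow> EV x = u x * radial_quot x + V x"
  using u_nonzero by (simp add: radial_quot_def)

lemma lderiv_radial_quot:
  assumes "x \<in> U"
  shows "radial_quot differentiable (at x)"
    "lderiv (rot a b) radial_quot x = (n - 1) * V x * lderiv (rot a b) u x * omega x"
proof -
  have diff: "(\<lambda>y. EV y - V y) differentiable (at x)" "u differentiable (at x)" "EV differentiable (at x)"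
    "V differentiable (at x)"
    by (intro differentiable_U[OF _ assms] smooth_diff smooth_radial_derivs smooth_u smooth_V open_U)+
  show "radial_quot differentiable (at x)"
    unfolding radial_quot_def using u_nonzero[OF assms] diff by (intro differentiable_divide) auto
  have "lderiv (rot a b) radial_quot x
      = (lderiv (rot a b) EV x - lderiv (rot a b) V x) / u x - (EV x - V x) * lderiv (rot a b) u x / (u x)\<^sup>2"
    unfolding radial_quot_def lderiv_def[of "rot a b"] dderiv_divide[OF diff(1,2) u_nonzero[OF assms]]
      dderiv_arith(2)[OF diff(3,4)] ..
  moreover have "lderiv (rot a b) EV x - lderiv (rot a b) V x = lderiv (rot a b) u x * mixed_coeff x / u x"
    using lderiv_EV[OF assms skew_rot, of a b] u_nonzero[OF assms] by (simp add: field_simps)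
  ultimately have "lderiv (rot a b) radial_quot x
      = lderiv (rot a b) u x * (mixed_coeff x - (EV x - V x)) / (u x)\<^sup>2"
    by (simp add: power2_eq_square right_diff_distrib diff_divide_distrib mult.commute)
  moreover have "mixed_coeff x - (EV x - V x) = (n - 1) * V x" by (simp add: mixed_coeff_def algebra_simps)
  ultimately show "lderiv (rot a b) radial_quot x = (n - 1) * V x * lderiv (rot a b) u x * omega x"
    by (simp add: omega_def)
qed

lemma mixed_coeff_le: "\<bar>mixed_coeff x\<bar> \<le> \<bar>EV x\<bar> + (n - 2) * \<bar>V x\<bar>"
  using n_ge_3 abs_triangle_ineq[of "EV x" "(n - 2) * V x"] by (simp add: mixed_coeff_def abs_mult)

end

context exterior_decay begin

lemma far_in_U: "norm x \<ge> r1 \<Longrightarrow> x \<in> U"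
  using r1 by (simp add: mem_U_iff)

lemma u_between: "norm x \<ge> r1 \<Longrightarrow> 1/2 \<le> u x" "norm x \<ge> r1 \<Longrightarrow> u x \<le> 2"
  using u_le(2)[of x] by linarith+

lemma omega_between:
  assumes "norm x \<ge> r1"
  shows "1/2 \<le> omega x" "omega x \<le> 2"
proof -
  have "(u x)\<^sup>2 \<le> (5/4)\<^sup>2" "(3/4)\<^sup>2 \<le> (u x)\<^sup>2" using u_le(2)[OF assms] by (intro power_mono; linarith)+
  then have "(u x)\<^sup>2 \<le> 2" "1/2 \<le> (u x)\<^sup>2" "(u x)\<^sup>2 > 0" by (auto simp: power2_eq_square)
  then show "1/2 \<le> omega x" "omega x \<le> 2" by (auto simp: omega_def field_simps)
qed

lemma far_norm_powr:
  assumes "norm x \<ge> r1"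
  shows "0 < norm x powr (-1/2)" "norm x powr (-1/2) \<le> 1" "1 / norm x \<le> norm x powr (-1/2)"
proof -
  have x: "norm x \<ge> 1" "norm x > 0" using assms r1 by auto
  then show "0 < norm x powr (-1/2)" by simp
  have "norm x powr (-1/2) \<le> norm x powr 0" using x by (intro powr_mono) auto
  then show "norm x powr (-1/2) \<le> 1" using x by simp
  have "norm x powr (-1) \<le> norm x powr (-1/2)" using x by (intro powr_mono) auto
  then show "1 / norm x \<le> norm x powr (-1/2)" using x by (simp add: powr_minus_divide)
qed

lemma far_ray:
  assumes "norm x \<ge> r1" "s \<ge> 1"
  shows "norm (s *\<^sub>R x) \<ge> r1" "s *\<^sub>R x \<in> U" "norm (s *\<^sub>R x) powr k = s powr k * norm x powr k"
proof -
  have "1 * norm x \<le> s * norm x" using assms by (intro mult_right_mono) auto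
  then show "norm (s *\<^sub>R x) \<ge> r1" using assms by simp
  then show "s *\<^sub>R x \<in> U" by (rule far_in_U)
  show "norm (s *\<^sub>R x) powr k = s powr k * norm x powr k" using assms by (simp add: powr_mult)
qed

lemma S_u_decay:
  assumes "norm x \<ge> r1" "orthonormal_pair a b"
  shows "\<bar>lderiv (rot a b) u x\<bar> \<le> C * norm x powr (-1/2)"
proof -
  have x: "norm x \<ge> 1" "x \<in> U" using assms r1 far_in_U by auto
  have "(lderiv (rot a b) u x)\<^sup>2 \<le> tangrad_sq u x"
    by (rule lderiv_rot_sq_le_tangrad_sq[OF differentiable_U[OF smooth_u x(2)] assms(2) U_nonzero[OF x(2)]])
  also have "\<dots> \<le> C\<^sup>2 * norm x powr (1/4 - 2 * (n - 2))" by (rule tangrad_sq_u_le[OF assms(1)])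
  also have "\<dots> \<le> C\<^sup>2 * norm x powr (-1)" using x n_ge_3 by (intro mult_left_mono powr_mono) auto
  also have "norm x powr (-1) = (norm x powr (-1/2))\<^sup>2" unfolding power2_eq_square powr_add[symmetric] by simp
  finally have "\<bar>lderiv (rot a b) u x\<bar> \<le> \<bar>C * norm x powr (-1/2)\<bar>"
    by (simp add: abs_le_square_iff power_mult_distrib)
  then show ?thesis using C_pos by (simp add: abs_mult)
qed

lemma radial_quot_oscillation:
  assumes "norm x \<ge> r1" "norm y = norm x"
  shows "\<bar>radial_quot y - radial_quot x\<bar> \<le> pi * ((n - 1) * Vm * C * 2) * norm x powr (-1/2)"
proof -
  have "\<bar>radial_quot y - radial_quot x\<bar> \<le> pi * ((n - 1) * Vm * (C * norm x powr (-1/2)) * 2)"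
  proof (rule sphere_oscillation_bound[OF _ assms(2)])
    show "DIM(real^'n) \<ge> 2" using CARD_ge_3 by simp
    show "x \<noteq> 0" by (rule U_nonzero[OF far_in_U[OF assms(1)]])
    show "radial_quot differentiable (at z)" if "norm z = norm x" for z
      by (rule lderiv_radial_quot(1)[OF far_in_U]) (use that assms in simp)
    show "\<bar>lderiv (rot a b) radial_quot z\<bar> \<le> (n - 1) * Vm * (C * norm x powr (-1/2)) * 2"
      if ab: "orthonormal_pair a b" and z: "norm z = norm x" for a b z
    proof -
      have far: "norm z \<ge> r1" using z assms by simp
      have "\<bar>lderiv (rot a b) radial_quot z\<bar> = (n - 1) * \<bar>V z\<bar> * \<bar>lderiv (rot a b) u z\<bar> * omega z"
        unfolding lderiv_radial_quot(2)[OF far_in_U[OF far]] using n_ge_3 omega_between[OF far]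
        by (simp add: abs_mult)
      also have "\<dots> \<le> (n - 1) * Vm * (C * norm x powr (-1/2)) * 2"
        using V_le(2)[OF far_in_U[OF far]] S_u_decay[OF far ab] omega_between[OF far] n_ge_3 V_le(1) C_pos z
        by (intro mult_mono) auto
      finally show ?thesis .
    qed
  qed
  then show ?thesis by (simp only: mult_ac)
qed

definition E_bound where "E_bound = (n - 2) * C * Vm"

lemma E_bound_pos: "E_bound > 0"
  using n_ge_3 C_pos V_le(1) by (simp add: E_bound_def)

lemma ex_EV_ge_on_sphere:
  fixes x :: "real^'n"
  assumes "norm x \<ge> r1" "s = 1 \<or> s = -1"
  obtains p where "norm p = norm x" "s * EV p \<ge> - (E_bound / norm x)"
proof -
  have "continuous_on U (\<lambda>y. s * V y)" by (intro continuous_intros smooth_continuous[OF smooth_V])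
  then have "continuous_on (sphere 0 (norm x)) (\<lambda>y. s * V y)"
    by (rule continuous_on_subset) (use assms(1) r1 in \<open>auto simp: mem_U_iff\<close>)
  from sphere_attains_sup[OF this] obtain p where p: "norm p = norm x"
    "\<And>y. norm y = norm x \<Longrightarrow> s * V y \<le> s * V p" by metis
  have far: "norm p \<ge> r1" using p(1) assms(1) by simp
  have "\<bar>(n - 2) / 2 * (1 - omega p) * (s * V p)\<bar> = (n - 2) / 2 * (\<bar>1 - omega p\<bar> * \<bar>V p\<bar>)"
    using n_ge_3 assms(2) by (auto simp: abs_mult)
  also have "\<dots> \<le> (n - 2) / 2 * ((C / norm p) * Vm)"
    using omega_le[OF far] V_le far_in_U[OF far] C_pos n_ge_3 by (intro mult_left_mono mult_mono) auto
  also have "\<dots> = E_bound / norm p / 2" by (simp add: E_bound_def)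
  finally have "- (E_bound / norm p / 2) \<le> (n - 2) / 2 * (1 - omega p) * (s * V p)" by linarith
  moreover have "(n - 2) / 2 * (1 - omega p) * (s * V p) \<le> omega p * (s * EV p)"
    by (rule omega_EV_at_sphere_max[OF far_in_U[OF far]]) (use p in simp)
  ultimately have "- (E_bound / norm p / 2) \<le> omega p * (s * EV p)" by linarith
  moreover have "0 \<le> E_bound / norm p" using E_bound_pos by simp
  ultimately have "- (E_bound / norm p) \<le> s * EV p" by (rule ge_of_mult_ge_half[OF omega_between(1)[OF far]])
  then show ?thesis using that[OF p(1)] p(1) by simp
qed

lemma EV_bounded:
  obtains B where "B > 0" "\<And>x. norm x \<ge> r1 \<Longrightarrow> \<bar>EV x\<bar> \<le> B"
proof -
  define D where "D = pi * ((n - 1) * Vm * C * 2)"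
  define K where "K = 2 * (E_bound + Vm) + D"
  have D: "D \<ge> 0" using n_ge_3 V_le(1) C_pos by (simp add: D_def)
  have quot: "- (s * radial_quot x) \<le> K" if x: "norm x \<ge> r1" and s: "s = 1 \<or> s = -1" for x s
  proof -
    obtain p where p: "norm p = norm x" "s * EV p \<ge> - (E_bound / norm x)" using ex_EV_ge_on_sphere[OF x s] .
    have far: "norm p \<ge> r1" using p(1) x by simp
    have "E_bound / norm x \<le> E_bound" using x r1 E_bound_pos by (simp add: divide_le_eq)
    then have "s * V p - s * EV p \<le> E_bound + Vm" using p(2) V_le(2)[OF far_in_U[OF far]] s by auto
    then have "(s * V p - s * EV p) / u p \<le> (E_bound + Vm) / u p"
      using u_between(1)[OF far] by (intro divide_right_mono) auto
    also have "\<dots> \<le> (E_bound + Vm) / (1/2)"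
      using u_between(1)[OF far] E_bound_pos V_le(1) by (intro divide_left_mono) auto
    finally have "- (s * radial_quot p) \<le> 2 * (E_bound + Vm)"
      by (simp add: radial_quot_def right_diff_distrib diff_divide_distrib)
    moreover have "\<bar>radial_quot p - radial_quot x\<bar> \<le> D * 1"
      by (rule order_trans[OF radial_quot_oscillation[OF x p(1), folded D_def]
        mult_left_mono[OF far_norm_powr(2)[OF x] D]])
    ultimately show ?thesis using s by (auto simp: K_def)
  qed
  have "\<bar>EV x\<bar> \<le> 2 * K + Vm" if x: "norm x \<ge> r1" for x
  proof -
    have "\<bar>radial_quot x\<bar> \<le> K" using quot[OF x, of 1] quot[OF x, of "-1"] by simp
    then have "\<bar>u x * radial_quot x\<bar> \<le> 2 * K"
      unfolding abs_mult using u_between[OF x] by (intro mult_mono) auto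
    then show ?thesis using EV_eq_radial_quot[OF far_in_U[OF x]] V_le(2)[OF far_in_U[OF x]] by linarith
  qed
  moreover have "2 * K + Vm > 0" using D E_bound_pos V_le(1) by (simp add: K_def)
  ultimately show ?thesis using that by blast
qed

lemma S_V_ray_close:
  obtains A where "A > 0" "\<And>x a b s. norm x \<ge> r1 \<Longrightarrow> orthonormal_pair a b \<Longrightarrow> s \<ge> 1 \<Longrightarrow>
    \<bar>lderiv (rot a b) V (s *\<^sub>R x) / s - lderiv (rot a b) V x\<bar> \<le> A * norm x powr (-1/2)"
proof -
  obtain B where B: "B > 0" "\<And>x. norm x \<ge> r1 \<Longrightarrow> \<bar>EV x\<bar> \<le> B" using EV_bounded by blast
  define M where "M = B + (n - 2) * Vm"
  have M: "M > 0" using B(1) V_le(1) n_ge_3 by (simp add: M_def add_pos_nonneg)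
  have mixed: "\<bar>mixed_coeff x\<bar> \<le> M" if "norm x \<ge> r1" for x
  proof -
    have "\<bar>EV x\<bar> + (n - 2) * \<bar>V x\<bar> \<le> M"
      unfolding M_def using B(2)[OF that] V_le(2)[OF far_in_U[OF that]] n_ge_3
      by (intro add_mono mult_left_mono) auto
    then show ?thesis using mixed_coeff_le[of x] by linarith
  qed
  have "\<bar>lderiv (rot a b) V (s *\<^sub>R x) / s - lderiv (rot a b) V x\<bar> \<le> 2 * C * M * norm x powr (-1/2)"
    if x: "norm x \<ge> r1" and ab: "orthonormal_pair a b" and s: "s \<ge> 1" for x a b s
  proof -
    have "\<bar>lderiv (rot a b) V (s *\<^sub>R x) / s - lderiv (rot a b) V x\<bar>
        \<le> (2 * C * M * norm x powr (-1/2)) / (1/2 + 1)"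
    proof (rule S_V_ray_diff_le[OF s])
      fix z assume z: "1 \<le> z" "z \<le> s"
      note far = far_ray[OF x z(1)]
      have "\<bar>lderiv (rot a b) u (z *\<^sub>R x) / u (z *\<^sub>R x)\<bar> \<le> C * norm (z *\<^sub>R x) powr (-1/2) / (1/2)"
        unfolding abs_divide using S_u_decay[OF far(1) ab] u_between(1)[OF far(1)] C_pos
        by (intro frac_le) auto
      then have "\<bar>lderiv (rot a b) u (z *\<^sub>R x) / u (z *\<^sub>R x)\<bar> * \<bar>mixed_coeff (z *\<^sub>R x)\<bar>
          \<le> C * norm (z *\<^sub>R x) powr (-1/2) / (1/2) * M"
        using mixed[OF far(1)] C_pos by (intro mult_mono) auto
      then show "\<bar>lderiv (rot a b) u (z *\<^sub>R x) / u (z *\<^sub>R x)\<bar> * \<bar>mixed_coeff (z *\<^sub>R x)\<bar>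
          \<le> 2 * C * M * norm x powr (-1/2) * z powr (- (1/2))"
        unfolding far(3) by (simp add: mult_ac)
    qed (use far_ray(2)[OF x] in auto)
    also have "\<dots> \<le> 2 * C * M * norm x powr (-1/2)" using C_pos M by simp
    finally show ?thesis .
  qed
  then show ?thesis using that[of "2 * C * M"] C_pos M by simp
qed

text \<open>If \<open>S V / r\<close> had a nonzero limit along a ray, \<open>V\<close> would be unbounded along rotation orbits.\<close>

lemma S_V_le_of_ray_close:
  assumes "norm x \<ge> r1" "orthonormal_pair a b" "0 \<le> K"
    and close: "\<And>y s. norm y = norm x \<Longrightarrow> s \<ge> 1 \<Longrightarrow> \<bar>lderiv (rot a b) V (s *\<^sub>R y) / s - lderiv (rot a b) V y\<bar> \<le> K"
  shows "lderiv (rot a b) V x \<le> K"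
proof (rule ccontr)
  let ?S = "lderiv (rot a b)"
  assume "\<not> ?thesis"
  then have gap: "?S V x > K" by simp
  define h where "h = (?S V x - K) / 2"
  have h: "h > 0" using gap by (simp add: h_def)
  have norm_flow: "norm (rot_flow a b y t) = norm y" for y t by (rule norm_rot_flow[OF assms(2)])
  have "isCont (\<lambda>t. ?S V (rot_flow a b x t)) 0"
    by (rule DERIV_isCont[OF DERIV_rot_flow[OF assms(2)]])
      (intro differentiable_U[OF _ far_in_U] smooth_lderiv open_U linear_rot smooth_V, simp
      add: norm_flow assms(1))
  then have "((\<lambda>t. ?S V (rot_flow a b x t)) \<longlongrightarrow> ?S V x) (at 0)" by (simp add: isCont_def)
  then have "\<forall>\<^sub>F t in at 0. ?S V (rot_flow a b x t) > K + h"
    by (rule order_tendstoD) (use h in \<open>simp add: h_def field_simps\<close>)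
  then obtain d where d: "d > 0" "\<And>t. t \<noteq> 0 \<Longrightarrow> dist t 0 < d \<Longrightarrow> ?S V (rot_flow a b x t) > K + h"
    unfolding eventually_at by blast
  define s where "s = max 1 (2 * Vm / (d/2 * h) + 1)"
  have s: "s \<ge> 1" "s > 2 * Vm / (d/2 * h)" by (simp_all add: s_def)
  have inU: "rot_flow a b (s *\<^sub>R x) t \<in> U" for t
    unfolding rot_flow_scaleR by (rule far_ray(2)[OF _ s(1)]) (simp add: norm_flow assms(1))
  have "\<exists>z>0. z < d/2 \<and> V (rot_flow a b (s *\<^sub>R x) (d/2)) - V (rot_flow a b (s *\<^sub>R x) 0)
      = (d/2 - 0) * ?S V (rot_flow a b (s *\<^sub>R x) z)"
    using d(1) by (intro MVT2 DERIV_rot_flow[OF assms(2) differentiable_U[OF smooth_V inU]]) simp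
  then obtain z where z: "0 < z" "z < d/2"
    "V (rot_flow a b (s *\<^sub>R x) (d/2)) - V (rot_flow a b (s *\<^sub>R x) 0) = d/2 * ?S V (s *\<^sub>R rot_flow a b x z)"
    unfolding rot_flow_scaleR by auto
  have "?S V (rot_flow a b x z) > K + h" by (rule d(2)) (use z d(1) in auto)
  then have "?S V (s *\<^sub>R rot_flow a b x z) / s > h" using close[OF norm_flow s(1), of z] by linarith
  then have "?S V (s *\<^sub>R rot_flow a b x z) > h * s" using s(1) by (simp add: less_divide_eq)
  then have "V (rot_flow a b (s *\<^sub>R x) (d/2)) - V (rot_flow a b (s *\<^sub>R x) 0) > d/2 * (h * s)"
    using z(3) d(1) by simp
  moreover have "d/2 * (h * s) > 2 * Vm" using s(2) d(1) h by (simp add: divide_less_eq mult_ac)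
  ultimately show False using V_le(2)[OF inU, of "d/2"] V_le(2)[OF inU, of 0] by linarith
qed

lemma S_V_decay:
  obtains D where "D > 0"
    "\<And>x a b. norm x \<ge> r1 \<Longrightarrow> orthonormal_pair a b \<Longrightarrow> \<bar>lderiv (rot a b) V x\<bar> \<le> D * norm x powr (-1/2)"
proof -
  obtain A where A: "A > 0" "\<And>x a b s. norm x \<ge> r1 \<Longrightarrow> orthonormal_pair a b \<Longrightarrow> s \<ge> 1 \<Longrightarrow>
    \<bar>lderiv (rot a b) V (s *\<^sub>R x) / s - lderiv (rot a b) V x\<bar> \<le> A * norm x powr (-1/2)" using S_V_ray_close
      by blast
  have upper: "lderiv (rot a b) V x \<le> A * norm x powr (-1/2)" if x: "norm x \<ge> r1"
    and ab: "orthonormal_pair a b" for x a b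
  proof (rule S_V_le_of_ray_close[OF x ab])
    show "\<bar>lderiv (rot a b) V (s *\<^sub>R y) / s - lderiv (rot a b) V y\<bar> \<le> A * norm x powr (-1/2)"
      if "norm y = norm x" "s \<ge> 1" for y s
      using A(2)[of y, OF _ ab that(2)] that(1) x by simp
  qed (use A(1) in simp)
  have "\<bar>lderiv (rot a b) V x\<bar> \<le> A * norm x powr (-1/2)" if x: "norm x \<ge> r1" and ab: "orthonormal_pair a b"
    for x a b
  proof -
    have "orthonormal_pair b a" using ab by (simp add: orthonormal_pair_def inner_commute)
    moreover have "rot b a x = - rot a b x" by (simp add: rot_def)
    then have "lderiv (rot b a) V x = - lderiv (rot a b) V x"
      using dderiv_linear(4)[OF differentiable_U[OF smooth_V far_in_U[OF x]]] by (simp add: lderiv_def)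
    ultimately show ?thesis using upper[OF x ab] upper[OF x, of b a] by simp
  qed
  then show ?thesis using that A(1) by blast
qed

lemma V_oscillation:
  assumes D: "\<And>x a b. norm x \<ge> r1 \<Longrightarrow> orthonormal_pair a b \<Longrightarrow> \<bar>lderiv (rot a b) V x\<bar> \<le> D * norm x powr (-1/2)"
    and x: "norm x \<ge> r1" "norm y = norm x"
  shows "\<bar>V y - V x\<bar> \<le> pi * (D * norm x powr (-1/2))"
proof (rule sphere_oscillation_bound[OF _ x(2)])
  show "DIM(real^'n) \<ge> 2" using CARD_ge_3 by simp
  show "x \<noteq> 0" by (rule U_nonzero[OF far_in_U[OF x(1)]])
  show "V differentiable (at z)" if "norm z = norm x" for z
    by (rule differentiable_U[OF smooth_V far_in_U]) (use that x in simp)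
  show "\<bar>lderiv (rot a b) V z\<bar> \<le> D * norm x powr (-1/2)" if "orthonormal_pair a b" "norm z = norm x" for a b z
    using D[of z a b] that x by simp
qed

lemma EV_oscillation:
  obtains D where "D > 0"
    "\<And>x z. norm x \<ge> r1 \<Longrightarrow> norm z = norm x \<Longrightarrow> \<bar>EV x - u x / u z * EV z\<bar> \<le> D * norm x powr (-1/2)"
proof -
  obtain D2 where D2: "D2 > 0"
    "\<And>x a b. norm x \<ge> r1 \<Longrightarrow> orthonormal_pair a b \<Longrightarrow> \<bar>lderiv (rot a b) V x\<bar> \<le> D2 * norm x powr (-1/2)"
    using S_V_decay by blast
  define D1 where "D1 = pi * ((n - 1) * Vm * C * 2)"
  define D where "D = 2 * D1 + pi * D2 + 4 * C * Vm"
  have D1: "D1 \<ge> 0" using n_ge_3 V_le(1) C_pos by (simp add: D1_def)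
  have D: "D > 0" using D1 D2(1) C_pos V_le(1) by (simp add: D_def add_pos_pos add_nonneg_pos)
  have "\<bar>EV x - u x / u z * EV z\<bar> \<le> D * norm x powr (-1/2)" if x: "norm x \<ge> r1" and zx: "norm z = norm x"
    for x z
  proof -
    define h where "h = norm x powr (-1/2)"
    have z: "norm z \<ge> r1" using x zx by simp
    have decomposition: "EV x - u x / u z * EV z
        = u x * (radial_quot x - radial_quot z) + (V x - V z) + V z * ((u z - u x) / u z)"
      unfolding EV_eq_radial_quot[OF far_in_U[OF x]] EV_eq_radial_quot[OF far_in_U[OF z]]
      using u_between(1)[OF z] by (simp add: field_simps)
    have "\<bar>u x * (radial_quot x - radial_quot z)\<bar> \<le> 2 * (D1 * h)"
      unfolding abs_mult using u_between[OF x] radial_quot_oscillation[OF z zx[symmetric]] zx D1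
      by (intro mult_mono) (auto simp: D1_def h_def)
    moreover have "\<bar>V x - V z\<bar> \<le> pi * (D2 * h)"
      using V_oscillation[OF D2(2) z zx[symmetric]] zx by (simp add: h_def)
    moreover have "\<bar>V z * ((u z - u x) / u z)\<bar> \<le> Vm * (4 * C * h)"
    proof -
      have "\<bar>u z - u x\<bar> \<le> C / norm x + C / norm x" using u_le(1)[OF x] u_le(1)[OF z] unfolding zx by linarith
      also have "\<dots> = 2 * C * (1 / norm x)" by simp
      also have "\<dots> \<le> 2 * C * h"
        unfolding h_def using far_norm_powr(3)[OF x] C_pos by (intro mult_left_mono) auto
      finally have "\<bar>(u z - u x) / u z\<bar> \<le> (2 * C * h) / (1/2)"
        unfolding abs_divide using u_between(1)[OF z] C_pos by (intro frac_le) (auto simp: h_def)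
      then show ?thesis unfolding abs_mult using V_le far_in_U[OF z] by (intro mult_mono) auto
    qed
    moreover have "D * h = 2 * (D1 * h) + pi * (D2 * h) + Vm * (4 * C * h)" by (simp add: D_def algebra_simps)
    ultimately show ?thesis unfolding decomposition h_def[symmetric] by linarith
  qed
  then show ?thesis using that D by blast
qed

lemma EV_decay:
  obtains D where "D > 0" "\<And>x. norm x \<ge> r1 \<Longrightarrow> \<bar>EV x\<bar> \<le> D * norm x powr (-1/2)"
proof -
  obtain D where D: "D > 0"
    "\<And>x z. norm x \<ge> r1 \<Longrightarrow> norm z = norm x \<Longrightarrow> \<bar>EV x - u x / u z * EV z\<bar> \<le> D * norm x powr (-1/2)"
    using EV_oscillation by blast
  have signed: "- (s * EV x) \<le> (4 * E_bound + D) * norm x powr (-1/2)" if x: "norm x \<ge> r1"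
    and s: "s = 1 \<or> s = -1" for x s
  proof -
    define h where "h = norm x powr (-1/2)"
    obtain p where p: "norm p = norm x" "s * EV p \<ge> - (E_bound / norm x)" using ex_EV_ge_on_sphere[OF x s] .
    have ratio: "0 \<le> u x / u p" "u x / u p \<le> 4"
      using u_between[of p] u_between[OF x] x p(1) by (auto simp: field_simps)
    have "E_bound * (1 / norm x) \<le> E_bound * h"
      unfolding h_def using far_norm_powr(3)[OF x] E_bound_pos by (intro mult_left_mono) auto
    then have "- (s * EV p) \<le> E_bound * h" using p(2) by simp
    then have "u x / u p * - (s * EV p) \<le> u x / u p * (E_bound * h)" using ratio(1) by (rule mult_left_mono)
    also have "\<dots> \<le> 4 * (E_bound * h)" using ratio(2) E_bound_pos by (intro mult_right_mono) (auto simp: h_def)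
    finally have "- (s * (u x / u p * EV p)) \<le> 4 * (E_bound * h)" by (simp add: mult_ac)
    moreover have "\<bar>EV x - u x / u p * EV p\<bar> \<le> D * h" unfolding h_def by (rule D(2)[OF x p(1)])
    ultimately show ?thesis unfolding h_def[symmetric] using s by (auto simp: algebra_simps)
  qed
  have "\<bar>EV x\<bar> \<le> (4 * E_bound + D) * norm x powr (-1/2)" if "norm x \<ge> r1" for x
    using signed[OF that, of 1] signed[OF that, of "-1"] by simp
  then show ?thesis using that[of "4 * E_bound + D"] D(1) E_bound_pos by simp
qed

lemma V_ray_diff_le:
  assumes D: "\<And>x. norm x \<ge> r1 \<Longrightarrow> \<bar>EV x\<bar> \<le> D * norm x powr (-1/2)" and x: "norm x \<ge> r1" and s: "s \<ge> 1"
  shows "\<bar>V (s *\<^sub>R x) - V x\<bar> \<le> 2 * D * norm x powr (-1/2)"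
proof -
  have "\<bar>V (s *\<^sub>R x) - V (1 *\<^sub>R x)\<bar> \<le> (D * norm x powr (-1/2)) / (1/2) * 1 powr (- (1/2))"
  proof (rule abs_diff_le_powr[OF _ s])
    fix z :: real assume z: "1 \<le> z" "z \<le> s"
    note far = far_ray[OF x z(1)]
    show "((\<lambda>s. V (s *\<^sub>R x)) has_real_derivative EV (z *\<^sub>R x) / z) (at z)"
      by (rule DERIV_along_ray) (use z differentiable_U[OF smooth_V far(2)] in auto)
    have "\<bar>EV (z *\<^sub>R x) / z\<bar> \<le> D * norm (z *\<^sub>R x) powr (-1/2) / z"
      using D[OF far(1)] z by (simp add: abs_divide divide_right_mono)
    also have "\<dots> = D * norm x powr (-1/2) * (z powr (-1/2) / z powr 1)" unfolding far(3) using z by simp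
    also have "z powr (-1/2) / z powr 1 = z powr (- (1/2) - 1)" unfolding powr_diff by simp
    finally show "\<bar>EV (z *\<^sub>R x) / z\<bar> \<le> D * norm x powr (-1/2) * z powr (- (1/2) - 1)" .
  qed simp_all
  then show ?thesis by simp
qed

lemma ex_far_V_nonzero:
  obtains y where "norm y > r1" "V y \<noteq> 0"
proof -
  have "\<exists>y. norm y > r1 \<and> V y \<noteq> 0"
  proof (rule ccontr)
    assume vanishes: "\<not> ?thesis"
    obtain z where z: "z \<in> U" "V z \<noteq> 0" using V_nontrivial by blast
    obtain w :: "real^'n" where w: "norm w = r1 + 1" using vector_choose_size[of "r1 + 1"] r1 by auto
    have "V z = 0"
    proof (rule unique_continuation_V[OF connected_U, of "{y. norm y > r1}"])
      show "open {y::real^'n. norm y > r1}" by (intro open_Collect_less continuous_intros)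
      show "{y. norm y > r1} \<noteq> ({}::(real^'n) set)" using w by (auto intro!: exI[of _ w])
      show "{y. norm y > r1} \<subseteq> U" using far_in_U by force
    qed (use vanishes z in auto)
    then show False using z by simp
  qed
  then show ?thesis using that by blast
qed

lemma V_EV_ge_at_sphere_max:
  assumes "norm x \<ge> r1" "\<And>y. norm y = norm x \<Longrightarrow> \<bar>V y\<bar> \<le> \<bar>V x\<bar>"
  shows "- ((n - 2) * C / norm x * (V x * V x)) \<le> V x * EV x"
proof -
  define s where "s = sgn (V x)"
  have s: "s * V x = \<bar>V x\<bar>" by (simp add: s_def sgn_if)
  have "s * V y \<le> s * V x" if "norm y = norm x" for y
  proof -
    have "s * V y \<le> \<bar>V y\<bar>" by (simp add: s_def sgn_if abs_if)
    then show ?thesis using assms(2)[OF that] unfolding s by linarith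
  qed
  note trace = omega_EV_at_sphere_max[OF far_in_U[OF assms(1)] this]
  have "- ((n - 2) * C / norm x * (\<bar>V x\<bar> * \<bar>V x\<bar>) / 2) = \<bar>V x\<bar> * ((n - 2) / 2 * - (C / norm x) * \<bar>V x\<bar>)"
    by (simp add: mult_ac del: abs_mult_self_eq)
  also have "\<dots> \<le> \<bar>V x\<bar> * ((n - 2) / 2 * (1 - omega x) * (s * V x))"
    unfolding s using omega_le[OF assms(1)] n_ge_3 by (intro mult_left_mono mult_right_mono) auto
  also have "\<dots> \<le> \<bar>V x\<bar> * (omega x * (s * EV x))" by (rule mult_left_mono[OF trace abs_ge_zero])
  also have "\<dots> = omega x * ((s * \<bar>V x\<bar>) * EV x)" by (simp only: mult_ac)
  also have "s * \<bar>V x\<bar> = V x" by (simp add: s_def sgn_mult_abs)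
  finally have "- ((n - 2) * C / norm x * (\<bar>V x\<bar> * \<bar>V x\<bar>) / 2) \<le> omega x * (V x * EV x)" .
  then have "- ((n - 2) * C / norm x * (V x * V x) / 2) \<le> omega x * (V x * EV x)" unfolding abs_mult_self_eq .
  moreover have "0 \<le> (n - 2) * C / norm x * (V x * V x)" using n_ge_3 C_pos by simp
  ultimately show ?thesis by (rule ge_of_mult_ge_half[OF omega_between(1)[OF assms(1)]])
qed

definition weighted_V_sq where "weighted_V_sq x = (V x * V x) * exp (- (2 * (n - 2) * C) / norm x)"

lemma lderiv_id_weighted_V_sq:
  assumes "norm x \<ge> r1"
  shows "weighted_V_sq differentiable (at x)"
    "lderiv id weighted_V_sq x
      = 2 * exp (- (2 * (n - 2) * C) / norm x) * (V x * EV x + (n - 2) * C / norm x * (V x * V x))"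
proof -
  define k where "k = 2 * (n - 2) * C"
  have x: "x \<in> U" "x \<noteq> 0" "norm x > 0" using far_in_U[OF assms] U_nonzero[OF far_in_U[OF assms]] by auto
  have V: "V differentiable (at x)" by (rule differentiable_U[OF smooth_V x(1)])
  have V_sq: "(\<lambda>y. V y * V y) differentiable (at x)" "lderiv id (\<lambda>y. V y * V y) x = 2 * (V x * EV x)"
    by (rule differentiable_mult[OF V V]) (simp add: lderiv_arith(3)[OF V V])
  have "((\<lambda>r. exp (- k / r)) has_real_derivative k / (norm x)\<^sup>2 * exp (- k / norm x)) (at (norm x))"
    using x(3) by (auto intro!: derivative_eq_intros simp: power2_eq_square)
  note weight = lderiv_id_of_norm[OF x(2) this]
  show "weighted_V_sq differentiable (at x)"
    unfolding weighted_V_sq_def k_def[symmetric] by (rule differentiable_mult[OF V_sq(1) weight(1)])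
  have "k = 2 * ((n - 2) * C)" by (simp add: k_def)
  then have half: "k / norm x / 2 = (n - 2) * C / norm x" by simp
  have "lderiv id weighted_V_sq x = 2 * exp (- k / norm x) * (V x * EV x + k / norm x / 2 * (V x * V x))"
    unfolding weighted_V_sq_def k_def[symmetric] lderiv_arith(3)[OF V_sq(1) weight(1)] V_sq(2) weight(2)
    using x(3) by (simp add: power2_eq_square distrib_left mult_ac)
  then show "lderiv id weighted_V_sq x
      = 2 * exp (- (2 * (n - 2) * C) / norm x) * (V x * EV x + (n - 2) * C / norm x * (V x * V x))"
    unfolding half unfolding k_def .
qed

lemma weighted_V_sq_increasing:
  assumes "norm x \<ge> r1" "\<And>y. norm y = norm x \<Longrightarrow> weighted_V_sq y \<le> weighted_V_sq x"
  shows "lderiv id weighted_V_sq x \<ge> 0"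
proof -
  have "\<bar>V y\<bar> \<le> \<bar>V x\<bar>" if "norm y = norm x" for y
    using assms(2)[OF that] that by (simp add: weighted_V_sq_def abs_le_square_iff power2_eq_square)
  then have "- ((n - 2) * C / norm x * (V x * V x)) \<le> V x * EV x" by (rule V_EV_ge_at_sphere_max[OF assms(1)])
  then show ?thesis unfolding lderiv_id_weighted_V_sq(2)[OF assms(1)] by (intro mult_nonneg_nonneg) auto
qed

lemma weighted_V_sq_le: "norm x \<ge> r1 \<Longrightarrow> weighted_V_sq x \<le> (V x)\<^sup>2"
  unfolding weighted_V_sq_def power2_eq_square using n_ge_3 C_pos by (intro mult_left_le) auto

lemma ex_V_ge_on_far_spheres:
  obtains m R where "m > 0" "R > r1" "\<And>x :: real^'n. norm x > R \<Longrightarrow> \<exists>z. norm z = norm x \<and> \<bar>V z\<bar> \<ge> m"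
proof -
  obtain y where y: "norm y > r1" "V y \<noteq> 0" by (rule ex_far_V_nonzero)
  define m where "m = sqrt (weighted_V_sq y)"
  have "V y * V y > 0" using y(2) not_real_square_gt_zero by metis
  then have m: "m > 0"
    unfolding m_def weighted_V_sq_def by (intro real_sqrt_gt_zero mult_pos_pos[OF _ exp_gt_zero])
  have "\<exists>z. norm z = norm x \<and> \<bar>V z\<bar> \<ge> m" if x: "norm x > norm y" for x :: "real^'n"
  proof -
    have "continuous_on (sphere 0 (norm x)) weighted_V_sq"
      unfolding weighted_V_sq_def using x y r1 r0_pos
      by (intro continuous_intros continuous_on_subset[OF smooth_continuous[OF smooth_V]])
        (auto simp: mem_U_iff)
    from sphere_attains_sup[OF this] obtain z
      where z: "norm z = norm x" "\<And>w. norm w = norm x \<Longrightarrow> weighted_V_sq w \<le> weighted_V_sq z" by metis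
    have "weighted_V_sq y \<le> weighted_V_sq z"
    proof (rule inner_sphere_max_le[where H = weighted_V_sq, OF _ x])
      fix w :: "real^'n" assume "norm w \<ge> norm y"
      then have far: "norm w \<ge> r1" using y(1) by simp
      show "weighted_V_sq differentiable (at w)" by (rule lderiv_id_weighted_V_sq(1)[OF far])
      show "lderiv id weighted_V_sq w \<ge> 0" if "\<And>v. norm v = norm w \<Longrightarrow> weighted_V_sq v \<le> weighted_V_sq w"
        by (rule weighted_V_sq_increasing[OF far that])
    qed (use y r1 z in auto)
    also have "\<dots> \<le> (V z)\<^sup>2" by (rule weighted_V_sq_le) (use x y z in simp)
    finally have "m \<le> sqrt ((V z)\<^sup>2)" unfolding m_def by (rule real_sqrt_le_mono)
    then show ?thesis using z(1) by auto
  qed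
  then show ?thesis using that m y(1) by blast
qed

lemma eventually_V_ge:
  obtains m where "m > 0" "\<forall>\<^sub>F x in at_infinity. \<bar>V x\<bar> \<ge> m"
proof -
  obtain D where D: "D > 0"
    "\<And>x a b. norm x \<ge> r1 \<Longrightarrow> orthonormal_pair a b \<Longrightarrow> \<bar>lderiv (rot a b) V x\<bar> \<le> D * norm x powr (-1/2)"
    using S_V_decay by blast
  obtain m R where m: "m > 0" "R > r1" "\<And>x :: real^'n. norm x > R \<Longrightarrow> \<exists>z. norm z = norm x \<and> \<bar>V z\<bar> \<ge> m"
    using ex_V_ge_on_far_spheres by blast
  have "((\<lambda>x::real^'n. pi * (D * norm x powr (-1/2))) \<longlongrightarrow> pi * (D * 0)) at_infinity"
    by (intro tendsto_intros norm_powr_tendsto_0) simp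
  then have "\<forall>\<^sub>F x :: real^'n in at_infinity. pi * (D * norm x powr (-1/2)) < m / 2"
    using m(1) by (intro order_tendstoD(2)) auto
  moreover have "\<forall>\<^sub>F x :: real^'n in at_infinity. norm x > R"
    unfolding eventually_at_infinity by (intro exI[of _ "R + 1"]) auto
  ultimately have "\<forall>\<^sub>F x in at_infinity. \<bar>V x\<bar> \<ge> m / 2"
  proof eventually_elim
    case (elim x)
    obtain z where z: "norm z = norm x" "\<bar>V z\<bar> \<ge> m" using m(3)[OF elim(2)] by blast
    have "\<bar>V z - V x\<bar> \<le> pi * (D * norm x powr (-1/2))"
      by (rule V_oscillation[OF D(2) _ z(1)]) (use elim(2) m(2) in auto)
    then show ?case using elim(1) z(2) by linarith
  qed
  then show ?thesis using that[of "m / 2"] m(1) by simp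
qed

end

section \<open>Symmetry near infinity\<close>

context exterior_static begin

definition log_grad_sq where "log_grad_sq x = tangrad_sq u x / (u x)\<^sup>2"

lemma log_grad_sq_nonneg: "log_grad_sq x \<ge> 0"
  by (simp add: log_grad_sq_def tangrad_sq_nonneg)

lemma log_grad_sq_pos_iff: "x \<in> U \<Longrightarrow> log_grad_sq x > 0 \<longleftrightarrow> tangrad_sq u x \<noteq> 0"
  using tangrad_sq_nonneg[of u x] u_nonzero by (auto simp: log_grad_sq_def zero_less_divide_iff)

lemma smooth_log_grad_sq: "smooth_on log_grad_sq U"
  unfolding log_grad_sq_def by (intro smooth_divide smooth_tangrad_sq smooth_power open_U smooth_u)
    (simp add: u_nonzero)

lemma S_log_u_le:
  assumes "x \<in> U" "orthonormal_pair a b"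
  shows "\<bar>lderiv (rot a b) u x / u x\<bar> \<le> sqrt (log_grad_sq x)"
proof -
  have "(lderiv (rot a b) u x / u x)\<^sup>2 \<le> log_grad_sq x"
    unfolding power_divide log_grad_sq_def
    by (intro divide_right_mono
      lderiv_rot_sq_le_tangrad_sq[OF differentiable_U[OF smooth_u assms(1)] assms(2)
      U_nonzero[OF assms(1)]]) simp
  then show ?thesis using real_sqrt_le_mono by fastforce
qed

lemma S_S_log_u_at_sphere_max:
  assumes "p \<in> U" "orthonormal_pair a b" "lderiv (rot a b) u p = sqrt (tangrad_sq u p)"
    and max: "\<And>y. norm y = norm p \<Longrightarrow> log_grad_sq y \<le> log_grad_sq p"
  shows "lderiv (rot a b) (\<lambda>x. lderiv (rot a b) u x / u x) p = 0"
proof -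
  define Z where "Z x = lderiv (rot a b) u x / u x" for x
  have flow_in_U: "rot_flow a b p t \<in> U" for t by (rule sphere_in_U[OF assms(1) norm_rot_flow[OF assms(2)]])
  have "smooth_on Z U"
    unfolding Z_def by (intro smooth_divide[OF open_U u_nonzero] smooth_lderiv open_U linear_rot smooth_u)
  then have "((\<lambda>t. Z (rot_flow a b p t)) has_real_derivative lderiv (rot a b) Z (rot_flow a b p 0)) (at 0)"
    by (intro DERIV_rot_flow[OF assms(2)] differentiable_U[OF _ flow_in_U])
  moreover have "Z (rot_flow a b p t) \<le> Z (rot_flow a b p 0)" for t
  proof -
    have "Z (rot_flow a b p t) \<le> sqrt (log_grad_sq (rot_flow a b p t))"
      unfolding Z_def by (rule order_trans[OF abs_ge_self S_log_u_le[OF flow_in_U assms(2)]])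
    also have "\<dots> \<le> sqrt (log_grad_sq p)" by (rule real_sqrt_le_mono[OF max[OF norm_rot_flow[OF assms(2)]]])
    also have "\<dots> = Z (rot_flow a b p 0)"
      using u_pos[OF assms(1)] by (simp add: Z_def log_grad_sq_def assms(3) real_sqrt_divide)
    finally show ?thesis .
  qed
  ultimately show ?thesis
    using DERIV_local_max[of "\<lambda>t. Z (rot_flow a b p t)" _ 0 1] by (simp add: Z_def[abs_def])
qed

lemma small_log_grad_contradiction:
  assumes p: "p \<in> U" "V p \<noteq> 0" "mixed_coeff p \<noteq> 0" and no_small: "no_small_relations (n - 1) w0 \<epsilon>"
    and log_grad: "log_grad_sq p > 0" "\<And>y. norm y = norm p \<Longrightarrow> log_grad_sq y \<le> log_grad_sq p"
    and small: "sqrt (log_grad_sq p) < \<epsilon>" "\<bar>omega p - w0\<bar> < \<epsilon>"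
    and \<delta>: "\<delta> \<le> 1" "\<delta> \<le> (if w0 = 1 then 1 else \<epsilon>)"
    and S_V: "\<And>a b. orthonormal_pair a b \<Longrightarrow> \<bar>lderiv (rot a b) V p\<bar> < \<delta> * sqrt (log_grad_sq p) * \<bar>V p\<bar>"
  shows False
proof -
  have "tangrad_sq u p > 0"
    using log_grad(1) tangrad_sq_nonneg[of u p] unfolding log_grad_sq_pos_iff[OF p(1)] by linarith
  then obtain a b where ab: "orthonormal_pair a b" "p = norm p *\<^sub>R a"
    "\<And>e. e \<bullet> a = 0 \<Longrightarrow> e \<bullet> b = 0 \<Longrightarrow> dderiv e u p = 0"
      "lderiv (rot a b) u p = sqrt (tangrad_sq u p)"
    using tangrad_sq_frame[OF differentiable_U[OF smooth_u p(1)] _ U_nonzero[OF p(1)]] by blast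
  define Z where "Z = lderiv (rot a b) u p / u p"
  define Y where "Y = lderiv (rot a b) V p / V p"
  have Z: "Z = sqrt (log_grad_sq p)" "Z > 0"
    using log_grad(1) u_pos[OF p(1)]
    by (simp_all add: Z_def ab(4) log_grad_sq_def real_sqrt_divide zero_less_divide_iff)
  have Y: "\<bar>Y\<bar> < \<delta> * Z"
    using S_V[OF ab(1)] p(2) by (simp add: Y_def Z(1) abs_divide divide_less_eq)
  have "\<delta> * Z \<le> 1 * Z" using \<delta>(1) Z(2) by (intro mult_right_mono) auto
  then have Y_plus_Z: "Y + Z \<noteq> 0" using Y by linarith
  have "\<delta> * Z \<le> (if w0 = 1 then 1 else \<epsilon>) * Z" using \<delta>(2) Z(2) by (intro mult_right_mono) auto
  then have Y_le: "\<bar>Y\<bar> \<le> (if w0 = 1 then 1 else \<epsilon>) * \<bar>Z\<bar>" unfolding abs_of_pos[OF Z(2)] using Y by linarith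
  obtain c l where relations: "slice_relations (n - 1) (Y + Z) (Z - Y) (omega p) c l"
    and l: "(n - 1) * l = 2 * lderiv (rot a b) (\<lambda>x. lderiv (rot a b) u x / u x) p + 2 * Z\<^sup>2 + 2 * c * Z"
    using slice_identities[OF n_ge_3 p(1) ab(1,2,3) p(2) _ Y_plus_Z p(3) Z_def Y_def] Z(2) by blast
  have "lderiv (rot a b) (\<lambda>x. lderiv (rot a b) u x / u x) p = 0"
    by (rule S_S_log_u_at_sphere_max[OF p(1) ab(1,4) log_grad(2)])
  then have "(n - 1) * l = 2 * Z\<^sup>2 + 2 * c * Z" using l by simp
  moreover have "\<bar>Z\<bar> < \<epsilon>" "Z \<noteq> 0" using small(1) Z by auto
  ultimately show False using no_small relations small(2) Y_le unfolding no_small_relations_def by blast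
qed

end

context exterior_decay begin

lemma log_grad_sq_le:
  assumes "norm x \<ge> r1"
  shows "log_grad_sq x \<le> 4 * C\<^sup>2 * norm x powr (1/4 - 2 * (n - 2))"
proof -
  have "(1/2)\<^sup>2 \<le> (u x)\<^sup>2" by (rule power_mono[OF u_between(1)[OF assms]]) simp
  then have "log_grad_sq x \<le> C\<^sup>2 * norm x powr (1/4 - 2 * (n - 2)) / (1/4)"
    unfolding log_grad_sq_def using tangrad_sq_u_le[OF assms] tangrad_sq_nonneg by (intro frac_le)
      (auto simp: power2_eq_square)
  then show ?thesis by simp
qed

lemma sqrt_log_grad_sq_le:
  assumes "norm x \<ge> r1"
  shows "sqrt (log_grad_sq x) \<le> 2 * C * norm x powr (-1/2)"
proof -
  note log_grad_sq_le[OF assms]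
  also have "4 * C\<^sup>2 * norm x powr (1/4 - 2 * (n - 2)) \<le> 4 * C\<^sup>2 * norm x powr (-1)"
    using assms r1 n_ge_3 by (intro mult_left_mono powr_mono) auto
  also have "norm x powr (-1) = (norm x powr (-1/2))\<^sup>2" unfolding power2_eq_square powr_add[symmetric] by simp
  also have "4 * C\<^sup>2 * \<dots> = (2 * C * norm x powr (-1/2))\<^sup>2" by (simp add: power_mult_distrib)
  finally show ?thesis using C_pos by (intro real_le_lsqrt) (auto simp: log_grad_sq_nonneg)
qed

text \<open>The exponent is chosen so that the weighted maximum below is attained, while the resulting factor
  \<open>(n - 3/2) / (n - 5/4)\<close> in \<open>S_V_less_at_weighted_max\<close> stays below 1.\<close>

definition weighted_log_grad_sq where "weighted_log_grad_sq x = norm x powr (2 * (n - 9/4)) * log_grad_sq x"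

lemma weighted_log_grad_sq_tendsto_0: "(weighted_log_grad_sq \<longlongrightarrow> 0) at_infinity"
proof (rule tendsto_sandwich[OF _ _ tendsto_const])
  show "\<forall>\<^sub>F x in at_infinity. 0 \<le> weighted_log_grad_sq x"
    by (simp add: weighted_log_grad_sq_def log_grad_sq_nonneg)
  have "weighted_log_grad_sq x \<le> 4 * C\<^sup>2 * norm x powr (-1/4)" if "norm x \<ge> r1" for x
  proof -
    have "weighted_log_grad_sq x \<le> norm x powr (2 * (n - 9/4)) * (4 * C\<^sup>2 * norm x powr (1/4 - 2 * (n - 2)))"
      unfolding weighted_log_grad_sq_def by (intro mult_left_mono log_grad_sq_le that) simp
    also have "\<dots> = 4 * C\<^sup>2 * norm x powr (2 * (n - 9/4) + (1/4 - 2 * (n - 2)))" unfolding powr_add by simp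
    also have "2 * (n - 9/4) + (1/4 - 2 * (n - 2)) = -1/4" by simp
    finally show ?thesis .
  qed
  then show "\<forall>\<^sub>F x in at_infinity. weighted_log_grad_sq x \<le> 4 * C\<^sup>2 * norm x powr (-1/4)"
    unfolding eventually_at_infinity by blast
  have "((\<lambda>x::real^'n. 4 * C\<^sup>2 * norm x powr (-1/4)) \<longlongrightarrow> 4 * C\<^sup>2 * 0) at_infinity"
    by (intro tendsto_intros norm_powr_tendsto_0) simp
  then show "((\<lambda>x::real^'n. 4 * C\<^sup>2 * norm x powr (-1/4)) \<longlongrightarrow> 0) at_infinity" by simp
qed

lemma sqrt_log_grad_sq_ray_le:
  assumes p: "norm p \<ge> r1" and max: "\<And>x. norm p \<le> norm x \<Longrightarrow> weighted_log_grad_sq x \<le> weighted_log_grad_sq p"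
    and s: "s \<ge> 1"
  shows "sqrt (log_grad_sq (s *\<^sub>R p)) \<le> s powr (- (n - 9/4)) * sqrt (log_grad_sq p)"
proof -
  define i where "i = n - 9/4"
  have norm_p: "norm p > 0" using p r1 by linarith
  have "norm p \<le> norm (s *\<^sub>R p)" using s by (simp add: mult_right_mono[of 1 s "norm p", simplified])
  from max[OF this] have "norm p powr (2 * i) * (s powr (2 * i) * log_grad_sq (s *\<^sub>R p))
      \<le> norm p powr (2 * i) * log_grad_sq p"
    unfolding weighted_log_grad_sq_def i_def[symmetric] far_ray(3)[OF p s] by (simp only: mult_ac)
  then have "s powr (2 * i) * log_grad_sq (s *\<^sub>R p) \<le> log_grad_sq p" using norm_p by simp
  then have "sqrt ((s powr i)\<^sup>2 * log_grad_sq (s *\<^sub>R p)) \<le> sqrt (log_grad_sq p)"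
    by (intro real_sqrt_le_mono) (simp add: power2_eq_square powr_add[symmetric])
  then have "s powr i * sqrt (log_grad_sq (s *\<^sub>R p)) \<le> sqrt (log_grad_sq p)" by (simp add: real_sqrt_mult)
  then show ?thesis using s by (simp add: i_def[symmetric] powr_minus_divide field_simps)
qed

lemma mixed_coeff_ray_le:
  assumes D: "D > 0" "\<And>x. norm x \<ge> r1 \<Longrightarrow> \<bar>EV x\<bar> \<le> D * norm x powr (-1/2)"
    and p: "norm p \<ge> r1" "8 * n * D * norm p powr (-1/2) \<le> \<bar>V p\<bar>" and s: "s \<ge> 1"
  shows "\<bar>mixed_coeff (s *\<^sub>R p)\<bar> \<le> (n - 3/2) * \<bar>V p\<bar>"
proof -
  define h where "h = norm p powr (-1/2)"
  note far = far_ray[OF p(1) s]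
  have h: "h > 0" using far_norm_powr(1)[OF p(1)] by (simp add: h_def)
  have "s powr (-1/2) \<le> s powr 0" using s by (intro powr_mono) auto
  then have "norm (s *\<^sub>R p) powr (-1/2) \<le> 1 * h" unfolding far(3) h_def using s by (intro mult_right_mono) auto
  then have "D * norm (s *\<^sub>R p) powr (-1/2) \<le> D * h" using D(1) by (intro mult_left_mono) auto
  then have EV_le: "\<bar>EV (s *\<^sub>R p)\<bar> \<le> D * h" using D(2)[OF far(1)] by linarith
  have V_le: "\<bar>V (s *\<^sub>R p)\<bar> \<le> \<bar>V p\<bar> + 2 * (D * h)" using V_ray_diff_le[OF D(2) p(1) s] by (simp add: h_def)
  have "8 * (D * h) * n \<le> \<bar>V p\<bar>" using p(2) by (simp add: h_def mult_ac)
  moreover have "D * h \<ge> 0" using D(1) h by simp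
  ultimately have small: "2 * (n * (D * h)) - 3 * (D * h) \<le> 1/2 * \<bar>V p\<bar>" by (simp add: mult_ac)
  have "\<bar>mixed_coeff (s *\<^sub>R p)\<bar> \<le> D * h + (n - 2) * (\<bar>V p\<bar> + 2 * (D * h))"
    using n_ge_3 by (intro order_trans[OF mixed_coeff_le] add_mono mult_left_mono EV_le V_le) auto
  also have "\<dots> = (n - 2) * \<bar>V p\<bar> + (2 * (n * (D * h)) - 3 * (D * h))" by (simp add: algebra_simps)
  also have "\<dots> \<le> (n - 2) * \<bar>V p\<bar> + 1/2 * \<bar>V p\<bar>" using small by simp
  finally show ?thesis by (simp add: algebra_simps)
qed

lemma S_V_le_of_ray_diff:
  assumes "norm x > 0" "orthonormal_pair a b"
    and diff: "\<And>s. s \<ge> 1 \<Longrightarrow> \<bar>lderiv (rot a b) V (s *\<^sub>R x) / s - lderiv (rot a b) V x\<bar> \<le> K"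
  shows "\<bar>lderiv (rot a b) V x\<bar> \<le> K"
proof -
  obtain D where D: "D > 0"
    "\<And>x a b. norm x \<ge> r1 \<Longrightarrow> orthonormal_pair a b \<Longrightarrow> \<bar>lderiv (rot a b) V x\<bar> \<le> D * norm x powr (-1/2)"
    using S_V_decay by blast
  show ?thesis
  proof (rule field_le_epsilon)
    fix e :: real assume e: "e > 0"
    define s where "s = max 1 (max (D / e) (r1 / norm x))"
    have s: "s \<ge> 1" "D / e \<le> s" "r1 / norm x \<le> s" by (simp_all add: s_def)
    have far: "norm (s *\<^sub>R x) \<ge> r1" using s assms(1) by (simp add: divide_le_eq)
    have "\<bar>lderiv (rot a b) V (s *\<^sub>R x)\<bar> \<le> D * 1"
      using D(2)[OF far assms(2)] mult_left_mono[OF far_norm_powr(2)[OF far], of D] D(1) by linarith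
    then have "\<bar>lderiv (rot a b) V (s *\<^sub>R x) / s\<bar> \<le> D / s" using s by (simp add: abs_divide divide_right_mono)
    also have "\<dots> \<le> e" using s e by (simp add: field_simps)
    finally show "\<bar>lderiv (rot a b) V x\<bar> \<le> K + e" using diff[OF s(1)] by linarith
  qed
qed

lemma S_V_less_at_weighted_max:
  assumes D: "D > 0" "\<And>x. norm x \<ge> r1 \<Longrightarrow> \<bar>EV x\<bar> \<le> D * norm x powr (-1/2)"
    and p: "norm p \<ge> r1" "8 * n * D * norm p powr (-1/2) \<le> \<bar>V p\<bar>" "V p \<noteq> 0" "log_grad_sq p > 0"
    and max: "\<And>x. norm p \<le> norm x \<Longrightarrow> weighted_log_grad_sq x \<le> weighted_log_grad_sq p"
    and ab: "orthonormal_pair a b"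
  shows "\<bar>lderiv (rot a b) V p\<bar> < sqrt (log_grad_sq p) * \<bar>V p\<bar>"
proof -
  define A where "A = sqrt (log_grad_sq p) * ((n - 3/2) * \<bar>V p\<bar>)"
  have "\<bar>lderiv (rot a b) V p\<bar> \<le> A / ((n - 9/4) + 1)"
  proof (rule S_V_le_of_ray_diff[OF _ ab])
    show "norm p > 0" using p(1) r1 by linarith
    fix s :: real assume s: "s \<ge> 1"
    show "\<bar>lderiv (rot a b) V (s *\<^sub>R p) / s - lderiv (rot a b) V p\<bar> \<le> A / ((n - 9/4) + 1)"
    proof (rule S_V_ray_diff_le[OF s])
      show "z *\<^sub>R p \<in> U" if "1 \<le> z" for z by (rule far_ray(2)[OF p(1) that])
      fix z :: real assume z: "1 \<le> z"
      have "\<bar>lderiv (rot a b) u (z *\<^sub>R p) / u (z *\<^sub>R p)\<bar> \<le> z powr (- (n - 9/4)) * sqrt (log_grad_sq p)"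
        by (rule order_trans[OF S_log_u_le[OF far_ray(2)[OF p(1) z] ab]
          sqrt_log_grad_sq_ray_le[OF p(1) max z]])
      then have "\<bar>lderiv (rot a b) u (z *\<^sub>R p) / u (z *\<^sub>R p)\<bar> * \<bar>mixed_coeff (z *\<^sub>R p)\<bar>
          \<le> (z powr (- (n - 9/4)) * sqrt (log_grad_sq p)) * ((n - 3/2) * \<bar>V p\<bar>)"
        using mixed_coeff_ray_le[OF D p(1,2) z] by (intro mult_mono) (auto simp: log_grad_sq_nonneg)
      then show "\<bar>lderiv (rot a b) u (z *\<^sub>R p) / u (z *\<^sub>R p)\<bar> * \<bar>mixed_coeff (z *\<^sub>R p)\<bar>
          \<le> A * z powr (- (n - 9/4))"
        by (simp add: A_def mult_ac)
    qed (use n_ge_3 in simp)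
  qed
  also have "A / ((n - 9/4) + 1) = (sqrt (log_grad_sq p) * \<bar>V p\<bar>) * ((n - 3/2) / (n - 5/4))"
    by (simp add: A_def)
  also have "\<dots> < (sqrt (log_grad_sq p) * \<bar>V p\<bar>) * 1"
    using p(3,4) n_ge_3 by (intro mult_strict_left_mono) auto
  finally show ?thesis by simp
qed

lemma mixed_coeff_nonzero_of_EV_less:
  assumes "\<bar>EV x\<bar> < \<bar>V x\<bar>"
  shows "mixed_coeff x \<noteq> 0"
proof
  assume "mixed_coeff x = 0"
  then have "\<bar>EV x\<bar> = \<bar>(n - 2) * V x\<bar>" by (simp add: mixed_coeff_def eq_neg_iff_add_eq_0[symmetric])
  also have "\<dots> \<ge> 1 * \<bar>V x\<bar>" unfolding abs_mult using n_ge_3 by (intro mult_right_mono) auto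
  finally show False using assms by simp
qed

lemma weighted_max_contradiction:
  assumes D: "D > 0" "\<And>x. norm x \<ge> r1 \<Longrightarrow> \<bar>EV x\<bar> \<le> D * norm x powr (-1/2)"
    and no_small: "no_small_relations (n - 1) 1 \<epsilon>"
    and p: "norm p \<ge> r1" "8 * n * D * norm p powr (-1/2) < \<bar>V p\<bar>" "2 * C * norm p powr (-1/2) < \<epsilon>"
    and log_grad: "log_grad_sq p > 0"
    and max: "\<And>x. norm p \<le> norm x \<Longrightarrow> weighted_log_grad_sq x \<le> weighted_log_grad_sq p"
  shows False
proof (rule small_log_grad_contradiction[OF far_in_U[OF p(1)] _ _ no_small log_grad, of 1])
  define h where "h = norm p powr (-1/2)"
  have h: "h > 0" "8 * n * D * h < \<bar>V p\<bar>" "2 * C * h < \<epsilon>"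
    using far_norm_powr(1)[OF p(1)] p(2,3) by (auto simp: h_def)
  have "1 * (D * h) \<le> 8 * n * (D * h)" using n_ge_3 D(1) h(1) by (intro mult_right_mono) auto
  then have EV_less: "\<bar>EV p\<bar> < \<bar>V p\<bar>"
    using D(2)[OF p(1)] h(2) unfolding h_def[symmetric] mult.assoc by linarith
  then show V: "V p \<noteq> 0" by auto
  show "mixed_coeff p \<noteq> 0" by (rule mixed_coeff_nonzero_of_EV_less[OF EV_less])
  show "log_grad_sq y \<le> log_grad_sq p" if "norm y = norm p" for y
    using max[of y] far_norm_powr(1)[OF p(1)] that by (simp add: weighted_log_grad_sq_def)
  show "sqrt (log_grad_sq p) < \<epsilon>" using sqrt_log_grad_sq_le[OF p(1)] p(3) by linarith
  show "\<bar>omega p - 1\<bar> < \<epsilon>"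
    using omega_le[OF p(1)] mult_left_mono[OF far_norm_powr(3)[OF p(1)], of C] C_pos h
    by (simp add: h_def abs_minus_commute)
  show "\<bar>lderiv (rot a b) V p\<bar> < 1 * sqrt (log_grad_sq p) * \<bar>V p\<bar>" if "orthonormal_pair a b" for a b
    using S_V_less_at_weighted_max[OF D p(1) _ V log_grad max that] p(2) by simp
qed simp_all

definition radial_beyond where "radial_beyond R \<longleftrightarrow> r0 < R \<and> (\<forall>x. R \<le> norm x \<longrightarrow> tangrad_sq u x = 0)"

lemma radial_near_infinity:
  obtains R where "radial_beyond R"
proof -
  obtain \<epsilon> where \<epsilon>: "\<epsilon> > 0" "no_small_relations (n - 1) 1 \<epsilon>"
    using ex_no_small_relations[of "n - 1" 1] n_ge_3 by auto
  obtain D where D: "D > 0" "\<And>x. norm x \<ge> r1 \<Longrightarrow> \<bar>EV x\<bar> \<le> D * norm x powr (-1/2)" using EV_decay by blast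
  obtain m where m: "m > 0" "\<forall>\<^sub>F x in at_infinity. \<bar>V x\<bar> \<ge> m" by (rule eventually_V_ge)
  have "((\<lambda>x::real^'n. K * norm x powr (-1/2)) \<longlongrightarrow> K * 0) at_infinity" for K
    by (intro tendsto_intros norm_powr_tendsto_0) simp
  then have decay: "\<forall>\<^sub>F x :: real^'n in at_infinity. K * norm x powr (-1/2) < e" if "e > 0" for K e
    using that by (intro order_tendstoD(2)) auto
  have "\<forall>\<^sub>F x in at_infinity. \<bar>V x\<bar> \<ge> m \<and> 8 * n * D * norm x powr (-1/2) < m \<and> 2 * C * norm x powr (-1/2) < \<epsilon>"
    using m(2) decay[OF m(1)] decay[OF \<epsilon>(1)] by eventually_elim blast
  then obtain R0 where R0: "\<And>x. norm x \<ge> R0 \<Longrightarrow> \<bar>V x\<bar> \<ge> m"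
      "\<And>x::real^'n. norm x \<ge> R0 \<Longrightarrow> 8 * n * D * norm x powr (-1/2) < m"
        "\<And>x::real^'n. norm x \<ge> R0 \<Longrightarrow> 2 * C * norm x powr (-1/2) < \<epsilon>"
    unfolding eventually_at_infinity by blast
  define R where "R = max R0 r1"
  have "tangrad_sq u x0 = 0" if x0: "norm x0 \<ge> R" for x0
  proof (rule ccontr)
    assume "tangrad_sq u x0 \<noteq> 0"
    then have "log_grad_sq x0 > 0" "norm x0 > 0"
      using x0 r1 far_in_U[of x0] log_grad_sq_pos_iff[of x0] by (auto simp: R_def)
    then have "weighted_log_grad_sq x0 > 0" unfolding weighted_log_grad_sq_def by (intro mult_pos_pos) auto
    moreover have "continuous_on {x. R \<le> norm x} weighted_log_grad_sq"
      unfolding weighted_log_grad_sq_def using r1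
      by (intro continuous_intros continuous_on_subset[OF smooth_continuous[OF smooth_log_grad_sq]])
        (auto simp: R_def mem_U_iff)
    ultimately obtain p where p: "R \<le> norm p"
      "\<And>x. R \<le> norm x \<Longrightarrow> weighted_log_grad_sq x \<le> weighted_log_grad_sq p"
      "weighted_log_grad_sq p > 0"
      using exterior_attains_sup[OF _ weighted_log_grad_sq_tendsto_0 x0] x0 by (metis order_less_le_trans)
    have far: "norm p \<ge> r1" "norm p \<ge> R0" using p(1) by (auto simp: R_def)
    show False
    proof (rule weighted_max_contradiction[OF D \<epsilon>(2) far(1)])
      show "8 * n * D * norm p powr (-1/2) < \<bar>V p\<bar>" using R0(1,2)[OF far(2)] by linarith
      show "log_grad_sq p > 0" using p(3) by (simp add: weighted_log_grad_sq_def zero_less_mult_iff)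
      show "weighted_log_grad_sq x \<le> weighted_log_grad_sq p" if "norm p \<le> norm x" for x
        by (rule p(2)) (use that p(1) in simp)
    qed (use R0(3)[OF far(2)] in simp_all)
  qed
  then show ?thesis using that[of R] r1 by (simp add: R_def radial_beyond_def)
qed

end

section \<open>Symmetry everywhere and the Schwarzschild form\<close>

context exterior_static begin

lemma radial_equations:
  assumes "x \<in> U" "sphere_laplace u x = 0" "sphere_laplace V x = 0"
  shows "2 * omega x * mixed_coeff x = (n - 2) * (1 + omega x) * V x" "lderiv id (\<lambda>y. u y * V y) x = 0"
proof -
  have "(n - 1) * (2 * omega x * EV x) = (n - 1) * ((n - 2) * (1 - omega x) * V x)"
    using static_trace(1)[OF assms(1)] assms(3) by argo
  then have EV: "2 * omega x * EV x = (n - 2) * (1 - omega x) * V x" using n_ge_3 by simp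
  define M where "M = Eu x / u x"
  have M: "Eu x = u x * M" using u_nonzero[OF assms(1)] by (simp add: M_def)
  have "- ((n - 1) * omega x * M) = (n - 1) * (n - 2) / 2 * (1 - omega x)"
    using scalar_equation[OF connected_U V_nontrivial assms(1)] assms(2) by (simp add: M_def)
  then have "(n - 1) * (2 * omega x * M) = - (n - 1) * (n - 2) * (1 - omega x)" by argo
  then have "(n - 1) * (2 * omega x * Eu x) = (n - 1) * (- (n - 2) * (1 - omega x) * u x)"
    unfolding M by algebra
  then have Eu: "2 * omega x * Eu x = - (n - 2) * (1 - omega x) * u x" using n_ge_3 by simp
  show "2 * omega x * mixed_coeff x = (n - 2) * (1 + omega x) * V x"
    unfolding mixed_coeff_def using EV by (simp add: algebra_simps)
  have "2 * omega x * (u x * EV x + Eu x * V x) = 0" using EV Eu by algebra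
  then have "u x * EV x + Eu x * V x = 0" using omega_pos[OF assms(1)] by simp
  then show "lderiv id (\<lambda>y. u y * V y) x = 0"
    unfolding lderiv_arith(3)[OF differentiable_U[OF smooth_u assms(1)]
      differentiable_U[OF smooth_V assms(1)]] .
qed

end

context exterior_decay begin

lemma radial_beyondD:
  assumes "radial_beyond R" "R \<le> norm x"
  shows "x \<in> U" "tangrad_sq u x = 0" "norm x > 0" "orthonormal_pair a b \<Longrightarrow> lderiv (rot a b) u x = 0"
proof -
  show x: "x \<in> U" "tangrad_sq u x = 0" using assms by (auto simp: radial_beyond_def mem_U_iff)
  show "norm x > 0" using U_nonzero[OF x(1)] by simp
  show "orthonormal_pair a b \<Longrightarrow> lderiv (rot a b) u x = 0"
    using lderiv_rot_sq_le_tangrad_sq[OF differentiable_U[OF smooth_u x(1)] _ U_nonzero[OF x(1)], of a b] x(2)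
    by simp
qed

lemma S_V_zero:
  assumes R: "radial_beyond R" and x: "R \<le> norm x" and ab: "orthonormal_pair a b"
  shows "lderiv (rot a b) V x = 0"
proof -
  have "\<bar>lderiv (rot a b) V x\<bar> \<le> 0"
  proof (rule S_V_le_of_ray_diff[OF radial_beyondD(3)[OF R x] ab])
    fix s :: real assume s: "s \<ge> 1"
    have ray: "R \<le> norm (z *\<^sub>R x)" if "1 \<le> z" for z :: real
      using x that mult_right_mono[of 1 z "norm x"] by simp
    have "\<bar>lderiv (rot a b) V (s *\<^sub>R x) / s - lderiv (rot a b) V x\<bar> \<le> 0 / (0 + 1)"
      by (rule S_V_ray_diff_le[OF s])
        (simp_all add: radial_beyondD(1)[OF R ray] radial_beyondD(4)[OF R ray ab])
    then show "\<bar>lderiv (rot a b) V (s *\<^sub>R x) / s - lderiv (rot a b) V x\<bar> \<le> 0" by simp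
  qed
  then show ?thesis by simp
qed

lemma radial_beyond_spheres:
  assumes R: "radial_beyond R" and x: "R \<le> norm x"
  shows "sphere_laplace u x = 0" "sphere_laplace V x = 0"
    "norm y = norm x \<Longrightarrow> u y = u x" "norm y = norm x \<Longrightarrow> V y = V x"
proof -
  have dim: "CARD('n) \<ge> 2" using CARD_ge_3 by simp
  have sphere: "x \<noteq> 0" "y \<in> U" "R \<le> norm y" if "norm y = norm x" for y
    using radial_beyondD(1,3)[OF R, of y] radial_beyondD(3)[OF R x] x that by auto
  note on_spheres = constant_on_sphere[OF dim open_U _ sphere(1)[OF refl] sphere(2)]
  have "lderiv (rot a b) u z = 0" "lderiv (rot a b) V z = 0" if "orthonormal_pair a b" "norm z = norm x"
    for a b z
    using radial_beyondD(4)[OF R sphere(3)[OF that(2)] that(1)] S_V_zero[OF R sphere(3)[OF that(2)] that(1)]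
    by auto
  then show "sphere_laplace u x = 0" "sphere_laplace V x = 0"
      "norm y = norm x \<Longrightarrow> u y = u x" "norm y = norm x \<Longrightarrow> V y = V x"
    using on_spheres[OF smooth_u] on_spheres[OF smooth_V] by blast+
qed

lemma radial_beyond_nonzero:
  assumes R: "radial_beyond R" and x: "R \<le> norm x"
  shows "V x \<noteq> 0" "mixed_coeff x \<noteq> 0"
proof -
  obtain m where "m > 0" "\<forall>\<^sub>F x in at_infinity. \<bar>V x\<bar> \<ge> m" by (rule eventually_V_ge)
  then obtain r where r: "\<And>x. norm x \<ge> r \<Longrightarrow> V x \<noteq> 0" unfolding eventually_at_infinity by fastforce
  define s where "s = max 1 (r / norm x)"
  have s: "s \<ge> 1" "r / norm x \<le> s" by (simp_all add: s_def)
  then have "V (s *\<^sub>R x) \<noteq> 0" using radial_beyondD(3)[OF R x] by (intro r) (simp add: divide_le_eq)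
  moreover have "s *\<^sub>R x \<in> U"
    using s(1) x mult_right_mono[of 1 s "norm x"] by (intro radial_beyondD(1)[OF R]) simp
  moreover have "u (s *\<^sub>R x) * V (s *\<^sub>R x) = u x * V x"
  proof (rule constant_on_ray[OF s(1)])
    fix y :: "real^'n" assume "norm x \<le> norm y"
    then have y: "R \<le> norm y" using x by simp
    note yU = radial_beyondD(1)[OF R y]
    show "(\<lambda>y. u y * V y) differentiable (at y)"
      by (intro differentiable_U[OF _ yU] smooth_mult open_U smooth_u smooth_V)
    show "lderiv id (\<lambda>y. u y * V y) y = 0"
      by (rule radial_equations(2)[OF yU radial_beyond_spheres(1,2)[OF R y]])
  qed
  ultimately show V: "V x \<noteq> 0" using u_nonzero[of "s *\<^sub>R x"] by auto
  have "2 * omega x * mixed_coeff x = (n - 2) * (1 + omega x) * V x"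
    by (rule radial_equations(1)[OF radial_beyondD(1)[OF R x] radial_beyond_spheres(1,2)[OF R x]])
  then show "mixed_coeff x \<noteq> 0" using omega_pos[OF radial_beyondD(1)[OF R x]] V n_ge_3 by auto
qed

definition nearly_radial where
  "nearly_radial \<epsilon> w0 v B x
    \<longleftrightarrow> log_grad_sq x < \<epsilon>\<^sup>2 \<and> \<bar>omega x - w0\<bar> < \<epsilon> \<and> v < \<bar>V x\<bar> \<and> mixed_coeff x \<noteq> 0 \<and> \<bar>mixed_coeff x\<bar> < B"

text \<open>\<open>S V\<close> vanishes on the sphere of radius \<open>R\<close>, and its radial derivative is controlled by the logarithmic
  gradient of \<open>u\<close>; hence \<open>S V / V\<close> is much smaller than that gradient just inside the sphere.\<close>

lemma S_V_le_inside_radial: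
  assumes R: "radial_beyond R" and p: "p \<in> U" "norm p < R"
    and bounds: "\<And>x. norm p \<le> norm x \<Longrightarrow> norm x \<le> R \<Longrightarrow> log_grad_sq x \<le> log_grad_sq p"
      "\<And>x. norm p \<le> norm x \<Longrightarrow> norm x \<le> R \<Longrightarrow> \<bar>mixed_coeff x\<bar> \<le> B"
    and ab: "orthonormal_pair a b"
  shows "\<bar>lderiv (rot a b) V p\<bar> \<le> (R / norm p - 1) * (sqrt (log_grad_sq p) * B)"
proof -
  define t where "t = R / norm p"
  define g where "g s = lderiv (rot a b) V (s *\<^sub>R p) / s" for s
  define g' where "g' s = lderiv (rot a b) u (s *\<^sub>R p) / u (s *\<^sub>R p) * mixed_coeff (s *\<^sub>R p) / s\<^sup>2" for s
  have norm_p: "norm p > 0" using U_nonzero[OF p(1)] by simp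
  have t: "t > 1" "t * norm p = R" using p(2) norm_p by (simp_all add: t_def less_divide_eq)
  have ray: "norm p \<le> norm (s *\<^sub>R p)" "norm (s *\<^sub>R p) \<le> R" "s *\<^sub>R p \<in> U" if s: "1 \<le> s" "s \<le> t" for s
  proof -
    have "1 * norm p \<le> s * norm p" "s * norm p \<le> t * norm p" using s by (intro mult_right_mono; simp)+
    then show "norm p \<le> norm (s *\<^sub>R p)" "norm (s *\<^sub>R p) \<le> R" using s t(2) by simp_all
    then show "s *\<^sub>R p \<in> U" using p(1) by (simp add: mem_U_iff)
  qed
  have "(g has_real_derivative g' s) (at s)" if "1 \<le> s" "s \<le> t" for s
    unfolding g_def g'_def by (rule DERIV_S_V_ray) (use ray(3)[OF that] that in auto)
  then obtain z where z: "1 < z" "z < t" "g t - g 1 = (t - 1) * g' z" using MVT2[OF t(1), of g g'] by blast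
  note ray_z = ray[of z]
  have "\<bar>lderiv (rot a b) u (z *\<^sub>R p) / u (z *\<^sub>R p)\<bar> \<le> sqrt (log_grad_sq p)"
    by (rule order_trans[OF S_log_u_le[OF _ ab] real_sqrt_le_mono[OF bounds(1)]]) (use ray_z z in auto)
  then have product: "\<bar>lderiv (rot a b) u (z *\<^sub>R p) / u (z *\<^sub>R p)\<bar> * \<bar>mixed_coeff (z *\<^sub>R p)\<bar>
      \<le> sqrt (log_grad_sq p) * B"
    using bounds(2)[of "z *\<^sub>R p"] ray_z z log_grad_sq_nonneg by (intro mult_mono) auto
  moreover have "0 \<le> sqrt (log_grad_sq p) * B" by (rule order_trans[OF _ product]) simp
  moreover have "1 \<le> z\<^sup>2" using z(1) by (simp add: one_le_power)
  ultimately have "\<bar>lderiv (rot a b) u (z *\<^sub>R p) / u (z *\<^sub>R p)\<bar> * \<bar>mixed_coeff (z *\<^sub>R p)\<bar> / z\<^sup>2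
      \<le> sqrt (log_grad_sq p) * B / 1"
    by (intro frac_le) simp_all
  then have g'_le: "\<bar>g' z\<bar> \<le> sqrt (log_grad_sq p) * B" by (simp add: g'_def abs_mult)
  have "g t = 0" "g 1 = lderiv (rot a b) V p"
    using S_V_zero[OF R _ ab, of "t *\<^sub>R p"] t by (simp_all add: g_def)
  then have "\<bar>lderiv (rot a b) V p\<bar> = \<bar>(t - 1) * g' z\<bar>" using z(3) by simp
  also have "\<dots> \<le> (t - 1) * (sqrt (log_grad_sq p) * B)"
    unfolding abs_mult using t(1) g'_le by (intro mult_mono) auto
  finally show ?thesis unfolding t_def .
qed

lemma eventually_nearly_radial:
  assumes R: "radial_beyond R" and x1: "norm x1 = R" and "\<epsilon> > 0"
  obtains v B where "v > 0" "B > 0"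
    "\<forall>\<^sub>F s in at_left R. \<forall>x. s \<le> norm x \<and> norm x \<le> R \<longrightarrow> nearly_radial \<epsilon> (omega x1) v B x"
proof -
  have R_gt: "r0 < R" using R by (simp add: radial_beyond_def)
  define v where "v = \<bar>V x1\<bar> / 2"
  have v: "v > 0" using radial_beyond_nonzero(1)[OF R, of x1] x1 by (simp add: v_def)
  have U: "U = {x. r0 < norm x}" by (auto simp: mem_U_iff)
  have cont: "continuous_on U log_grad_sq" "continuous_on U omega" "continuous_on U V"
    "continuous_on U mixed_coeff"
    by (intro smooth_continuous smooth_log_grad_sq smooth_coefficients smooth_V smooth_radial_derivs)+
  have "continuous_on (sphere 0 R) mixed_coeff"
    by (rule continuous_on_subset[OF cont(4)]) (use R_gt in \<open>auto simp: mem_U_iff\<close>)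
  from bounded_on_sphere[OF this] obtain K where K: "\<And>x. norm x = R \<Longrightarrow> \<bar>mixed_coeff x\<bar> \<le> K" by metis
  define B where "B = \<bar>K\<bar> + 1"
  have on_sphere: "log_grad_sq x < \<epsilon>\<^sup>2" "\<bar>omega x - omega x1\<bar> < \<epsilon>" "- \<bar>V x\<bar> < - v" "- \<bar>mixed_coeff x\<bar> < 0"
    "\<bar>mixed_coeff x\<bar> < B"
    if x: "norm x = R" for x
    using assms(3) v K[OF x] radial_beyond_spheres(3,4)[OF R, of x1 x] radial_beyondD(2)[OF R, of x]
      radial_beyond_nonzero(2)[OF R, of x] x x1
    by (auto simp: log_grad_sq_def omega_def v_def B_def)
  have near: "\<forall>\<^sub>F s in at_left R. \<forall>x. s \<le> norm x \<and> norm x \<le> R \<longrightarrow> f x < c"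
    if "continuous_on U f" "\<And>x. norm x = R \<Longrightarrow> f x < c" for f and c :: real
    by (rule eventually_annulus_less[OF that(1)[unfolded U] R_gt that(2)])
  have "\<forall>\<^sub>F s in at_left R. \<forall>x. s \<le> norm x \<and> norm x \<le> R \<longrightarrow> log_grad_sq x < \<epsilon>\<^sup>2"
    by (rule near[OF cont(1) on_sphere(1)])
  moreover have "\<forall>\<^sub>F s in at_left R. \<forall>x. s \<le> norm x \<and> norm x \<le> R \<longrightarrow> \<bar>omega x - omega x1\<bar> < \<epsilon>"
    by (rule near[OF _ on_sphere(2)]) (intro continuous_intros cont)
  moreover have "\<forall>\<^sub>F s in at_left R. \<forall>x. s \<le> norm x \<and> norm x \<le> R \<longrightarrow> - \<bar>V x\<bar> < - v"
    by (rule near[OF _ on_sphere(3)]) (intro continuous_intros cont)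
  moreover have "\<forall>\<^sub>F s in at_left R. \<forall>x. s \<le> norm x \<and> norm x \<le> R \<longrightarrow> - \<bar>mixed_coeff x\<bar> < 0"
    by (rule near[OF _ on_sphere(4)]) (intro continuous_intros cont)
  moreover have "\<forall>\<^sub>F s in at_left R. \<forall>x. s \<le> norm x \<and> norm x \<le> R \<longrightarrow> \<bar>mixed_coeff x\<bar> < B"
    by (rule near[OF _ on_sphere(5)]) (intro continuous_intros cont)
  ultimately have "\<forall>\<^sub>F s in at_left R. \<forall>x. s \<le> norm x \<and> norm x \<le> R \<longrightarrow> nearly_radial \<epsilon> (omega x1) v B x"
    by eventually_elim (auto simp: nearly_radial_def)
  then show ?thesis using that[of v B] v by (simp add: B_def)
qed

lemma ex_nearly_radial_annulus:
  assumes R: "radial_beyond R" and x1: "norm x1 = R" and "\<epsilon> > 0" "\<delta> > 0"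
  obtains s v B where "r0 < s" "s < R" "v > 0" "B > 0" "(R / s - 1) * B < \<delta> * v"
    "\<And>x. s \<le> norm x \<Longrightarrow> norm x \<le> R \<Longrightarrow> nearly_radial \<epsilon> (omega x1) v B x"
proof -
  have R_gt: "r0 < R" "R > 0" using R r0_pos by (auto simp: radial_beyond_def)
  obtain v B where vB: "v > 0" "B > 0"
    and near: "\<forall>\<^sub>F s in at_left R. \<forall>x. s \<le> norm x \<and> norm x \<le> R \<longrightarrow> nearly_radial \<epsilon> (omega x1) v B x"
    by (rule eventually_nearly_radial[OF R x1 assms(3)])
  have "\<forall>\<^sub>F s in at_left R. (R / s - 1) * B < \<delta> * v"
  proof (rule order_tendstoD(2))
    show "((\<lambda>s. (R / s - 1) * B) \<longlongrightarrow> (R / R - 1) * B) (at_left R)" using R_gt by (intro tendsto_intros) auto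
  qed (use assms(4) vB R_gt in simp)
  with near eventually_at_left_real[OF R_gt(1)] have "\<forall>\<^sub>F s in at_left R. s \<in> {r0<..<R}
      \<and> (R / s - 1) * B < \<delta> * v \<and>
      (\<forall>x. s \<le> norm x \<and> norm x \<le> R \<longrightarrow> nearly_radial \<epsilon> (omega x1) v B x)"
    by eventually_elim simp
  then obtain s where "s \<in> {r0<..<R}" "(R / s - 1) * B < \<delta> * v"
      "\<forall>x. s \<le> norm x \<and> norm x \<le> R \<longrightarrow> nearly_radial \<epsilon> (omega x1) v B x"
    using eventually_happens'[OF trivial_limit_at_left_real] by blast
  then show ?thesis using that[of s v B] vB by simp
qed

lemma ex_log_grad_max_inside_radial:
  assumes R: "radial_beyond R" and s: "r0 < s" and x: "s \<le> norm x" "tangrad_sq u x \<noteq> 0"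
  obtains p where "p \<in> U" "s \<le> norm p" "norm p < R" "log_grad_sq p > 0"
    "\<And>y. s \<le> norm y \<Longrightarrow> norm y \<le> R \<Longrightarrow> log_grad_sq y \<le> log_grad_sq p"
proof -
  have x_le: "norm x \<le> R" using radial_beyondD(2)[OF R, of x] x(2) by force
  have "continuous_on {x. s \<le> norm x \<and> norm x \<le> R} log_grad_sq"
    by (rule continuous_on_subset[OF smooth_continuous[OF smooth_log_grad_sq]])
      (use s in \<open>auto simp: mem_U_iff\<close>)
  from annulus_attains_sup[OF this x(1) x_le] obtain p where p: "s \<le> norm p" "norm p \<le> R"
    and max: "\<And>y. s \<le> norm y \<Longrightarrow> norm y \<le> R \<Longrightarrow> log_grad_sq y \<le> log_grad_sq p" by metis
  have pU: "p \<in> U" using p(1) s by (simp add: mem_U_iff)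
  have "0 < log_grad_sq x" using x s by (simp add: log_grad_sq_pos_iff mem_U_iff)
  then have log_grad: "log_grad_sq p > 0" using max[OF x(1) x_le] by linarith
  then have "norm p < R" using radial_beyondD(2)[OF R, of p] log_grad_sq_pos_iff[OF pU] by force
  then show ?thesis using that[OF pU p(1) _ log_grad max] by blast
qed

lemma radial_beyond_extends:
  assumes R: "radial_beyond R"
  obtains s where "s < R" "radial_beyond s"
proof -
  have "r0 < R" using R by (simp add: radial_beyond_def)
  then obtain x1 :: "real^'n" where x1: "norm x1 = R" using vector_choose_size[of R] r0_pos by auto
  have "omega x1 > 0" by (rule omega_pos[OF radial_beyondD(1)[OF R]]) (simp add: x1)
  then obtain \<epsilon> where \<epsilon>: "\<epsilon> > 0" "no_small_relations (n - 1) (omega x1) \<epsilon>"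
    using ex_no_small_relations[of "n - 1" "omega x1"] n_ge_3 by auto
  define \<delta> where "\<delta> = min \<epsilon> 1"
  have \<delta>: "\<delta> > 0" "\<delta> \<le> 1" "\<delta> \<le> \<epsilon>" using \<epsilon>(1) by (auto simp: \<delta>_def)
  obtain s v B where s: "r0 < s" "s < R" "v > 0" "B > 0" "(R / s - 1) * B < \<delta> * v"
    and annulus: "\<And>x. s \<le> norm x \<Longrightarrow> norm x \<le> R \<Longrightarrow> nearly_radial \<epsilon> (omega x1) v B x"
    using ex_nearly_radial_annulus[OF R x1 \<epsilon>(1) \<delta>(1)] by metis
  note near = annulus[unfolded nearly_radial_def]
  have "tangrad_sq u x = 0" if x: "s \<le> norm x" for x
  proof (rule ccontr)
    assume "tangrad_sq u x \<noteq> 0"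
    from ex_log_grad_max_inside_radial[OF R s(1) x this] obtain p
      where p: "p \<in> U" "s \<le> norm p" "norm p < R" "log_grad_sq p > 0"
        and max: "\<And>y. s \<le> norm y \<Longrightarrow> norm y \<le> R \<Longrightarrow> log_grad_sq y \<le> log_grad_sq p" by metis
    note near_p = near[OF p(2) less_imp_le[OF p(3)]]
    show False
    proof (rule small_log_grad_contradiction[OF p(1) _ _ \<epsilon>(2) p(4)])
      show "V p \<noteq> 0" "mixed_coeff p \<noteq> 0" "\<bar>omega p - omega x1\<bar> < \<epsilon>" using near_p s(3) by auto
      show "log_grad_sq y \<le> log_grad_sq p" if "norm y = norm p" for y by (rule max) (use that p in simp_all)
      show "sqrt (log_grad_sq p) < \<epsilon>" by (rule real_less_lsqrt) (use near_p \<epsilon>(1) p(4) in auto)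
      show "\<delta> \<le> 1" "\<delta> \<le> (if omega x1 = 1 then 1 else \<epsilon>)" using \<delta> by auto
      fix a b :: "real^'n" assume ab: "orthonormal_pair a b"
      have "\<bar>lderiv (rot a b) V p\<bar> \<le> (R / norm p - 1) * (sqrt (log_grad_sq p) * B)"
        by (rule S_V_le_inside_radial[OF R p(1,3) _ _ ab]) (use p max near in \<open>force simp: less_imp_le\<close>)+
      also have "\<dots> \<le> (R / s - 1) * (sqrt (log_grad_sq p) * B)"
        using p s r0_pos U_nonzero[OF p(1)]
        by (intro mult_right_mono diff_right_mono divide_left_mono mult_pos_pos) simp_all
      also have "\<dots> = sqrt (log_grad_sq p) * ((R / s - 1) * B)" by simp
      also have "\<dots> < sqrt (log_grad_sq p) * (\<delta> * \<bar>V p\<bar>)"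
        using s(5) near_p \<delta>(1) p(4) by (intro mult_strict_left_mono) (auto intro: less_trans)
      finally show "\<bar>lderiv (rot a b) V p\<bar> < \<delta> * sqrt (log_grad_sq p) * \<bar>V p\<bar>" by (simp add: mult_ac)
    qed
  qed
  then show ?thesis using that s by (simp add: radial_beyond_def)
qed

lemma radial_beyond_of_greater:
  assumes "r0 < R" "\<And>x. R < norm x \<Longrightarrow> tangrad_sq u x = 0"
  shows "radial_beyond R"
proof -
  have "tangrad_sq u x = 0" if x: "norm x = R" for x
  proof -
    have xU: "x \<in> U" using assms(1) x by (simp add: mem_U_iff)
    have "isCont (tangrad_sq u) x"
      using differentiable_U[OF smooth_tangrad_sq[OF open_U smooth_u] xU] differentiable_imp_continuous_within
      by blast
    moreover have "((\<lambda>s. s *\<^sub>R x) \<longlongrightarrow> 1 *\<^sub>R x) (at_right 1)" by (intro tendsto_intros)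
    ultimately have "((\<lambda>s. tangrad_sq u (s *\<^sub>R x)) \<longlongrightarrow> tangrad_sq u x) (at_right 1)"
      using isCont_tendsto_compose[of x "tangrad_sq u"] by simp
    moreover have "\<forall>\<^sub>F s in at_right 1. tangrad_sq u (s *\<^sub>R x) = 0"
    proof (rule eventually_at_rightI[of 1 2])
      fix s :: real assume "s \<in> {1<..<2}"
      then show "tangrad_sq u (s *\<^sub>R x) = 0" using x assms(1) r0_pos by (intro assms(2)) simp
    qed simp
    ultimately show ?thesis using tendsto_unique[OF trivial_limit_at_right_real _ tendsto_eventually] by blast
  qed
  then show ?thesis using assms by (auto simp: radial_beyond_def le_less)
qed

lemma radial_everywhere:
  assumes "r0 < R"
  shows "radial_beyond R"
proof -
  define T where "T = Collect radial_beyond"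
  obtain R1 where "radial_beyond R1" by (rule radial_near_infinity)
  then have R1: "R1 \<in> T" by (simp add: T_def)
  have below: "bdd_below T" by (rule bdd_belowI[of _ r0]) (simp add: T_def radial_beyond_def)
  have beyond_Inf: "tangrad_sq u x = 0" if "Inf T < norm x" for x
  proof -
    have "T \<noteq> {}" using R1 by blast
    from that[unfolded cInf_less_iff[OF this below]] obtain R where "R \<in> T" "R < norm x" by (rule bexE)
    then show ?thesis by (simp add: T_def radial_beyond_def)
  qed
  have "Inf T \<le> r0"
  proof (rule ccontr)
    assume "\<not> Inf T \<le> r0"
    then have "radial_beyond (Inf T)" by (intro radial_beyond_of_greater beyond_Inf) simp_all
    then obtain s where "s < Inf T" "radial_beyond s" by (rule radial_beyond_extends)
    then have "Inf T \<le> s" by (intro cInf_lower[OF _ below]) (simp add: T_def)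
    then show False using \<open>s < Inf T\<close> by simp
  qed
  then show ?thesis using assms by (intro radial_beyond_of_greater beyond_Inf) linarith+
qed

end

context exterior_static begin

lemma rotational_symmetry:
  assumes "x \<in> U"
  shows "sphere_laplace u x = 0" "sphere_laplace V x = 0" "norm y = norm x \<Longrightarrow> u y = u x"
    "norm y = norm x \<Longrightarrow> V y = V x"
proof -
  obtain C r1 Vm where "exterior_decay U u V n r0 C r1 Vm" by (rule ex_exterior_decay)
  then interpret exterior_decay U u V n r0 C r1 Vm .
  have "radial_beyond (norm x)" using assms by (intro radial_everywhere) (simp add: mem_U_iff)
  note spheres = radial_beyond_spheres[OF this order_refl]
  show "sphere_laplace u x = 0" "sphere_laplace V x = 0" "norm y = norm x \<Longrightarrow> u y = u x"
    "norm y = norm x \<Longrightarrow> V y = V x"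
    by (fact spheres)+
qed

lemma radial_constant_on_U:
  assumes "\<And>x. x \<in> U \<Longrightarrow> f differentiable (at x)" "\<And>x. x \<in> U \<Longrightarrow> lderiv id f x = 0"
    and "\<And>x y. x \<in> U \<Longrightarrow> norm y = norm x \<Longrightarrow> f y = f x" "x \<in> U" "y \<in> U"
  shows "f y = f x"
  using r0_pos assms by (intro radial_constant[of r0 f x y] assms(1-3)) (simp_all only: mem_U_iff less_imp_le)

lemma ex_schwarzschild_form:
  obtains m c where "\<And>x. x \<in> U \<Longrightarrow> omega x = 1 - 2 * m * norm x powr (2 - n)" "\<And>x. x \<in> U \<Longrightarrow> V x = c / u x"
proof -
  obtain x0 where x0: "x0 \<in> U" using V_nontrivial by blast
  have mass: "mass_fun x = mass_fun x0" if "x \<in> U" for x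
  proof (rule radial_constant_on_U[OF lderiv_id_mass_fun(1) _ _ x0 that])
    show "lderiv id mass_fun z = 0" if "z \<in> U" for z
      using lderiv_id_mass_fun(2)[OF that] rotational_symmetry(1)[OF that] by simp
    show "mass_fun y = mass_fun z" if "z \<in> U" "norm y = norm z" for y z
      using rotational_symmetry(3)[OF that] that(2) by (simp add: mass_fun_def omega_def)
  qed
  have uV: "u x * V x = u x0 * V x0" if "x \<in> U" for x
  proof (rule radial_constant_on_U[OF _ _ _ x0 that])
    show "(\<lambda>x. u x * V x) differentiable (at z)" if "z \<in> U" for z
      by (intro differentiable_U[OF _ that] smooth_mult open_U smooth_u smooth_V)
    show "lderiv id (\<lambda>x. u x * V x) z = 0" if "z \<in> U" for z
      by (rule radial_equations(2)[OF that rotational_symmetry(1,2)[OF that]])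
    show "u y * V y = u z * V z" if "z \<in> U" "norm y = norm z" for y z
      using rotational_symmetry(3,4)[OF that] by simp
  qed
  show ?thesis
  proof (rule that[of "mass_fun x0 / 2" "u x0 * V x0"])
    fix x assume x: "x \<in> U"
    have "norm x powr (n - 2) * norm x powr (2 - n) = 1"
      using U_nonzero[OF x] by (simp add: powr_add[symmetric])
    then have "1 - omega x = mass_fun x * norm x powr (2 - n)" by (simp add: mass_fun_def mult.assoc)
    then show "omega x = 1 - 2 * (mass_fun x0 / 2) * norm x powr (2 - n)" using mass[OF x] by simp
    show "V x = u x0 * V x0 / u x" using uV[OF x] u_nonzero[OF x] by (simp add: field_simps)
  qed
qed

lemma sqrt_omega: "x \<in> U \<Longrightarrow> sqrt (omega x) = 1 / u x"
  using u_pos[of x] by (simp add: omega_def real_sqrt_divide)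

lemma u_eq_omega_powr:
  assumes "x \<in> U"
  shows "u x = omega x powr (-1/2)"
proof -
  have "omega x powr (-1/2) = 1 / omega x powr (1/2)" by (simp add: powr_minus_divide)
  then show ?thesis
    using sqrt_omega[OF assms] omega_pos[OF assms] u_pos[OF assms] by (simp add: powr_half_sqrt)
qed

end

lemma open_ext_region: "open (ext_region r0 :: (real^'n::finite) set)"
  unfolding ext_region_def by (intro open_Collect_less continuous_intros)

lemma schw_rm_le:
  fixes r0 m :: real
  assumes "r0 > 0" "n \<ge> 3" "\<And>r. r > r0 \<Longrightarrow> 2 * m * r powr (2 - real n) < 1"
  shows "schw_rm n m \<le> r0"
proof -
  define k where "k = n - 2"
  have k: "k > 0" "2 - real n = - real k" using assms(2) by (auto simp: k_def)
  have "2 * m \<le> r0 ^ k"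
  proof (rule tendsto_lowerbound)
    show "((\<lambda>r. r ^ k) \<longlongrightarrow> r0 ^ k) (at_right r0)" by (intro tendsto_intros)
    show "\<forall>\<^sub>F r in at_right r0. 2 * m \<le> r ^ k"
    proof (rule eventually_at_rightI[of r0 "r0 + 1"])
      fix r assume "r \<in> {r0<..<r0 + 1}"
      then have "r > r0" "r > 0" using assms(1) by auto
      then show "2 * m \<le> r ^ k"
        using assms(3)[of r] unfolding k(2) by (simp add: powr_minus_divide powr_realpow divide_less_eq)
    qed simp
  qed simp
  then have "root k (max (2 * m) 0) \<le> root k (r0 ^ k)" using assms(1) k(1) by simp
  then show ?thesis using assms(1) k(1) by (simp add: schw_rm_def k_def[symmetric] real_root_power_cancel)
qed

theorem theorem1p2:
  fixes u V :: "real^'n::finite \<Rightarrow> real" and r0 :: real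
  assumes n3: "CARD('n) \<ge> 3"
    and r0: "r0 > 0"
    and u_smooth: "smooth_on u (ext_region r0)"
    and u_pos: "\<forall>x\<in>ext_region r0. u x > 0"
    and V_smooth: "smooth_on V (ext_region r0)"
    and V_bdd: "bounded (V ` ext_region r0)"
    and V_nontriv: "\<exists>x\<in>ext_region r0. V x \<noteq> 0"
    and static: "\<forall>x\<in>ext_region r0. \<forall>i j.
        hessian (warped_metric u) V i j x = V x * ricci (warped_metric u) i j x"
    and harmonic: "\<forall>x\<in>ext_region r0. laplacian (warped_metric u) V x = 0"
  shows "\<exists>m::real. r0 \<ge> schw_rm CARD('n) m
      \<and> (\<forall>x\<in>ext_region r0. u x = (1 - 2*m * norm x powr (2 - real CARD('n))) powr (-1/2))
      \<and> (\<exists>c::real. \<forall>x\<in>ext_region r0. V x = c * schw_V CARD('n) m (norm x))"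
proof -
  interpret exterior_static "ext_region r0" u V "real CARD('n)" r0
    using assms open_ext_region by unfold_locales (auto simp: ext_region_def)
  note CARD_eq [simp del]
  obtain m c where omega: "\<And>x. x \<in> ext_region r0 \<Longrightarrow> omega x = 1 - 2 * m * norm x powr (2 - real CARD('n))"
    and V: "\<And>x. x \<in> ext_region r0 \<Longrightarrow> V x = c / u x" using ex_schwarzschild_form by blast
  have u: "u x = (1 - 2*m * norm x powr (2 - real CARD('n))) powr (-1/2)" if "x \<in> ext_region r0" for x
    using u_eq_omega_powr[OF that] unfolding omega[OF that] .
  have V_schw: "V x = c * schw_V CARD('n) m (norm x)" if "x \<in> ext_region r0" for x
    using V[OF that] sqrt_omega[OF that] unfolding omega[OF that] by (simp add: schw_V_def)
  have "schw_rm CARD('n) m \<le> r0"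
  proof (rule schw_rm_le[OF r0 n3])
    fix r assume "r > r0"
    then obtain x :: "real^'n" where x: "norm x = r" "x \<in> ext_region r0"
      using vector_choose_size[of r] r0 by (auto simp: ext_region_def)
    show "2 * m * r powr (2 - real CARD('n)) < 1"
      using omega_pos[OF x(2)] unfolding omega[OF x(2)] x(1) by simp
  qed
  then show ?thesis using u V_schw by blast
qed

end
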